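(* (a) Consider a rank 2 $(TE)$-structure over a point of type (Bra). The formal invariants $\rho^{(0)},\rho^{(1)},\delta^{(1)}\in\mathbb C$ and the set $\mathrm{Eig}(M^{\mathrm{mon}})$ of eigenvalues of its monodromy are invariants of its isomorphism class. Together they form a complete set of invariants, that is, the isomorphism class of the $(TE)$-structure is determined by these invariants. (b) Any such $(TE)$-structure has a $\mathbb C\{z\}$-basis $\underline v=(v_1,v_2)$ of $\mathcal O(H)_0$ such that its matrix $B$, defined by $z^2\nabla_{\partial_z}\underline v=\underline v\cdot B$, is in Birkhoff normal form, and more precisely has the shape $$B=(\rho^{(0)}+z\rho^{(1)})C_1+b_2^{(0)}C_2+zb_3^{(1)}D+zb_4^{(1)}E,$$ where $b_2^{(0)},b_4^{(1)}\in\mathbb C^*$ and $b_3^{(1)}\in\mathbb C$ satisfy $-b_2^{(0)}b_4^{(1)}=\delta^{(1)}-2\rho^{(0)}\rho^{(1)}$ and $\mathrm{Eig}(M^{\mathrm{mon}})=\{e^{-2\pi i(\rho^{(1)}\pm b_3^{(1)})}\}$.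
   Context: A $(TE)$-structure over a point is a holomorphic vector bundle $H\to\mathbb C$ ($z$ the coordinate) with a holomorphic connection $\nabla$ on $H|_{\mathbb C^*}$ such that $z^2\nabla_{\partial_z}$ maps $\mathcal O(H)$ to $\mathcal O(H)$; $\mathcal O(H)_0$ is the germ at $z=0$ of the sheaf of sections. Isomorphisms are holomorphic bundle isomorphisms respecting the connections. For rank 2 and a $\mathbb C\{z\}$-basis $\underline v$ of $\mathcal O(H)_0$ write $z^2\nabla_{\partial_z}\underline v=\underline v B$, $B=\sum_{k\ge0}B^{(k)}z^k$, $\det B=\sum_{k\ge0}\delta^{(k)}z^k$, $\rho^{(0)}=\frac12\operatorname{tr}B^{(0)}$, $\rho^{(1)}=\frac12\operatorname{tr}B^{(1)}$. The numbers $\rho^{(0)},\rho^{(1)},\delta^{(0)},\delta^{(1)}$ do not depend on the basis. Let $\mathcal U=[z^2\nabla_{\partial_z}]:H|_0\to H|_0$. Type (Bra): $\mathcal U$ has only one eigenvalue (which is then $\rho^{(0)}$), one $2\times2$ Jordan block, and $\delta^{(1)}-2\rho^{(0)}\rho^{(1)}\ne0$. $C_1=\begin{pmatrix}1&0\\0&1\end{pmatrix}$, $C_2=\begin{pmatrix}0&0\\1&0\end{pmatrix}$, $D=\begin{pmatrix}1&0\\0&-1\end{pmatrix}$, $E=\begin{pmatrix}0&1\\0&0\end{pmatrix}$. Birkhoff normal form (over a point): $B^{(k)}=0$ for $k\ge2$. $M^{\mathrm{mon}}$ is the monodromy (along $z\mapsto ze^{2\pi i}$) on the space of flat multivalued sections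 of $H|_{\mathbb C^*}$. *)

theory Defs
  imports "HOL-Complex_Analysis.Complex_Analysis"
begin

no_notation fps_nth (infixl "$" 75) (* keeps "$" for vector components *)

section \<open>Holomorphic vector bundles over the complex plane\<close>

text \<open>
  A bundle of rank \<open>CARD('n)\<close> is given by its total space, the projection to the base, and an atlas
  of local trivialisations. A pair \<open>(U, \<phi>)\<close> in the atlas stands for the trivialisation
  \<open>e \<mapsto> (base e, \<phi> e)\<close> of the part of the bundle over \<open>U\<close>. The topology and the complex structure
  of the total space and the vector space structures of the fibres are those induced by the atlas.
  The atlas need not be maximal.

  The field \<open>nabla\<close> is the covariant derivative in the direction of the coordinate vector field:
  for an open \<open>W \<subseteq> - {0}\<close> and a section \<open>s\<close> over \<open>W\<close>, \<open>nabla H W s\<close> is a section over \<open>W\<close>.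
  Sections over \<open>W\<close> are total functions whose values outside \<open>W\<close> are irrelevant.
\<close>

record ('h, 'n::finite) te =
  total :: "'h set"
  base :: "'h \<Rightarrow> complex"
  atlas :: "(complex set \<times> ('h \<Rightarrow> complex ^ 'n)) set"
  nabla :: "complex set \<Rightarrow> (complex \<Rightarrow> 'h) \<Rightarrow> (complex \<Rightarrow> 'h)"

definition fibre :: "('h, 'n::finite) te \<Rightarrow> complex \<Rightarrow> 'h set" where
  "fibre H z = {e \<in> total H. base H e = z}"

definition holomorphic_matrix_on ::
    "(complex \<Rightarrow> complex ^ 'n::finite ^ 'm::finite) \<Rightarrow> complex set \<Rightarrow> bool" where
  "holomorphic_matrix_on g W \<longleftrightarrow> (\<forall>i j. (\<lambda>z. g z $ i $ j) holomorphic_on W)"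

text \<open>The transition matrices are automatically invertible, since the roles of the two charts can be
  exchanged.\<close>

definition holomorphic_bundle :: "('h, 'n::finite) te \<Rightarrow> bool" where
  "holomorphic_bundle H \<longleftrightarrow>
     (\<forall>(U, \<phi>) \<in> atlas H. open U \<and>
        bij_betw (\<lambda>e. (base H e, \<phi> e)) {e \<in> total H. base H e \<in> U} (U \<times> UNIV)) \<and>
     (\<Union>(U, \<phi>) \<in> atlas H. U) = UNIV \<and>
     (\<forall>(U, \<phi>) \<in> atlas H. \<forall>(V, \<psi>) \<in> atlas H.
        \<exists>g :: complex \<Rightarrow> complex ^ 'n ^ 'n. holomorphic_matrix_on g (U \<inter> V) \<and>
          (\<forall>e \<in> total H. base H e \<in> U \<inter> V \<longrightarrow> \<psi> e = g (base H e) *v \<phi> e))"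

definition fibre_zero :: "('h, 'n::finite) te \<Rightarrow> complex \<Rightarrow> 'h" where
  "fibre_zero H z = (THE e. e \<in> fibre H z \<and> (\<forall>(U, \<phi>) \<in> atlas H. z \<in> U \<longrightarrow> \<phi> e = 0))"

definition fibre_add :: "('h, 'n::finite) te \<Rightarrow> 'h \<Rightarrow> 'h \<Rightarrow> 'h" where
  "fibre_add H x y = (THE e. e \<in> fibre H (base H x) \<and>
     (\<forall>(U, \<phi>) \<in> atlas H. base H x \<in> U \<longrightarrow> \<phi> e = \<phi> x + \<phi> y))"

definition fibre_scale :: "('h, 'n::finite) te \<Rightarrow> complex \<Rightarrow> 'h \<Rightarrow> 'h" where
  "fibre_scale H c x = (THE e. e \<in> fibre H (base H x) \<and>
     (\<forall>(U, \<phi>) \<in> atlas H. base H x \<in> U \<longrightarrow> \<phi> e = c *s \<phi> x))"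

definition hol_section :: "('h, 'n::finite) te \<Rightarrow> complex set \<Rightarrow> (complex \<Rightarrow> 'h) \<Rightarrow> bool" where
  "hol_section H W s \<longleftrightarrow> (\<forall>z \<in> W. s z \<in> fibre H z) \<and>
     (\<forall>(U, \<phi>) \<in> atlas H. \<forall>i. (\<lambda>z. \<phi> (s z) $ i) holomorphic_on (W \<inter> U))"


section \<open>TE-structures over a point\<close>

text \<open>A holomorphic connection over the punctured plane, as an operator on the sheaf of holomorphic
  sections: the conditions are well-definedness, compatibility with restrictions, additivity and the
  Leibniz rule.\<close>

definition holomorphic_connection :: "('h, 'n::finite) te \<Rightarrow> bool" where
  "holomorphic_connection H \<longleftrightarrow>
     (\<forall>W s. open W \<and> W \<subseteq> - {0} \<and> hol_section H W s \<longrightarrow> hol_section H W (nabla H W s)) \<and>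
     (\<forall>W W' s s'. open W \<and> W \<subseteq> - {0} \<and> open W' \<and> W' \<subseteq> W \<and> hol_section H W s \<and>
        (\<forall>z \<in> W'. s' z = s z) \<longrightarrow> (\<forall>z \<in> W'. nabla H W' s' z = nabla H W s z)) \<and>
     (\<forall>W s t. open W \<and> W \<subseteq> - {0} \<and> hol_section H W s \<and> hol_section H W t \<longrightarrow>
        (\<forall>z \<in> W. nabla H W (\<lambda>w. fibre_add H (s w) (t w)) z =
          fibre_add H (nabla H W s z) (nabla H W t z))) \<and>
     (\<forall>W f s. open W \<and> W \<subseteq> - {0} \<and> f holomorphic_on W \<and> hol_section H W s \<longrightarrow>
        (\<forall>z \<in> W. nabla H W (\<lambda>w. fibre_scale H (f w) (s w)) z =
          fibre_add H (fibre_scale H (deriv f z) (s z)) (fibre_scale H (f z) (nabla H W s z))))"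

text \<open>\<open>z2nabla H W s t\<close> says that the holomorphic section \<open>t\<close> over \<open>W\<close> is
  \<open>z\<^sup>2 \<nabla>\<^bsub>\<partial>z\<^esub> s\<close>; at \<open>z = 0\<close> its value is fixed by continuity.\<close>

definition z2nabla ::
    "('h, 'n::finite) te \<Rightarrow> complex set \<Rightarrow> (complex \<Rightarrow> 'h) \<Rightarrow> (complex \<Rightarrow> 'h) \<Rightarrow> bool" where
  "z2nabla H W s t \<longleftrightarrow> hol_section H W s \<and> hol_section H W t \<and>
     (\<forall>z \<in> W - {0}. t z = fibre_scale H (z\<^sup>2) (nabla H (W - {0}) s z))"

definition te_structure :: "('h, 'n::finite) te \<Rightarrow> bool" where
  "te_structure H \<longleftrightarrow> holomorphic_bundle H \<and> holomorphic_connection H \<and>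
     (\<forall>W s. open W \<and> hol_section H W s \<longrightarrow> (\<exists>t. z2nabla H W s t))"

definition te_isomorphism ::
    "('h, 'n::finite) te \<Rightarrow> ('k, 'n) te \<Rightarrow> ('h \<Rightarrow> 'k) \<Rightarrow> bool" where
  "te_isomorphism H H' F \<longleftrightarrow>
     bij_betw F (total H) (total H') \<and>
     (\<forall>e \<in> total H. base H' (F e) = base H e) \<and>
     (\<forall>(U, \<phi>) \<in> atlas H. \<forall>(V, \<psi>) \<in> atlas H'.
        \<exists>g :: complex \<Rightarrow> complex ^ 'n ^ 'n. holomorphic_matrix_on g (U \<inter> V) \<and>
          (\<forall>e \<in> total H. base H e \<in> U \<inter> V \<longrightarrow> \<psi> (F e) = g (base H e) *v \<phi> e)) \<and>
     (\<forall>W s. open W \<and> W \<subseteq> - {0} \<and> hol_section H W s \<longrightarrow>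
        (\<forall>z \<in> W. F (nabla H W s z) = nabla H' W (\<lambda>w. F (s w)) z))"

definition te_isomorphic :: "('h, 'n::finite) te \<Rightarrow> ('k, 'n) te \<Rightarrow> bool" where
  "te_isomorphic H H' \<longleftrightarrow> (\<exists>F. te_isomorphism H H' F)"


section \<open>Monodromy\<close>

text \<open>Multivalued sections over the punctured plane are sections of the pullback along the universal
  covering \<open>exp\<close>; \<open>z \<mapsto> z e\<^bsup>2\<pi>i\<^esup>\<close> is the deck transformation \<open>\<zeta> \<mapsto> \<zeta> + 2\<pi>i\<close>.\<close>

definition flat_section :: "('h, 'n::finite) te \<Rightarrow> complex set \<Rightarrow> (complex \<Rightarrow> 'h) \<Rightarrow> bool" where
  "flat_section H W s \<longleftrightarrow> hol_section H W s \<and> (\<forall>z \<in> W. nabla H W s z = fibre_zero H z)"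

definition flat_multivalued :: "('h, 'n::finite) te \<Rightarrow> (complex \<Rightarrow> 'h) set" where
  "flat_multivalued H = {\<sigma>. \<forall>\<zeta>. \<exists>N W s. open N \<and> \<zeta> \<in> N \<and> open W \<and> W \<subseteq> - {0} \<and> exp ` N \<subseteq> W \<and>
     flat_section H W s \<and> (\<forall>\<xi> \<in> N. \<sigma> \<xi> = s (exp \<xi>))}"

definition monodromy :: "(complex \<Rightarrow> 'h) \<Rightarrow> (complex \<Rightarrow> 'h)" where
  "monodromy \<sigma> = (\<lambda>\<zeta>. \<sigma> (\<zeta> + 2 * of_real pi * \<i>))"

definition Eig_mon :: "('h, 'n::finite) te \<Rightarrow> complex set" where
  "Eig_mon H = {c. \<exists>\<sigma> \<in> flat_multivalued H. (\<exists>\<zeta>. \<sigma> \<zeta> \<noteq> fibre_zero H (exp \<zeta>)) \<and>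
     monodromy \<sigma> = (\<lambda>\<zeta>. fibre_scale H c (\<sigma> \<zeta>))}"


section \<open>Rank 2: bases of the germ at 0, connection matrices and formal invariants\<close>

definition comb2 :: "('h, 'n::finite) te \<Rightarrow> complex \<Rightarrow> 'h \<Rightarrow> complex \<Rightarrow> 'h \<Rightarrow> 'h" where
  "comb2 H a x b y = fibre_add H (fibre_scale H a x) (fibre_scale H b y)"

definition germ_section :: "('h, 'n::finite) te \<Rightarrow> (complex \<Rightarrow> 'h) \<Rightarrow> bool" where
  "germ_section H s \<longleftrightarrow> (\<exists>W. open W \<and> 0 \<in> W \<and> hol_section H W s)"

text \<open>Bases of the module of germs at 0 of holomorphic sections, over the ring of germs at 0 of
  holomorphic functions; equality of germs is equality near 0.\<close>

definition germ_basis :: "('h, 2) te \<Rightarrow> (complex \<Rightarrow> 'h) \<Rightarrow> (complex \<Rightarrow> 'h) \<Rightarrow> bool" where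
  "germ_basis H v1 v2 \<longleftrightarrow> germ_section H v1 \<and> germ_section H v2 \<and>
     (\<forall>s. germ_section H s \<longrightarrow> (\<exists>f g. f analytic_on {0} \<and> g analytic_on {0} \<and>
        (\<forall>\<^sub>F z in nhds 0. s z = comb2 H (f z) (v1 z) (g z) (v2 z)))) \<and>
     (\<forall>f g. f analytic_on {0} \<and> g analytic_on {0} \<and>
        (\<forall>\<^sub>F z in nhds 0. comb2 H (f z) (v1 z) (g z) (v2 z) = fibre_zero H z) \<longrightarrow>
        (\<forall>\<^sub>F z in nhds 0. f z = 0 \<and> g z = 0))"

text \<open>\<open>z\<^sup>2 \<nabla>\<^bsub>\<partial>z\<^esub> (v1, v2) = (v1, v2) B\<close> near 0, where \<open>(v1, v2)\<close> is a row vector, so that the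
  \<open>j\<close>-th column of \<open>B\<close> belongs to \<open>v\<^sub>j\<close>.\<close>

definition connection_matrix ::
    "('h, 2) te \<Rightarrow> (complex \<Rightarrow> 'h) \<Rightarrow> (complex \<Rightarrow> 'h) \<Rightarrow> (complex \<Rightarrow> complex ^ 2 ^ 2) \<Rightarrow> bool" where
  "connection_matrix H v1 v2 B \<longleftrightarrow> (\<exists>W. open W \<and> 0 \<in> W \<and> holomorphic_matrix_on B W \<and>
     z2nabla H W v1 (\<lambda>z. comb2 H (B z $ 1 $ 1) (v1 z) (B z $ 2 $ 1) (v2 z)) \<and>
     z2nabla H W v2 (\<lambda>z. comb2 H (B z $ 1 $ 2) (v1 z) (B z $ 2 $ 2) (v2 z)))"

definition matrix_coeff :: "(complex \<Rightarrow> complex ^ 2 ^ 2) \<Rightarrow> nat \<Rightarrow> complex ^ 2 ^ 2" where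
  "matrix_coeff B k = (\<chi> i j. fps_nth (fps_expansion (\<lambda>z. B z $ i $ j) 0) k)"

text \<open>The values of \<open>rho\<close> and \<open>delta\<close> are independent of the basis for \<open>k \<le> 1\<close>; only these are
  meaningful.\<close>

definition rho :: "('h, 2) te \<Rightarrow> nat \<Rightarrow> complex" where
  "rho H k = (THE r. \<forall>v1 v2 B. germ_basis H v1 v2 \<and> connection_matrix H v1 v2 B \<longrightarrow>
     r = trace (matrix_coeff B k) / 2)"

definition delta :: "('h, 2) te \<Rightarrow> nat \<Rightarrow> complex" where
  "delta H k = (THE d. \<forall>v1 v2 B. germ_basis H v1 v2 \<and> connection_matrix H v1 v2 B \<longrightarrow>
     d = fps_nth (fps_expansion (\<lambda>z. det (B z)) 0) k)"

text \<open>The endomorphism of the fibre over 0 induced by \<open>z\<^sup>2 \<nabla>\<^bsub>\<partial>z\<^esub>\<close>.\<close>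

definition pole_part :: "('h, 'n::finite) te \<Rightarrow> 'h \<Rightarrow> 'h" where
  "pole_part H x = (THE y. \<exists>W s t. open W \<and> 0 \<in> W \<and> z2nabla H W s t \<and> s 0 = x \<and> t 0 = y)"

definition fibre_basis :: "('h, 2) te \<Rightarrow> complex \<Rightarrow> 'h \<Rightarrow> 'h \<Rightarrow> bool" where
  "fibre_basis H z x y \<longleftrightarrow> x \<in> fibre H z \<and> y \<in> fibre H z \<and>
     (\<forall>e \<in> fibre H z. \<exists>!(a, b). e = comb2 H a x b y)"

text \<open>The Jordan normal form of \<open>pole_part H\<close> is a single block of size 2.\<close>

definition single_jordan_block :: "('h, 2) te \<Rightarrow> bool" where
  "single_jordan_block H \<longleftrightarrow> (\<exists>c x y. fibre_basis H 0 x y \<and>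
     pole_part H x = fibre_scale H c x \<and>
     pole_part H y = fibre_add H x (fibre_scale H c y))"

definition type_Bra :: "('h, 2) te \<Rightarrow> bool" where
  "type_Bra H \<longleftrightarrow> single_jordan_block H \<and> delta H 1 - 2 * rho H 0 * rho H 1 \<noteq> 0"

definition matC1 :: "complex ^ 2 ^ 2" where "matC1 = vector [vector [1, 0], vector [0, 1]]"
definition matC2 :: "complex ^ 2 ^ 2" where "matC2 = vector [vector [0, 0], vector [1, 0]]"
definition matD :: "complex ^ 2 ^ 2" where "matD = vector [vector [1, 0], vector [0, -1]]"
definition matE :: "complex ^ 2 ^ 2" where "matE = vector [vector [0, 1], vector [0, 0]]"

definition mat_scale :: "complex \<Rightarrow> complex ^ 2 ^ 2 \<Rightarrow> complex ^ 2 ^ 2" (infixl "*\<^sub>m" 70) where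
  "c *\<^sub>m A = (\<chi> i j. c * A $ i $ j)"

definition birkhoff_normal_form :: "(complex \<Rightarrow> complex ^ 2 ^ 2) \<Rightarrow> bool" where
  "birkhoff_normal_form B \<longleftrightarrow> (\<forall>k \<ge> 2. matrix_coeff B k = 0)"

end

theory Submission
  imports Defs
begin

text \<open>
  A structure of type (Bra) has a frame near 0 in which the connection matrix is
  \<open>(\<rho>0 + \<rho>1 z) C1\<close> plus the companion matrix of a function \<open>p\<close> with a simple zero at 0. After
  twisting by \<open>exp (\<rho>1 \<zeta> - \<rho>0 exp (- \<zeta>))\<close>, where \<open>z = exp \<zeta>\<close>, flat sections become solutions of
  \<open>y' = - exp (- \<zeta>) v\<close>, \<open>v' = - exp (- \<zeta>) p (exp \<zeta>) y\<close>. With \<open>w\<close> a branch of \<open>2 sqrt (p'(0) / z)\<close>,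
  there is a solution of size \<open>exp (- Re w)\<close>, up to powers of \<open>z\<close>, in the strip of width \<open>4 \<pi>\<close>
  around a line on which \<open>w > 0\<close>. This solution and its continuation along one turn form a basis, in
  which the monodromy matrix depends only on the two mutually inverse monodromy eigenvalues. Hence for
  two such functions \<open>p\<close>, \<open>q\<close> with the same derivative at 0 and the same eigenvalues, the linear map
  between the solution spaces matching these bases is single-valued in \<open>z\<close>. It has moderate growth,
  since in its entries recessive factors meet dominant ones; so it is meromorphic, and a descent using
  \<open>p(0) = 0\<close> and \<open>p'(0) \<noteq> 0\<close> removes its pole.

  Every such \<open>p\<close> is therefore equivalent to \<open>c z + (b\<^sup>2 + b) z\<^sup>2\<close>, where \<open>exp (\<plusminus> 2 \<pi> i b)\<close> are the
  eigenvalues and \<open>b\<close> is shifted by an integer to make its real part negative; that system has an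
  explicit Frobenius eigensolution and is gauge equivalent to the Birkhoff normal form. Two structures
  with the same invariants thus have the same normal form near 0, and the resulting flat isomorphism
  continues along flat frames over the punctured plane.
\<close>


section \<open>Linear systems and companion systems\<close>

text \<open>The singularity at 0 is irregular and ramified, because \<open>deriv p 0\<close> is not
  0: one turn changes the sign of \<open>w\<close>. Hence the continuation of a recessive solution
  is dominant where the solution itself is recessive, and one solution replaces a system of
  sectorial ones. Turning acts on the resulting basis by a companion matrix of determinant 1, whose
  only free entry is the trace. So no Stokes data beyond the eigenvalues survive, and the set of
  eigenvalues suffices even when the two coincide. The model is chosen for its computable monodromy.
  A quadratic \<open>p\<close> has no singular points besides 0 and \<infinity>, and \<infinity> is
  regular singular, so an exponent there gives an eigenvalue of the turn around 0. These exponents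
  are b and - 1 - b. When they differ by an integer the series may break down and call for
  logarithms; a negative real part of b excludes this for the series with exponent b, because its
  denominators contain the factors n - 2 b.\<close>

fun system_coeffs ::
    "(nat \<Rightarrow> complex) \<Rightarrow> (nat \<Rightarrow> complex) \<Rightarrow> (nat \<Rightarrow> complex) \<Rightarrow> (nat \<Rightarrow> complex) \<Rightarrow>
     complex \<Rightarrow> complex \<Rightarrow> nat \<Rightarrow> complex \<times> complex" where
  "system_coeffs a b c d x y 0 = (x, y)"
| "system_coeffs a b c d x y (Suc n) =
    ((\<Sum>k\<le>n. a (n - k) * fst (system_coeffs a b c d x y k) + b (n - k) * snd (system_coeffs a b c d x y k)) / of_nat (Suc n),
     (\<Sum>k\<le>n. c (n - k) * fst (system_coeffs a b c d x y k) + d (n - k) * snd (system_coeffs a b c d x y k)) / of_nat (Suc n))"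

lemma fps_mult_nth_flip:
  fixes F G :: "complex fps"
  shows "fps_nth (F * G) n = (\<Sum>k\<le>n. fps_nth F (n - k) * fps_nth G k)"
  proof -
  have "fps_nth (F * G) n = (\<Sum>i\<le>n. fps_nth F i * fps_nth G (n - i))"
    by (simp add: fps_mult_nth atLeast0AtMost)
  also have "\<dots> = (\<Sum>k\<le>n. fps_nth F (n - k) * fps_nth G k)"
    by (rule sum.reindex_bij_witness[of _ "\<lambda>k. n - k" "\<lambda>k. n - k"]) auto
  finally show ?thesis .
qed

lemma geometric_sum_le:
  fixes q :: real
  assumes "0 \<le> q" "q < 1"
  shows "(\<Sum>k\<le>n. q ^ (n - k)) \<le> 1 / (1 - q)"
proof -
  have "(\<Sum>k\<le>n. q ^ (n - k)) = (\<Sum>k\<le>n. q ^ k)"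
    by (rule sum.reindex_bij_witness[of _ "\<lambda>k. n - k" "\<lambda>k. n - k"]) auto
  also have "\<dots> \<le> (\<Sum>k. q ^ k)"
    using assms by (intro sum_le_suminf) (auto intro: summable_geometric)
  also have "\<dots> = 1 / (1 - q)" using assms by (simp add: suminf_geometric)
  finally show ?thesis .
qed

text \<open>The factor \<open>1 / (n + 1)\<close> eventually beats the constant of the convolution.\<close>

lemma convolution_recursion_bounded:
  fixes y :: "nat \<Rightarrow> real"
  assumes y: "\<And>n. y n \<ge> 0" and q: "0 \<le> q" "q < 1" and M: "M \<ge> 0"
    and rec: "\<And>n. y (Suc n) \<le> M * (\<Sum>k\<le>n. q ^ (n - k) * y k) / real (Suc n)"
  obtains C where "\<And>n. y n \<le> C"
proof -
  obtain m :: nat where m: "M / (1 - q) \<le> real m" using real_arch_simple by blast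
  define C where "C = Max (y ` {..m})"
  have C: "y n \<le> C" if "n \<le> m" for n using that by (auto simp: C_def intro: Max_ge)
  have C0: "C \<ge> 0" using C[of 0] y[of 0] by simp
  have "y n \<le> C" for n
  proof (induction n rule: less_induct)
    case (less n)
    show ?case
    proof (cases "n \<le> m")
      case True thus ?thesis by (rule C)
    next
      case False
      then obtain k where k: "n = Suc k" "m \<le> k" by (cases n) auto
      have "y n \<le> M * (\<Sum>j\<le>k. q ^ (k - j) * y j) / real (Suc k)" using rec[of k] k by simp
      also have "\<dots> \<le> M * (\<Sum>j\<le>k. q ^ (k - j) * C) / real (Suc k)"
        using less.IH k q M by (intro divide_right_mono mult_left_mono sum_mono) auto
      also have "\<dots> = M * C * (\<Sum>j\<le>k. q ^ (k - j)) / real (Suc k)"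
        by (simp add: sum_distrib_left sum_distrib_right mult_ac)
      also have "\<dots> \<le> M * C * (1 / (1 - q)) / real (Suc k)"
        using geometric_sum_le[OF q] M C0 by (intro divide_right_mono mult_left_mono) auto
      also have "\<dots> = (M / (1 - q)) * C / real (Suc k)" by simp
      also have "\<dots> \<le> real m * C / real (Suc k)"
        using m C0 by (intro divide_right_mono mult_right_mono) auto
      also have "\<dots> \<le> C"
        using k C0 mult_right_mono[of "real m" "real (Suc k)" C] by (simp add: divide_le_eq mult.commute)
      finally show ?thesis .
    qed
  qed
  thus thesis by (rule that)
qed

lemma coeff_bound_below_radius:
  fixes F :: "complex fps"
  assumes "ereal \<rho> < fps_conv_radius F" "\<rho> \<ge> 0"
  obtains M where "M \<ge> 0" "\<And>n. norm (fps_nth F n) * \<rho> ^ n \<le> M"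
proof -
  have "summable (\<lambda>n. norm (fps_nth F n * of_real \<rho> ^ n))"
    using assms by (intro norm_summable_fps) auto
  hence "summable (\<lambda>n. norm (fps_nth F n) * \<rho> ^ n)"
    using assms(2) by (simp add: norm_mult norm_power)
  hence "Bseq (\<lambda>n. norm (fps_nth F n) * \<rho> ^ n)"
    by (intro convergent_imp_Bseq) (auto simp: convergent_def dest: summable_LIMSEQ_zero)
  then obtain M where "M > 0" "\<And>n. norm (norm (fps_nth F n) * \<rho> ^ n) \<le> M"
    by (auto simp: Bseq_def)
  thus thesis using assms(2) by (intro that[of M]) (auto simp: abs_mult)
qed

text \<open>Majorants: after weighting the \<open>n\<close>-th coefficients by \<open>r ^ n\<close>,
  those of the system are dominated by a geometric sequence with ratio
  \<open>q = r / \<rho>\<close>, for a radius \<rho> between \<open>r\<close> and \<open>R\<close>.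
  The recursion then has the shape treated in \<open>convolution_recursion_bounded\<close>.\<close>

lemma system_coeffs_radius:
  fixes A B C D :: "complex fps" and x y :: complex
  defines "s \<equiv> system_coeffs (fps_nth A) (fps_nth B) (fps_nth C) (fps_nth D) x y"
  assumes "R \<le> fps_conv_radius A" "R \<le> fps_conv_radius B" "R \<le> fps_conv_radius C" "R \<le> fps_conv_radius D"
  shows "R \<le> fps_conv_radius (Abs_fps (\<lambda>n. fst (s n)))" "R \<le> fps_conv_radius (Abs_fps (\<lambda>n. snd (s n)))"
proof -
  have bounded: "\<exists>K. \<forall>n. (norm (fst (s n)) + norm (snd (s n))) * r ^ n \<le> K"
    if r: "0 < r" "ereal r < R" for r
  proof -
    obtain \<rho> where \<rho>: "r < \<rho>" "ereal \<rho> < R" using ereal_dense2[OF r(2)] by auto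
    hence \<rho>0: "\<rho> > 0" using r by simp
    define q where "q = r / \<rho>"
    have q: "0 \<le> q" "q < 1" using \<rho> r \<rho>0 by (auto simp: q_def)
    have lt: "ereal \<rho> < fps_conv_radius A" "ereal \<rho> < fps_conv_radius B"
      "ereal \<rho> < fps_conv_radius C" "ereal \<rho> < fps_conv_radius D"
      using \<rho>(2) assms by (auto intro: less_le_trans)
    obtain MA where MA: "MA \<ge> 0" "\<And>n. norm (fps_nth A n) * \<rho> ^ n \<le> MA"
      using coeff_bound_below_radius[OF lt(1)] \<rho>0 by auto
    obtain MB where MB: "MB \<ge> 0" "\<And>n. norm (fps_nth B n) * \<rho> ^ n \<le> MB"
      using coeff_bound_below_radius[OF lt(2)] \<rho>0 by auto
    obtain MC where MC: "MC \<ge> 0" "\<And>n. norm (fps_nth C n) * \<rho> ^ n \<le> MC"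
      using coeff_bound_below_radius[OF lt(3)] \<rho>0 by auto
    obtain MD where MD: "MD \<ge> 0" "\<And>n. norm (fps_nth D n) * \<rho> ^ n \<le> MD"
      using coeff_bound_below_radius[OF lt(4)] \<rho>0 by auto
    define M where "M = MA + MB + MC + MD"
    have M: "M \<ge> 0" using MA MB MC MD by (simp add: M_def)
    have scale: "norm z * r ^ n \<le> m * q ^ n" if "norm z * \<rho> ^ n \<le> m" for z :: complex and n m
    proof -
      have "norm z * r ^ n = (norm z * \<rho> ^ n) * q ^ n"
        using \<rho>0 by (simp add: q_def power_divide)
      also have "\<dots> \<le> m * q ^ n" using that q by (intro mult_right_mono) auto
      finally show ?thesis .
    qed
    have bd: "norm (fps_nth F n) * r ^ n \<le> M * q ^ n" if "F \<in> {A, B, C, D}" for F n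
      using that MA(1) MB(1) MC(1) MD(1) MA(2)[of n] MB(2)[of n] MC(2)[of n] MD(2)[of n]
      by (intro scale) (auto simp: M_def)
    define Y where "Y n = (norm (fst (s n)) + norm (snd (s n))) * r ^ n" for n
    have Y0: "Y n \<ge> 0" for n using r by (simp add: Y_def)
    have conv: "norm (\<Sum>k\<le>n. fps_nth F (n - k) * fst (s k) + fps_nth G (n - k) * snd (s k)) * r ^ n
        \<le> M * (\<Sum>k\<le>n. q ^ (n - k) * Y k)" if FG: "F \<in> {A, B, C, D}" "G \<in> {A, B, C, D}" for F G n
    proof -
      have "norm (\<Sum>k\<le>n. fps_nth F (n - k) * fst (s k) + fps_nth G (n - k) * snd (s k)) * r ^ n
         \<le> (\<Sum>k\<le>n. norm (fps_nth F (n - k) * fst (s k) + fps_nth G (n - k) * snd (s k))) * r ^ n"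
        using r by (intro mult_right_mono norm_sum) auto
      also have "\<dots> = (\<Sum>k\<le>n. norm (fps_nth F (n - k) * fst (s k) + fps_nth G (n - k) * snd (s k)) * r ^ n)"
        by (rule sum_distrib_right)
      also have "\<dots> \<le> (\<Sum>k\<le>n. M * q ^ (n - k) * Y k)"
      proof (rule sum_mono)
        fix k assume "k \<in> {..n}"
        hence rn: "r ^ n = r ^ (n - k) * r ^ k" by (simp flip: power_add)
        have "norm (fps_nth F (n - k) * fst (s k) + fps_nth G (n - k) * snd (s k)) * r ^ n
          \<le> (norm (fps_nth F (n - k)) * norm (fst (s k)) + norm (fps_nth G (n - k)) * norm (snd (s k))) * r ^ n"
          using r by (intro mult_right_mono) (auto intro: norm_triangle_le simp: norm_mult)
        also have "\<dots> = (norm (fps_nth F (n - k)) * r ^ (n - k)) * (norm (fst (s k)) * r ^ k)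
            + (norm (fps_nth G (n - k)) * r ^ (n - k)) * (norm (snd (s k)) * r ^ k)"
          by (simp add: rn algebra_simps)
        also have "\<dots> \<le> (M * q ^ (n - k)) * (norm (fst (s k)) * r ^ k)
            + (M * q ^ (n - k)) * (norm (snd (s k)) * r ^ k)"
          using bd[OF FG(1), of "n - k"] bd[OF FG(2), of "n - k"] r
          by (intro add_mono mult_right_mono) auto
        also have "\<dots> = M * q ^ (n - k) * Y k" by (simp add: Y_def algebra_simps)
        finally show "norm (fps_nth F (n - k) * fst (s k) + fps_nth G (n - k) * snd (s k)) * r ^ n
          \<le> M * q ^ (n - k) * Y k" .
      qed
      finally show ?thesis by (simp add: sum_distrib_left mult.assoc)
    qed
    \<comment> \<open>The factor 2 comes from adding the two components, the factor \<open>r\<close>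
      from the shift of the index.\<close>
    have rec: "Y (Suc n) \<le> (2 * r * M) * (\<Sum>k\<le>n. q ^ (n - k) * Y k) / real (Suc n)" for n
    proof -
      let ?S = "M * (\<Sum>k\<le>n. q ^ (n - k) * Y k)"
      let ?X = "\<Sum>k\<le>n. fps_nth A (n - k) * fst (s k) + fps_nth B (n - k) * snd (s k)"
      let ?Z = "\<Sum>k\<le>n. fps_nth C (n - k) * fst (s k) + fps_nth D (n - k) * snd (s k)"
      have "Y (Suc n) = (norm (?X / of_nat (Suc n)) + norm (?Z / of_nat (Suc n))) * r ^ Suc n"
        by (simp add: Y_def s_def)
      also have "\<dots> = (norm ?X * r ^ n + norm ?Z * r ^ n) * r / real (Suc n)"
        by (simp add: norm_divide algebra_simps add_divide_distrib del: of_nat_Suc)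
      also have "\<dots> \<le> (?S + ?S) * r / real (Suc n)"
        using conv[of A B n] conv[of C D n] r by (intro divide_right_mono mult_right_mono add_mono) auto
      finally show ?thesis by (simp add: algebra_simps)
    qed
    obtain K where "\<And>n. Y n \<le> K"
      using convolution_recursion_bounded[of Y q "2 * r * M", OF Y0 q _ rec] M r by auto
    thus ?thesis unfolding Y_def by blast
  qed
  have radius: "R \<le> fps_conv_radius (Abs_fps f)"
    if f: "\<And>n. norm (f n) \<le> norm (fst (s n)) + norm (snd (s n))" for f
    unfolding fps_conv_radius_def
  proof (rule conv_radius_geI_ex')
    fix r :: real assume r: "0 < r" "ereal r < R"
    \<comment> \<open>Boundedness at \<rho> gives summability only at strictly smaller radii, so
      there must be room between \<open>r\<close> and \<open>R\<close>.\<close>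
    obtain \<rho> where \<rho>: "r < \<rho>" "ereal \<rho> < R" using ereal_dense2[OF r(2)] by auto
    obtain K where K: "\<And>n. (norm (fst (s n)) + norm (snd (s n))) * \<rho> ^ n \<le> K"
      using bounded[of \<rho>] \<rho> r by auto
    have "norm (f n) * \<rho> ^ n \<le> K" for n
      using K[of n] f[of n] \<rho> r by (meson mult_right_mono order_trans zero_le_power less_imp_le less_trans)
    hence "summable (\<lambda>n. norm (f n) * r ^ n)" using \<rho> r
      by (intro Abel_lemma[of r \<rho> f K]) auto
    thus "summable (\<lambda>n. fps_nth (Abs_fps f) n * of_real r ^ n)"
      using r by (intro summable_norm_cancel[of "\<lambda>n. fps_nth (Abs_fps f) n * of_real r ^ n"])
        (simp add: norm_mult norm_power)
  qed
  show "R \<le> fps_conv_radius (Abs_fps (\<lambda>n. fst (s n)))" "R \<le> fps_conv_radius (Abs_fps (\<lambda>n. snd (s n)))"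
    by (rule radius; simp)+
qed

text \<open>The power series converges as far as the coefficients are holomorphic, so no
  continuation inside the ball is needed. The extended radius covers both discs, for local flat
  frames, and the whole plane, for entire systems in the variable \<zeta>.\<close>

theorem linear_system_solution:
  fixes a b c d :: "complex \<Rightarrow> complex"
  assumes "a holomorphic_on eball z0 R" "b holomorphic_on eball z0 R"
    "c holomorphic_on eball z0 R" "d holomorphic_on eball z0 R"
  obtains f g where "f z0 = x" "g z0 = y"
    "\<And>z. z \<in> eball z0 R \<Longrightarrow> (f has_field_derivative a z * f z + b z * g z) (at z)"
    "\<And>z. z \<in> eball z0 R \<Longrightarrow> (g has_field_derivative c z * f z + d z * g z) (at z)"
proof -
  define A where "A = fps_expansion a z0"
  define B where "B = fps_expansion b z0"
  define C where "C = fps_expansion c z0"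
  define D where "D = fps_expansion d z0"
  have rad: "R \<le> fps_conv_radius A" "R \<le> fps_conv_radius B" "R \<le> fps_conv_radius C" "R \<le> fps_conv_radius D"
    using assms unfolding A_def B_def C_def D_def by (auto intro: conv_radius_fps_expansion)
  have ev: "eval_fps A (z - z0) = a z" "eval_fps B (z - z0) = b z"
    "eval_fps C (z - z0) = c z" "eval_fps D (z - z0) = d z" if "z \<in> eball z0 R" for z
    using that unfolding A_def B_def C_def D_def by (auto intro!: eval_fps_expansion[OF assms(1)] eval_fps_expansion[OF assms(2)] eval_fps_expansion[OF assms(3)] eval_fps_expansion[OF assms(4)])
  define s where "s = system_coeffs (fps_nth A) (fps_nth B) (fps_nth C) (fps_nth D) x y"
  define F where "F = Abs_fps (\<lambda>n. fst (s n))"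
  define G where "G = Abs_fps (\<lambda>n. snd (s n))"
  have radF: "R \<le> fps_conv_radius F" and radG: "R \<le> fps_conv_radius G"
    using system_coeffs_radius[OF rad] unfolding F_def G_def s_def by auto
  have F': "fps_deriv F = A * F + B * G" and G': "fps_deriv G = C * F + D * G"
    by (rule fps_ext, simp add: fps_mult_nth_flip F_def G_def s_def sum.distrib del: of_nat_Suc)+
  have der: "((\<lambda>z. eval_fps F (z - z0)) has_field_derivative a z * eval_fps F (z - z0) + b z * eval_fps G (z - z0)) (at z)"
       "((\<lambda>z. eval_fps G (z - z0)) has_field_derivative c z * eval_fps F (z - z0) + d z * eval_fps G (z - z0)) (at z)"
    if z: "z \<in> eball z0 R" for z
  proof -
    have n: "ereal (norm (z - z0)) < R" using z by (simp add: dist_norm norm_minus_commute)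
    hence lt: "ereal (norm (z - z0)) < fps_conv_radius A" "ereal (norm (z - z0)) < fps_conv_radius B"
       "ereal (norm (z - z0)) < fps_conv_radius C" "ereal (norm (z - z0)) < fps_conv_radius D"
       "ereal (norm (z - z0)) < fps_conv_radius F" "ereal (norm (z - z0)) < fps_conv_radius G"
      using rad radF radG by (auto intro: less_le_trans)
    have m: "ereal (norm (z - z0)) < fps_conv_radius (U * V)"
      if "ereal (norm (z - z0)) < fps_conv_radius U" "ereal (norm (z - z0)) < fps_conv_radius V"
      for U V :: "complex fps"
      using that fps_conv_radius_mult[of U V] by (auto simp: min_def split: if_splits intro: less_le_trans)
    have "eval_fps (fps_deriv F) (z - z0) = a z * eval_fps F (z - z0) + b z * eval_fps G (z - z0)"
      unfolding F' using lt m by (subst eval_fps_add) (auto simp: eval_fps_mult ev[OF z])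
    moreover have "eval_fps (fps_deriv G) (z - z0) = c z * eval_fps F (z - z0) + d z * eval_fps G (z - z0)"
      unfolding G' using lt m by (subst eval_fps_add) (auto simp: eval_fps_mult ev[OF z])
    moreover have "((\<lambda>z. eval_fps U (z - z0)) has_field_derivative eval_fps (fps_deriv U) (z - z0)) (at z)"
      if "ereal (norm (z - z0)) < fps_conv_radius U" for U :: "complex fps"
      using that by (auto intro!: derivative_eq_intros has_field_derivative_eval_fps[THEN DERIV_chain2])
    ultimately show "((\<lambda>z. eval_fps F (z - z0)) has_field_derivative a z * eval_fps F (z - z0) + b z * eval_fps G (z - z0)) (at z)"
       "((\<lambda>z. eval_fps G (z - z0)) has_field_derivative c z * eval_fps F (z - z0) + d z * eval_fps G (z - z0)) (at z)"
      using lt by metis+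
  qed
  show thesis
    by (rule that[of "\<lambda>z. eval_fps F (z - z0)" "\<lambda>z. eval_fps G (z - z0)"])
       (use der in \<open>auto simp: eval_fps_at_0 F_def G_def s_def\<close>)
qed

section \<open>Energy estimates on real intervals\<close>

lemma has_real_derivative_cmod_power2:
  fixes h :: "real \<Rightarrow> complex"
  assumes "(h has_vector_derivative h') (at t)"
  shows "((\<lambda>t. (cmod (h t))\<^sup>2) has_real_derivative 2 * (h t \<bullet> h')) (at t)"
proof -
  have "((\<lambda>t. h t \<bullet> h t) has_vector_derivative h t \<bullet> h' + h' \<bullet> h t) (at t)"
    by (rule bounded_bilinear.has_vector_derivative[OF bounded_bilinear_inner assms assms])
  moreover have "h t \<bullet> h' + h' \<bullet> h t = 2 * (h t \<bullet> h')"
    by (simp only: inner_commute[of h' "h t"] mult_2)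
  ultimately show ?thesis
    by (simp only: has_real_derivative_iff_has_vector_derivative power2_norm_eq_inner)
qed

text \<open>Up to the rate \<open>k t\<close>, the left-hand side is what the Cauchy-Schwarz
  inequality leaves of the energy derivative in \<open>gronwall_pair\<close>. The constant 2 fits
  the rate \<open>2 * k t\<close> of \<open>gronwall\<close>.\<close>

lemma quadratic_form_le:
  fixes x y :: real
  shows "x\<^sup>2 / 2 + 5 / 4 * (x * y) + y\<^sup>2 / 2 \<le> 2 * (x\<^sup>2 + y\<^sup>2)"
proof -
  have "2 * (x\<^sup>2 + y\<^sup>2) - (x\<^sup>2 / 2 + 5 / 4 * (x * y) + y\<^sup>2 / 2) = 5 / 8 * (x - y)\<^sup>2 + 7 / 8 * (x\<^sup>2 + y\<^sup>2)"
    by (simp add: power2_eq_square field_simps)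
  also have "\<dots> \<ge> 0" by simp
  finally show ?thesis by simp
qed

lemma le_mult_exp_diff:
  fixes u v x y :: real
  assumes "x * exp (- (2 * u)) \<le> y * exp (- (2 * v))"
  shows "x \<le> y * exp (2 * (u - v))"
proof -
  have e: "exp (2 * (u - v)) = exp (2 * u) * exp (- (2 * v))"
    unfolding exp_add[symmetric] by (simp add: right_diff_distrib)
  have "x = x * exp (- (2 * u)) * exp (2 * u)"
    unfolding mult.assoc exp_add[symmetric] by simp
  also have "\<dots> \<le> y * exp (- (2 * v)) * exp (2 * u)"
    by (rule mult_right_mono[OF assms]) (rule exp_ge_zero)
  also have "\<dots> = y * exp (2 * (u - v))" unfolding e by (simp only: mult_ac)
  finally show ?thesis .
qed

text \<open>The integrating factor \<open>exp (- (2 * m t))\<close> turns \<phi> into a decreasing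
  function; stating the bound with a primitive \<open>m\<close> of the rate avoids
  integrals.\<close>

lemma gronwall:
  fixes \<phi> m :: "real \<Rightarrow> real"
  assumes "a \<le> b"
    and \<phi>: "\<And>t. a \<le> t \<Longrightarrow> t \<le> b \<Longrightarrow> (\<phi> has_real_derivative d t) (at t)"
    and m: "\<And>t. a \<le> t \<Longrightarrow> t \<le> b \<Longrightarrow> (m has_real_derivative k t) (at t)"
    and le: "\<And>t. a \<le> t \<Longrightarrow> t \<le> b \<Longrightarrow> d t \<le> 2 * k t * \<phi> t"
  shows "\<phi> b \<le> \<phi> a * exp (2 * (m b - m a))"
proof (rule le_mult_exp_diff)
  show "\<phi> b * exp (- (2 * m b)) \<le> \<phi> a * exp (- (2 * m a))"
  proof (rule DERIV_nonpos_imp_nonincreasing[OF assms(1)])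
    fix t assume t: "a \<le> t" "t \<le> b"
    have "((\<lambda>t. \<phi> t * exp (- (2 * m t))) has_real_derivative
        d t * exp (- (2 * m t)) + \<phi> t * (exp (- (2 * m t)) * (- (2 * k t)))) (at t)"
      using \<phi>[OF t] m[OF t] by (auto intro!: derivative_eq_intros)
    moreover have "d t * exp (- (2 * m t)) \<le> (2 * k t * \<phi> t) * exp (- (2 * m t))"
      by (rule mult_right_mono[OF le[OF t] exp_ge_zero])
    hence "d t * exp (- (2 * m t)) + \<phi> t * (exp (- (2 * m t)) * (- (2 * k t))) \<le> 0"
      by (simp add: mult_ac)
    ultimately show "\<exists>y. ((\<lambda>t. \<phi> t * exp (- (2 * m t))) has_real_derivative y) (at t) \<and> y \<le> 0"
      by blast
  qed
qed

text \<open>The term with \<nu> only damps \<open>g\<close>: it contributes a nonpositive multiple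
  of the square of \<open>cmod (g t)\<close> to the energy derivative. The growth is thus governed
  by the coupling \<mu>, however large \<nu> is, and this makes the estimate usable where
  \<open>w\<close> tends to infinity.\<close>

lemma gronwall_pair:
  fixes h g :: "real \<Rightarrow> complex"
  assumes ab: "a \<le> b"
    and h: "\<And>t. a \<le> t \<Longrightarrow> t \<le> b \<Longrightarrow> (h has_vector_derivative \<mu> t * (h t + g t / 2) / 4) (at t)"
    and g: "\<And>t. a \<le> t \<Longrightarrow> t \<le> b \<Longrightarrow>
      (g has_vector_derivative - \<nu> t * g t - \<mu> t * (h t + g t / 2) / 2) (at t)"
    and m: "\<And>t. a \<le> t \<Longrightarrow> t \<le> b \<Longrightarrow> (m has_real_derivative k t) (at t)"
    and k: "\<And>t. a \<le> t \<Longrightarrow> t \<le> b \<Longrightarrow> cmod (\<mu> t) \<le> k t"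
    and \<nu>: "\<And>t. a \<le> t \<Longrightarrow> t \<le> b \<Longrightarrow> Re (\<nu> t) \<ge> 0"
  shows "(cmod (h b))\<^sup>2 + (cmod (g b))\<^sup>2 \<le> ((cmod (h a))\<^sup>2 + (cmod (g a))\<^sup>2) * exp (2 * (m b - m a))"
proof (rule gronwall[OF ab _ m])
  fix t assume t: "a \<le> t" "t \<le> b"
  define F where "F = h t + g t / 2"
  let ?H = "cmod (h t)" and ?G = "cmod (g t)"
  show "((\<lambda>t. (cmod (h t))\<^sup>2 + (cmod (g t))\<^sup>2) has_real_derivative
      2 * (h t \<bullet> (\<mu> t * F / 4)) + 2 * (g t \<bullet> (- \<nu> t * g t - \<mu> t * F / 2))) (at t)"
    unfolding F_def by (rule DERIV_add has_real_derivative_cmod_power2 h[OF t] g[OF t])+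
  define S where "S = k t * (?H + ?G / 2)"
  have k0: "k t \<ge> 0" using k[OF t] norm_ge_zero order_trans by blast
  have f: "cmod F \<le> ?H + ?G / 2"
    using norm_triangle_ineq[of "h t" "g t / 2"] by (simp add: norm_divide F_def)
  have \<mu>F: "cmod (\<mu> t * F) \<le> S"
    unfolding norm_mult S_def using k[OF t] f k0 by (intro mult_mono) auto
  have 1: "h t \<bullet> (\<mu> t * F / 4) \<le> ?H * (S / 4)"
  proof -
    have "h t \<bullet> (\<mu> t * F / 4) \<le> ?H * cmod (\<mu> t * F / 4)" by (rule norm_cauchy_schwarz)
    also have "\<dots> \<le> ?H * (S / 4)" using \<mu>F by (intro mult_left_mono) (auto simp: norm_divide)
    finally show ?thesis .
  qed
  have "g t \<bullet> (\<nu> t * g t) = Re (\<nu> t) * (?G)\<^sup>2"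
    by (simp add: inner_complex_def cmod_power2) (simp add: algebra_simps power2_eq_square)
  hence \<nu>0: "g t \<bullet> (\<nu> t * g t) \<ge> 0" using \<nu>[OF t] by simp
  have "- (g t \<bullet> (\<mu> t * F / 2)) \<le> ?G * cmod (\<mu> t * F / 2)"
    using Cauchy_Schwarz_ineq2[of "g t" "\<mu> t * F / 2"] by linarith
  also have "\<dots> \<le> ?G * (S / 2)" using \<mu>F by (intro mult_left_mono) (auto simp: norm_divide)
  finally have 2: "g t \<bullet> (- \<nu> t * g t - \<mu> t * F / 2) \<le> ?G * (S / 2)"
    using \<nu>0 by (simp add: inner_diff_right)
  have "2 * (h t \<bullet> (\<mu> t * F / 4)) + 2 * (g t \<bullet> (- \<nu> t * g t - \<mu> t * F / 2))
      \<le> 2 * (?H * (S / 4)) + 2 * (?G * (S / 2))"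
    using 1 2 by (intro add_mono mult_left_mono) auto
  also have "\<dots> = k t * (?H\<^sup>2 / 2 + 5 / 4 * (?H * ?G) + ?G\<^sup>2 / 2)"
    by (simp add: S_def power2_eq_square field_simps)
  also have "\<dots> \<le> k t * (2 * (?H\<^sup>2 + ?G\<^sup>2))"
    by (rule mult_left_mono[OF quadratic_form_le k0])
  finally show "2 * (h t \<bullet> (\<mu> t * F / 4)) + 2 * (g t \<bullet> (- \<nu> t * g t - \<mu> t * F / 2))
      \<le> 2 * k t * (?H\<^sup>2 + ?G\<^sup>2)" by (simp only: mult_ac)
qed

text \<open>With the value \<open>deriv f 0\<close> at 0 the quotient is a total function, and the
  factorisation holds for every \<open>z\<close>, also outside \<open>S\<close>. This spares
  membership conditions later on.\<close>

lemma holomorphic_divide_by_variable: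
  fixes f :: "complex \<Rightarrow> complex"
  assumes "f holomorphic_on S" "open S" "f 0 = 0"
  obtains g where "g holomorphic_on S" "\<And>z. f z = z * g z" "g 0 = deriv f 0"
proof (rule that[of "\<lambda>z. if z = 0 then deriv f 0 else (f z - f 0) / (z - 0)"])
  show "(\<lambda>z. if z = 0 then deriv f 0 else (f z - f 0) / (z - 0)) holomorphic_on S"
    by (rule pole_lemma_open) fact+
qed (use assms in auto)

lemma holomorphic_second_order_bound:
  fixes p :: "complex \<Rightarrow> complex"
  assumes "p holomorphic_on ball 0 r" "r > 0" "p 0 = 0"
  obtains M \<delta> where "M \<ge> 0" "\<delta> > 0" "\<delta> < r" "\<And>z. cmod z \<le> \<delta> \<Longrightarrow> cmod (p z - deriv p 0 * z) \<le> M * (cmod z)\<^sup>2"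
proof -
  obtain q where q: "q holomorphic_on ball 0 r" "\<And>z. p z = z * q z" "q 0 = deriv p 0"
    using holomorphic_divide_by_variable[OF assms(1) open_ball assms(3)] by blast
  have "(\<lambda>z. q z - q 0) holomorphic_on ball 0 r" by (intro holomorphic_intros q)
  then obtain s where s: "s holomorphic_on ball 0 r" "\<And>z. q z - q 0 = z * s z"
    using holomorphic_divide_by_variable[of "\<lambda>z. q z - q 0" "ball 0 r"] by auto
  have "compact (s ` cball 0 (r/2))"
    using s(1) assms(2) by (intro compact_continuous_image holomorphic_on_imp_continuous_on)
      (auto elim: holomorphic_on_subset)
  then obtain M where M: "\<And>z. z \<in> cball 0 (r/2) \<Longrightarrow> cmod (s z) \<le> M"
    by (meson bounded_iff compact_imp_bounded imageI)
  show thesis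
  proof (rule that[of "max M 0" "r / 2"])
    fix z :: complex assume z: "cmod z \<le> r / 2"
    have "p z - deriv p 0 * z = z * (q z - q 0)" using q by (simp add: algebra_simps)
    also have "\<dots> = z * z * s z" using s(2)[of z] by simp
    finally have "cmod (p z - deriv p 0 * z) = (cmod z)\<^sup>2 * cmod (s z)"
      by (simp add: norm_mult power2_eq_square)
    also have "\<dots> \<le> (cmod z)\<^sup>2 * max M 0" using M[of z] z by (intro mult_left_mono) auto
    finally show "cmod (p z - deriv p 0 * z) \<le> max M 0 * (cmod z)\<^sup>2" by (simp add: mult.commute)
  qed (use assms in auto)
qed

text \<open>In the variable z = exp \<zeta> this is the system z^2 y' = - v, z^2 v' = - p y,
  equivalent to a scalar equation of second order for \<open>y\<close>. The half-plane is the
  universal covering of the punctured disc of radius \<open>exp L\<close>.\<close>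

definition companion_sol ::
    "(complex \<Rightarrow> complex) \<Rightarrow> real \<Rightarrow> (complex \<Rightarrow> complex) \<Rightarrow> (complex \<Rightarrow> complex) \<Rightarrow> bool" where
  "companion_sol p L y v \<longleftrightarrow> (\<forall>\<zeta>. Re \<zeta> < L \<longrightarrow>
     (y has_field_derivative - exp (- \<zeta>) * v \<zeta>) (at \<zeta>) \<and>
     (v has_field_derivative - exp (- \<zeta>) * p (exp \<zeta>) * y \<zeta>) (at \<zeta>))"

lemma companion_solD:
  assumes "companion_sol p L y v" "Re \<zeta> < L"
  shows "(y has_field_derivative - exp (- \<zeta>) * v \<zeta>) (at \<zeta>)"
    and "(v has_field_derivative - exp (- \<zeta>) * p (exp \<zeta>) * y \<zeta>) (at \<zeta>)"
  using assms unfolding companion_sol_def by blast+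

lemma companion_sol_lincomb:
  assumes "companion_sol p L y1 v1" "companion_sol p L y2 v2"
  shows "companion_sol p L (\<lambda>\<zeta>. a * y1 \<zeta> + b * y2 \<zeta>) (\<lambda>\<zeta>. a * v1 \<zeta> + b * v2 \<zeta>)"
  unfolding companion_sol_def
proof (intro allI impI conjI)
  fix \<zeta> :: complex assume "Re \<zeta> < L"
  note d = companion_solD[OF assms(1) this] companion_solD[OF assms(2) this]
  show "((\<lambda>\<zeta>. a * y1 \<zeta> + b * y2 \<zeta>) has_field_derivative - exp (- \<zeta>) * (a * v1 \<zeta> + b * v2 \<zeta>)) (at \<zeta>)"
    by (rule d derivative_eq_intros refl)+ (simp add: algebra_simps)
  show "((\<lambda>\<zeta>. a * v1 \<zeta> + b * v2 \<zeta>) has_field_derivative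
      - exp (- \<zeta>) * p (exp \<zeta>) * (a * y1 \<zeta> + b * y2 \<zeta>)) (at \<zeta>)"
    by (rule d derivative_eq_intros refl)+ (simp add: algebra_simps)
qed

lemma companion_sol_shift:
  assumes "companion_sol p L y v"
  shows "companion_sol p L (\<lambda>\<zeta>. y (\<zeta> + 2 * of_real pi * \<i>)) (\<lambda>\<zeta>. v (\<zeta> + 2 * of_real pi * \<i>))"
  unfolding companion_sol_def
proof (intro allI impI conjI)
  fix \<zeta> :: complex assume \<zeta>: "Re \<zeta> < L"
  let ?s = "\<zeta> + 2 * of_real pi * \<i>"
  have e2: "exp ?s = exp \<zeta>" by (simp only: exp_add exp_two_pi_i mult_1_right)
  have e1: "exp (- ?s) = exp (- \<zeta>)" by (simp only: exp_minus e2)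
  have "Re ?s < L" using \<zeta> by simp
  hence d: "(y has_field_derivative - exp (- \<zeta>) * v ?s) (at ?s)"
    "(v has_field_derivative - exp (- \<zeta>) * p (exp \<zeta>) * y ?s) (at ?s)"
    using companion_solD[OF assms, of ?s] \<zeta> unfolding e1 e2 by simp_all
  show "((\<lambda>\<zeta>. y (\<zeta> + 2 * of_real pi * \<i>)) has_field_derivative - exp (- \<zeta>) * v ?s) (at \<zeta>)"
    using d(1) by (rule DERIV_shift[THEN iffD1])
  show "((\<lambda>\<zeta>. v (\<zeta> + 2 * of_real pi * \<i>)) has_field_derivative - exp (- \<zeta>) * p (exp \<zeta>) * y ?s) (at \<zeta>)"
    using d(2) by (rule DERIV_shift[THEN iffD1])
qed

definition wronskian ::
    "(complex \<Rightarrow> complex) \<Rightarrow> (complex \<Rightarrow> complex) \<Rightarrow> (complex \<Rightarrow> complex) \<Rightarrow> (complex \<Rightarrow> complex) \<Rightarrow> complex \<Rightarrow> complex" where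
  "wronskian y1 v1 y2 v2 \<zeta> = y1 \<zeta> * v2 \<zeta> - y2 \<zeta> * v1 \<zeta>"

text \<open>The coefficient matrix has trace 0, so the determinant of two solutions is
  constant.\<close>

lemma wronskian_deriv:
  assumes "companion_sol p L y1 v1" "companion_sol p L y2 v2" "Re \<zeta> < L"
  shows "(wronskian y1 v1 y2 v2 has_field_derivative 0) (at \<zeta>)"
proof -
  define e q where "e = - exp (- \<zeta>)" and "q = p (exp \<zeta>)"
  note d = companion_solD[OF assms(1,3), folded e_def q_def] companion_solD[OF assms(2,3), folded e_def q_def]
  have "e * v1 \<zeta> * v2 \<zeta> + e * q * y2 \<zeta> * y1 \<zeta> - (e * v2 \<zeta> * v1 \<zeta> + e * q * y1 \<zeta> * y2 \<zeta>) = 0"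
    by (simp add: mult_ac)
  thus ?thesis using DERIV_diff[OF DERIV_mult[OF d(1) d(4)] DERIV_mult[OF d(3) d(2)]]
    unfolding wronskian_def[abs_def] by (simp only:)
qed

lemma wronskian_const:
  assumes "companion_sol p L y1 v1" "companion_sol p L y2 v2"
  obtains W where "\<And>\<zeta>. Re \<zeta> < L \<Longrightarrow> wronskian y1 v1 y2 v2 \<zeta> = W"
proof -
  have "(wronskian y1 v1 y2 v2 has_field_derivative 0) (at \<zeta> within {\<zeta>. Re \<zeta> < L})"
    if "\<zeta> \<in> {\<zeta>. Re \<zeta> < L}" for \<zeta>
    using that has_field_derivative_at_within[OF wronskian_deriv[OF assms]] by simp
  hence "\<exists>W. \<forall>\<zeta>\<in>{\<zeta>. Re \<zeta> < L}. wronskian y1 v1 y2 v2 \<zeta> = W"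
    using has_field_derivative_zero_constant[OF convex_halfspace_Re_lt, of L "wronskian y1 v1 y2 v2"] by blast
  thus thesis using that by auto
qed

section \<open>Recessive solutions\<close>

text \<open>The solutions behave like \<open>exp (\<plusminus> w) / X\<close>, where \<open>w\<^sup>2 = 4 p'(0) / z\<close>, \<open>z = exp \<zeta>\<close> and
  \<open>X = w\<close> to the power \<open>- 1/2\<close>. The components of \<open>X y\<close> along \<open>exp (- w)\<close> and \<open>exp w\<close>, multiplied by
  \<open>exp w\<close>, are \<open>h\<close> and \<open>g / 2\<close>; the perturbation \<open>Q\<close> is what couples them.\<close>

definition wkb_w :: "complex \<Rightarrow> complex \<Rightarrow> complex" where
  "wkb_w l \<zeta> = exp ((l - \<zeta>) / 2)"

definition wkb_X :: "complex \<Rightarrow> complex \<Rightarrow> complex" where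
  "wkb_X l \<zeta> = exp ((\<zeta> - l) / 4)"

definition wkb_h :: "complex \<Rightarrow> (complex \<Rightarrow> complex) \<Rightarrow> (complex \<Rightarrow> complex) \<Rightarrow> complex \<Rightarrow> complex" where
  "wkb_h l y v \<zeta> = exp (wkb_w l \<zeta>) *
     (wkb_X l \<zeta> * y \<zeta> + wkb_X l \<zeta> ^ 3 * (y \<zeta> / 2 - 2 * exp (- \<zeta>) * v \<zeta>)) / 2"

definition wkb_g :: "complex \<Rightarrow> (complex \<Rightarrow> complex) \<Rightarrow> (complex \<Rightarrow> complex) \<Rightarrow> complex \<Rightarrow> complex" where
  "wkb_g l y v \<zeta> = exp (wkb_w l \<zeta>) *
     (wkb_X l \<zeta> * y \<zeta> - wkb_X l \<zeta> ^ 3 * (y \<zeta> / 2 - 2 * exp (- \<zeta>) * v \<zeta>))"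

definition wkb_Q :: "complex \<Rightarrow> (complex \<Rightarrow> complex) \<Rightarrow> complex \<Rightarrow> complex" where
  "wkb_Q l p \<zeta> = 4 * wkb_X l \<zeta> ^ 4 * (exp (- \<zeta>))\<^sup>2 * p (exp \<zeta>) - 1 + 3 / 4 * wkb_X l \<zeta> ^ 4"

text \<open>With A = X y and B = X^3 (y / 2 - 2 Z v) the system becomes A' = (w / 2) B, B' = (w / 2)
  (1 + Q) A. If Q were 0, then A + B and A - B would be multiples of exp (- w) and exp w; multiplied
  by exp w, the first becomes constant and the second satisfies g' = - w g. With X, Z and w kept
  abstract, only field arithmetic with w X^2 = 1 remains.\<close>

lemma wkb_derivs_aux:
  fixes X Z w ew y v :: "complex \<Rightarrow> complex"
  assumes X: "(X has_field_derivative X \<zeta> / 4) (at \<zeta>)"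
    and Z: "(Z has_field_derivative - Z \<zeta>) (at \<zeta>)"
    and ew: "(ew has_field_derivative - (w \<zeta> / 2) * ew \<zeta>) (at \<zeta>)"
    and y: "(y has_field_derivative - Z \<zeta> * v \<zeta>) (at \<zeta>)"
    and v: "(v has_field_derivative - Z \<zeta> * P * y \<zeta>) (at \<zeta>)"
    and wX: "w \<zeta> * X \<zeta> ^ 2 = 1"
    and Q: "Q = 4 * X \<zeta> ^ 4 * (Z \<zeta>)\<^sup>2 * P - 1 + 3 / 4 * X \<zeta> ^ 4"
  defines "h \<equiv> \<lambda>\<zeta>. ew \<zeta> * (X \<zeta> * y \<zeta> + X \<zeta> ^ 3 * (y \<zeta> / 2 - 2 * Z \<zeta> * v \<zeta>)) / 2"
    and "g \<equiv> \<lambda>\<zeta>. ew \<zeta> * (X \<zeta> * y \<zeta> - X \<zeta> ^ 3 * (y \<zeta> / 2 - 2 * Z \<zeta> * v \<zeta>))"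
  shows "(h has_field_derivative w \<zeta> * Q * (h \<zeta> + g \<zeta> / 2) / 4) (at \<zeta>)"
    and "(g has_field_derivative - w \<zeta> * g \<zeta> - w \<zeta> * Q * (h \<zeta> + g \<zeta> / 2) / 2) (at \<zeta>)"
proof -
  define A where "A = (\<lambda>\<zeta>. X \<zeta> * y \<zeta>)"
  define B where "B = (\<lambda>\<zeta>. X \<zeta> ^ 3 * (y \<zeta> / 2 - 2 * Z \<zeta> * v \<zeta>))"
  have X0: "X \<zeta> \<noteq> 0" using wX by auto
  have w: "w \<zeta> = 1 / X \<zeta> ^ 2" using wX X0 by (simp add: field_simps)
  have A: "(A has_field_derivative - (w \<zeta> / 2) * (- B \<zeta>)) (at \<zeta>)"
    unfolding A_def using DERIV_mult[OF X y]
    by (rule DERIV_cong) (use X0 in \<open>simp add: w B_def field_simps power2_eq_square power3_eq_cube\<close>)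
  have "((\<lambda>\<zeta>. X \<zeta> ^ 3) has_field_derivative 3 * X \<zeta> ^ 2 * (X \<zeta> / 4)) (at \<zeta>)"
    using DERIV_power[OF X, of 3] by (simp add: mult_ac)
  moreover have "((\<lambda>\<zeta>. y \<zeta> / 2 - 2 * Z \<zeta> * v \<zeta>) has_field_derivative
      - Z \<zeta> * v \<zeta> / 2 - ((2 * (- Z \<zeta>)) * v \<zeta> + (- Z \<zeta> * P * y \<zeta>) * (2 * Z \<zeta>))) (at \<zeta>)"
    by (intro DERIV_diff DERIV_mult DERIV_cdivide DERIV_cmult y Z v)
  ultimately have "(B has_field_derivative 3 * X \<zeta> ^ 2 * (X \<zeta> / 4) * (y \<zeta> / 2 - 2 * Z \<zeta> * v \<zeta>) +
     (- Z \<zeta> * v \<zeta> / 2 - ((2 * (- Z \<zeta>)) * v \<zeta> + (- Z \<zeta> * P * y \<zeta>) * (2 * Z \<zeta>))) * X \<zeta> ^ 3) (at \<zeta>)"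
    unfolding B_def by (rule DERIV_mult)
  hence B: "(B has_field_derivative (w \<zeta> / 2) * (1 + Q) * A \<zeta>) (at \<zeta>)"
    by (rule DERIV_cong)
      (use X0 in \<open>simp add: w Q A_def field_simps power2_eq_square power3_eq_cube power4_eq_xxxx\<close>)
  have f: "h \<zeta> + g \<zeta> / 2 = ew \<zeta> * A \<zeta>"
    by (simp add: h_def g_def A_def field_simps)
  have h: "h = (\<lambda>\<zeta>. ew \<zeta> * (A \<zeta> + B \<zeta>) / 2)" and g: "g = (\<lambda>\<zeta>. ew \<zeta> * (A \<zeta> - B \<zeta>))"
    by (simp_all add: h_def g_def A_def B_def)
  have dh: "(h has_field_derivative (- (w \<zeta> / 2) * ew \<zeta> * (A \<zeta> + B \<zeta>) +
      (- (w \<zeta> / 2) * (- B \<zeta>) + (w \<zeta> / 2) * (1 + Q) * A \<zeta>) * ew \<zeta>) / 2) (at \<zeta>)"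
    unfolding h by (intro DERIV_cdivide DERIV_mult DERIV_add ew A B)
  show "(h has_field_derivative w \<zeta> * Q * (h \<zeta> + g \<zeta> / 2) / 4) (at \<zeta>)"
    by (rule DERIV_cong[OF dh]) (unfold f, simp add: field_simps)
  have dg: "(g has_field_derivative - (w \<zeta> / 2) * ew \<zeta> * (A \<zeta> - B \<zeta>) +
      (- (w \<zeta> / 2) * (- B \<zeta>) - (w \<zeta> / 2) * (1 + Q) * A \<zeta>) * ew \<zeta>) (at \<zeta>)"
    unfolding g by (intro DERIV_mult DERIV_diff ew A B)
  show "(g has_field_derivative - w \<zeta> * g \<zeta> - w \<zeta> * Q * (h \<zeta> + g \<zeta> / 2) / 2) (at \<zeta>)"
    by (rule DERIV_cong[OF dg]) (unfold f, simp add: g field_simps)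
qed

lemma exp_quarter:
  fixes x :: complex
  shows "exp (x / 4) ^ 2 = exp (x / 2)" and "exp (x / 4) ^ 4 = exp x"
  using exp_of_nat_mult[of 2 "x / 4"] exp_of_nat_mult[of 4 "x / 4"] by simp_all

lemma wkb_w_X: "wkb_w l \<zeta> * wkb_X l \<zeta> ^ 2 = 1"
proof -
  have "wkb_X l \<zeta> ^ 2 = exp ((\<zeta> - l) / 2)"
    unfolding wkb_X_def by (rule exp_quarter)
  thus ?thesis unfolding wkb_w_def by (simp add: exp_add[symmetric] add_divide_distrib[symmetric])
qed

lemma wkb_derivs:
  assumes "companion_sol p L y v" "Re \<zeta> < L"
  shows "(wkb_h l y v has_field_derivative
       wkb_w l \<zeta> * wkb_Q l p \<zeta> * (wkb_h l y v \<zeta> + wkb_g l y v \<zeta> / 2) / 4) (at \<zeta>)"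
    and "(wkb_g l y v has_field_derivative
       - wkb_w l \<zeta> * wkb_g l y v \<zeta> - wkb_w l \<zeta> * wkb_Q l p \<zeta> * (wkb_h l y v \<zeta> + wkb_g l y v \<zeta> / 2) / 2) (at \<zeta>)"
proof -
  have X: "(wkb_X l has_field_derivative wkb_X l \<zeta> / 4) (at \<zeta>)"
    unfolding wkb_X_def[abs_def] by (auto intro!: derivative_eq_intros)
  have Z: "((\<lambda>\<zeta>. exp (- \<zeta>)) has_field_derivative - exp (- \<zeta>)) (at \<zeta>)"
    by (auto intro!: derivative_eq_intros)
  have w: "(wkb_w l has_field_derivative - (wkb_w l \<zeta> / 2)) (at \<zeta>)"
    unfolding wkb_w_def[abs_def] by (auto intro!: derivative_eq_intros)
  have ew: "((\<lambda>\<zeta>. exp (wkb_w l \<zeta>)) has_field_derivative - (wkb_w l \<zeta> / 2) * exp (wkb_w l \<zeta>)) (at \<zeta>)"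
    using DERIV_fun_exp[OF w] by (simp add: mult.commute)
  note * = wkb_derivs_aux[where X = "wkb_X l" and Z = "\<lambda>\<zeta>. exp (- \<zeta>)" and w = "wkb_w l" and
      ew = "\<lambda>\<zeta>. exp (wkb_w l \<zeta>)" and P = "p (exp \<zeta>)" and \<zeta> = \<zeta> and Q = "wkb_Q l p \<zeta>",
      OF X Z ew companion_solD[OF assms] wkb_w_X wkb_Q_def]
  show "(wkb_h l y v has_field_derivative
       wkb_w l \<zeta> * wkb_Q l p \<zeta> * (wkb_h l y v \<zeta> + wkb_g l y v \<zeta> / 2) / 4) (at \<zeta>)"
    using *(1) unfolding wkb_h_def[abs_def] wkb_g_def[abs_def] .
  show "(wkb_g l y v has_field_derivative
       - wkb_w l \<zeta> * wkb_g l y v \<zeta> - wkb_w l \<zeta> * wkb_Q l p \<zeta> * (wkb_h l y v \<zeta> + wkb_g l y v \<zeta> / 2) / 2) (at \<zeta>)"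
    using *(2) unfolding wkb_h_def[abs_def] wkb_g_def[abs_def] .
qed

text \<open>By the choice of \<open>l\<close> the linear part of \<open>p\<close> cancels the
  \<open>- 1\<close> in \<open>wkb_Q\<close>, so Q is of order z. Since w is of order z^(-1/2), the
  coupling w Q is of order z^(1/2) = exp (\<zeta> / 2), which is integrable along half-lines to the
  left.\<close>

lemma wkb_Q_bound:
  assumes "p holomorphic_on ball 0 r" "r > 0" "p 0 = 0" "exp l = 4 * deriv p 0"
  obtains K x1 where "K > 0" "exp x1 < r"
    "\<And>\<zeta>. Re \<zeta> \<le> x1 \<Longrightarrow> cmod (wkb_w l \<zeta> * wkb_Q l p \<zeta>) \<le> K * exp (Re \<zeta> / 2)"
proof -
  obtain M \<delta> where M: "M \<ge> 0" "\<delta> > 0" "\<delta> < r"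
    "\<And>z. cmod z \<le> \<delta> \<Longrightarrow> cmod (p z - deriv p 0 * z) \<le> M * (cmod z)\<^sup>2"
    using holomorphic_second_order_bound[OF assms(1-3)] by blast
  show thesis
  proof (rule that[of "(4 * M + 1) * exp (- Re l / 2)" "ln \<delta>"])
    fix \<zeta> assume "Re \<zeta> \<le> ln \<delta>"
    hence "cmod (exp \<zeta>) \<le> \<delta>" using M(2) by (metis exp_le_cancel_iff exp_ln norm_exp_eq_Re)
    hence b: "cmod (p (exp \<zeta>) - deriv p 0 * exp \<zeta>) \<le> M * (exp (Re \<zeta>))\<^sup>2"
      using M(4)[of "exp \<zeta>"] by simp
    have X4: "wkb_X l \<zeta> ^ 4 = exp (\<zeta> - l)"
      unfolding wkb_X_def by (rule exp_quarter)
    have "exp (\<zeta> - l) * (exp (- \<zeta>))\<^sup>2 * (4 * deriv p 0 * exp \<zeta>) = 1"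
      unfolding assms(4)[symmetric] power2_eq_square exp_add[symmetric] by simp
    hence "wkb_Q l p \<zeta> = 4 * exp (\<zeta> - l) * (exp (- \<zeta>))\<^sup>2 * (p (exp \<zeta>) - deriv p 0 * exp \<zeta>) + 3 / 4 * exp (\<zeta> - l)"
      unfolding wkb_Q_def X4 by (simp add: algebra_simps)
    hence "cmod (wkb_Q l p \<zeta>) \<le> cmod (4 * exp (\<zeta> - l) * (exp (- \<zeta>))\<^sup>2 * (p (exp \<zeta>) - deriv p 0 * exp \<zeta>))
       + cmod (3 / 4 * exp (\<zeta> - l))" by (simp only: norm_triangle_ineq)
    also have "\<dots> = 4 * exp (Re \<zeta> - Re l) * (exp (- Re \<zeta>))\<^sup>2 * cmod (p (exp \<zeta>) - deriv p 0 * exp \<zeta>)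
       + 3 / 4 * exp (Re \<zeta> - Re l)"
      by (simp add: norm_mult norm_power)
    also have "\<dots> \<le> 4 * exp (Re \<zeta> - Re l) * (exp (- Re \<zeta>))\<^sup>2 * (M * (exp (Re \<zeta>))\<^sup>2) + 1 * exp (Re \<zeta> - Re l)"
      using b by (intro add_mono mult_left_mono mult_right_mono) auto
    also have "\<dots> = (4 * M + 1) * exp (Re \<zeta> - Re l)"
      by (simp add: exp_minus field_simps)
    finally have Q: "cmod (wkb_Q l p \<zeta>) \<le> (4 * M + 1) * exp (Re \<zeta> - Re l)" .
    have w: "cmod (wkb_w l \<zeta>) = exp ((Re l - Re \<zeta>) / 2)" by (simp add: wkb_w_def)
    have "cmod (wkb_w l \<zeta> * wkb_Q l p \<zeta>) \<le> exp ((Re l - Re \<zeta>) / 2) * ((4 * M + 1) * exp (Re \<zeta> - Re l))"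
      unfolding norm_mult w using Q by (intro mult_left_mono) auto
    also have "\<dots> = (4 * M + 1) * (exp ((Re l - Re \<zeta>) / 2) * exp (Re \<zeta> - Re l))" by (simp only: mult_ac)
    also have "exp ((Re l - Re \<zeta>) / 2) * exp (Re \<zeta> - Re l) = exp (- Re l / 2) * exp (Re \<zeta> / 2)"
      unfolding exp_add[symmetric] by (rule arg_cong[where f = exp]) (simp add: field_simps)
    finally show "cmod (wkb_w l \<zeta> * wkb_Q l p \<zeta>) \<le> (4 * M + 1) * exp (- Re l / 2) * exp (Re \<zeta> / 2)"
      by (simp only: mult.assoc)
  qed (use M in auto)
qed

definition wkb_energy :: "complex \<Rightarrow> (complex \<Rightarrow> complex) \<Rightarrow> (complex \<Rightarrow> complex) \<Rightarrow> complex \<Rightarrow> real" where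
  "wkb_energy l y v \<zeta> = (cmod (wkb_h l y v \<zeta>))\<^sup>2 + (cmod (wkb_g l y v \<zeta>))\<^sup>2"

text \<open>The energy can be transported in any direction \<open>d\<close> in which the factor
  belonging to \<open>g\<close> does not grow. Below, \<open>d = 1\<close> is used on the central
  line and \<open>d = \<i>\<close> or \<open>d = - \<i>\<close> to leave it.\<close>

lemma wkb_energy_segment:
  assumes sol: "companion_sol p L y v" and ab: "a \<le> b" and d: "cmod d = 1"
    and dom: "\<And>t. a \<le> t \<Longrightarrow> t \<le> b \<Longrightarrow> Re (\<zeta> + d * of_real t) < L"
    and k: "\<And>t. a \<le> t \<Longrightarrow> t \<le> b \<Longrightarrow>
      cmod (wkb_w l (\<zeta> + d * of_real t) * wkb_Q l p (\<zeta> + d * of_real t)) \<le> k t"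
    and m: "\<And>t. a \<le> t \<Longrightarrow> t \<le> b \<Longrightarrow> (m has_real_derivative k t) (at t)"
    and dw: "\<And>t. a \<le> t \<Longrightarrow> t \<le> b \<Longrightarrow> Re (d * wkb_w l (\<zeta> + d * of_real t)) \<ge> 0"
  shows "wkb_energy l y v (\<zeta> + d * of_real b) \<le> wkb_energy l y v (\<zeta> + d * of_real a) * exp (2 * (m b - m a))"
proof -
  let ?z = "\<lambda>t. \<zeta> + d * of_real t"
  have z: "(?z has_vector_derivative d) (at t)" for t
    by (auto intro!: derivative_eq_intros simp: has_vector_derivative_def scaleR_conv_of_real)
  have chain: "((\<lambda>t. F (?z t)) has_vector_derivative d * F') (at t)"
    if "(F has_field_derivative F') (at (?z t))" for F F' t
    using field_vector_diff_chain_at[OF z that] by (simp add: o_def)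
  show ?thesis unfolding wkb_energy_def
  proof (rule gronwall_pair[OF ab, where \<mu> = "\<lambda>t. d * (wkb_w l (?z t) * wkb_Q l p (?z t))" and
       \<nu> = "\<lambda>t. d * wkb_w l (?z t)"])
    fix t assume t: "a \<le> t" "t \<le> b"
    show "((\<lambda>t. wkb_h l y v (?z t)) has_vector_derivative
        d * (wkb_w l (?z t) * wkb_Q l p (?z t)) * (wkb_h l y v (?z t) + wkb_g l y v (?z t) / 2) / 4) (at t)"
      using chain[OF wkb_derivs(1)[OF sol dom[OF t]]] by (simp only: mult.assoc times_divide_eq_right)
    show "((\<lambda>t. wkb_g l y v (?z t)) has_vector_derivative
        - (d * wkb_w l (?z t)) * wkb_g l y v (?z t) -
        d * (wkb_w l (?z t) * wkb_Q l p (?z t)) * (wkb_h l y v (?z t) + wkb_g l y v (?z t) / 2) / 2) (at t)"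
      using chain[OF wkb_derivs(2)[OF sol dom[OF t]]]
      by (simp only: mult.assoc times_divide_eq_right right_diff_distrib mult_minus_left mult_minus_right)
    show "(m has_real_derivative k t) (at t)" by (rule m[OF t])
    show "cmod (d * (wkb_w l (?z t) * wkb_Q l p (?z t))) \<le> k t"
      using k[OF t] d by (simp add: norm_mult)
    show "Re (d * wkb_w l (?z t)) \<ge> 0" by (rule dw[OF t])
  qed
qed

text \<open>The factor in front of the Wronskian has no zeros, so the combinations of a fundamental
  pair take arbitrary values of (h, g) at a given point.\<close>

lemma wkb_wronskian:
  "wkb_h l y1 v1 \<zeta> * wkb_g l y2 v2 \<zeta> - wkb_h l y2 v2 \<zeta> * wkb_g l y1 v1 \<zeta> =
     2 * (exp (wkb_w l \<zeta>))\<^sup>2 * wkb_X l \<zeta> ^ 4 * exp (- \<zeta>) * wronskian y1 v1 y2 v2 \<zeta>"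
proof -
  have "e * (X * a + X ^ 3 * (a / 2 - 2 * Z * b)) / 2 * (e * (X * c - X ^ 3 * (c / 2 - 2 * Z * d))) -
      e * (X * c + X ^ 3 * (c / 2 - 2 * Z * d)) / 2 * (e * (X * a - X ^ 3 * (a / 2 - 2 * Z * b))) =
      2 * e\<^sup>2 * X ^ 4 * Z * (a * d - c * b)" for e X Z a b c d :: complex
    by (simp add: field_simps power2_eq_square power3_eq_cube power4_eq_xxxx)
  thus ?thesis unfolding wkb_h_def wkb_g_def wronskian_def by blast
qed

lemma wkb_lincomb:
  "wkb_h l (\<lambda>\<zeta>. a * y1 \<zeta> + b * y2 \<zeta>) (\<lambda>\<zeta>. a * v1 \<zeta> + b * v2 \<zeta>) \<zeta> = a * wkb_h l y1 v1 \<zeta> + b * wkb_h l y2 v2 \<zeta>"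
  "wkb_g l (\<lambda>\<zeta>. a * y1 \<zeta> + b * y2 \<zeta>) (\<lambda>\<zeta>. a * v1 \<zeta> + b * v2 \<zeta>) \<zeta> = a * wkb_g l y1 v1 \<zeta> + b * wkb_g l y2 v2 \<zeta>"
  by (simp_all add: wkb_h_def wkb_g_def field_simps)

lemma wkb_recover:
  fixes l \<zeta> :: complex and y v :: "complex \<Rightarrow> complex"
  defines "h \<equiv> wkb_h l y v \<zeta>" and "g \<equiv> wkb_g l y v \<zeta>"
  shows "y \<zeta> = exp (- wkb_w l \<zeta>) * (h + g / 2) / wkb_X l \<zeta>"
    and "v \<zeta> = exp \<zeta> * (y \<zeta> - 2 * exp (- wkb_w l \<zeta>) * (h - g / 2) / wkb_X l \<zeta> ^ 3) / 4"
proof -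
  have X: "wkb_X l \<zeta> \<noteq> 0" by (simp add: wkb_X_def)
  have f: "h + g / 2 = exp (wkb_w l \<zeta>) * (wkb_X l \<zeta> * y \<zeta>)"
    by (simp add: h_def g_def wkb_h_def wkb_g_def field_simps)
  show "y \<zeta> = exp (- wkb_w l \<zeta>) * (h + g / 2) / wkb_X l \<zeta>"
    unfolding f exp_minus using X by simp
  have f: "h - g / 2 = exp (wkb_w l \<zeta>) * (wkb_X l \<zeta> ^ 3 * (y \<zeta> / 2 - 2 * exp (- \<zeta>) * v \<zeta>))"
    by (simp add: h_def g_def wkb_h_def wkb_g_def field_simps)
  show "v \<zeta> = exp \<zeta> * (y \<zeta> - 2 * exp (- wkb_w l \<zeta>) * (h - g / 2) / wkb_X l \<zeta> ^ 3) / 4"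
    unfolding f exp_minus using X by (simp add: field_simps)
qed

lemma sum_squares_le_two:
  fixes x y :: real
  assumes "x\<^sup>2 + y\<^sup>2 \<le> 2"
  shows "x \<le> 2" and "y \<le> 2"
proof -
  have "x\<^sup>2 \<le> 2\<^sup>2" "y\<^sup>2 \<le> 2\<^sup>2"
    using assms zero_le_power2[of x] zero_le_power2[of y] by (simp_all, linarith+)
  thus "x \<le> 2" "y \<le> 2" by (auto intro: power2_le_imp_le[of _ 2])
qed

lemma exp_le_two:
  fixes x :: real
  assumes "x \<le> 1 / 2"
  shows "exp x \<le> 2"
proof -
  have "exp x \<le> exp (1 / 2)" using assms by simp
  also have "\<dots> \<le> 1 + 1 / 2 + (1 / 2)\<^sup>2" by (rule exp_bound) auto
  also have "\<dots> \<le> 2" by (simp add: power2_eq_square)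
  finally show ?thesis .
qed

text \<open>A primitive of the coupling bound is \<open>2 * K * exp (t / 2)\<close>, and it is at
  most 1/4 to the left of \<open>x0\<close>. This makes the horizontal growth factor of the energy
  at most exp (1/2), hence below 2, and keeps \<open>h\<close> close to its initial value in
  \<open>normalised_h_bound\<close>. For \<open>x0 \<le> 0\<close> the various negative powers of z
  can be bounded by a single one.\<close>

locale wkb_domain =
  fixes p :: "complex \<Rightarrow> complex" and L K x0 :: real and l :: complex
  assumes x0L: "x0 < L" and x0: "x0 \<le> 0" and K0: "K > 0" and Kx0: "K * exp (x0 / 2) \<le> 1 / 8"
    and wQ: "\<And>\<zeta>. Re \<zeta> \<le> x0 \<Longrightarrow> cmod (wkb_w l \<zeta> * wkb_Q l p \<zeta>) \<le> K * exp (Re \<zeta> / 2)"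
begin

lemma Kx: "x \<le> x0 \<Longrightarrow> K * exp (x / 2) \<le> 1 / 8"
  using K0 Kx0 by (meson exp_le_cancel_iff divide_right_mono mult_left_mono less_imp_le order_trans zero_le_numeral)

lemma energy_horizontal:
  assumes sol: "companion_sol p L y v" and t: "s \<le> t" "t \<le> x0"
  shows "wkb_energy l y v (Complex t (Im l)) \<le> 2 * wkb_energy l y v (Complex s (Im l))"
proof -
  have z: "Complex 0 (Im l) + 1 * of_real t = Complex t (Im l)" for t
    by (simp add: complex_eq_iff)
  have "wkb_energy l y v (Complex 0 (Im l) + 1 * of_real t) \<le>
     wkb_energy l y v (Complex 0 (Im l) + 1 * of_real s) * exp (2 * (2 * K * exp (t / 2) - 2 * K * exp (s / 2)))"
  proof (rule wkb_energy_segment[OF sol t(1)])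
    fix r assume r: "s \<le> r" "r \<le> t"
    show "Re (Complex 0 (Im l) + 1 * of_real r) < L" using r t x0L by simp
    show "cmod (wkb_w l (Complex 0 (Im l) + 1 * of_real r) * wkb_Q l p (Complex 0 (Im l) + 1 * of_real r))
        \<le> K * exp (r / 2)"
      unfolding z using wQ[of "Complex r (Im l)"] r t by simp
    show "((\<lambda>t. 2 * K * exp (t / 2)) has_real_derivative K * exp (r / 2)) (at r)"
      by (auto intro!: derivative_eq_intros)
    show "Re (1 * wkb_w l (Complex 0 (Im l) + 1 * of_real r)) \<ge> 0"
      unfolding z by (simp add: wkb_w_def Re_exp)
  qed simp
  moreover have exp2: "exp (2 * (2 * K * exp (t / 2) - 2 * K * exp (s / 2))) \<le> 2"
  proof (rule exp_le_two)
    have "K * exp (s / 2) \<ge> 0" using K0 by simp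
    thus "2 * (2 * K * exp (t / 2) - 2 * K * exp (s / 2)) \<le> 1 / 2" using Kx[OF t(2)] by simp
  qed
  have "wkb_energy l y v (Complex s (Im l)) * exp (2 * (2 * K * exp (t / 2) - 2 * K * exp (s / 2))) \<le>
      wkb_energy l y v (Complex s (Im l)) * 2"
    by (rule mult_left_mono[OF exp2]) (simp add: wkb_energy_def)
  ultimately show ?thesis unfolding z by linarith
qed

text \<open>At distance \<open>r\<close> from the central line, \<open>Re (d * w)\<close> equals |w|
  sin (r / 2). It stays nonnegative up to r = 2 \<pi>, which is why the strip has width 4
  \<pi>.\<close>

lemma energy_vertical:
  assumes sol: "companion_sol p L y v" and \<zeta>: "Re \<zeta> \<le> x0" "\<bar>Im \<zeta> - Im l\<bar> \<le> 2 * pi"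
  shows "wkb_energy l y v \<zeta> \<le> wkb_energy l y v (Complex (Re \<zeta>) (Im l)) * exp (pi / 2)"
proof -
  define \<sigma> :: real where "\<sigma> = (if Im \<zeta> \<ge> Im l then 1 else - 1)"
  define T where "T = \<bar>Im \<zeta> - Im l\<bar>"
  define d where "d = \<i> * of_real \<sigma>"
  have \<sigma>: "\<sigma> = 1 \<or> \<sigma> = - 1" "\<sigma> * T = Im \<zeta> - Im l" by (auto simp: \<sigma>_def T_def)
  have z: "Complex (Re \<zeta>) (Im l) + d * of_real t = Complex (Re \<zeta>) (Im l + \<sigma> * t)" for t
    by (simp add: complex_eq_iff d_def)
  have "wkb_energy l y v (Complex (Re \<zeta>) (Im l) + d * of_real T) \<le>
     wkb_energy l y v (Complex (Re \<zeta>) (Im l) + d * of_real 0) *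
        exp (2 * (K * exp (Re \<zeta> / 2) * T - K * exp (Re \<zeta> / 2) * 0))"
  proof (rule wkb_energy_segment[OF sol])
    show "0 \<le> T" by (simp add: T_def)
    show "cmod d = 1" using \<sigma>(1) by (auto simp: d_def norm_mult)
    fix r assume r: "0 \<le> r" "r \<le> T"
    hence r': "r \<le> 2 * pi" using \<zeta> by (simp add: T_def)
    show "Re (Complex (Re \<zeta>) (Im l) + d * of_real r) < L" unfolding z using \<zeta> x0L by simp
    show "cmod (wkb_w l (Complex (Re \<zeta>) (Im l) + d * of_real r) * wkb_Q l p (Complex (Re \<zeta>) (Im l) + d * of_real r))
        \<le> K * exp (Re \<zeta> / 2)"
      unfolding z using wQ[of "Complex (Re \<zeta>) (Im l + \<sigma> * r)"] \<zeta> by simp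
    show "((\<lambda>t. K * exp (Re \<zeta> / 2) * t) has_real_derivative K * exp (Re \<zeta> / 2)) (at r)"
      by (auto intro!: derivative_eq_intros)
    have s: "sin (r / 2) \<ge> 0" using r r' by (intro sin_ge_zero) auto
    have "Im (wkb_w l (Complex (Re \<zeta>) (Im l + \<sigma> * r))) = - exp ((Re l - Re \<zeta>) / 2) * sin (\<sigma> * r / 2)"
      by (simp add: wkb_w_def Im_exp)
    hence "Re (d * wkb_w l (Complex (Re \<zeta>) (Im l + \<sigma> * r))) = exp ((Re l - Re \<zeta>) / 2) * sin (r / 2)"
      using \<sigma>(1) by (auto simp: d_def)
    thus "Re (d * wkb_w l (Complex (Re \<zeta>) (Im l) + d * of_real r)) \<ge> 0"
      unfolding z using s by simp
  qed
  also have "\<dots> \<le> wkb_energy l y v (Complex (Re \<zeta>) (Im l) + d * of_real 0) * exp (pi / 2)"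
  proof (rule mult_left_mono)
    have "K * exp (Re \<zeta> / 2) * T \<le> 1 / 8 * (2 * pi)"
      using Kx[OF \<zeta>(1)] \<zeta>(2) K0 by (intro mult_mono) (auto simp: T_def)
    thus "exp (2 * (K * exp (Re \<zeta> / 2) * T - K * exp (Re \<zeta> / 2) * 0)) \<le> exp (pi / 2)" by simp
  qed (simp add: wkb_energy_def)
  finally show ?thesis unfolding z \<sigma>(2) by simp
qed

text \<open>The bound does not depend on how far to the left the initial point lies. It keeps the
  limit in \<open>recessive_solution\<close> from being the zero solution.\<close>

lemma normalised_h_bound:
  assumes sol: "companion_sol p L y v" and s: "s \<le> x0"
    and n: "wkb_h l y v (Complex s (Im l)) = 1" "wkb_g l y v (Complex s (Im l)) = 0"
  shows "cmod (wkb_h l y v (Complex x0 (Im l)) - 1) \<le> 1 / 2"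
proof (cases "s = x0")
  case True thus ?thesis using n by simp
next
  case False
  let ?P = "\<lambda>t. Complex t (Im l)"
  let ?h' = "\<lambda>t. wkb_w l (?P t) * wkb_Q l p (?P t) * (wkb_h l y v (?P t) + wkb_g l y v (?P t) / 2) / 4"
  have e: "wkb_energy l y v (?P t) \<le> 2" if "s \<le> t" "t \<le> x0" for t
    using energy_horizontal[OF sol that] n by (simp add: wkb_energy_def)
  have P: "(?P has_vector_derivative 1) (at t)" for t
  proof -
    have "?P = (\<lambda>t. Complex 0 (Im l) + of_real t)" by (simp add: fun_eq_iff complex_eq_iff)
    moreover have "((\<lambda>t. Complex 0 (Im l) + of_real t) has_vector_derivative 1) (at t)"
      by (auto intro!: derivative_eq_intros simp: has_vector_derivative_def scaleR_conv_of_real)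
    ultimately show ?thesis by simp
  qed
  have h: "((\<lambda>t. wkb_h l y v (?P t)) has_vector_derivative ?h' t) (at t)" if "t \<le> x0" for t
    using field_vector_diff_chain_at[OF P wkb_derivs(1)[OF sol, of "?P t" l]] that x0L by (simp add: o_def)
  have m: "((\<lambda>t. 2 * K * exp (t / 2)) has_vector_derivative K * exp (t / 2)) (at t)" for t
    unfolding has_real_derivative_iff_has_vector_derivative[symmetric] by (auto intro!: derivative_eq_intros)
  have "norm (wkb_h l y v (?P x0) - wkb_h l y v (?P s)) \<le> 2 * K * exp (x0 / 2) - 2 * K * exp (s / 2)"
  proof (rule differentiable_bound_general[where f = "\<lambda>t. wkb_h l y v (?P t)" and f' = ?h' and
        \<phi> = "\<lambda>t. 2 * K * exp (t / 2)" and \<phi>' = "\<lambda>t. K * exp (t / 2)"])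
    show "s < x0" using s False by simp
    show "continuous_on {s..x0} (\<lambda>t. wkb_h l y v (?P t))"
      by (intro continuous_at_imp_continuous_on ballI has_vector_derivative_continuous[OF h]) auto
    show "continuous_on {s..x0} (\<lambda>t. 2 * K * exp (t / 2))" by (intro continuous_intros) auto
    fix t assume t: "s < t" "t < x0"
    show "((\<lambda>t. wkb_h l y v (?P t)) has_vector_derivative ?h' t) (at t)" using h t by simp
    show "((\<lambda>t. 2 * K * exp (t / 2)) has_vector_derivative K * exp (t / 2)) (at t)" by (rule m)
    note hg = sum_squares_le_two[OF e[of t, unfolded wkb_energy_def]]
    have "cmod (wkb_h l y v (?P t) + wkb_g l y v (?P t) / 2) \<le> 4"
      using norm_triangle_ineq[of "wkb_h l y v (?P t)" "wkb_g l y v (?P t) / 2"] hg t by (simp add: norm_divide)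
    moreover have "cmod (wkb_w l (?P t) * wkb_Q l p (?P t)) \<le> K * exp (t / 2)"
      using wQ[of "?P t"] t by simp
    ultimately have "cmod (wkb_w l (?P t) * wkb_Q l p (?P t)) * cmod (wkb_h l y v (?P t) + wkb_g l y v (?P t) / 2)
      \<le> K * exp (t / 2) * 4" using K0 by (intro mult_mono) auto
    thus "norm (?h' t) \<le> K * exp (t / 2)" by (simp add: norm_mult norm_divide)
  qed
  moreover have "K * exp (s / 2) \<ge> 0" using K0 by simp
  ultimately show ?thesis using n Kx0 by simp
qed

end

lemma ex_wkb_domain:
  assumes "p holomorphic_on ball 0 (exp L)" "p 0 = 0" "exp l = 4 * deriv p 0"
  obtains K x0 where "wkb_domain p L K x0 l"
proof -
  obtain K x1 where K: "K > 0" "exp x1 < exp L"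
    "\<And>\<zeta>. Re \<zeta> \<le> x1 \<Longrightarrow> cmod (wkb_w l \<zeta> * wkb_Q l p \<zeta>) \<le> K * exp (Re \<zeta> / 2)"
    using wkb_Q_bound[OF assms(1) exp_gt_zero assms(2,3)] by blast
  define x0 where "x0 = min (min x1 0) (- 2 * ln (8 * K + 8))"
  have "exp (x0 / 2) \<le> exp (- ln (8 * K + 8))" by (simp add: x0_def)
  also have "\<dots> = 1 / (8 * K + 8)" using K(1) by (simp add: exp_minus field_simps)
  finally have "K * exp (x0 / 2) \<le> K * (1 / (8 * K + 8))" using K(1) by (intro mult_left_mono) auto
  also have "\<dots> \<le> 1 / 8" using K(1) by (simp add: field_simps)
  finally have "wkb_domain p L K x0 l"
    using K by unfold_locales (auto simp: x0_def)
  thus thesis by (rule that)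
qed

text \<open>A compactness argument: the solutions with h = 1, g = 0 at points moving to the left
  have energy at most 2 between that point and \<open>x0\<close>, so their coefficients stay
  bounded. A limit has bounded energy on the whole half-line and then, by
  \<open>energy_vertical\<close>, in the strip. Bounded h and g mean size exp (- Re w) up to powers
  of z.\<close>

theorem recessive_solution:
  assumes p: "p holomorphic_on ball 0 (exp L)" "p 0 = 0" "exp l = 4 * deriv p 0"
    and sol: "companion_sol p L y1 v1" "companion_sol p L y2 v2"
    and W: "\<And>\<zeta>. Re \<zeta> < L \<Longrightarrow> wronskian y1 v1 y2 v2 \<zeta> \<noteq> 0"
  obtains a b C x0 where "a \<noteq> 0 \<or> b \<noteq> 0" "x0 < L" "C > 0"
    "\<And>\<zeta>. Re \<zeta> \<le> x0 \<Longrightarrow> \<bar>Im \<zeta> - Im l\<bar> \<le> 2 * pi \<Longrightarrow>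
       cmod (a * y1 \<zeta> + b * y2 \<zeta>) \<le> C * exp (- Re (wkb_w l \<zeta>) - Re \<zeta>)"
    "\<And>\<zeta>. Re \<zeta> \<le> x0 \<Longrightarrow> \<bar>Im \<zeta> - Im l\<bar> \<le> 2 * pi \<Longrightarrow>
       cmod (a * v1 \<zeta> + b * v2 \<zeta>) \<le> C * exp (- Re (wkb_w l \<zeta>) - Re \<zeta>)"
proof -
  obtain K x0 where "wkb_domain p L K x0 l" using ex_wkb_domain[OF p] by blast
  then interpret wkb_domain p L K x0 l .
  define P where "P t = Complex t (Im l)" for t
  define h1 g1 h2 g2 where "h1 = wkb_h l y1 v1" and "g1 = wkb_g l y1 v1"
    and "h2 = wkb_h l y2 v2" and "g2 = wkb_g l y2 v2"
  define \<Delta> where "\<Delta> \<zeta> = h1 \<zeta> * g2 \<zeta> - h2 \<zeta> * g1 \<zeta>" for \<zeta>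
  have \<Delta>: "\<Delta> (P t) \<noteq> 0" if "t \<le> x0" for t
    using that W[of "P t"] x0L unfolding \<Delta>_def h1_def g1_def h2_def g2_def wkb_wronskian
    by (simp add: P_def wkb_X_def)
  define E where "E a b \<zeta> = (cmod (a * h1 \<zeta> + b * h2 \<zeta>))\<^sup>2 + (cmod (a * g1 \<zeta> + b * g2 \<zeta>))\<^sup>2" for a b \<zeta>
  have E: "wkb_energy l (\<lambda>\<zeta>. a * y1 \<zeta> + b * y2 \<zeta>) (\<lambda>\<zeta>. a * v1 \<zeta> + b * v2 \<zeta>) \<zeta> = E a b \<zeta>" for a b \<zeta>
    unfolding wkb_energy_def wkb_lincomb E_def h1_def g1_def h2_def g2_def ..
  \<comment> \<open>Cramer's rule for the values h = 1 and g = 0 at the point with real part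
    \<open>x0 - real n\<close>.\<close>
  define a where "a n = g2 (P (x0 - real n)) / \<Delta> (P (x0 - real n))" for n
  define b where "b n = - g1 (P (x0 - real n)) / \<Delta> (P (x0 - real n))" for n
  have init: "a n * h1 (P (x0 - real n)) + b n * h2 (P (x0 - real n)) = 1"
    "a n * g1 (P (x0 - real n)) + b n * g2 (P (x0 - real n)) = 0" for n
  proof -
    let ?P = "P (x0 - real n)"
    have "u / d * c + - c' / d * u' = (c * u - u' * c') / d" for u c c' u' d :: complex
      by (simp add: diff_divide_distrib mult.commute)
    from this[of "g2 ?P" "\<Delta> ?P" "h1 ?P" "g1 ?P" "h2 ?P"]
    show "a n * h1 ?P + b n * h2 ?P = 1"
      unfolding a_def b_def using \<Delta>[of "x0 - real n"] by (simp flip: \<Delta>_def)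
    show "a n * g1 ?P + b n * g2 ?P = 0" by (simp add: a_def b_def mult.commute)
  qed
  have solab: "companion_sol p L (\<lambda>\<zeta>. a * y1 \<zeta> + b * y2 \<zeta>) (\<lambda>\<zeta>. a * v1 \<zeta> + b * v2 \<zeta>)" for a b
    by (rule companion_sol_lincomb[OF sol])
  have E2: "E (a n) (b n) (P t) \<le> 2" if "x0 - real n \<le> t" "t \<le> x0" for n t
    using energy_horizontal[OF solab[of "a n" "b n"] that] init[of n]
    unfolding E P_def[symmetric] by (simp add: E_def)
  have h_near: "cmod (a n * h1 (P x0) + b n * h2 (P x0) - 1) \<le> 1 / 2" for n
    using normalised_h_bound[OF solab[of "a n" "b n"], of "x0 - real n"] init[of n]
    unfolding wkb_lincomb P_def[symmetric] h1_def[symmetric] h2_def[symmetric] g1_def[symmetric] g2_def[symmetric]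
    by simp
  define M where "M = 2 * (cmod (g1 (P x0)) + cmod (h1 (P x0)) + cmod (g2 (P x0)) + cmod (h2 (P x0))) / cmod (\<Delta> (P x0))"
  have M\<Delta>: "M * cmod (\<Delta> (P x0)) = 2 * (cmod (g1 (P x0)) + cmod (h1 (P x0)) + cmod (g2 (P x0)) + cmod (h2 (P x0)))"
    using \<Delta>[of x0] by (simp add: M_def)
  have bounded: "cmod (a n) \<le> M" "cmod (b n) \<le> M" for n
  proof -
    define H G where "H = a n * h1 (P x0) + b n * h2 (P x0)" and "G = a n * g1 (P x0) + b n * g2 (P x0)"
    have "(cmod H)\<^sup>2 + (cmod G)\<^sup>2 \<le> 2" using E2[of n x0] by (simp add: E_def H_def G_def)
    note HG = sum_squares_le_two[OF this]
    \<comment> \<open>At \<open>P x0\<close> the determinant does not depend on \<open>n\<close>, so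
      bounds for h and g there become bounds for the coefficients.\<close>
    have "a n * \<Delta> (P x0) = H * g2 (P x0) - G * h2 (P x0)" "b n * \<Delta> (P x0) = G * h1 (P x0) - H * g1 (P x0)"
      by (simp_all add: H_def G_def \<Delta>_def algebra_simps)
    moreover have "cmod (H * x - G * z) \<le> 2 * (cmod x + cmod z)" "cmod (G * z - H * x) \<le> 2 * (cmod x + cmod z)" for x z
    proof -
      have "cmod (H * x - G * z) \<le> cmod (H * x) + cmod (G * z)" by (rule norm_triangle_ineq4)
      also have "\<dots> \<le> 2 * cmod x + 2 * cmod z"
        unfolding norm_mult using HG by (intro add_mono mult_right_mono) auto
      finally show "cmod (H * x - G * z) \<le> 2 * (cmod x + cmod z)" by simp
      thus "cmod (G * z - H * x) \<le> 2 * (cmod x + cmod z)" by (simp add: norm_minus_commute)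
    qed
    ultimately have "cmod (a n * \<Delta> (P x0)) \<le> 2 * (cmod (g2 (P x0)) + cmod (h2 (P x0)))"
      "cmod (b n * \<Delta> (P x0)) \<le> 2 * (cmod (g1 (P x0)) + cmod (h1 (P x0)))" by simp_all
    hence "cmod (a n * \<Delta> (P x0)) \<le> M * cmod (\<Delta> (P x0))" "cmod (b n * \<Delta> (P x0)) \<le> M * cmod (\<Delta> (P x0))"
      using norm_ge_zero[of "g1 (P x0)"] norm_ge_zero[of "h1 (P x0)"] norm_ge_zero[of "g2 (P x0)"]
        norm_ge_zero[of "h2 (P x0)"] unfolding M\<Delta> distrib_left by - linarith+
    thus "cmod (a n) \<le> M" "cmod (b n) \<le> M"
      using \<Delta>[of x0] by (simp_all add: norm_mult)
  qed
  have "norm (a n, b n) \<le> M + M" for n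
    using norm_Pair_le[of "a n" "b n"] bounded[of n] by linarith
  hence "bounded (range (\<lambda>n. (a n, b n)))"
    by (intro boundedI[of _ "M + M"]) blast
  then obtain ab r where r: "strict_mono r" "((\<lambda>n. (a n, b n)) \<circ> r) \<longlonglongrightarrow> ab"
    using bounded_imp_convergent_subsequence by blast
  obtain A B where "ab = (A, B)" by (cases ab)
  hence lim: "(\<lambda>n. a (r n)) \<longlonglongrightarrow> A" "(\<lambda>n. b (r n)) \<longlonglongrightarrow> B"
    using tendsto_fst[OF r(2)] tendsto_snd[OF r(2)] by (simp_all add: o_def)
  have nz: "A \<noteq> 0 \<or> B \<noteq> 0"
  proof (rule ccontr)
    assume "\<not> (A \<noteq> 0 \<or> B \<noteq> 0)"
    hence "(\<lambda>n. cmod (a (r n) * h1 (P x0) + b (r n) * h2 (P x0) - 1)) \<longlonglongrightarrow> cmod (0 * h1 (P x0) + 0 * h2 (P x0) - 1)"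
      using lim by (intro tendsto_intros) auto
    hence "cmod (0 * h1 (P x0) + 0 * h2 (P x0) - 1) \<le> 1 / 2"
      by (rule LIMSEQ_le_const2) (use h_near in auto)
    thus False by simp
  qed
  have Elim: "E A B (P t) \<le> 2" if t: "t \<le> x0" for t
  proof -
    have "(\<lambda>n. E (a (r n)) (b (r n)) (P t)) \<longlonglongrightarrow> E A B (P t)"
      unfolding E_def by (intro tendsto_intros lim)
    moreover obtain N :: nat where N: "x0 - t \<le> real N" using real_arch_simple by blast
    have "E (a (r n)) (b (r n)) (P t) \<le> 2" if "n \<ge> N" for n
      using E2[of "r n" t] seq_suble[OF r(1), of n] that N t by simp
    ultimately show ?thesis by (intro LIMSEQ_le_const2) auto
  qed
  \<comment> \<open>The factor 2 is the energy bound on the central line, and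
    \<open>exp (pi / 2)\<close> is the loss on the way to the edge of the strip.\<close>
  define M' where "M' = 2 * exp (pi / 2)"
  define C0 where "C0 = 2 * (M' + 1)"
  have M': "M' > 0" by (simp add: M'_def)
  define C where "C = C0 * (exp (Re l / 4) + exp (3 * Re l / 4))"
  show thesis
  proof (rule that[OF nz x0L, of C])
    show "C > 0" using M' by (simp add: C_def C0_def add_pos_pos)
    fix \<zeta> assume \<zeta>: "Re \<zeta> \<le> x0" "\<bar>Im \<zeta> - Im l\<bar> \<le> 2 * pi"
    define y where "y = (\<lambda>\<zeta>. A * y1 \<zeta> + B * y2 \<zeta>)"
    define v where "v = (\<lambda>\<zeta>. A * v1 \<zeta> + B * v2 \<zeta>)"
    define h g where "h = wkb_h l y v \<zeta>" and "g = wkb_g l y v \<zeta>"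
    have "wkb_energy l y v \<zeta> \<le> E A B (P (Re \<zeta>)) * exp (pi / 2)"
      using energy_vertical[OF solab \<zeta>, of A B] unfolding E[of A B] y_def v_def P_def .
    also have "\<dots> \<le> 2 * exp (pi / 2)" using Elim[OF \<zeta>(1)] by simp
    finally have "(cmod h)\<^sup>2 + (cmod g)\<^sup>2 \<le> M'" by (simp add: wkb_energy_def h_def g_def M'_def)
    moreover have "t \<le> t\<^sup>2 + 1" for t :: real
      using zero_le_power2[of "t - 1 / 2"] by (simp add: power2_eq_square algebra_simps)
    ultimately have hg: "cmod h \<le> M' + 1" "cmod g \<le> M' + 1"
      using zero_le_power2[of "cmod h"] zero_le_power2[of "cmod g"] by (smt (verit))+
    have g2: "cmod (g / 2) = cmod g / 2" by (simp add: norm_divide)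
    have f: "cmod (h + g / 2) \<le> C0" "cmod (h - g / 2) \<le> C0"
      using norm_triangle_ineq[of h "g / 2"] norm_triangle_ineq4[of h "g / 2"] hg M'
      unfolding g2 C0_def distrib_left by - linarith+
    define w where "w = wkb_w l \<zeta>"
    have "wkb_X l \<zeta> * exp ((l - \<zeta>) / 4) = 1"
      unfolding wkb_X_def exp_add[symmetric] by (simp add: add_divide_distrib[symmetric])
    hence "1 / wkb_X l \<zeta> = exp ((l - \<zeta>) / 4)" by (metis div_by_0 mult_zero_left nonzero_mult_div_cancel_left zero_neq_one)
    hence "cmod (1 / wkb_X l \<zeta>) = exp ((Re l - Re \<zeta>) / 4)" by simp
    also have "\<dots> = exp (Re l / 4) * exp (- Re \<zeta> / 4)"
      unfolding exp_add[symmetric] by (simp add: diff_divide_distrib)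
    finally have X: "cmod (1 / wkb_X l \<zeta>) = exp (Re l / 4) * exp (- Re \<zeta> / 4)" .
    have X3: "cmod (1 / wkb_X l \<zeta> ^ 3) = exp (3 * Re l / 4) * exp (- 3 * Re \<zeta> / 4)"
    proof -
      have "cmod (1 / wkb_X l \<zeta> ^ 3) = (cmod (1 / wkb_X l \<zeta>)) ^ 3" by (simp add: norm_divide norm_power power_one_over)
      moreover have "\<dots> = exp (Re l / 4) ^ 3 * exp (- Re \<zeta> / 4) ^ 3" unfolding X by (simp add: power_mult_distrib)
      moreover have "exp (x / 4) ^ 3 = exp (3 * x / 4)" for x :: real
        using exp_of_nat_mult[of 3 "x / 4"] by simp
      note this[of "Re l"] this[of "- Re \<zeta>"]
      ultimately show ?thesis by simp
    qed
    \<comment> \<open>Since \<open>Re \<zeta> \<le> 0\<close>, the fractional powers of z from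
      \<open>wkb_X\<close> are absorbed into the single factor
      \<open>exp (- Re \<zeta>)\<close>.\<close>
    have e1: "exp (- Re \<zeta> / 4) \<le> exp (- Re \<zeta>)" "exp (- 3 * Re \<zeta> / 4) \<le> exp (- Re \<zeta>)" "exp (Re \<zeta>) \<le> 1"
      using \<zeta>(1) x0 by simp_all
    define D where "D = exp (- Re w) * exp (- Re \<zeta>)"
    have D: "D > 0" by (simp add: D_def)
    have "cmod (y \<zeta>) = exp (- Re w) * cmod (h + g / 2) * cmod (1 / wkb_X l \<zeta>)"
      unfolding wkb_recover(1)[of y \<zeta> l v] h_def g_def w_def by (simp add: norm_mult norm_divide)
    also have "\<dots> \<le> exp (- Re w) * C0 * (exp (Re l / 4) * exp (- Re \<zeta>))"
      unfolding X using f e1 M' by (intro mult_mono) (auto simp: C0_def)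
    finally have y: "cmod (y \<zeta>) \<le> C0 * exp (Re l / 4) * D" by (simp add: D_def mult_ac)
    also have "\<dots> \<le> C * D" using D M' by (simp add: C_def C0_def)
    finally show "cmod (A * y1 \<zeta> + B * y2 \<zeta>) \<le> C * exp (- Re (wkb_w l \<zeta>) - Re \<zeta>)"
      by (simp add: y_def D_def w_def exp_add[symmetric])
    have "cmod (v \<zeta>) = exp (Re \<zeta>) * cmod (y \<zeta> - 2 * exp (- w) * (h - g / 2) / wkb_X l \<zeta> ^ 3) / 4"
      unfolding wkb_recover(2)[of v \<zeta> y l] h_def g_def w_def by (simp add: norm_mult norm_divide)
    also have "\<dots> \<le> 1 * cmod (y \<zeta> - 2 * exp (- w) * (h - g / 2) / wkb_X l \<zeta> ^ 3) / 4"
      using e1 by (intro divide_right_mono mult_right_mono) auto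
    also have "\<dots> \<le> (cmod (y \<zeta>) + cmod (2 * exp (- w) * (h - g / 2) / wkb_X l \<zeta> ^ 3)) / 4"
      by (simp add: norm_triangle_ineq4)
    also have "cmod (2 * exp (- w) * (h - g / 2) / wkb_X l \<zeta> ^ 3) =
       2 * (exp (- Re w) * cmod (h - g / 2) * cmod (1 / wkb_X l \<zeta> ^ 3))"
      by (simp add: norm_mult norm_divide)
    also have "\<dots> \<le> 2 * (exp (- Re w) * C0 * (exp (3 * Re l / 4) * exp (- Re \<zeta>)))"
      unfolding X3 using f e1 M' by (intro mult_left_mono mult_mono) (auto simp: C0_def)
    also have "\<dots> = 2 * (C0 * exp (3 * Re l / 4) * D)" by (simp add: D_def mult_ac)
    finally have "cmod (v \<zeta>) \<le> (C0 * exp (Re l / 4) * D + 2 * (C0 * exp (3 * Re l / 4) * D)) / 4"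
      using y by simp
    also have "\<dots> \<le> C0 * exp (Re l / 4) * D + C0 * exp (3 * Re l / 4) * D"
    proof -
      have "(s + 2 * t) / 4 \<le> s + t" if "s \<ge> 0" "t \<ge> 0" for s t :: real
        using that by (simp add: divide_le_eq)
      thus ?thesis using D M' by (simp add: C0_def)
    qed
    also have "\<dots> = C * D" by (simp add: C_def algebra_simps)
    finally show "cmod (A * v1 \<zeta> + B * v2 \<zeta>) \<le> C * exp (- Re (wkb_w l \<zeta>) - Re \<zeta>)"
      by (simp add: v_def D_def w_def exp_add[symmetric])
  qed
qed

section \<open>From periodic functions of the logarithm to holomorphic functions near 0\<close>

lemma periodic_int:
  fixes F :: "complex \<Rightarrow> 'a"
  assumes per: "\<And>\<zeta>. Re \<zeta> < L \<Longrightarrow> F (\<zeta> + 2 * of_real pi * \<i>) = F \<zeta>" and "Re \<zeta> < L"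
  shows "F (\<zeta> + of_int n * (2 * of_real pi * \<i>)) = F \<zeta>"
proof -
  have nat: "F (\<xi> + of_nat k * (2 * of_real pi * \<i>)) = F \<xi>" if "Re \<xi> < L" for \<xi> k
  proof (induction k)
    case (Suc k)
    have "F (\<xi> + of_nat (Suc k) * (2 * of_real pi * \<i>)) = F ((\<xi> + of_nat k * (2 * of_real pi * \<i>)) + 2 * of_real pi * \<i>)"
      by (simp add: algebra_simps)
    also have "\<dots> = F (\<xi> + of_nat k * (2 * of_real pi * \<i>))" using that by (intro per) simp
    finally show ?case using Suc by simp
  qed simp
  show ?thesis
  proof (cases n)
    case (nonneg k)
    thus ?thesis using nat[OF assms(2), of k] by simp
  next
    case (neg k)
    have "F ((\<zeta> + of_int n * (2 * of_real pi * \<i>)) + of_nat (Suc k) * (2 * of_real pi * \<i>)) =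
       F (\<zeta> + of_int n * (2 * of_real pi * \<i>))" using assms(2) by (intro nat) simp
    thus ?thesis by (simp add: neg algebra_simps)
  qed
qed

text \<open>The type of the values is arbitrary, because the lemma is also applied to the fibrewise
  maps that make up the final isomorphism.\<close>

lemma periodic_eq_if_exp_eq:
  assumes "\<And>\<zeta>. Re \<zeta> < L \<Longrightarrow> F (\<zeta> + 2 * of_real pi * \<i>) = F \<zeta>" "Re \<zeta> < L" "exp \<xi> = exp \<zeta>"
  shows "F \<xi> = F \<zeta>"
proof -
  obtain n where n: "\<xi> = \<zeta> + of_int (2 * n) * of_real pi * \<i>"
    using assms(3) by (auto simp: exp_eq)
  have "F (\<zeta> + of_int n * (2 * of_real pi * \<i>)) = F \<zeta>" by (rule periodic_int[of L F, OF assms(1,2)])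
  moreover have "\<xi> = \<zeta> + of_int n * (2 * of_real pi * \<i>)" unfolding n by (simp add: mult_ac)
  ultimately show ?thesis by simp
qed

lemma Re_less_of_exp_in_ball:
  assumes "exp \<zeta> \<in> ball 0 (exp L)" shows "Re \<zeta> < L"
  using assms by simp

lemma periodic_descends:
  fixes F :: "complex \<Rightarrow> complex"
  assumes hol: "F holomorphic_on {\<zeta>. Re \<zeta> < L}"
    and per: "\<And>\<zeta>. Re \<zeta> < L \<Longrightarrow> F (\<zeta> + 2 * of_real pi * \<i>) = F \<zeta>"
  obtains \<phi> where "\<phi> holomorphic_on ball 0 (exp L) - {0}" "\<And>\<zeta>. Re \<zeta> < L \<Longrightarrow> \<phi> (exp \<zeta>) = F \<zeta>"
proof
  define \<phi> where "\<phi> = (\<lambda>z. F (Ln z))"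
  show eq: "\<phi> (exp \<zeta>) = F \<zeta>" if "Re \<zeta> < L" for \<zeta>
    unfolding \<phi>_def using that by (intro periodic_eq_if_exp_eq[of L F, OF per]) auto
  show "\<phi> holomorphic_on ball 0 (exp L) - {0}"
    unfolding holomorphic_on_def
  proof
    fix z0 :: complex assume z0: "z0 \<in> ball 0 (exp L) - {0}"
    \<comment> \<open>A branch of the logarithm that is holomorphic near \<open>z0\<close> even if
      \<open>z0\<close> lies on the cut of \<open>Ln\<close>; by periodicity it gives the same
      function.\<close>
    define G where "G z = F (Ln (z / z0) + Ln z0)" for z
    have \<phi>G: "\<phi> z = G z" if "z \<in> ball 0 (exp L) - {0}" for z
    proof -
      have "exp (Ln (z / z0) + Ln z0) = z" using that z0 by (simp add: exp_add)
      moreover from this have "Re (Ln (z / z0) + Ln z0) < L"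
        using that by (intro Re_less_of_exp_in_ball) simp
      ultimately show ?thesis using eq[of "Ln (z / z0) + Ln z0"] by (simp add: G_def)
    qed
    have "Re (Ln z0) < L" using z0 by (intro Re_less_of_exp_in_ball) simp
    hence "(F has_field_derivative deriv F (Ln z0)) (at (Ln (z0 / z0) + Ln z0))"
      using hol z0 by (simp add: holomorphic_derivI[OF _ open_halfspace_Re_lt])
    moreover have "((\<lambda>z. Ln (z / z0) + Ln z0) has_field_derivative 1 / z0) (at z0)"
      using z0 by (auto intro!: derivative_eq_intros)
    ultimately have "((\<lambda>z. F (Ln (z / z0) + Ln z0)) has_field_derivative deriv F (Ln z0) * (1 / z0)) (at z0)"
      by (rule DERIV_chain2)
    hence "G field_differentiable (at z0 within ball 0 (exp L) - {0})"
      unfolding field_differentiable_def G_def[abs_def] using has_field_derivative_at_within by blast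
    thus "\<phi> field_differentiable (at z0 within ball 0 (exp L) - {0})"
      by (rule field_differentiable_transform_within[where d = 1, rotated 3]) (use z0 \<phi>G in auto)
  qed
qed

lemma ex_log_in_strip:
  assumes "z \<noteq> 0"
  obtains \<zeta> where "exp \<zeta> = z" "c \<le> Im \<zeta>" "Im \<zeta> \<le> c + 2 * pi"
proof -
  define n where "n = \<lceil>(c - Im (Ln z)) / (2 * pi)\<rceil>"
  define \<zeta> where "\<zeta> = Ln z + of_int n * (2 * of_real pi * \<i>)"
  have "exp (of_int n * (2 * of_real pi * \<i>)) = 1" unfolding exp_eq_1 by auto
  hence "exp \<zeta> = z" using assms by (simp add: \<zeta>_def exp_add)
  moreover have "(c - Im (Ln z)) / (2 * pi) \<le> of_int n" "of_int n < (c - Im (Ln z)) / (2 * pi) + 1"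
    unfolding n_def by linarith+
  hence "c - Im (Ln z) \<le> of_int n * (2 * pi)" "of_int n * (2 * pi) < c - Im (Ln z) + 2 * pi"
    using pi_gt_zero by (simp_all add: field_simps)
  moreover have "Im \<zeta> = Im (Ln z) + of_int n * (2 * pi)" by (simp add: \<zeta>_def)
  ultimately show thesis using that by simp
qed

lemma moderate_growth_extends:
  fixes \<phi> :: "complex \<Rightarrow> complex"
  assumes hol: "\<phi> holomorphic_on ball 0 r - {0}" and r: "r > 0" and \<delta>: "\<delta> > 0"
    and bound: "\<And>z. z \<noteq> 0 \<Longrightarrow> cmod z < \<delta> \<Longrightarrow> cmod (z ^ N * \<phi> z) \<le> C"
  obtains \<psi> where "\<psi> holomorphic_on ball 0 r" "\<And>z. z \<in> ball 0 r - {0} \<Longrightarrow> \<psi> z = z ^ N * \<phi> z"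
proof -
  have "(\<lambda>z. z ^ N * \<phi> z) holomorphic_on ball 0 r - {0}" by (intro holomorphic_intros hol)
  moreover have "eventually (\<lambda>z. cmod (z ^ N * \<phi> z) \<le> C) (at 0)"
    unfolding eventually_at using \<delta> bound by (intro exI[of _ \<delta>]) auto
  ultimately obtain \<psi> where "\<psi> holomorphic_on ball 0 r" "\<forall>z\<in>ball 0 r - {0}. \<psi> z = z ^ N * \<phi> z"
    using holomorphic_on_extend_bounded[of "\<lambda>z. z ^ N * \<phi> z" "ball 0 r" 0] r by auto
  thus thesis using that by blast
qed

lemma continuous_eq_at_zero:
  fixes f g :: "complex \<Rightarrow> complex"
  assumes "f holomorphic_on ball 0 r" "g holomorphic_on ball 0 r" "r > 0"
    and "\<And>z. z \<in> ball 0 r - {0} \<Longrightarrow> f z = g z"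
  shows "z \<in> ball 0 r \<Longrightarrow> f z = g z"
proof (cases "z = 0")
  case True
  have "isCont f 0" "isCont g 0"
    using assms(1-3) by (auto intro!: continuous_on_interior[OF holomorphic_on_imp_continuous_on] simp: interior_open)
  hence "(f \<longlongrightarrow> f 0) (at 0)" "(g \<longlongrightarrow> g 0) (at 0)" by (simp_all add: isCont_def)
  moreover have "eventually (\<lambda>z. f z = g z) (at 0)"
    unfolding eventually_at using assms(3,4) by (intro exI[of _ r]) auto
  ultimately have "f 0 = g 0"
    using tendsto_cong tendsto_unique trivial_limit_at by metis
  thus ?thesis using True by simp
qed (use assms in auto)

text \<open>F and G are z^N times the first row of a gauge matrix, and the identity is its
  determinant equation after the second row has been expressed through the first. At z = 0 it gives
  F(0)^2 = 0. After division by z it gives G(0)^2 p'(0) = 0, since p / z has the value p'(0) at 0.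
  So both functions are divisible by z, and the quotients satisfy the identity for the next smaller
  N.\<close>

lemma pole_descent:
  fixes F G p :: "complex \<Rightarrow> complex"
  assumes r: "r > 0" and p: "p holomorphic_on ball 0 r" "p 0 = 0" "deriv p 0 \<noteq> 0"
  shows "F holomorphic_on ball 0 r \<Longrightarrow> G holomorphic_on ball 0 r \<Longrightarrow>
      (\<And>z. z \<in> ball 0 r - {0} \<Longrightarrow> (F z)\<^sup>2 - z\<^sup>2 * (F z * deriv G z - G z * deriv F z) - (G z)\<^sup>2 * p z = z ^ (2 * N) * W) \<Longrightarrow>
    \<exists>A B. A holomorphic_on ball 0 r \<and> B holomorphic_on ball 0 r \<and>
      (\<forall>z\<in>ball 0 r. F z = z ^ N * A z \<and> G z = z ^ N * B z) \<and>
      (\<forall>z\<in>ball 0 r. (A z)\<^sup>2 - z\<^sup>2 * (A z * deriv B z - B z * deriv A z) - (B z)\<^sup>2 * p z = W)"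
proof (induction N arbitrary: F G)
  case 0
  have "(F z)\<^sup>2 - z\<^sup>2 * (F z * deriv G z - G z * deriv F z) - (G z)\<^sup>2 * p z = W" if "z \<in> ball 0 r" for z
    by (rule continuous_eq_at_zero[OF _ _ r _ that, of _ "\<lambda>_. W"])
      (use 0 in \<open>auto intro!: holomorphic_intros p\<close>)
  thus ?case using 0(1,2) by (intro exI[of _ F] exI[of _ G]) auto
next
  case (Suc N)
  note hol = Suc.prems(1,2) and eq = Suc.prems(3)
  have der: "(f has_field_derivative deriv f z) (at z)" if "f holomorphic_on ball 0 r" "z \<in> ball 0 r" for f z
    using that by (intro holomorphic_derivI[of f "ball 0 r"]) auto
  have "(F z)\<^sup>2 - z\<^sup>2 * (F z * deriv G z - G z * deriv F z) - (G z)\<^sup>2 * p z = z ^ (2 * Suc N) * W" if "z \<in> ball 0 r" for z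
    by (rule continuous_eq_at_zero[OF _ _ r _ that, of _ "\<lambda>z. z ^ (2 * Suc N) * W"])
      (use eq in \<open>auto intro!: holomorphic_intros p hol\<close>)
  from this[of 0] have "F 0 = 0" using r p by simp
  then obtain F1 where F1: "F1 holomorphic_on ball 0 r" "\<And>z. F z = z * F1 z"
    using holomorphic_divide_by_variable[OF hol(1) open_ball] by metis
  obtain q where q: "q holomorphic_on ball 0 r" "\<And>z. p z = z * q z" "q 0 = deriv p 0"
    using holomorphic_divide_by_variable[OF p(1) open_ball p(2)] by metis
  have dF: "deriv F z = F1 z + z * deriv F1 z" if "z \<in> ball 0 r" for z
  proof -
    have "((\<lambda>z. z * F1 z) has_field_derivative 1 * F1 z + deriv F1 z * z) (at z)"
      by (rule DERIV_mult[OF DERIV_ident der[OF F1(1) that]])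
    moreover have "F = (\<lambda>z. z * F1 z)" using F1(2) by auto
    ultimately show ?thesis by (simp add: DERIV_imp_deriv mult.commute)
  qed
  have eq1: "z * (F1 z)\<^sup>2 - z\<^sup>2 * F1 z * deriv G z + z * G z * F1 z + z\<^sup>2 * G z * deriv F1 z - (G z)\<^sup>2 * q z =
      z ^ Suc (2 * N) * W" if z: "z \<in> ball 0 r - {0}" for z
  proof -
    have "z * (z * (F1 z)\<^sup>2 - z\<^sup>2 * F1 z * deriv G z + z * G z * F1 z + z\<^sup>2 * G z * deriv F1 z - (G z)\<^sup>2 * q z) =
       (F z)\<^sup>2 - z\<^sup>2 * (F z * deriv G z - G z * deriv F z) - (G z)\<^sup>2 * p z"
      using z by (simp add: dF F1(2) q(2) power2_eq_square algebra_simps)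
    also have "\<dots> = z * (z ^ Suc (2 * N) * W)" unfolding eq[OF z] by (simp add: mult_ac)
    finally show ?thesis using z by simp
  qed
  have "z * (F1 z)\<^sup>2 - z\<^sup>2 * F1 z * deriv G z + z * G z * F1 z + z\<^sup>2 * G z * deriv F1 z - (G z)\<^sup>2 * q z =
      z ^ Suc (2 * N) * W" if "z \<in> ball 0 r" for z
    by (rule continuous_eq_at_zero[OF _ _ r _ that, of _ "\<lambda>z. z ^ Suc (2 * N) * W"])
      (use eq1 in \<open>auto intro!: holomorphic_intros q hol F1\<close>)
  from this[of 0] have "G 0 = 0" using r p(3) q(3) by simp
  then obtain G1 where G1: "G1 holomorphic_on ball 0 r" "\<And>z. G z = z * G1 z"
    using holomorphic_divide_by_variable[OF hol(2) open_ball] by metis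
  have dG: "deriv G z = G1 z + z * deriv G1 z" if "z \<in> ball 0 r" for z
  proof -
    have "((\<lambda>z. z * G1 z) has_field_derivative 1 * G1 z + deriv G1 z * z) (at z)"
      by (rule DERIV_mult[OF DERIV_ident der[OF G1(1) that]])
    moreover have "G = (\<lambda>z. z * G1 z)" using G1(2) by auto
    ultimately show ?thesis by (simp add: DERIV_imp_deriv mult.commute)
  qed
  have "(F1 z)\<^sup>2 - z\<^sup>2 * (F1 z * deriv G1 z - G1 z * deriv F1 z) - (G1 z)\<^sup>2 * p z = z ^ (2 * N) * W"
    if z: "z \<in> ball 0 r - {0}" for z
  proof -
    have "z * ((F1 z)\<^sup>2 - z\<^sup>2 * (F1 z * deriv G1 z - G1 z * deriv F1 z) - (G1 z)\<^sup>2 * p z) =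
      z * (F1 z)\<^sup>2 - z\<^sup>2 * F1 z * deriv G z + z * G z * F1 z + z\<^sup>2 * G z * deriv F1 z - (G z)\<^sup>2 * q z"
      using z by (simp add: dG G1(2) q(2) power2_eq_square algebra_simps)
    also have "\<dots> = z * (z ^ (2 * N) * W)" unfolding eq1[OF z] by simp
    finally show ?thesis using z by simp
  qed
  from Suc.IH[OF F1(1) G1(1) this] obtain A B where AB: "A holomorphic_on ball 0 r" "B holomorphic_on ball 0 r"
      "\<forall>z\<in>ball 0 r. F1 z = z ^ N * A z \<and> G1 z = z ^ N * B z"
      "\<forall>z\<in>ball 0 r. (A z)\<^sup>2 - z\<^sup>2 * (A z * deriv B z - B z * deriv A z) - (B z)\<^sup>2 * p z = W"
    by blast
  thus ?case using F1(2) G1(2) by (intro exI[of _ A] exI[of _ B]) auto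
qed

lemma companion_sol_combination:
  assumes sol: "companion_sol p L y1 v1" "companion_sol p L y2 v2" "companion_sol p L y v"
    and W: "\<And>\<zeta>. Re \<zeta> < L \<Longrightarrow> wronskian y1 v1 y2 v2 \<zeta> \<noteq> 0"
  obtains a b where "\<And>\<zeta>. Re \<zeta> < L \<Longrightarrow> y \<zeta> = a * y1 \<zeta> + b * y2 \<zeta> \<and> v \<zeta> = a * v1 \<zeta> + b * v2 \<zeta>"
proof -
  obtain W where W12: "\<And>\<zeta>. Re \<zeta> < L \<Longrightarrow> wronskian y1 v1 y2 v2 \<zeta> = W"
    using wronskian_const[OF sol(1,2)] by blast
  obtain A where A: "\<And>\<zeta>. Re \<zeta> < L \<Longrightarrow> wronskian y v y2 v2 \<zeta> = A"
    using wronskian_const[OF sol(3,2)] by blast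
  obtain B where B: "\<And>\<zeta>. Re \<zeta> < L \<Longrightarrow> wronskian y1 v1 y v \<zeta> = B"
    using wronskian_const[OF sol(1,3)] by blast
  show thesis
  proof (rule that[of "A / W" "B / W"])
    fix \<zeta> assume \<zeta>: "Re \<zeta> < L"
    have W0: "W \<noteq> 0" using W[OF \<zeta>] W12[OF \<zeta>] by simp
    have "W * y \<zeta> = A * y1 \<zeta> + B * y2 \<zeta>" "W * v \<zeta> = A * v1 \<zeta> + B * v2 \<zeta>"
      unfolding W12[OF \<zeta>, symmetric] A[OF \<zeta>, symmetric] B[OF \<zeta>, symmetric] wronskian_def
      by (simp_all add: algebra_simps)
    thus "y \<zeta> = A / W * y1 \<zeta> + B / W * y2 \<zeta> \<and> v \<zeta> = A / W * v1 \<zeta> + B / W * v2 \<zeta>"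
      using W0 by (simp add: field_simps)
  qed
qed

lemma companion_sol_zero:
  assumes sol: "companion_sol p L y1 v1" "companion_sol p L y2 v2" "companion_sol p L y v"
    and W: "\<And>\<zeta>. Re \<zeta> < L \<Longrightarrow> wronskian y1 v1 y2 v2 \<zeta> \<noteq> 0"
    and z: "Re \<zeta>0 < L" "y \<zeta>0 = 0" "v \<zeta>0 = 0" and \<zeta>: "Re \<zeta> < L"
  shows "y \<zeta> = 0" "v \<zeta> = 0"
proof -
  obtain a b where ab: "\<And>\<zeta>. Re \<zeta> < L \<Longrightarrow> y \<zeta> = a * y1 \<zeta> + b * y2 \<zeta> \<and> v \<zeta> = a * v1 \<zeta> + b * v2 \<zeta>"
    using companion_sol_combination[OF sol W] by blast
  have "a * wronskian y1 v1 y2 v2 \<zeta>0 = y \<zeta>0 * v2 \<zeta>0 - v \<zeta>0 * y2 \<zeta>0"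
    "b * wronskian y1 v1 y2 v2 \<zeta>0 = v \<zeta>0 * y1 \<zeta>0 - y \<zeta>0 * v1 \<zeta>0"
    using ab[OF z(1)] by (simp_all add: wronskian_def algebra_simps)
  hence "a = 0" "b = 0" using z W[OF z(1)] by simp_all
  thus "y \<zeta> = 0" "v \<zeta> = 0" using ab[OF \<zeta>] by simp_all
qed

lemma double_exp_decay:
  fixes C \<epsilon> n a T :: real
  assumes "\<epsilon> > 0" "C > 0"
  obtains t where "t \<ge> T" "C * exp (n * t - exp ((a + t) / 2)) < \<epsilon>"
proof
  \<comment> \<open>The bound exp x >= x^2 / 2 at x = t / 2 makes \<open>exp ((a + t) / 2)\<close>
    at least \<open>\<kappa> * t\<^sup>2\<close>, which eventually beats any linear function of
    \<open>t\<close>.\<close>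
  define \<kappa> where "\<kappa> = exp (a / 2) / 8"
  have \<kappa>: "\<kappa> > 0" by (simp add: \<kappa>_def)
  define t where "t = Max {T, 0, (n + 1) / \<kappa>, ln (C / \<epsilon>) + 1}"
  show "t \<ge> T" by (simp add: t_def)
  have t: "t \<ge> 0" "t \<ge> (n + 1) / \<kappa>" "t \<ge> ln (C / \<epsilon>) + 1" by (simp_all add: t_def)
  have "t\<^sup>2 / 8 \<le> exp (t / 2)"
    using exp_lower_Taylor_quadratic[of "t / 2"] t(1) by (simp add: power2_eq_square)
  hence "exp (a / 2) * (t\<^sup>2 / 8) \<le> exp (a / 2) * exp (t / 2)" by (rule mult_left_mono) simp
  also have "\<dots> = exp ((a + t) / 2)" unfolding exp_add[symmetric] by (simp add: add_divide_distrib)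
  finally have "\<kappa> * t\<^sup>2 \<le> exp ((a + t) / 2)" by (simp add: \<kappa>_def)
  moreover have "(n + 1) * t \<le> \<kappa> * t\<^sup>2"
  proof -
    have "n + 1 \<le> \<kappa> * t" using t(2) \<kappa> by (simp add: field_simps)
    thus ?thesis using t(1) by (simp add: power2_eq_square mult_right_mono flip: mult.assoc)
  qed
  ultimately have "n * t - exp ((a + t) / 2) \<le> - t" by (simp add: distrib_right)
  also have "\<dots> < - ln (C / \<epsilon>)" using t(3) by simp
  finally have "exp (n * t - exp ((a + t) / 2)) < exp (- ln (C / \<epsilon>))" by simp
  also have "\<dots> = \<epsilon> / C" using assms by (simp add: exp_minus)
  finally show "C * exp (n * t - exp ((a + t) / 2)) < \<epsilon>" using assms by (simp add: field_simps)
qed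

lemma wkb_w_shift: "wkb_w l (\<zeta> + 2 * of_real pi * \<i>) = - wkb_w l \<zeta>"
proof -
  have "(l - (\<zeta> + 2 * of_real pi * \<i>)) / 2 = (l - \<zeta>) / 2 - of_real pi * \<i>" by (simp add: field_simps)
  thus ?thesis unfolding wkb_w_def by (simp only: exp_diff exp_pi_i' exp_pi_i mult.commute[of "of_real pi"]) simp
qed

lemma companion_sol_holomorphic:
  assumes "companion_sol p L y v"
  shows "y holomorphic_on {\<zeta>. Re \<zeta> < L}" "v holomorphic_on {\<zeta>. Re \<zeta> < L}"
  using companion_solD[OF assms] open_halfspace_Re_lt[of L] by (auto simp: holomorphic_on_open)

text \<open>Dividing by z^\<nu> with exp (2 \<pi> \<i> \<nu>) = \<mu> gives a single-valued
  function. It has moderate growth because \<open>Re w\<close> is nonnegative in a strip of width 2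
  \<pi>, which already covers every z. So it is meromorphic at 0 and, not being 0, bounded below by
  a power of |z|; on the central line it would however decay like exp (- |w|).\<close>

lemma no_decaying_eigensolution:
  assumes sol: "companion_sol p L s t" and nz: "\<And>\<zeta>. Re \<zeta> < L \<Longrightarrow> s \<zeta> \<noteq> 0 \<or> t \<zeta> \<noteq> 0"
    and \<mu>: "\<mu> \<noteq> 0" "\<And>\<zeta>. Re \<zeta> < L \<Longrightarrow> s (\<zeta> + 2 * of_real pi * \<i>) = \<mu> * s \<zeta>"
    and x0: "x0 < L" and C: "C > 0"
    and bound: "\<And>\<zeta>. Re \<zeta> \<le> x0 \<Longrightarrow> \<bar>Im \<zeta> - Im l\<bar> \<le> pi \<Longrightarrow> cmod (s \<zeta>) \<le> C * exp (- Re (wkb_w l \<zeta>) - Re \<zeta>)"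
  shows False
proof -
  define \<nu> where "\<nu> = Ln \<mu> / (2 * of_real pi * \<i>)"
  have \<nu>: "exp (\<nu> * (2 * of_real pi * \<i>)) = \<mu>" using \<mu>(1) by (simp add: \<nu>_def)
  define F where "F \<zeta> = s \<zeta> * exp (- (\<nu> * \<zeta>))" for \<zeta>
  have "F holomorphic_on {\<zeta>. Re \<zeta> < L}"
    unfolding F_def[abs_def] by (intro holomorphic_intros companion_sol_holomorphic[OF sol])
  moreover have "F (\<zeta> + 2 * of_real pi * \<i>) = F \<zeta>" if "Re \<zeta> < L" for \<zeta>
  proof -
    have "exp (- (\<nu> * (\<zeta> + 2 * of_real pi * \<i>))) = exp (- (\<nu> * \<zeta>)) / \<mu>"
      by (simp only: distrib_left minus_add_distrib exp_add exp_minus \<nu>[symmetric] divide_inverse)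
    thus ?thesis using \<mu>(1) by (simp add: F_def \<mu>(2)[OF that])
  qed
  ultimately obtain \<phi> where \<phi>: "\<phi> holomorphic_on ball 0 (exp L) - {0}" "\<And>\<zeta>. Re \<zeta> < L \<Longrightarrow> \<phi> (exp \<zeta>) = F \<zeta>"
    using periodic_descends by blast
  define M where "M = \<bar>Im \<nu>\<bar> * (\<bar>Im l\<bar> + pi)"
  obtain N :: nat where N: "1 + \<bar>Re \<nu>\<bar> \<le> real N" using real_arch_simple by blast
  define x1 where "x1 = min x0 0"
  define C1 where "C1 = C * exp M"
  have C1: "C1 > 0" using C by (simp add: C1_def)
  have bd: "cmod (exp \<zeta> ^ N * \<phi> (exp \<zeta>)) \<le> C1 * exp (- Re (wkb_w l \<zeta>))"
    if \<zeta>: "Re \<zeta> \<le> x1" "\<bar>Im \<zeta> - Im l\<bar> \<le> pi" for \<zeta>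
  proof -
    have x: "Re \<zeta> \<le> x0" "Re \<zeta> \<le> 0" "Re \<zeta> < L" using \<zeta> x0 by (auto simp: x1_def)
    have "\<bar>Im \<nu> * Im \<zeta>\<bar> \<le> M"
      unfolding M_def abs_mult using \<zeta>(2) by (intro mult_left_mono) auto
    moreover have "- (Re \<nu> * Re \<zeta>) \<le> \<bar>Re \<nu>\<bar> * (- Re \<zeta>)"
      using abs_ge_self[of "- (Re \<nu> * Re \<zeta>)"] x(2) by (simp add: abs_mult)
    moreover have "Re (\<nu> * \<zeta>) = Re \<nu> * Re \<zeta> - Im \<nu> * Im \<zeta>" by simp
    ultimately have "- Re (\<nu> * \<zeta>) \<le> M - \<bar>Re \<nu>\<bar> * Re \<zeta>" by linarith
    moreover have "real N * Re \<zeta> \<le> (1 + \<bar>Re \<nu>\<bar>) * Re \<zeta>"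
      using N x(2) by (rule mult_right_mono_neg)
    ultimately have e: "real N * Re \<zeta> + (- Re (wkb_w l \<zeta>) - Re \<zeta>) + - Re (\<nu> * \<zeta>) \<le> M + - Re (wkb_w l \<zeta>)"
      by (simp add: distrib_right)
    have "cmod (exp \<zeta> ^ N * \<phi> (exp \<zeta>)) = exp (real N * Re \<zeta>) * (cmod (s \<zeta>) * exp (- Re (\<nu> * \<zeta>)))"
      unfolding \<phi>(2)[OF x(3)] F_def norm_mult norm_power norm_exp_eq_Re by (simp add: exp_of_nat_mult)
    also have "\<dots> \<le> exp (real N * Re \<zeta>) * (C * exp (- Re (wkb_w l \<zeta>) - Re \<zeta>) * exp (- Re (\<nu> * \<zeta>)))"
      using bound[OF x(1) \<zeta>(2)] by (intro mult_left_mono mult_right_mono) auto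
    also have "\<dots> = C * exp (real N * Re \<zeta> + (- Re (wkb_w l \<zeta>) - Re \<zeta>) + - Re (\<nu> * \<zeta>))"
      by (simp only: exp_add mult_ac)
    also have "\<dots> \<le> C * exp (M + - Re (wkb_w l \<zeta>))" using e C by simp
    finally show ?thesis by (simp only: C1_def exp_add mult_ac)
  qed
  have w_pos: "Re (wkb_w l \<zeta>) \<ge> 0" if "\<bar>Im \<zeta> - Im l\<bar> \<le> pi" for \<zeta>
  proof -
    have "cos ((Im l - Im \<zeta>) / 2) \<ge> 0" using that by (intro cos_ge_zero) auto
    thus ?thesis by (simp add: wkb_w_def Re_exp)
  qed
  have "cmod (z ^ N * \<phi> z) \<le> C1" if z: "z \<noteq> 0" "cmod z < exp x1" for z
  proof -
    obtain \<zeta> where \<zeta>: "exp \<zeta> = z" "Im l - pi \<le> Im \<zeta>" "Im \<zeta> \<le> Im l - pi + 2 * pi"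
      using ex_log_in_strip[OF z(1)] by blast
    have "exp (Re \<zeta>) < exp x1" using z(2) \<zeta>(1) norm_exp_eq_Re by metis
    hence Re: "Re \<zeta> \<le> x1" by simp
    have Im: "\<bar>Im \<zeta> - Im l\<bar> \<le> pi" using \<zeta> by linarith
    have "cmod (z ^ N * \<phi> z) \<le> C1 * exp (- Re (wkb_w l \<zeta>))" using bd[OF Re Im] \<zeta>(1) by simp
    also have "\<dots> \<le> C1 * 1" using w_pos[OF Im] C1 by (intro mult_left_mono) auto
    finally show ?thesis by simp
  qed
  then obtain \<psi> where \<psi>: "\<psi> holomorphic_on ball 0 (exp L)" "\<And>z. z \<in> ball 0 (exp L) - {0} \<Longrightarrow> \<psi> z = z ^ N * \<phi> z"
    using moderate_growth_extends[OF \<phi>(1) exp_gt_zero exp_gt_zero] by blast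
  have in_ball: "exp \<zeta> \<in> ball 0 (exp L) - {0}" if "Re \<zeta> < L" for \<zeta> using that by simp
  \<comment> \<open>If \<open>s\<close> vanished identically, the first equation of the system would
    force \<open>t\<close> to vanish as well.\<close>
  have \<psi>_nz: "\<exists>z\<in>ball 0 (exp L). \<psi> z \<noteq> 0"
  proof (rule ccontr)
    assume "\<not> (\<exists>z\<in>ball 0 (exp L). \<psi> z \<noteq> 0)"
    hence s0: "s \<zeta> = 0" if "Re \<zeta> < L" for \<zeta>
      using \<psi>(2)[OF in_ball[OF that]] in_ball[OF that] \<phi>(2)[OF that] by (auto simp: F_def)
    define \<zeta> where "\<zeta> = Complex (L - 1) 0"
    have \<zeta>: "Re \<zeta> < L" by (simp add: \<zeta>_def)
    have "((\<lambda>_. 0) has_field_derivative - exp (- \<zeta>) * t \<zeta>) (at \<zeta>)"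
      by (rule has_field_derivative_transform_within_open[OF companion_solD(1)[OF sol \<zeta>] open_halfspace_Re_lt[of L]])
        (use \<zeta> s0 in auto)
    hence "- exp (- \<zeta>) * t \<zeta> = 0" by (rule DERIV_unique) simp
    thus False using nz[OF \<zeta>] s0[OF \<zeta>] by simp
  qed
  have z0: "0 \<in> ball 0 (exp L)" by simp
  from conjunct2[OF zorder_exist_zero[OF \<psi>(1) open_ball connected_ball z0 \<psi>_nz]]
  obtain r where "r > 0 \<and> cball (0 :: complex) r \<subseteq> ball 0 (exp L) \<and> zor_poly \<psi> 0 holomorphic_on cball 0 r \<and>
      (\<forall>w\<in>cball 0 r. \<psi> w = zor_poly \<psi> 0 w * (w - 0) ^ nat (zorder \<psi> 0) \<and> zor_poly \<psi> 0 w \<noteq> 0)" ..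
  hence r: "r > 0" "cball (0 :: complex) r \<subseteq> ball 0 (exp L)" "zor_poly \<psi> 0 holomorphic_on cball 0 r"
      "\<And>w. w \<in> cball 0 r \<Longrightarrow> \<psi> w = zor_poly \<psi> 0 w * w ^ nat (zorder \<psi> 0) \<and> zor_poly \<psi> 0 w \<noteq> 0" by simp_all
  define g where "g = zor_poly \<psi> 0"
  define k where "k = nat (zorder \<psi> 0)"
  have "compact ((\<lambda>w. cmod (g w)) ` cball 0 r)"
    by (intro compact_continuous_image continuous_intros holomorphic_on_imp_continuous_on) (use r(3) in \<open>auto simp: g_def\<close>)
  then obtain w0 where w0: "w0 \<in> cball 0 r" "\<And>w. w \<in> cball 0 r \<Longrightarrow> cmod (g w0) \<le> cmod (g w)"
    using compact_attains_inf[of "(\<lambda>w. cmod (g w)) ` cball 0 r"] r(1) by auto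
  define \<epsilon> where "\<epsilon> = cmod (g w0)"
  have \<epsilon>: "\<epsilon> > 0" using r(4)[OF w0(1)] by (simp add: \<epsilon>_def g_def)
  \<comment> \<open>A point of the central line so far to the left that the lower bound \<epsilon>
    |z|^k exceeds the decaying upper bound.\<close>
  obtain \<tau> where \<tau>: "\<tau> \<ge> max (- x1) (- ln r)" "C1 * exp (real k * \<tau> - exp ((Re l + \<tau>) / 2)) < \<epsilon>"
    using double_exp_decay[OF \<epsilon> C1] by blast
  define \<zeta> where "\<zeta> = Complex (- \<tau>) (Im l)"
  have \<zeta>: "Re \<zeta> \<le> x1" "\<bar>Im \<zeta> - Im l\<bar> \<le> pi" "Re \<zeta> < L" using \<tau>(1) x0 by (auto simp: \<zeta>_def x1_def)
  have "exp (- \<tau>) \<le> exp (ln r)" using \<tau>(1) by (subst exp_le_cancel_iff) linarith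
  hence "exp \<zeta> \<in> cball 0 r" using r(1) by (simp add: \<zeta>_def)
  hence "\<psi> (exp \<zeta>) = g (exp \<zeta>) * exp \<zeta> ^ k" and ge: "\<epsilon> \<le> cmod (g (exp \<zeta>))"
    using r(4) w0(2) by (auto simp: g_def k_def \<epsilon>_def)
  hence "cmod (\<psi> (exp \<zeta>)) = cmod (g (exp \<zeta>)) * exp (- (real k * \<tau>))"
    by (simp add: norm_mult norm_power \<zeta>_def exp_of_nat_mult[symmetric])
  moreover have "cmod (\<psi> (exp \<zeta>)) \<le> C1 * exp (- Re (wkb_w l \<zeta>))"
    using bd[OF \<zeta>(1,2)] \<psi>(2)[OF in_ball[OF \<zeta>(3)]] by simp
  moreover have "Re (wkb_w l \<zeta>) = exp ((Re l + \<tau>) / 2)" by (simp add: wkb_w_def \<zeta>_def Re_exp)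
  ultimately have "cmod (g (exp \<zeta>)) * exp (- (real k * \<tau>)) \<le> C1 * exp (- exp ((Re l + \<tau>) / 2))" by simp
  hence "cmod (g (exp \<zeta>)) * exp (- (real k * \<tau>)) * exp (real k * \<tau>) \<le> C1 * exp (- exp ((Re l + \<tau>) / 2)) * exp (real k * \<tau>)"
    by (rule mult_right_mono) simp
  hence "cmod (g (exp \<zeta>)) \<le> C1 * exp (real k * \<tau> - exp ((Re l + \<tau>) / 2))"
    unfolding mult.assoc exp_add[symmetric] by simp
  thus False using \<tau>(2) ge by linarith
qed

section \<open>Holomorphic equivalence of companion systems\<close>

text \<open>The eigensolution brings in the eigenvalue: turning has determinant 1 on the solution
  space, so \<open>lam\<close> determines its trace.\<close>

locale companion_system =
  fixes p :: "complex \<Rightarrow> complex" and L :: real and y1 v1 y2 v2 f g :: "complex \<Rightarrow> complex" and lam :: complex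
  assumes p_hol: "p holomorphic_on ball 0 (exp L)" and p0: "p 0 = 0" and p1: "deriv p 0 \<noteq> 0"
    and sol1: "companion_sol p L y1 v1" and sol2: "companion_sol p L y2 v2"
    and fundamental: "\<And>\<zeta>. Re \<zeta> < L \<Longrightarrow> wronskian y1 v1 y2 v2 \<zeta> \<noteq> 0"
    and solf: "companion_sol p L f g"
    and eigen: "\<And>\<zeta>. Re \<zeta> < L \<Longrightarrow> f (\<zeta> + 2 * of_real pi * \<i>) = lam * f \<zeta>"
      "\<And>\<zeta>. Re \<zeta> < L \<Longrightarrow> g (\<zeta> + 2 * of_real pi * \<i>) = lam * g \<zeta>"
    and f_nz: "\<exists>\<zeta>. Re \<zeta> < L \<and> (f \<zeta> \<noteq> 0 \<or> g \<zeta> \<noteq> 0)"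

abbreviation turn :: "(complex \<Rightarrow> complex) \<Rightarrow> complex \<Rightarrow> complex" where
  "turn s \<equiv> \<lambda>\<zeta>. s (\<zeta> + 2 * of_real pi * \<i>)"

lemma lincomb_zero_2x2:
  assumes "a * (s1 :: complex) + b * s2 = 0" "a * t1 + b * t2 = 0" "s1 * t2 - s2 * t1 \<noteq> 0"
  shows "a = 0" "b = 0"
proof -
  have "a * (s1 * t2 - s2 * t1) = (a * s1 + b * s2) * t2 - (a * t1 + b * t2) * s2" by (simp add: algebra_simps)
  thus "a = 0" using assms by simp
  have "b * (s1 * t2 - s2 * t1) = (a * t1 + b * t2) * s1 - (a * s1 + b * s2) * t1" by (simp add: algebra_simps)
  thus "b = 0" using assms by simp
qed

context companion_system
begin

text \<open>If \<open>s\<close> and its turn were dependent, \<open>s\<close> would be an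
  eigensolution of the turn, against \<open>no_decaying_eigensolution\<close>. In the basis they
  form, the constancy of the Wronskian makes the determinant of the turn 1, and the given
  eigensolution makes its trace \<open>lam + 1 / lam\<close>.\<close>

lemma ex_recessive_pair:
  assumes l: "exp l = 4 * deriv p 0"
  obtains s t C x0 W where "companion_sol p L s t" "C > 0" "x0 < L" "W \<noteq> 0"
    "\<And>\<zeta>. Re \<zeta> \<le> x0 \<Longrightarrow> \<bar>Im \<zeta> - Im l\<bar> \<le> 2 * pi \<Longrightarrow> cmod (s \<zeta>) \<le> C * exp (- Re (wkb_w l \<zeta>) - Re \<zeta>)"
    "\<And>\<zeta>. Re \<zeta> \<le> x0 \<Longrightarrow> \<bar>Im \<zeta> - Im l\<bar> \<le> 2 * pi \<Longrightarrow> cmod (t \<zeta>) \<le> C * exp (- Re (wkb_w l \<zeta>) - Re \<zeta>)"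
    "\<And>\<zeta>. Re \<zeta> < L \<Longrightarrow> wronskian s t (turn s) (turn t) \<zeta> = W"
    "\<And>\<zeta>. Re \<zeta> < L \<Longrightarrow> turn (turn s) \<zeta> = (lam + 1 / lam) * turn s \<zeta> - s \<zeta>"
    "\<And>\<zeta>. Re \<zeta> < L \<Longrightarrow> turn (turn t) \<zeta> = (lam + 1 / lam) * turn t \<zeta> - t \<zeta>"
proof -
  obtain a b C x0 where ab: "a \<noteq> 0 \<or> b \<noteq> 0" "x0 < L" "C > 0"
    "\<And>\<zeta>. Re \<zeta> \<le> x0 \<Longrightarrow> \<bar>Im \<zeta> - Im l\<bar> \<le> 2 * pi \<Longrightarrow>
       cmod (a * y1 \<zeta> + b * y2 \<zeta>) \<le> C * exp (- Re (wkb_w l \<zeta>) - Re \<zeta>)"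
    "\<And>\<zeta>. Re \<zeta> \<le> x0 \<Longrightarrow> \<bar>Im \<zeta> - Im l\<bar> \<le> 2 * pi \<Longrightarrow>
       cmod (a * v1 \<zeta> + b * v2 \<zeta>) \<le> C * exp (- Re (wkb_w l \<zeta>) - Re \<zeta>)"
    by (rule recessive_solution[OF p_hol p0 l sol1 sol2 fundamental], assumption, rule that)
  define s t where "s = (\<lambda>\<zeta>. a * y1 \<zeta> + b * y2 \<zeta>)" and "t = (\<lambda>\<zeta>. a * v1 \<zeta> + b * v2 \<zeta>)"
  have sol: "companion_sol p L s t" unfolding s_def t_def by (rule companion_sol_lincomb[OF sol1 sol2])
  note sol' = companion_sol_shift[OF sol]
  have nz: "s \<zeta> \<noteq> 0 \<or> t \<zeta> \<noteq> 0" if "Re \<zeta> < L" for \<zeta>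
    using lincomb_zero_2x2[of a "y1 \<zeta>" b "y2 \<zeta>" "v1 \<zeta>" "v2 \<zeta>"] fundamental[OF that] ab(1)
    by (auto simp: s_def t_def wronskian_def)
  obtain W where W: "\<And>\<zeta>. Re \<zeta> < L \<Longrightarrow> wronskian s t (turn s) (turn t) \<zeta> = W"
    using wronskian_const[OF sol sol'] by blast
  have W0: "W \<noteq> 0"
  proof
    assume "W = 0"
    define \<zeta>0 where "\<zeta>0 = Complex (L - 1) 0"
    have \<zeta>0: "Re \<zeta>0 < L" by (simp add: \<zeta>0_def)
    have w: "s \<zeta>0 * turn t \<zeta>0 = turn s \<zeta>0 * t \<zeta>0"
      using W[OF \<zeta>0] \<open>W = 0\<close> by (simp add: wronskian_def)
    obtain \<mu> where \<mu>: "turn s \<zeta>0 = \<mu> * s \<zeta>0" "turn t \<zeta>0 = \<mu> * t \<zeta>0"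
    proof (cases "s \<zeta>0 = 0")
      case True
      thus ?thesis using that[of "turn t \<zeta>0 / t \<zeta>0"] nz[OF \<zeta>0] w by simp
    next
      case False
      thus ?thesis using that[of "turn s \<zeta>0 / s \<zeta>0"] w by (simp add: field_simps)
    qed
    note solm = companion_sol_lincomb[OF sol' sol, of 1 "- \<mu>"]
    have "turn s \<zeta> = \<mu> * s \<zeta>" if "Re \<zeta> < L" for \<zeta>
      using companion_sol_zero(1)[OF sol1 sol2 solm fundamental \<zeta>0 _ _ that] \<mu> by simp
    moreover have "\<mu> \<noteq> 0"
      using \<mu> nz[of "\<zeta>0 + 2 * of_real pi * \<i>"] \<zeta>0 by auto
    ultimately show False
      using no_decaying_eigensolution[OF sol nz, of \<mu> x0 C l] ab(2,3,4) by (simp add: s_def)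
  qed
  have fund: "wronskian s t (turn s) (turn t) \<zeta> \<noteq> 0" if "Re \<zeta> < L" for \<zeta>
    using W[OF that] W0 by simp
  obtain A T where AT: "\<And>\<zeta>. Re \<zeta> < L \<Longrightarrow> turn (turn s) \<zeta> = A * s \<zeta> + T * turn s \<zeta> \<and> turn (turn t) \<zeta> = A * t \<zeta> + T * turn t \<zeta>"
    using companion_sol_combination[OF sol sol' companion_sol_shift[OF sol'] fund] by blast
  obtain \<alpha> \<beta> where f: "\<And>\<zeta>. Re \<zeta> < L \<Longrightarrow> f \<zeta> = \<alpha> * s \<zeta> + \<beta> * turn s \<zeta> \<and> g \<zeta> = \<alpha> * t \<zeta> + \<beta> * turn t \<zeta>"
    using companion_sol_combination[OF sol sol' solf fund] by blast
  define \<zeta> where "\<zeta> = Complex (L - 1) 0"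
  define \<zeta>' where "\<zeta>' = \<zeta> + 2 * of_real pi * \<i>"
  have \<zeta>: "Re \<zeta> < L" "Re \<zeta>' < L" by (simp_all add: \<zeta>_def \<zeta>'_def)
  have w0: "s \<zeta> * turn t \<zeta> - turn s \<zeta> * t \<zeta> = W" using W[OF \<zeta>(1)] by (simp add: wronskian_def)
  have "turn s \<zeta> * turn (turn t) \<zeta> - turn (turn s) \<zeta> * turn t \<zeta> = W"
    using W[OF \<zeta>(2)] by (simp add: wronskian_def \<zeta>'_def)
  hence "- A * (s \<zeta> * turn t \<zeta> - turn s \<zeta> * t \<zeta>) = W"
    using AT[OF \<zeta>(1)] by (simp add: algebra_simps)
  hence A: "A = - 1" using w0 W0 by (metis minus_equation_iff mult_cancel_right1)
  have ff: "turn f \<zeta> = \<alpha> * turn s \<zeta> + \<beta> * turn (turn s) \<zeta>" "turn g \<zeta> = \<alpha> * turn t \<zeta> + \<beta> * turn (turn t) \<zeta>"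
    using f[OF \<zeta>(2)] by (simp_all add: \<zeta>'_def)
  have key: "(- \<beta> - lam * \<alpha>) * x + (\<alpha> + \<beta> * T - lam * \<beta>) * y = (\<alpha> * y + \<beta> * (A * x + T * y)) - lam * (\<alpha> * x + \<beta> * y)" for x y
    by (simp add: A algebra_simps)
  have AT': "A * s \<zeta> + T * turn s \<zeta> = turn (turn s) \<zeta>" "A * t \<zeta> + T * turn t \<zeta> = turn (turn t) \<zeta>"
    by (rule AT[OF \<zeta>(1), THEN conjunct1, symmetric], rule AT[OF \<zeta>(1), THEN conjunct2, symmetric])
  have f': "\<alpha> * s \<zeta> + \<beta> * turn s \<zeta> = f \<zeta>" "\<alpha> * t \<zeta> + \<beta> * turn t \<zeta> = g \<zeta>"
    using f[OF \<zeta>(1)] by simp_all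
  have "(- \<beta> - lam * \<alpha>) * s \<zeta> + (\<alpha> + \<beta> * T - lam * \<beta>) * turn s \<zeta> = 0"
    unfolding key AT' f' ff(1)[symmetric] eigen[OF \<zeta>(1)] by simp
  moreover have "(- \<beta> - lam * \<alpha>) * t \<zeta> + (\<alpha> + \<beta> * T - lam * \<beta>) * turn t \<zeta> = 0"
    unfolding key AT' f' ff(2)[symmetric] eigen[OF \<zeta>(1)] by simp
  ultimately have 1: "- \<beta> - lam * \<alpha> = 0" and 2: "\<alpha> + \<beta> * T - lam * \<beta> = 0"
    using lincomb_zero_2x2 w0 W0 by blast+
  have \<beta>: "\<beta> \<noteq> 0"
  proof
    assume "\<beta> = 0"
    hence "\<alpha> = 0" using 2 by simp
    thus False using f_nz f \<open>\<beta> = 0\<close> by auto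
  qed
  have lam0: "lam \<noteq> 0" using 1 \<beta> by auto
  \<comment> \<open>Eliminating \<alpha> leaves the characteristic equation of the turn at
    \<open>lam\<close>, multiplied by \<beta>.\<close>
  have "\<beta> * (lam * T - lam * lam - 1) = lam * (\<alpha> + \<beta> * T - lam * \<beta>) + (- \<beta> - lam * \<alpha>)"
    by (simp add: algebra_simps)
  hence "\<beta> * (lam * T - lam * lam - 1) = 0" using 1 2 by simp
  hence "lam * T - lam * lam - 1 = 0" using \<beta> by (simp only: mult_eq_0_iff) simp
  hence T: "T = lam + 1 / lam" using lam0 by (simp add: field_simps)
  show thesis
    by (rule that[OF sol ab(3,2) W0 _ _ W]) (use ab(4,5) AT A T in \<open>simp_all add: s_def t_def\<close>)
qed

end

lemma moderate_product:
  assumes "cmod s \<le> C * exp (- w - x)" "cmod t \<le> C' * exp (w - x)" "C > 0" "C' > 0"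
  shows "cmod (s * t) \<le> C * C' * exp (- 2 * x)"
proof -
  have "cmod (s * t) \<le> (C * exp (- w - x)) * (C' * exp (w - x))"
    unfolding norm_mult using assms by (intro mult_mono) auto
  also have "\<dots> = C * C' * (exp (- w - x) * exp (w - x))" by (simp only: mult_ac)
  also have "exp (- w - x) * exp (w - x) = exp (- 2 * x)" unfolding exp_add[symmetric] by simp
  finally show ?thesis .
qed

text \<open>The map sending the recessive pair of one system to that of the other has single-valued
  coefficients because both pairs turn in the same way, and these have moderate growth because
  recessive factors meet dominant ones in each product.\<close>

theorem companion_equivalence:
  assumes S1: "companion_system p L y1 v1 y2 v2 f g lam"
    and S2: "companion_system q L y1' v1' y2' v2' f' g' lam"
    and same: "deriv p 0 = deriv q 0"
  obtains A B W where "A holomorphic_on ball 0 (exp L)" "B holomorphic_on ball 0 (exp L)" "W \<noteq> 0"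
    "\<And>C D z. C = (\<lambda>z. B z * p z - z\<^sup>2 * deriv A z) \<Longrightarrow> D = (\<lambda>z. A z - z\<^sup>2 * deriv B z) \<Longrightarrow> z \<in> ball 0 (exp L) \<Longrightarrow>
       A z * D z - B z * C z = W \<and> A z * q z = D z * p z - z\<^sup>2 * deriv C z \<and> B z * q z = C z - z\<^sup>2 * deriv D z"
proof -
  interpret S1: companion_system p L y1 v1 y2 v2 f g lam by fact
  interpret S2: companion_system q L y1' v1' y2' v2' f' g' lam by fact
  define l where "l = Ln (4 * deriv p 0)"
  have l: "exp l = 4 * deriv p 0" using S1.p1 by (simp add: l_def)
  obtain s t K x0 W1 where s: "companion_sol p L s t" "K > 0" "x0 < L" "W1 \<noteq> 0"
    "\<And>\<zeta>. Re \<zeta> \<le> x0 \<Longrightarrow> \<bar>Im \<zeta> - Im l\<bar> \<le> 2 * pi \<Longrightarrow> cmod (s \<zeta>) \<le> K * exp (- Re (wkb_w l \<zeta>) - Re \<zeta>)"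
    "\<And>\<zeta>. Re \<zeta> \<le> x0 \<Longrightarrow> \<bar>Im \<zeta> - Im l\<bar> \<le> 2 * pi \<Longrightarrow> cmod (t \<zeta>) \<le> K * exp (- Re (wkb_w l \<zeta>) - Re \<zeta>)"
    "\<And>\<zeta>. Re \<zeta> < L \<Longrightarrow> wronskian s t (turn s) (turn t) \<zeta> = W1"
    "\<And>\<zeta>. Re \<zeta> < L \<Longrightarrow> turn (turn s) \<zeta> = (lam + 1 / lam) * turn s \<zeta> - s \<zeta>"
    "\<And>\<zeta>. Re \<zeta> < L \<Longrightarrow> turn (turn t) \<zeta> = (lam + 1 / lam) * turn t \<zeta> - t \<zeta>"
    by (rule S1.ex_recessive_pair[OF l], rule that)
  obtain s' t' K' x0' W2 where s': "companion_sol q L s' t'" "K' > 0" "x0' < L" "W2 \<noteq> 0"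
    "\<And>\<zeta>. Re \<zeta> \<le> x0' \<Longrightarrow> \<bar>Im \<zeta> - Im l\<bar> \<le> 2 * pi \<Longrightarrow> cmod (s' \<zeta>) \<le> K' * exp (- Re (wkb_w l \<zeta>) - Re \<zeta>)"
    "\<And>\<zeta>. Re \<zeta> \<le> x0' \<Longrightarrow> \<bar>Im \<zeta> - Im l\<bar> \<le> 2 * pi \<Longrightarrow> cmod (t' \<zeta>) \<le> K' * exp (- Re (wkb_w l \<zeta>) - Re \<zeta>)"
    "\<And>\<zeta>. Re \<zeta> < L \<Longrightarrow> wronskian s' t' (turn s') (turn t') \<zeta> = W2"
    "\<And>\<zeta>. Re \<zeta> < L \<Longrightarrow> turn (turn s') \<zeta> = (lam + 1 / lam) * turn s' \<zeta> - s' \<zeta>"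
    "\<And>\<zeta>. Re \<zeta> < L \<Longrightarrow> turn (turn t') \<zeta> = (lam + 1 / lam) * turn t' \<zeta> - t' \<zeta>"
    by (rule S2.ex_recessive_pair[OF l[unfolded same]], rule that)
  define T where "T = lam + 1 / lam"
  note hol = companion_sol_holomorphic[OF s(1)] companion_sol_holomorphic[OF companion_sol_shift[OF s(1)]]
    companion_sol_holomorphic[OF s'(1)] companion_sol_holomorphic[OF companion_sol_shift[OF s'(1)]]
  \<comment> \<open>Cramer's rule for the row (a, b) that sends (s, t) to \<open>s'\<close> and the
    turned pair to the turn of \<open>s'\<close>.\<close>
  define a where "a \<zeta> = (s' \<zeta> * turn t \<zeta> - turn s' \<zeta> * t \<zeta>) / W1" for \<zeta>
  define b where "b \<zeta> = (turn s' \<zeta> * s \<zeta> - s' \<zeta> * turn s \<zeta>) / W1" for \<zeta>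
  have a_hol: "a holomorphic_on {\<zeta>. Re \<zeta> < L}" and b_hol: "b holomorphic_on {\<zeta>. Re \<zeta> < L}"
    unfolding a_def[abs_def] b_def[abs_def] using s(4) by (auto intro!: holomorphic_intros hol)
  \<comment> \<open>Turning applies one and the same matrix of determinant 1 to both pairs, so the
    determinants in the numerators do not change.\<close>
  have a_per: "turn a \<zeta> = a \<zeta>" and b_per: "turn b \<zeta> = b \<zeta>" if "Re \<zeta> < L" for \<zeta>
    unfolding a_def b_def s(8,9)[OF that] s'(8)[OF that] by (simp_all add: algebra_simps)
  obtain \<alpha> where \<alpha>: "\<alpha> holomorphic_on ball 0 (exp L) - {0}" "\<And>\<zeta>. Re \<zeta> < L \<Longrightarrow> \<alpha> (exp \<zeta>) = a \<zeta>"
    using periodic_descends[OF a_hol a_per] by blast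
  obtain \<beta> where \<beta>: "\<beta> holomorphic_on ball 0 (exp L) - {0}" "\<And>\<zeta>. Re \<zeta> < L \<Longrightarrow> \<beta> (exp \<zeta>) = b \<zeta>"
    using periodic_descends[OF b_hol b_per] by blast
  define x1 where "x1 = min x0 x0'"
  define M where "M = 2 * (K * K') / cmod W1"
  \<comment> \<open>The half of the strip below \<open>Im l\<close> already covers every z, and
    there the point shifted by 2 \<pi> \<i> also lies in the strip, with the opposite sign of
    \<open>w\<close>.\<close>
  have bd: "cmod (a \<zeta>) \<le> M * exp (- 2 * Re \<zeta>)" "cmod (b \<zeta>) \<le> M * exp (- 2 * Re \<zeta>)"
    if \<zeta>: "Re \<zeta> \<le> x1" "Im l - 2 * pi \<le> Im \<zeta>" "Im \<zeta> \<le> Im l" for \<zeta>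
  proof -
    have x: "Re \<zeta> \<le> x0" "Re \<zeta> \<le> x0'" using \<zeta> by (auto simp: x1_def)
    have i: "\<bar>Im \<zeta> - Im l\<bar> \<le> 2 * pi" "\<bar>Im (\<zeta> + 2 * of_real pi * \<i>) - Im l\<bar> \<le> 2 * pi" using \<zeta> by simp_all
    have *: "cmod (turn s \<zeta>) \<le> K * exp (Re (wkb_w l \<zeta>) - Re \<zeta>)" "cmod (turn t \<zeta>) \<le> K * exp (Re (wkb_w l \<zeta>) - Re \<zeta>)"
      "cmod (turn s' \<zeta>) \<le> K' * exp (Re (wkb_w l \<zeta>) - Re \<zeta>)"
      using s(5)[OF _ i(2)] s(6)[OF _ i(2)] s'(5)[OF _ i(2)] x by (simp_all add: wkb_w_shift)
    note m = moderate_product[OF s'(5)[OF x(2) i(1)] *(2) s'(2) s(2)]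
      moderate_product[OF s(6)[OF x(1) i(1)] *(3) s(2) s'(2)]
      moderate_product[OF s(5)[OF x(1) i(1)] *(3) s(2) s'(2)]
      moderate_product[OF s'(5)[OF x(2) i(1)] *(1) s'(2) s(2)]
    have "cmod (s' \<zeta> * turn t \<zeta> - turn s' \<zeta> * t \<zeta>) \<le> 2 * (K * K') * exp (- 2 * Re \<zeta>)"
      using norm_triangle_ineq4[of "s' \<zeta> * turn t \<zeta>" "turn s' \<zeta> * t \<zeta>"] m(1,2) by (simp add: mult_ac)
    moreover have "cmod (turn s' \<zeta> * s \<zeta> - s' \<zeta> * turn s \<zeta>) \<le> 2 * (K * K') * exp (- 2 * Re \<zeta>)"
      using norm_triangle_ineq4[of "turn s' \<zeta> * s \<zeta>" "s' \<zeta> * turn s \<zeta>"] m(3,4) by (simp add: mult_ac)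
    ultimately show "cmod (a \<zeta>) \<le> M * exp (- 2 * Re \<zeta>)" "cmod (b \<zeta>) \<le> M * exp (- 2 * Re \<zeta>)"
      using s(4) by (simp_all add: a_def b_def M_def norm_divide divide_right_mono)
  qed
  have mod: "cmod (z ^ 2 * \<phi> z) \<le> M" if z: "z \<noteq> 0" "cmod z < exp x1"
    and \<phi>: "\<And>\<zeta>. Re \<zeta> < L \<Longrightarrow> \<phi> (exp \<zeta>) = c \<zeta>"
    and c: "\<And>\<zeta>. Re \<zeta> \<le> x1 \<Longrightarrow> Im l - 2 * pi \<le> Im \<zeta> \<Longrightarrow> Im \<zeta> \<le> Im l \<Longrightarrow> cmod (c \<zeta>) \<le> M * exp (- 2 * Re \<zeta>)" for z \<phi> c
  proof -
    obtain \<zeta> where \<zeta>: "exp \<zeta> = z" "Im l - 2 * pi \<le> Im \<zeta>" "Im \<zeta> \<le> Im l - 2 * pi + 2 * pi"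
      using ex_log_in_strip[OF z(1)] by blast
    have "exp (Re \<zeta>) < exp x1" using z(2) \<zeta>(1) norm_exp_eq_Re by metis
    hence Re: "Re \<zeta> \<le> x1" by simp
    have "Re \<zeta> < L" using Re s(3) by (simp add: x1_def)
    hence "cmod (z ^ 2 * \<phi> z) = exp (Re \<zeta>) ^ 2 * cmod (c \<zeta>)"
      using \<phi>[of \<zeta>] \<zeta>(1) by (auto simp: norm_mult norm_power)
    also have "\<dots> \<le> exp (Re \<zeta>) ^ 2 * (M * exp (- 2 * Re \<zeta>))" using c[OF Re] \<zeta> by (intro mult_left_mono) auto
    also have "\<dots> = M * (exp (Re \<zeta>) ^ 2 * exp (- 2 * Re \<zeta>))" by (simp only: mult_ac)
    also have "exp (Re \<zeta>) ^ 2 * exp (- 2 * Re \<zeta>) = 1"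
      unfolding power2_eq_square exp_add[symmetric] by simp
    finally show ?thesis by simp
  qed
  obtain F where F: "F holomorphic_on ball 0 (exp L)" "\<And>z. z \<in> ball 0 (exp L) - {0} \<Longrightarrow> F z = z ^ 2 * \<alpha> z"
    using moderate_growth_extends[OF \<alpha>(1) exp_gt_zero exp_gt_zero, of x1 2 M] mod[OF _ _ \<alpha>(2) bd(1)] by blast
  obtain G where G: "G holomorphic_on ball 0 (exp L)" "\<And>z. z \<in> ball 0 (exp L) - {0} \<Longrightarrow> G z = z ^ 2 * \<beta> z"
    using moderate_growth_extends[OF \<beta>(1) exp_gt_zero exp_gt_zero, of x1 2 M] mod[OF _ _ \<beta>(2) bd(2)] by blast
  have op: "open (ball 0 (exp L) - {0 :: complex})" by (intro open_Diff) auto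
  define W where "W = W2 / W1"
  have W0: "W \<noteq> 0" using s(4) s'(4) by (simp add: W_def)
  \<comment> \<open>Differentiating \<alpha> s + \<beta> t = s' and inserting both systems expresses
    t' through s and t; \<gamma> and \<delta> are the coefficients that arise.\<close>
  define \<gamma> where "\<gamma> z = \<beta> z * p z - z\<^sup>2 * deriv \<alpha> z" for z
  define \<delta> where "\<delta> z = \<alpha> z - z\<^sup>2 * deriv \<beta> z" for z
  have \<gamma>\<delta>_hol: "\<gamma> holomorphic_on ball 0 (exp L) - {0}" "\<delta> holomorphic_on ball 0 (exp L) - {0}"
    unfolding \<gamma>_def[abs_def] \<delta>_def[abs_def]
    by (auto intro!: holomorphic_intros \<alpha> \<beta> op holomorphic_on_subset[OF S1.p_hol])
  have gauge: "\<alpha> z * \<delta> z - \<beta> z * \<gamma> z = W \<and> \<alpha> z * q z = \<delta> z * p z - z\<^sup>2 * deriv \<gamma> z \<and> \<beta> z * q z = \<gamma> z - z\<^sup>2 * deriv \<delta> z"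
    if z: "z \<in> ball 0 (exp L) - {0}" for z
  proof -
    have der: "((\<lambda>\<zeta>. \<phi> (exp \<zeta>)) has_field_derivative deriv \<phi> (exp \<zeta>) * exp \<zeta>) (at \<zeta>)"
      if "\<phi> holomorphic_on ball 0 (exp L) - {0}" "Re \<zeta> < L" for \<phi> \<zeta>
      using holomorphic_derivI[OF that(1) op, of "exp \<zeta>"] that(2)
      by (intro DERIV_chain2[of \<phi>]) (auto intro: derivative_eq_intros)
    \<comment> \<open>The derivative of an identity \<phi> U + \<psi> V = R, arranged so that the
      right-hand sides of the systems can be inserted for the derivatives of U, V and R.\<close>
    have uniq: "deriv \<phi> (exp \<zeta>) * exp \<zeta> * u + \<phi> (exp \<zeta>) * u' + (deriv \<psi> (exp \<zeta>) * exp \<zeta> * v + \<psi> (exp \<zeta>) * v') = r"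
      if h: "\<phi> holomorphic_on ball 0 (exp L) - {0}" "\<psi> holomorphic_on ball 0 (exp L) - {0}" "Re \<zeta> < L"
        and d: "(U has_field_derivative u') (at \<zeta>)" "(V has_field_derivative v') (at \<zeta>)" "(R has_field_derivative r) (at \<zeta>)"
        and e: "u = U \<zeta>" "v = V \<zeta>" "\<And>\<zeta>. Re \<zeta> < L \<Longrightarrow> \<phi> (exp \<zeta>) * U \<zeta> + \<psi> (exp \<zeta>) * V \<zeta> = R \<zeta>" for \<phi> \<psi> \<zeta> U V R u u' v v' r
    proof -
      have 1: "((\<lambda>\<zeta>. \<phi> (exp \<zeta>) * U \<zeta> + \<psi> (exp \<zeta>) * V \<zeta>) has_field_derivative
        (deriv \<phi> (exp \<zeta>) * exp \<zeta> * U \<zeta> + u' * \<phi> (exp \<zeta>)) + (deriv \<psi> (exp \<zeta>) * exp \<zeta> * V \<zeta> + v' * \<psi> (exp \<zeta>))) (at \<zeta>)"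
        by (intro DERIV_add DERIV_mult der h d)
      have "(R has_field_derivative
        (deriv \<phi> (exp \<zeta>) * exp \<zeta> * U \<zeta> + u' * \<phi> (exp \<zeta>)) + (deriv \<psi> (exp \<zeta>) * exp \<zeta> * V \<zeta> + v' * \<psi> (exp \<zeta>))) (at \<zeta>)"
        by (rule has_field_derivative_transform_within_open[OF 1 open_halfspace_Re_lt[of L]]) (use h e in auto)
      from DERIV_unique[OF this d(3)] show ?thesis by (simp add: e mult_ac)
    qed
    have trans1: "\<alpha> (exp \<zeta>) * s \<zeta> + \<beta> (exp \<zeta>) * t \<zeta> = s' \<zeta>" "\<alpha> (exp \<zeta>) * turn s \<zeta> + \<beta> (exp \<zeta>) * turn t \<zeta> = turn s' \<zeta>"
      if "Re \<zeta> < L" for \<zeta>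
    proof -
      have "W1 * (a \<zeta> * s \<zeta> + b \<zeta> * t \<zeta>) = s' \<zeta> * wronskian s t (turn s) (turn t) \<zeta>"
        "W1 * (a \<zeta> * turn s \<zeta> + b \<zeta> * turn t \<zeta>) = turn s' \<zeta> * wronskian s t (turn s) (turn t) \<zeta>"
        using s(4) by (simp_all add: a_def b_def wronskian_def distrib_left) (simp_all add: algebra_simps)
      thus "\<alpha> (exp \<zeta>) * s \<zeta> + \<beta> (exp \<zeta>) * t \<zeta> = s' \<zeta>" "\<alpha> (exp \<zeta>) * turn s \<zeta> + \<beta> (exp \<zeta>) * turn t \<zeta> = turn s' \<zeta>"
        unfolding s(7)[OF that] \<alpha>(2)[OF that] \<beta>(2)[OF that] using s(4) by (simp_all add: mult.commute)
    qed
    have step1: "\<gamma> (exp \<zeta>) * u + \<delta> (exp \<zeta>) * v = v''"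
      if "Re \<zeta> < L" "companion_sol p L U V" "companion_sol q L U' V'" "u = U \<zeta>" "v = V \<zeta>" "v'' = V' \<zeta>"
        "\<And>\<zeta>. Re \<zeta> < L \<Longrightarrow> \<alpha> (exp \<zeta>) * U \<zeta> + \<beta> (exp \<zeta>) * V \<zeta> = U' \<zeta>" for \<zeta> U V U' V' u v v''
    proof -
      define Z where "Z = exp \<zeta>"
      have Z: "exp (- \<zeta>) = 1 / Z" "Z \<noteq> 0" by (simp_all add: Z_def exp_minus divide_inverse)
      have "deriv \<alpha> Z * Z * U \<zeta> + \<alpha> Z * (- (1 / Z) * V \<zeta>) + (deriv \<beta> Z * Z * V \<zeta> + \<beta> Z * (- (1 / Z) * p Z * U \<zeta>)) = - (1 / Z) * V' \<zeta>"
        using uniq[OF \<alpha>(1) \<beta>(1) that(1) companion_solD[OF that(2,1)] companion_solD(1)[OF that(3,1)] refl refl that(7)]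
        by (simp only: Z(1) Z_def[symmetric])
      hence "- Z * (deriv \<alpha> Z * Z * U \<zeta> + \<alpha> Z * (- (1 / Z) * V \<zeta>) + (deriv \<beta> Z * Z * V \<zeta> + \<beta> Z * (- (1 / Z) * p Z * U \<zeta>))) = V' \<zeta>"
        using Z(2) by simp
      moreover have "- Z * (x * Z * u + y * (- (1 / Z) * v) + (x' * Z * v + y' * (- (1 / Z) * r * u))) =
          (y' * r - Z\<^sup>2 * x) * u + (y - Z\<^sup>2 * x') * v" for x y x' y' u v r
        using Z(2) by (simp add: field_simps power2_eq_square)
      ultimately show ?thesis unfolding that(4,5,6) \<gamma>_def \<delta>_def Z_def[symmetric] by metis
    qed
    have trans2: "\<gamma> (exp \<zeta>) * s \<zeta> + \<delta> (exp \<zeta>) * t \<zeta> = t' \<zeta>" "\<gamma> (exp \<zeta>) * turn s \<zeta> + \<delta> (exp \<zeta>) * turn t \<zeta> = turn t' \<zeta>"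
      if "Re \<zeta> < L" for \<zeta>
      using step1[OF that s(1) s'(1) refl refl refl trans1(1)]
        step1[OF that companion_sol_shift[OF s(1)] companion_sol_shift[OF s'(1)] refl refl refl trans1(2)] by blast+
    \<comment> \<open>Differentiating the second row yields a linear relation for each of the two
      basis solutions; as their determinant is not 0, both coefficients vanish.\<close>
    have step2: "(\<delta> Z * p Z - Z\<^sup>2 * deriv \<gamma> Z - q Z * \<alpha> Z) * U \<zeta> + (\<gamma> Z - Z\<^sup>2 * deriv \<delta> Z - q Z * \<beta> Z) * V \<zeta> = 0"
      if "Re \<zeta> < L" "companion_sol p L U V" "companion_sol q L U' V'" "Z = exp \<zeta>"
        "\<And>\<zeta>. Re \<zeta> < L \<Longrightarrow> \<alpha> (exp \<zeta>) * U \<zeta> + \<beta> (exp \<zeta>) * V \<zeta> = U' \<zeta>"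
        "\<And>\<zeta>. Re \<zeta> < L \<Longrightarrow> \<gamma> (exp \<zeta>) * U \<zeta> + \<delta> (exp \<zeta>) * V \<zeta> = V' \<zeta>" for \<zeta> U V U' V' Z
    proof -
      have Z: "exp (- \<zeta>) = 1 / Z" "Z \<noteq> 0" by (simp_all add: that(4) exp_minus divide_inverse)
      have "deriv \<gamma> Z * Z * U \<zeta> + \<gamma> Z * (- (1 / Z) * V \<zeta>) + (deriv \<delta> Z * Z * V \<zeta> + \<delta> Z * (- (1 / Z) * p Z * U \<zeta>)) = - (1 / Z) * q Z * U' \<zeta>"
        using uniq[OF \<gamma>\<delta>_hol that(1) companion_solD[OF that(2,1)] companion_solD(2)[OF that(3,1)] refl refl that(6)]
        by (simp only: Z(1) that(4)[symmetric])
      hence "- Z * (deriv \<gamma> Z * Z * U \<zeta> + \<gamma> Z * (- (1 / Z) * V \<zeta>) + (deriv \<delta> Z * Z * V \<zeta> + \<delta> Z * (- (1 / Z) * p Z * U \<zeta>))) = q Z * U' \<zeta>"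
        using Z(2) by simp
      moreover have "U' \<zeta> = \<alpha> Z * U \<zeta> + \<beta> Z * V \<zeta>" using that(5)[OF that(1)] that(4) by simp
      moreover have "- Z * (x * Z * u + y * (- (1 / Z) * v) + (x' * Z * v + y' * (- (1 / Z) * r * u))) =
          (y' * r - Z\<^sup>2 * x) * u + (y - Z\<^sup>2 * x') * v" for x y x' y' u v r
        using Z(2) by (simp add: field_simps power2_eq_square)
      ultimately have "(\<delta> Z * p Z - Z\<^sup>2 * deriv \<gamma> Z) * U \<zeta> + (\<gamma> Z - Z\<^sup>2 * deriv \<delta> Z) * V \<zeta> = q Z * (\<alpha> Z * U \<zeta> + \<beta> Z * V \<zeta>)"
        by metis
      thus ?thesis by (simp add: algebra_simps)
    qed
    define \<zeta> where "\<zeta> = Ln z"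
    have \<zeta>: "z = exp \<zeta>" using z by (simp add: \<zeta>_def)
    hence Re: "Re \<zeta> < L" using z by (intro Re_less_of_exp_in_ball) auto
    have w: "s \<zeta> * turn t \<zeta> - turn s \<zeta> * t \<zeta> \<noteq> 0" using s(7)[OF Re] s(4) by (simp add: wronskian_def)
    have "(\<alpha> z * \<delta> z - \<beta> z * \<gamma> z) * W1 = W2"
      unfolding s(7)[OF Re, symmetric] s'(7)[OF Re, symmetric] wronskian_def
        trans1[OF Re, symmetric] trans2[OF Re, symmetric] \<zeta>[symmetric] by (simp add: algebra_simps)
    hence w3: "\<alpha> z * \<delta> z - \<beta> z * \<gamma> z = W" using s(4) by (simp add: W_def field_simps)
    have e1: "(\<delta> z * p z - z\<^sup>2 * deriv \<gamma> z - q z * \<alpha> z) * s \<zeta> + (\<gamma> z - z\<^sup>2 * deriv \<delta> z - q z * \<beta> z) * t \<zeta> = 0"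
      by (rule step2[OF Re s(1) s'(1) \<zeta>]) (rule trans1 trans2, assumption)+
    have e2: "(\<delta> z * p z - z\<^sup>2 * deriv \<gamma> z - q z * \<alpha> z) * turn s \<zeta> + (\<gamma> z - z\<^sup>2 * deriv \<delta> z - q z * \<beta> z) * turn t \<zeta> = 0"
      by (rule step2[OF Re companion_sol_shift[OF s(1)] companion_sol_shift[OF s'(1)] \<zeta>]) (rule trans1 trans2, assumption)+
    have "\<delta> z * p z - z\<^sup>2 * deriv \<gamma> z - q z * \<alpha> z = 0" "\<gamma> z - z\<^sup>2 * deriv \<delta> z - q z * \<beta> z = 0"
      using lincomb_zero_2x2[OF e1 e2] w by (simp_all add: mult.commute)
    with w3 show ?thesis by (simp add: algebra_simps)
  qed
  have same_deriv: "deriv \<phi> z = deriv \<psi> z"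
    if "\<And>z. z \<in> ball 0 (exp L) - {0} \<Longrightarrow> \<phi> z = \<psi> z" "z \<in> ball 0 (exp L) - {0}" for \<phi> \<psi> :: "complex \<Rightarrow> complex" and z
    by (rule deriv_cong_ev[OF eventually_nhds_in_open[OF op that(2), THEN eventually_mono]]) (use that in auto)
  have d2: "deriv (\<lambda>z. z\<^sup>2 * \<phi> z) z = 2 * z * \<phi> z + z\<^sup>2 * deriv \<phi> z"
    if "\<phi> holomorphic_on ball 0 (exp L) - {0}" "z \<in> ball 0 (exp L) - {0}" for \<phi> z
    using holomorphic_derivI[OF that(1) op that(2)]
    by (intro DERIV_imp_deriv) (auto intro!: derivative_eq_intros)
  \<comment> \<open>The determinant equation in terms of z^2 \<alpha> and z^2 \<beta>: the
    derivatives of the two factors z^2 cancel, which leaves the plain factor z^4.\<close>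
  have identity: "(F z)\<^sup>2 - z\<^sup>2 * (F z * deriv G z - G z * deriv F z) - (G z)\<^sup>2 * p z = z ^ (2 * 2) * W"
    if z: "z \<in> ball 0 (exp L) - {0}" for z
  proof -
    have "deriv F z = 2 * z * \<alpha> z + z\<^sup>2 * deriv \<alpha> z" "deriv G z = 2 * z * \<beta> z + z\<^sup>2 * deriv \<beta> z"
      using same_deriv[OF F(2) z] same_deriv[OF G(2) z] d2[OF \<alpha>(1) z] d2[OF \<beta>(1) z] by simp_all
    hence "(F z)\<^sup>2 - z\<^sup>2 * (F z * deriv G z - G z * deriv F z) - (G z)\<^sup>2 * p z = z ^ 4 * (\<alpha> z * \<delta> z - \<beta> z * \<gamma> z)"
      unfolding F(2)[OF z] G(2)[OF z] \<gamma>_def \<delta>_def by (simp add: algebra_simps power2_eq_square power4_eq_xxxx)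
    thus ?thesis using gauge[OF z] by simp
  qed
  obtain A B where A: "A holomorphic_on ball 0 (exp L)" and B: "B holomorphic_on ball 0 (exp L)"
    and FG: "\<forall>z\<in>ball 0 (exp L). F z = z ^ 2 * A z \<and> G z = z ^ 2 * B z"
    and AB: "\<forall>z\<in>ball 0 (exp L). (A z)\<^sup>2 - z\<^sup>2 * (A z * deriv B z - B z * deriv A z) - (B z)\<^sup>2 * p z = W"
    using pole_descent[OF exp_gt_zero S1.p_hol S1.p0 S1.p1 F(1) G(1) identity] by blast
  have A\<alpha>: "A z = \<alpha> z" and B\<beta>: "B z = \<beta> z" if "z \<in> ball 0 (exp L) - {0}" for z
    using FG F(2)[OF that] G(2)[OF that] that by auto
  show thesis
  proof (rule that[OF A B W0])
    fix C D :: "complex \<Rightarrow> complex" and z :: complex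
    assume C: "C = (\<lambda>z. B z * p z - z\<^sup>2 * deriv A z)" and D: "D = (\<lambda>z. A z - z\<^sup>2 * deriv B z)"
      and z: "z \<in> ball 0 (exp L)"
    have "A z * D z - B z * C z = (A z)\<^sup>2 - z\<^sup>2 * (A z * deriv B z - B z * deriv A z) - (B z)\<^sup>2 * p z"
      by (simp add: C D algebra_simps power2_eq_square)
    also have "\<dots> = W" using AB z by blast
    finally have 1: "A z * D z - B z * C z = W" .
    have 2: "A z * q z = D z * p z - z\<^sup>2 * deriv C z \<and> B z * q z = C z - z\<^sup>2 * deriv D z"
    proof (cases "z = 0")
      case True
      thus ?thesis by (simp add: S1.p0 S2.p0 C)
    next
      case False
      hence z': "z \<in> ball 0 (exp L) - {0}" using z by simp
      have C\<gamma>: "C z = \<gamma> z" and D\<delta>: "D z = \<delta> z" if "z \<in> ball 0 (exp L) - {0}" for z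
        using same_deriv[OF A\<alpha> that] same_deriv[OF B\<beta> that] A\<alpha>[OF that] B\<beta>[OF that]
        by (simp_all add: C D \<gamma>_def \<delta>_def)
      show ?thesis
        using gauge[OF z'] same_deriv[OF C\<gamma> z'] same_deriv[OF D\<delta> z'] C\<gamma>[OF z'] D\<delta>[OF z'] A\<alpha>[OF z'] B\<beta>[OF z'] by simp
    qed
    show "A z * D z - B z * C z = W \<and> A z * q z = D z * p z - z\<^sup>2 * deriv C z \<and> B z * q z = C z - z\<^sup>2 * deriv D z"
      using 1 2 by blast
  qed
qed

section \<open>Entire companion systems and the quadratic model\<close>

lemma ex_fundamental_companion_sol:
  fixes p :: "complex \<Rightarrow> complex"
  assumes "p holomorphic_on UNIV"
  obtains y1 v1 y2 v2 where "\<And>L. companion_sol p L y1 v1" "\<And>L. companion_sol p L y2 v2"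
    "\<And>\<zeta>. wronskian y1 v1 y2 v2 \<zeta> \<noteq> 0"
proof -
  have hol: "(\<lambda>\<zeta>. - exp (- \<zeta>)) holomorphic_on eball 0 \<infinity>" "(\<lambda>\<zeta>. - exp (- \<zeta>) * p (exp \<zeta>)) holomorphic_on eball 0 \<infinity>"
    "(\<lambda>\<zeta>::complex. 0) holomorphic_on eball 0 \<infinity>"
    by (auto intro!: holomorphic_intros holomorphic_on_compose_gen[OF _ assms, unfolded o_def])
  have ex: "\<exists>y v. y 0 = a \<and> v 0 = b \<and> (\<forall>L. companion_sol p L y v)" for a b
  proof -
    obtain y v where yv: "y 0 = a" "v 0 = b"
      "\<And>\<zeta>. \<zeta> \<in> eball 0 \<infinity> \<Longrightarrow> (y has_field_derivative 0 * y \<zeta> + - exp (- \<zeta>) * v \<zeta>) (at \<zeta>)"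
      "\<And>\<zeta>. \<zeta> \<in> eball 0 \<infinity> \<Longrightarrow> (v has_field_derivative - exp (- \<zeta>) * p (exp \<zeta>) * y \<zeta> + 0 * v \<zeta>) (at \<zeta>)"
      using linear_system_solution[OF hol(3,1,2,3), of a b] by blast
    hence "companion_sol p L y v" for L unfolding companion_sol_def by simp
    thus ?thesis using yv by blast
  qed
  obtain y1 v1 where 1: "y1 0 = 1" "v1 0 = 0" "\<And>L. companion_sol p L y1 v1" using ex[of 1 0] by blast
  obtain y2 v2 where 2: "y2 0 = 0" "v2 0 = 1" "\<And>L. companion_sol p L y2 v2" using ex[of 0 1] by blast
  have "wronskian y1 v1 y2 v2 \<zeta> \<noteq> 0" for \<zeta>
  proof -
    obtain W where W: "\<And>\<xi>. Re \<xi> < max (Re \<zeta>) 0 + 1 \<Longrightarrow> wronskian y1 v1 y2 v2 \<xi> = W"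
      using wronskian_const[OF 1(3) 2(3)] by blast
    have "W = 1" using W[of 0] 1 2 by (simp add: wronskian_def)
    thus ?thesis using W[of \<zeta>] by simp
  qed
  thus thesis using that 1 2 by blast
qed

text \<open>The power series with t \<Phi>'' = 2 b \<Phi>' + c \<Phi> and \<Phi>(0) = 1, of Bessel
  type. For t = 1 / z the function z^b \<Phi>(t) is the first component of a solution of the
  quadratic companion system.\<close>

fun frobenius_coeff :: "complex \<Rightarrow> complex \<Rightarrow> nat \<Rightarrow> complex" where
  "frobenius_coeff c b 0 = 1"
| "frobenius_coeff c b (Suc n) = c * frobenius_coeff c b n / (of_nat (Suc n) * (of_nat n - 2 * b))"

text \<open>The factors n - 2 b stay at distance at least - 2 Re b from 0, so an exponential series
  is a majorant.\<close>

lemma frobenius_radius: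
  assumes "Re b < 0"
  shows "fps_conv_radius (Abs_fps (frobenius_coeff c b)) = \<infinity>"
proof -
  define d where "d = - 2 * Re b"
  have d: "d > 0" using assms by (simp add: d_def)
  have den: "d \<le> cmod (of_nat n - 2 * b)" for n
  proof -
    have "d \<le> Re (of_nat n - 2 * b)" by (simp add: d_def)
    also have "\<dots> \<le> cmod (of_nat n - 2 * b)" by (rule complex_Re_le_cmod)
    finally show ?thesis .
  qed
  have bd: "cmod (frobenius_coeff c b n) \<le> (cmod c / d) ^ n / fact n" for n
  proof (induction n)
    case (Suc n)
    have "cmod (frobenius_coeff c b (Suc n)) = cmod c * cmod (frobenius_coeff c b n) / (real (Suc n) * cmod (of_nat n - 2 * b))"
      by (simp add: norm_mult norm_divide del: of_nat_Suc)
    also have "\<dots> \<le> cmod c * ((cmod c / d) ^ n / fact n) / (real (Suc n) * d)"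
      using Suc den d by (intro frac_le mult_left_mono mult_nonneg_nonneg) auto
    also have "\<dots> = (cmod c / d) ^ Suc n / fact (Suc n)" by (simp add: field_simps)
    finally show ?case .
  qed simp
  have "summable (\<lambda>n. frobenius_coeff c b n * of_real r ^ n)" if r: "r > 0" for r
  proof (rule summable_comparison_test')
    have "summable (\<lambda>n. (cmod c / d * r) ^ n / fact n)"
      using summable_exp[of "cmod c / d * r"] by (simp add: divide_inverse mult.commute)
    moreover have "(cmod c / d) ^ n / fact n * r ^ n = (cmod c / d * r) ^ n / fact n" for n
      by (simp add: power_mult_distrib power_divide)
    ultimately show "summable (\<lambda>n. (cmod c / d) ^ n / fact n * r ^ n)" by (simp only:)
    show "norm (frobenius_coeff c b n * of_real r ^ n) \<le> (cmod c / d) ^ n / fact n * r ^ n" if "n \<ge> 0" for n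
      using mult_right_mono[OF bd, of "r ^ n"] r by (simp add: norm_mult norm_power)
  qed
  hence "\<infinity> \<le> fps_conv_radius (Abs_fps (frobenius_coeff c b))"
    unfolding fps_conv_radius_def by (intro conv_radius_geI_ex') auto
  thus ?thesis by simp
qed

lemma frobenius_algebra:
  fixes b c t E P P1 P2 :: complex
  assumes "t \<noteq> 0"
  shows "b * E * P + (P1 * - t) * E = - t * (E * (P1 - b * (1 / t) * P))"
    and "b * E * (P1 - b * (1 / t) * P) + (P2 * - t - (b * (1 / t) * P + (P1 * - t) * (b * (1 / t)))) * E =
       E * (2 * b * P1 - t * P2 - (b\<^sup>2 + b) * (1 / t) * P)"
    and "E * (2 * b * P1 - (2 * b * P1 + c * P) - (b\<^sup>2 + b) * (1 / t) * P) =
       - t * (c * (1 / t) + (b\<^sup>2 + b) * (1 / t)\<^sup>2) * (E * P)"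
  using assms by (simp_all add: field_simps power2_eq_square)

text \<open>Solution with exponent \<open>b\<close> at the regular singular point \<open>z = \<infinity>\<close>, in the variable \<open>exp (- \<zeta>) = 1 / z\<close>.\<close>

lemma frobenius_solution:
  fixes b c :: complex
  assumes b: "Re b < 0"
  obtains f g where "\<And>L. companion_sol (\<lambda>z. c * z + (b\<^sup>2 + b) * z\<^sup>2) L f g"
    "\<And>\<zeta>. f (\<zeta> + 2 * of_real pi * \<i>) = exp (2 * of_real pi * \<i> * b) * f \<zeta>"
    "\<And>\<zeta>. g (\<zeta> + 2 * of_real pi * \<i>) = exp (2 * of_real pi * \<i> * b) * g \<zeta>"
    "\<exists>\<zeta>. f \<zeta> \<noteq> 0"
proof -
  define F where "F = Abs_fps (frobenius_coeff c b)"
  have rad: "fps_conv_radius F = \<infinity>" unfolding F_def by (rule frobenius_radius[OF b])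
  have rad': "fps_conv_radius (fps_deriv F) = \<infinity>" "fps_conv_radius (fps_deriv (fps_deriv F)) = \<infinity>"
    using fps_conv_radius_deriv[of F] fps_conv_radius_deriv[of "fps_deriv F"] rad by auto
  define \<Phi> where "\<Phi> = eval_fps F"
  define \<Phi>1 where "\<Phi>1 = eval_fps (fps_deriv F)"
  define \<Phi>2 where "\<Phi>2 = eval_fps (fps_deriv (fps_deriv F))"
  have \<Phi>: "(\<Phi> has_field_derivative \<Phi>1 t) (at t)" and \<Phi>1: "(\<Phi>1 has_field_derivative \<Phi>2 t) (at t)" for t
    unfolding \<Phi>_def \<Phi>1_def \<Phi>2_def by (intro has_field_derivative_eval_fps; simp add: rad rad')+
  have ode: "t * \<Phi>2 t = 2 * b * \<Phi>1 t + c * \<Phi> t" for t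
  proof -
    have "fps_X * fps_deriv (fps_deriv F) = fps_const (2 * b) * fps_deriv F + fps_const c * F"
    proof (rule fps_ext)
      fix n
      have nz: "of_nat n - 2 * b \<noteq> 0"
      proof
        assume "of_nat n - 2 * b = 0"
        hence "Re (of_nat n - 2 * b) = 0" by simp
        thus False using b by simp
      qed
      have "of_nat n * (of_nat (Suc n) * frobenius_coeff c b (Suc n)) =
        2 * b * (of_nat (Suc n) * frobenius_coeff c b (Suc n)) + c * frobenius_coeff c b n"
        using nz by (simp add: field_simps del: of_nat_Suc)
      thus "fps_nth (fps_X * fps_deriv (fps_deriv F)) n = fps_nth (fps_const (2 * b) * fps_deriv F + fps_const c * F) n"
        by (cases n) (simp_all add: F_def fps_X_mult_nth algebra_simps)
    qed
    moreover have "eval_fps (fps_X * fps_deriv (fps_deriv F)) t = t * \<Phi>2 t"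
      by (subst eval_fps_mult) (auto simp: rad' \<Phi>2_def)
    moreover have "fps_conv_radius (fps_const (2 * b) * fps_deriv F) = \<infinity>" "fps_conv_radius (fps_const c * F) = \<infinity>"
      using fps_conv_radius_mult[of "fps_const (2 * b)" "fps_deriv F"] fps_conv_radius_mult[of "fps_const c" F] rad rad' by auto
    hence "eval_fps (fps_const (2 * b) * fps_deriv F + fps_const c * F) t = 2 * b * \<Phi>1 t + c * \<Phi> t"
      by (subst eval_fps_add) (auto simp: eval_fps_mult rad rad' \<Phi>_def \<Phi>1_def)
    ultimately show ?thesis by simp
  qed
  define f where "f \<zeta> = exp (b * \<zeta>) * \<Phi> (exp (- \<zeta>))" for \<zeta>
  define g where "g \<zeta> = exp (b * \<zeta>) * (\<Phi>1 (exp (- \<zeta>)) - b * exp \<zeta> * \<Phi> (exp (- \<zeta>)))" for \<zeta>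
  have e: "((\<lambda>\<zeta>. exp (- \<zeta>)) has_field_derivative - exp (- \<zeta>)) (at \<zeta>)" for \<zeta> :: complex
    by (auto intro!: derivative_eq_intros)
  have eb: "((\<lambda>\<zeta>. exp (b * \<zeta>)) has_field_derivative b * exp (b * \<zeta>)) (at \<zeta>)" for \<zeta>
    by (auto intro!: derivative_eq_intros)
  have d0: "((\<lambda>\<zeta>. \<Phi> (exp (- \<zeta>))) has_field_derivative \<Phi>1 (exp (- \<zeta>)) * - exp (- \<zeta>)) (at \<zeta>)"
    and d1: "((\<lambda>\<zeta>. \<Phi>1 (exp (- \<zeta>))) has_field_derivative \<Phi>2 (exp (- \<zeta>)) * - exp (- \<zeta>)) (at \<zeta>)" for \<zeta>
    by (rule DERIV_chain2[OF \<Phi> e] DERIV_chain2[OF \<Phi>1 e])+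
  have inv: "exp \<zeta> * exp (- \<zeta>) = 1" for \<zeta> :: complex by (simp add: exp_minus)
  have sol: "companion_sol (\<lambda>z. c * z + (b\<^sup>2 + b) * z\<^sup>2) L f g" for L
    unfolding companion_sol_def
  proof (intro allI impI conjI)
    fix \<zeta> :: complex
    define E Z t where "E = exp (b * \<zeta>)" and "Z = exp \<zeta>" and "t = exp (- \<zeta>)"
    have Zt: "Z = 1 / t" "t \<noteq> 0" using inv[of \<zeta>] by (auto simp: Z_def t_def exp_minus divide_inverse)
    have "(f has_field_derivative b * E * \<Phi> t + (\<Phi>1 t * - t) * E) (at \<zeta>)"
      unfolding f_def[abs_def] E_def t_def by (rule DERIV_mult[OF eb d0])
    moreover have "b * E * \<Phi> t + (\<Phi>1 t * - t) * E = - t * g \<zeta>"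
      unfolding g_def E_def[symmetric] t_def[symmetric] Z_def[symmetric] Zt(1) by (rule frobenius_algebra(1)[OF Zt(2)])
    ultimately show "(f has_field_derivative - exp (- \<zeta>) * g \<zeta>) (at \<zeta>)" by (simp add: t_def)
    have "((\<lambda>\<zeta>. b * exp \<zeta> * \<Phi> (exp (- \<zeta>))) has_field_derivative b * Z * \<Phi> t + (\<Phi>1 t * - t) * (b * Z)) (at \<zeta>)"
      unfolding Z_def t_def by (rule DERIV_mult[OF DERIV_cmult[OF DERIV_exp] d0])
    hence "(g has_field_derivative b * E * (\<Phi>1 t - b * Z * \<Phi> t) + (\<Phi>2 t * - t - (b * Z * \<Phi> t + (\<Phi>1 t * - t) * (b * Z))) * E) (at \<zeta>)"
      unfolding g_def[abs_def] E_def t_def Z_def by (intro DERIV_mult[OF eb DERIV_diff[OF d1]])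
    moreover have "b * E * (\<Phi>1 t - b * Z * \<Phi> t) + (\<Phi>2 t * - t - (b * Z * \<Phi> t + (\<Phi>1 t * - t) * (b * Z))) * E =
       E * (2 * b * \<Phi>1 t - t * \<Phi>2 t - (b\<^sup>2 + b) * Z * \<Phi> t)"
      unfolding Zt(1) by (rule frobenius_algebra(2)[OF Zt(2)])
    moreover have "\<dots> = - t * (c * Z + (b\<^sup>2 + b) * Z\<^sup>2) * f \<zeta>"
      unfolding ode f_def E_def[symmetric] t_def[symmetric] Zt(1) by (rule frobenius_algebra(3)[OF Zt(2)])
    ultimately show "(g has_field_derivative - exp (- \<zeta>) * (c * exp \<zeta> + (b\<^sup>2 + b) * (exp \<zeta>)\<^sup>2) * f \<zeta>) (at \<zeta>)"
      by (simp add: t_def Z_def)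
  qed
  have e1: "exp (- (\<zeta> + 2 * of_real pi * \<i>)) = exp (- \<zeta>)" "exp (\<zeta> + 2 * of_real pi * \<i>) = exp \<zeta>"
    "exp (b * (\<zeta> + 2 * of_real pi * \<i>)) = exp (2 * of_real pi * \<i> * b) * exp (b * \<zeta>)" for \<zeta>
    by (simp_all only: exp_minus exp_add exp_two_pi_i mult_1_right distrib_left mult.commute[of b] mult.commute[of _ "exp (\<zeta> * b)"])
  have "isCont \<Phi> 0" using \<Phi> DERIV_isCont by blast
  moreover have "\<Phi> 0 = 1" by (simp add: \<Phi>_def eval_fps_at_0 F_def)
  ultimately have "eventually (\<lambda>t. \<Phi> t \<noteq> 0) (nhds 0)"
    by (intro tendsto_imp_eventually_ne[of \<Phi> 1]) (auto simp: isCont_def continuous_within tendsto_nhds_iff)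
  then obtain \<epsilon> where \<epsilon>: "\<epsilon> > 0" "\<And>t. dist t 0 < \<epsilon> \<Longrightarrow> \<Phi> t \<noteq> 0" unfolding eventually_nhds_metric by blast
  \<comment> \<open>Nonvanishing is visible far to the right, where \<open>exp (- \<zeta>)\<close>
    is near 0 and \<Phi> is near 1.\<close>
  have "f (of_real (- ln (\<epsilon> / 2))) \<noteq> 0"
  proof -
    have "cmod (exp (- of_real (- ln (\<epsilon> / 2)))) = \<epsilon> / 2" using \<epsilon>(1) by simp
    thus ?thesis using \<epsilon> by (simp add: f_def)
  qed
  moreover have "f (\<zeta> + 2 * of_real pi * \<i>) = exp (2 * of_real pi * \<i> * b) * f \<zeta>"
    "g (\<zeta> + 2 * of_real pi * \<i>) = exp (2 * of_real pi * \<i> * b) * g \<zeta>" for \<zeta>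
    unfolding f_def g_def e1 by (simp_all only: mult.assoc)
  ultimately show thesis using that[OF sol] by blast
qed

lemma companion_system_model:
  assumes b: "Re b < 0" and c: "c \<noteq> 0"
  obtains y1 v1 y2 v2 f g where
    "companion_system (\<lambda>z. c * z + (b\<^sup>2 + b) * z\<^sup>2) L y1 v1 y2 v2 f g (exp (2 * of_real pi * \<i> * b))"
proof -
  let ?p = "\<lambda>z. c * z + (b\<^sup>2 + b) * z\<^sup>2"
  have hol: "?p holomorphic_on S" for S by (intro holomorphic_intros)
  obtain y1 v1 y2 v2 where Y: "\<And>L. companion_sol ?p L y1 v1" "\<And>L. companion_sol ?p L y2 v2"
    "\<And>\<zeta>. wronskian y1 v1 y2 v2 \<zeta> \<noteq> 0"
    using ex_fundamental_companion_sol[OF hol] by blast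
  obtain f g where fg: "\<And>L. companion_sol ?p L f g"
    "\<And>\<zeta>. f (\<zeta> + 2 * of_real pi * \<i>) = exp (2 * of_real pi * \<i> * b) * f \<zeta>"
    "\<And>\<zeta>. g (\<zeta> + 2 * of_real pi * \<i>) = exp (2 * of_real pi * \<i> * b) * g \<zeta>"
    "\<exists>\<zeta>. f \<zeta> \<noteq> 0"
    by (rule frobenius_solution[OF b, of c], rule that)
  obtain \<zeta>1 where \<zeta>1: "f \<zeta>1 \<noteq> 0" using fg(4) by blast
  have "deriv ?p 0 = c"
    by (rule DERIV_imp_deriv) (auto intro!: derivative_eq_intros)
  moreover have "f (Complex (L - 1) 0) \<noteq> 0 \<or> g (Complex (L - 1) 0) \<noteq> 0"
  proof (rule ccontr)
    assume "\<not> (f (Complex (L - 1) 0) \<noteq> 0 \<or> g (Complex (L - 1) 0) \<noteq> 0)"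
    hence z: "f (Complex (L - 1) 0) = 0" "g (Complex (L - 1) 0) = 0" by simp_all
    \<comment> \<open>The point where \<open>f\<close> is known not to vanish may lie outside the
      half-plane, so uniqueness is applied on a larger one that contains both points.\<close>
    define L' where "L' = max L (Re \<zeta>1 + 1)"
    have L': "Re (Complex (L - 1) 0) < L'" "Re \<zeta>1 < L'" by (auto simp: L'_def)
    have "f \<zeta>1 = 0"
      by (rule companion_sol_zero(1)[OF Y(1)[of L'] Y(2)[of L'] fg(1)[of L'] Y(3) L'(1) z L'(2)])
    thus False using \<zeta>1 by simp
  qed
  hence "\<exists>\<zeta>. Re \<zeta> < L \<and> (f \<zeta> \<noteq> 0 \<or> g \<zeta> \<noteq> 0)" by (intro exI[of _ "Complex (L - 1) 0"]) simp
  ultimately have "companion_system ?p L y1 v1 y2 v2 f g (exp (2 * of_real pi * \<i> * b))"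
    using c Y fg by unfold_locales (auto intro: hol)
  thus thesis by (rule that)
qed

section \<open>Bundles of rank 2 and their frames\<close>

definition det2 :: "complex ^ 2 \<Rightarrow> complex ^ 2 \<Rightarrow> complex" where
  "det2 x y = x $ 1 * y $ 2 - x $ 2 * y $ 1"

lemma vec2_eqI: "(x :: complex ^ 2) $ 1 = y $ 1 \<Longrightarrow> x $ 2 = y $ 2 \<Longrightarrow> x = y"
  by (simp add: vec_eq_iff forall_2)

lemma matrix_vector_2:
  "((g :: complex ^ 2 ^ 2) *v x) $ i = g $ i $ 1 * x $ 1 + g $ i $ 2 * x $ 2"
  by (simp add: matrix_vector_mult_def sum_2)

lemma det2_matrix_vector: "det2 (g *v x) (g *v y) = det g * det2 x y"
  by (simp add: det2_def matrix_vector_2 det_2 algebra_simps)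

lemma det2_lincomb:
  "det2 (a *s x + b *s y) y = a * det2 x y" "det2 x (a *s x + b *s y) = b * det2 x y"
  by (simp_all add: det2_def algebra_simps)

lemma cramer_2:
  assumes "det2 x y \<noteq> 0"
  shows "e = (det2 e y / det2 x y) *s x + (det2 x e / det2 x y) *s y"
proof -
  have "e $ i = det2 e y / det2 x y * x $ i + det2 x e / det2 x y * y $ i" if "i = 1 \<or> i = 2" for i
  proof -
    have "e $ i * det2 x y = det2 e y * x $ i + det2 x e * y $ i"
      using that by (auto simp: det2_def algebra_simps)
    thus ?thesis using assms by (simp add: field_simps)
  qed
  thus ?thesis by (intro vec2_eqI) auto
qed

lemma lincomb_eq_0_det2:
  assumes "a *s x + b *s y = 0" "det2 x y \<noteq> 0" shows "a = 0" "b = 0"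
  using assms det2_lincomb(1)[of a x b y] det2_lincomb(2)[of x a b y] by (auto simp: det2_def)

locale bundle2 =
  fixes H :: "('h, 2) te"
  assumes holomorphic_bundle: "holomorphic_bundle H"
begin

lemma chart_open: "(U, \<phi>) \<in> atlas H \<Longrightarrow> open U"
  using holomorphic_bundle unfolding holomorphic_bundle_def by blast

lemma chart_bij: "(U, \<phi>) \<in> atlas H \<Longrightarrow> bij_betw (\<lambda>e. (base H e, \<phi> e)) {e \<in> total H. base H e \<in> U} (U \<times> UNIV)"
  using holomorphic_bundle unfolding holomorphic_bundle_def by blast

lemma ex_chart: obtains U \<phi> where "(U, \<phi>) \<in> atlas H" "z \<in> U"
  using holomorphic_bundle unfolding holomorphic_bundle_def by blast

lemma ex_transition:
  assumes "(U, \<phi>) \<in> atlas H" "(V, \<psi>) \<in> atlas H"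
  obtains g :: "complex \<Rightarrow> complex ^ 2 ^ 2" where "holomorphic_matrix_on g (U \<inter> V)"
    "\<And>e z. e \<in> fibre H z \<Longrightarrow> z \<in> U \<Longrightarrow> z \<in> V \<Longrightarrow> \<psi> e = g z *v \<phi> e"
proof -
  have "\<forall>(U, \<phi>) \<in> atlas H. \<forall>(V, \<psi>) \<in> atlas H.
        \<exists>g :: complex \<Rightarrow> complex ^ 2 ^ 2. holomorphic_matrix_on g (U \<inter> V) \<and>
          (\<forall>e \<in> total H. base H e \<in> U \<inter> V \<longrightarrow> \<psi> e = g (base H e) *v \<phi> e)"
    using holomorphic_bundle unfolding holomorphic_bundle_def by (elim conjE)
  from bspec[OF this assms(1), unfolded prod.case, THEN bspec, OF assms(2), unfolded prod.case]
  obtain g :: "complex \<Rightarrow> complex ^ 2 ^ 2" where "holomorphic_matrix_on g (U \<inter> V)"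
    "\<forall>e \<in> total H. base H e \<in> U \<inter> V \<longrightarrow> \<psi> e = g (base H e) *v \<phi> e" by (elim exE conjE)
  thus thesis using that[of g] by (auto simp: fibre_def)
qed

lemma chart_inj:
  assumes "(U, \<phi>) \<in> atlas H" "z \<in> U" "x \<in> fibre H z" "y \<in> fibre H z" "\<phi> x = \<phi> y"
  shows "x = y"
  using bij_betw_imp_inj_on[OF chart_bij[OF assms(1)]] assms(2-5)
  by (auto simp: fibre_def inj_on_def)

lemma chart_surj:
  assumes "(U, \<phi>) \<in> atlas H" "z \<in> U"
  obtains e where "e \<in> fibre H z" "\<phi> e = c"
proof -
  have "(z, c) \<in> (\<lambda>e. (base H e, \<phi> e)) ` {e \<in> total H. base H e \<in> U}"
    using bij_betw_imp_surj_on[OF chart_bij[OF assms(1)]] assms(2) by simp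
  thus thesis using that by (auto simp: fibre_def)
qed

lemma base_fibre [simp]: "x \<in> fibre H z \<Longrightarrow> base H x = z"
  by (simp add: fibre_def)

text \<open>A point of a fibre can be prescribed by its values in all charts if these are compatible
  with the transition matrices. This justifies the definite descriptions of zero, sum and
  multiple.\<close>

lemma the_element:
  assumes "\<And>U \<phi> V \<psi> g. (U, \<phi>) \<in> atlas H \<Longrightarrow> (V, \<psi>) \<in> atlas H \<Longrightarrow> z \<in> U \<Longrightarrow> z \<in> V \<Longrightarrow>
     (\<And>e. e \<in> fibre H z \<Longrightarrow> \<psi> e = g *v \<phi> e) \<Longrightarrow> F \<psi> = g *v F \<phi>"
  shows "\<exists>!e. e \<in> fibre H z \<and> (\<forall>(U, \<phi>) \<in> atlas H. z \<in> U \<longrightarrow> \<phi> e = F \<phi>)"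
proof -
  obtain U \<phi> where U: "(U, \<phi>) \<in> atlas H" "z \<in> U" using ex_chart by blast
  obtain e where e: "e \<in> fibre H z" "\<phi> e = F \<phi>" using chart_surj[OF U] by blast
  have "\<psi> e = F \<psi>" if V: "(V, \<psi>) \<in> atlas H" "z \<in> V" for V \<psi>
  proof -
    obtain g :: "complex \<Rightarrow> complex ^ 2 ^ 2" where g: "\<And>e z. e \<in> fibre H z \<Longrightarrow> z \<in> U \<Longrightarrow> z \<in> V \<Longrightarrow> \<psi> e = g z *v \<phi> e"
      by (rule ex_transition[OF U(1) V(1)], rule that)
    have "F \<psi> = g z *v F \<phi>" by (rule assms[OF U(1) V(1) U(2) V(2)]) (use g U V in auto)
    thus ?thesis using g[OF e(1) U(2) V(2)] e(2) by simp
  qed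
  hence "e \<in> fibre H z \<and> (\<forall>(U, \<phi>) \<in> atlas H. z \<in> U \<longrightarrow> \<phi> e = F \<phi>)" using e(1) by blast
  moreover have "x = e" if "x \<in> fibre H z \<and> (\<forall>(U, \<phi>) \<in> atlas H. z \<in> U \<longrightarrow> \<phi> x = F \<phi>)" for x
    using that U e by (intro chart_inj[OF U]) auto
  ultimately show ?thesis by blast
qed

lemma zero_fibre: "fibre_zero H z \<in> fibre H z"
  and zero_chart: "(U, \<phi>) \<in> atlas H \<Longrightarrow> z \<in> U \<Longrightarrow> \<phi> (fibre_zero H z) = 0"
  using theI'[OF the_element[of z "\<lambda>_. 0"]] unfolding fibre_zero_def by auto

lemma add_fibre: "x \<in> fibre H z \<Longrightarrow> y \<in> fibre H z \<Longrightarrow> fibre_add H x y \<in> fibre H z"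
  and add_chart: "(U, \<phi>) \<in> atlas H \<Longrightarrow> z \<in> U \<Longrightarrow> x \<in> fibre H z \<Longrightarrow> y \<in> fibre H z \<Longrightarrow>
    \<phi> (fibre_add H x y) = \<phi> x + \<phi> y"
proof -
  have *: "fibre_add H x y \<in> fibre H z \<and> (\<forall>(U, \<phi>) \<in> atlas H. z \<in> U \<longrightarrow> \<phi> (fibre_add H x y) = \<phi> x + \<phi> y)"
    if xy: "x \<in> fibre H z" "y \<in> fibre H z"
  proof -
    have "\<exists>!e. e \<in> fibre H z \<and> (\<forall>(U, \<phi>) \<in> atlas H. z \<in> U \<longrightarrow> \<phi> e = \<phi> x + \<phi> y)"
      by (rule the_element) (simp add: xy matrix_vector_right_distrib)
    from theI'[OF this] show ?thesis unfolding fibre_add_def base_fibre[OF xy(1)] .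
  qed
  thus "x \<in> fibre H z \<Longrightarrow> y \<in> fibre H z \<Longrightarrow> fibre_add H x y \<in> fibre H z"
    "(U, \<phi>) \<in> atlas H \<Longrightarrow> z \<in> U \<Longrightarrow> x \<in> fibre H z \<Longrightarrow> y \<in> fibre H z \<Longrightarrow> \<phi> (fibre_add H x y) = \<phi> x + \<phi> y"
    by auto
qed

lemma scale_fibre: "x \<in> fibre H z \<Longrightarrow> fibre_scale H c x \<in> fibre H z"
  and scale_chart: "(U, \<phi>) \<in> atlas H \<Longrightarrow> z \<in> U \<Longrightarrow> x \<in> fibre H z \<Longrightarrow> \<phi> (fibre_scale H c x) = c *s \<phi> x"
proof -
  have *: "fibre_scale H c x \<in> fibre H z \<and> (\<forall>(U, \<phi>) \<in> atlas H. z \<in> U \<longrightarrow> \<phi> (fibre_scale H c x) = c *s \<phi> x)"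
    if x: "x \<in> fibre H z"
  proof -
    have "\<exists>!e. e \<in> fibre H z \<and> (\<forall>(U, \<phi>) \<in> atlas H. z \<in> U \<longrightarrow> \<phi> e = c *s \<phi> x)"
      by (rule the_element) (simp add: x vector_scalar_commute)
    from theI'[OF this] show ?thesis unfolding fibre_scale_def base_fibre[OF x] .
  qed
  thus "x \<in> fibre H z \<Longrightarrow> fibre_scale H c x \<in> fibre H z"
    "(U, \<phi>) \<in> atlas H \<Longrightarrow> z \<in> U \<Longrightarrow> x \<in> fibre H z \<Longrightarrow> \<phi> (fibre_scale H c x) = c *s \<phi> x" by auto
qed

lemma comb_fibre: "x \<in> fibre H z \<Longrightarrow> y \<in> fibre H z \<Longrightarrow> comb2 H a x b y \<in> fibre H z"
  unfolding comb2_def by (intro add_fibre scale_fibre)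

lemma comb_chart:
  "(U, \<phi>) \<in> atlas H \<Longrightarrow> z \<in> U \<Longrightarrow> x \<in> fibre H z \<Longrightarrow> y \<in> fibre H z \<Longrightarrow> \<phi> (comb2 H a x b y) = a *s \<phi> x + b *s \<phi> y"
  unfolding comb2_def by (simp add: add_chart scale_chart scale_fibre)

lemmas chart_simps = add_fibre scale_fibre comb_fibre zero_fibre add_chart scale_chart comb_chart zero_chart

lemma fibre_eqI:
  assumes "x \<in> fibre H z" "y \<in> fibre H z"
    and "\<And>U \<phi>. (U, \<phi>) \<in> atlas H \<Longrightarrow> z \<in> U \<Longrightarrow> \<phi> x = \<phi> y"
  shows "x = y"
  using ex_chart[of z] chart_inj assms by metis

lemma comb_comb:
  assumes "x \<in> fibre H z" "y \<in> fibre H z"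
  shows "comb2 H p (comb2 H a x b y) q (comb2 H c x d y) = comb2 H (p * a + q * c) x (p * b + q * d) y"
  by (rule fibre_eqI[of _ z]; simp add: chart_simps assms; (intro vec2_eqI; simp add: algebra_simps))

lemma scale_comb:
  assumes "x \<in> fibre H z" "y \<in> fibre H z"
  shows "fibre_scale H c (comb2 H a x b y) = comb2 H (c * a) x (c * b) y"
  by (rule fibre_eqI[of _ z]; simp add: chart_simps assms; (intro vec2_eqI; simp add: algebra_simps))

lemma comb_zero:
  assumes "x \<in> fibre H z" "y \<in> fibre H z"
  shows "comb2 H 0 x 0 y = fibre_zero H z"
  by (rule fibre_eqI[of _ z]; simp add: chart_simps assms; (intro vec2_eqI; simp add: algebra_simps))

lemma comb_1:
  assumes "x \<in> fibre H z" "y \<in> fibre H z"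
  shows "comb2 H 1 x 0 y = x" "comb2 H 0 x 1 y = y"
  by (rule fibre_eqI[of _ z]; simp add: chart_simps assms; (intro vec2_eqI; simp))+

definition indep :: "complex \<Rightarrow> 'h \<Rightarrow> 'h \<Rightarrow> bool" where
  "indep z x y \<longleftrightarrow> x \<in> fibre H z \<and> y \<in> fibre H z \<and>
     (\<forall>(U, \<phi>) \<in> atlas H. z \<in> U \<longrightarrow> det2 (\<phi> x) (\<phi> y) \<noteq> 0)"

lemma indep_fibre: "indep z x y \<Longrightarrow> x \<in> fibre H z" "indep z x y \<Longrightarrow> y \<in> fibre H z"
  by (simp_all add: indep_def)

lemma indep_chart: "indep z x y \<Longrightarrow> (U, \<phi>) \<in> atlas H \<Longrightarrow> z \<in> U \<Longrightarrow> det2 (\<phi> x) (\<phi> y) \<noteq> 0"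
  unfolding indep_def by blast

text \<open>A transition matrix multiplies \<open>det2\<close> by its determinant, so a zero in any
  other chart would also be a zero in the given one.\<close>

lemma indepI:
  assumes "x \<in> fibre H z" "y \<in> fibre H z" "(U, \<phi>) \<in> atlas H" "z \<in> U" "det2 (\<phi> x) (\<phi> y) \<noteq> 0"
  shows "indep z x y"
  unfolding indep_def
proof (intro conjI ballI assms(1,2))
  fix c assume "c \<in> atlas H"
  moreover obtain V \<psi> where c: "c = (V, \<psi>)" by (cases c)
  ultimately have V: "(V, \<psi>) \<in> atlas H" by simp
  have "det2 (\<psi> x) (\<psi> y) \<noteq> 0" if z: "z \<in> V"
  proof
    assume 0: "det2 (\<psi> x) (\<psi> y) = 0"
    obtain g :: "complex \<Rightarrow> complex ^ 2 ^ 2" where g: "\<And>e z. e \<in> fibre H z \<Longrightarrow> z \<in> V \<Longrightarrow> z \<in> U \<Longrightarrow> \<phi> e = g z *v \<psi> e"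
      by (rule ex_transition[OF V assms(3)], rule that)
    have "det2 (\<phi> x) (\<phi> y) = 0"
      unfolding g[OF assms(1) z assms(4)] g[OF assms(2) z assms(4)] det2_matrix_vector 0 by simp
    thus False using assms(5) by simp
  qed
  thus "case c of (U, \<phi>) \<Rightarrow> z \<in> U \<longrightarrow> det2 (\<phi> x) (\<phi> y) \<noteq> 0" by (simp add: c)
qed

lemma indep_comb_eq:
  assumes "indep z x y" "comb2 H a x b y = comb2 H c x d y"
  shows "a = c" "b = d"
proof -
  note xy = indep_fibre[OF assms(1)]
  obtain U \<phi> where U: "(U, \<phi>) \<in> atlas H" "z \<in> U" using ex_chart by blast
  have "a *s \<phi> x + b *s \<phi> y = c *s \<phi> x + d *s \<phi> y"
    using arg_cong[OF assms(2), of \<phi>] U xy by (simp add: comb_chart)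
  hence "(a - c) *s \<phi> x + (b - d) *s \<phi> y = 0"
    by (simp add: vector_sub_rdistrib algebra_simps)
  from lincomb_eq_0_det2[OF this indep_chart[OF assms(1) U]] show "a = c" "b = d" by simp_all
qed

lemma indep_span:
  assumes "indep z x y" "e \<in> fibre H z"
  obtains a b where "e = comb2 H a x b y"
proof -
  note xy = indep_fibre[OF assms(1)]
  obtain U \<phi> where U: "(U, \<phi>) \<in> atlas H" "z \<in> U" using ex_chart by blast
  have "\<phi> e = \<phi> (comb2 H (det2 (\<phi> e) (\<phi> y) / det2 (\<phi> x) (\<phi> y)) x (det2 (\<phi> x) (\<phi> e) / det2 (\<phi> x) (\<phi> y)) y)"
    using cramer_2[OF indep_chart[OF assms(1) U]] U xy by (simp add: comb_chart)
  hence "e = comb2 H (det2 (\<phi> e) (\<phi> y) / det2 (\<phi> x) (\<phi> y)) x (det2 (\<phi> x) (\<phi> e) / det2 (\<phi> x) (\<phi> y)) y"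
    using assms xy by (intro chart_inj[OF U]) (auto intro: comb_fibre)
  thus thesis by (rule that)
qed

definition coord1 :: "'h \<Rightarrow> 'h \<Rightarrow> 'h \<Rightarrow> complex" where
  "coord1 x y e = (THE a. \<exists>b. e = comb2 H a x b y)"

definition coord2 :: "'h \<Rightarrow> 'h \<Rightarrow> 'h \<Rightarrow> complex" where
  "coord2 x y e = (THE b. \<exists>a. e = comb2 H a x b y)"

lemma coord_comb:
  assumes "indep z x y"
  shows "coord1 x y (comb2 H a x b y) = a" "coord2 x y (comb2 H a x b y) = b"
  unfolding coord1_def coord2_def using indep_comb_eq[OF assms] by (intro the_equality; blast)+

lemma comb_coord:
  assumes "indep z x y" "e \<in> fibre H z"
  shows "comb2 H (coord1 x y e) x (coord2 x y e) y = e"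
  using indep_span[OF assms] coord_comb[OF assms(1)] by metis

lemma coord_chart:
  assumes "indep z x y" "e \<in> fibre H z" "(U, \<phi>) \<in> atlas H" "z \<in> U"
  shows "coord1 x y e = det2 (\<phi> e) (\<phi> y) / det2 (\<phi> x) (\<phi> y)"
    and "coord2 x y e = det2 (\<phi> x) (\<phi> e) / det2 (\<phi> x) (\<phi> y)"
proof -
  have "\<phi> e = coord1 x y e *s \<phi> x + coord2 x y e *s \<phi> y"
    using comb_coord[OF assms(1,2)] comb_chart[OF assms(3,4) indep_fibre[OF assms(1)]] by metis
  thus "coord1 x y e = det2 (\<phi> e) (\<phi> y) / det2 (\<phi> x) (\<phi> y)"
    "coord2 x y e = det2 (\<phi> x) (\<phi> e) / det2 (\<phi> x) (\<phi> y)"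
    using det2_lincomb indep_chart[OF assms(1,3,4)] by (metis nonzero_mult_div_cancel_right)+
qed

lemma indep_comb_iff:
  assumes "indep z x y"
  shows "indep z (comb2 H a x b y) (comb2 H c x d y) \<longleftrightarrow> a * d - b * c \<noteq> 0"
proof -
  note xy = indep_fibre[OF assms(1)]
  have det: "det2 (\<phi> (comb2 H a x b y)) (\<phi> (comb2 H c x d y)) = (a * d - b * c) * det2 (\<phi> x) (\<phi> y)"
    if "(U, \<phi>) \<in> atlas H" "z \<in> U" for U \<phi>
    using that xy by (simp add: comb_chart) (simp add: det2_def algebra_simps)
  obtain U \<phi> where U: "(U, \<phi>) \<in> atlas H" "z \<in> U" using ex_chart by blast
  show ?thesis
  proof
    assume "indep z (comb2 H a x b y) (comb2 H c x d y)"
    from indep_chart[OF this U] show "a * d - b * c \<noteq> 0" using det[OF U] by auto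
  next
    assume "a * d - b * c \<noteq> 0"
    thus "indep z (comb2 H a x b y) (comb2 H c x d y)"
      using det[OF U] indep_chart[OF assms U] xy by (intro indepI[OF _ _ U]) (auto intro: comb_fibre)
  qed
qed

lemma hol_section_fibre: "hol_section H W s \<Longrightarrow> z \<in> W \<Longrightarrow> s z \<in> fibre H z"
  unfolding hol_section_def by (drule conjunct1) (rule bspec)

lemma hol_section_chart:
  "hol_section H W s \<Longrightarrow> (U, \<phi>) \<in> atlas H \<Longrightarrow> (\<lambda>z. \<phi> (s z) $ i) holomorphic_on (W \<inter> U)"
  unfolding hol_section_def by (drule conjunct2, drule (1) bspec) simp

lemma hol_sectionI:
  assumes "\<And>z. z \<in> W \<Longrightarrow> s z \<in> fibre H z"
    and "\<And>U \<phi> i. (U, \<phi>) \<in> atlas H \<Longrightarrow> (\<lambda>z. \<phi> (s z) $ i) holomorphic_on (W \<inter> U)"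
  shows "hol_section H W s"
  unfolding hol_section_def
proof (intro conjI ballI)
  fix c assume "c \<in> atlas H"
  thus "case c of (U, \<phi>) \<Rightarrow> \<forall>i. (\<lambda>z. \<phi> (s z) $ i) holomorphic_on (W \<inter> U)"
    using assms(2) by (cases c) simp
qed (rule assms(1))

lemma hol_section_subset:
  assumes "hol_section H W s" "W' \<subseteq> W" shows "hol_section H W' s"
proof (rule hol_sectionI)
  show "s z \<in> fibre H z" if "z \<in> W'" for z using hol_section_fibre[OF assms(1)] assms(2) that by blast
  show "(\<lambda>z. \<phi> (s z) $ i) holomorphic_on (W' \<inter> U)" if "(U, \<phi>) \<in> atlas H" for U \<phi> i
    by (rule holomorphic_on_subset[OF hol_section_chart[OF assms(1) that]]) (use assms(2) in auto)
qed

lemma hol_section_cong: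
  assumes "hol_section H W s" "\<And>z. z \<in> W \<Longrightarrow> s z = t z" shows "hol_section H W t"
proof (rule hol_sectionI)
  show "t z \<in> fibre H z" if "z \<in> W" for z
    using hol_section_fibre[OF assms(1) that] assms(2)[OF that] by simp
  show "(\<lambda>z. \<phi> (t z) $ i) holomorphic_on (W \<inter> U)" if "(U, \<phi>) \<in> atlas H" for U \<phi> i
    by (rule holomorphic_transform[OF hol_section_chart[OF assms(1) that]]) (use assms(2) in auto)
qed

lemma holomorphic_on_local:
  assumes "\<And>z. z \<in> A \<Longrightarrow> \<exists>N. open N \<and> z \<in> N \<and> f holomorphic_on (N \<inter> A)"
  shows "(f :: complex \<Rightarrow> complex) holomorphic_on A"
  unfolding holomorphic_on_def
proof
  fix z assume z: "z \<in> A"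
  then obtain N where N: "open N" "z \<in> N" "f holomorphic_on (N \<inter> A)" using assms by blast
  hence "f field_differentiable (at z within N \<inter> A)" using z by (auto simp: holomorphic_on_def)
  moreover have "at z within N \<inter> A = at z within A"
    using N(1,2) by (intro at_within_nhd[of _ N]) auto
  ultimately show "f field_differentiable (at z within A)" by simp
qed

lemma hol_section_local:
  assumes "\<And>z. z \<in> W \<Longrightarrow> \<exists>N. open N \<and> z \<in> N \<and> hol_section H (N \<inter> W) s"
  shows "hol_section H W s"
proof (rule hol_sectionI)
  show "s z \<in> fibre H z" if "z \<in> W" for z
    using assms[OF that] hol_section_fibre that by blast
  fix U \<phi> i assume U: "(U, \<phi>) \<in> atlas H"
  show "(\<lambda>z. \<phi> (s z) $ i) holomorphic_on (W \<inter> U)"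
  proof (rule holomorphic_on_local)
    fix z assume "z \<in> W \<inter> U"
    then obtain N where N: "open N" "z \<in> N" "hol_section H (N \<inter> W) s" using assms by blast
    thus "\<exists>N. open N \<and> z \<in> N \<and> (\<lambda>z. \<phi> (s z) $ i) holomorphic_on (N \<inter> (W \<inter> U))"
      using hol_section_chart[OF N(3) U, of i] by (intro exI[of _ N]) (simp add: Int_assoc)
  qed
qed

lemma hol_section_comb:
  assumes "hol_section H W s" "hol_section H W t" "f holomorphic_on W" "g holomorphic_on W"
  shows "hol_section H W (\<lambda>z. comb2 H (f z) (s z) (g z) (t z))"
proof (rule hol_sectionI)
  note fib = hol_section_fibre[OF assms(1)] hol_section_fibre[OF assms(2)]
  show "comb2 H (f z) (s z) (g z) (t z) \<in> fibre H z" if "z \<in> W" for z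
    by (rule comb_fibre[OF fib(1)[OF that] fib(2)[OF that]])
  fix U \<phi> i assume U: "(U, \<phi>) \<in> atlas H"
  have "(\<lambda>z. f z * \<phi> (s z) $ i + g z * \<phi> (t z) $ i) holomorphic_on (W \<inter> U)"
    by (intro holomorphic_intros hol_section_chart[OF assms(1) U] hol_section_chart[OF assms(2) U]
        holomorphic_on_subset[OF assms(3)] holomorphic_on_subset[OF assms(4)]) auto
  thus "(\<lambda>z. \<phi> (comb2 H (f z) (s z) (g z) (t z)) $ i) holomorphic_on (W \<inter> U)"
  proof (rule holomorphic_transform)
    fix z assume "z \<in> W \<inter> U"
    hence z: "z \<in> W" "z \<in> U" by simp_all
    show "f z * \<phi> (s z) $ i + g z * \<phi> (t z) $ i = \<phi> (comb2 H (f z) (s z) (g z) (t z)) $ i"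
      by (simp add: comb_chart[OF U z(2) fib(1)[OF z(1)] fib(2)[OF z(1)]])
  qed
qed

section \<open>Holomorphic frames and coordinates of sections\<close>

definition frame :: "complex set \<Rightarrow> (complex \<Rightarrow> 'h) \<Rightarrow> (complex \<Rightarrow> 'h) \<Rightarrow> bool" where
  "frame W v1 v2 \<longleftrightarrow> open W \<and> hol_section H W v1 \<and> hol_section H W v2 \<and> (\<forall>z\<in>W. indep z (v1 z) (v2 z))"

lemma frameD:
  assumes "frame W v1 v2"
  shows "open W" "hol_section H W v1" "hol_section H W v2" "z \<in> W \<Longrightarrow> indep z (v1 z) (v2 z)"
    "z \<in> W \<Longrightarrow> v1 z \<in> fibre H z" "z \<in> W \<Longrightarrow> v2 z \<in> fibre H z"
  using assms unfolding frame_def by (auto dest: indep_fibre)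

lemma frame_subset: "frame W v1 v2 \<Longrightarrow> open W' \<Longrightarrow> W' \<subseteq> W \<Longrightarrow> frame W' v1 v2"
  unfolding frame_def using hol_section_subset by blast

text \<open>In a chart, Cramer's rule writes the coordinates as quotients of holomorphic
  functions.\<close>

lemma coord_holomorphic:
  assumes fr: "frame W v1 v2" and s: "hol_section H W s"
  shows "(\<lambda>z. coord1 (v1 z) (v2 z) (s z)) holomorphic_on W" "(\<lambda>z. coord2 (v1 z) (v2 z) (s z)) holomorphic_on W"
proof -
  note fr = frameD[OF fr]
  have "\<exists>N. open N \<and> z \<in> N \<and> (\<lambda>z. coord1 (v1 z) (v2 z) (s z)) holomorphic_on (N \<inter> W) \<and>
       (\<lambda>z. coord2 (v1 z) (v2 z) (s z)) holomorphic_on (N \<inter> W)" if "z \<in> W" for z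
  proof -
    obtain U \<phi> where U: "(U, \<phi>) \<in> atlas H" "z \<in> U" using ex_chart by blast
    note h = hol_section_chart[OF fr(2) U(1)] hol_section_chart[OF fr(3) U(1)] hol_section_chart[OF s U(1)]
    have nz: "det2 (\<phi> (v1 z)) (\<phi> (v2 z)) \<noteq> 0" if "z \<in> W \<inter> U" for z
      using fr(4)[of z] indep_chart[OF _ U(1)] that by blast
    have h1: "(\<lambda>z. det2 (\<phi> (s z)) (\<phi> (v2 z)) / det2 (\<phi> (v1 z)) (\<phi> (v2 z))) holomorphic_on (W \<inter> U)"
      and h2: "(\<lambda>z. det2 (\<phi> (v1 z)) (\<phi> (s z)) / det2 (\<phi> (v1 z)) (\<phi> (v2 z))) holomorphic_on (W \<inter> U)"
      using nz unfolding det2_def by (auto intro!: holomorphic_intros h)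
    have "(\<lambda>z. coord1 (v1 z) (v2 z) (s z)) holomorphic_on (W \<inter> U)"
      by (rule holomorphic_transform[OF h1])
        (use coord_chart(1)[OF fr(4) hol_section_fibre[OF s] U(1)] in auto)
    moreover have "(\<lambda>z. coord2 (v1 z) (v2 z) (s z)) holomorphic_on (W \<inter> U)"
      by (rule holomorphic_transform[OF h2])
        (use coord_chart(2)[OF fr(4) hol_section_fibre[OF s] U(1)] in auto)
    ultimately show ?thesis using U chart_open[OF U(1)] by (intro exI[of _ U]) (auto simp: Int_commute)
  qed
  thus "(\<lambda>z. coord1 (v1 z) (v2 z) (s z)) holomorphic_on W" "(\<lambda>z. coord2 (v1 z) (v2 z) (s z)) holomorphic_on W"
    by (auto intro!: holomorphic_on_local)
qed

text \<open>The coordinate vectors of a chart form a frame: seen from another chart, these sections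
  are the columns of the transition matrix and hence holomorphic.\<close>

lemma chart_frame:
  assumes U: "(U, \<phi>) \<in> atlas H"
  obtains v1 v2 where "frame U v1 v2" "\<And>z. z \<in> U \<Longrightarrow> \<phi> (v1 z) = axis 1 1" "\<And>z. z \<in> U \<Longrightarrow> \<phi> (v2 z) = axis 2 1"
proof -
  define v where "v i z = (SOME e. e \<in> fibre H z \<and> \<phi> e = axis i 1)" for i :: 2 and z
  have v: "v i z \<in> fibre H z \<and> \<phi> (v i z) = axis i 1" if "z \<in> U" for i z
    unfolding v_def by (rule someI_ex) (use chart_surj[OF U that] in blast)
  have "hol_section H U (v i)" for i
  proof (rule hol_sectionI)
    show "v i z \<in> fibre H z" if "z \<in> U" for z using v[OF that] by blast
    fix V \<psi> j assume V: "(V, \<psi>) \<in> atlas H"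
    obtain g :: "complex \<Rightarrow> complex ^ 2 ^ 2" where g: "holomorphic_matrix_on g (U \<inter> V)"
      "\<And>e z. e \<in> fibre H z \<Longrightarrow> z \<in> U \<Longrightarrow> z \<in> V \<Longrightarrow> \<psi> e = g z *v \<phi> e"
      by (rule ex_transition[OF U V], rule that)
    have "(\<lambda>z. (g z $ j $ 1) * axis i 1 $ 1 + (g z $ j $ 2) * axis i 1 $ 2) holomorphic_on (U \<inter> V)"
      using g(1) unfolding holomorphic_matrix_on_def by (intro holomorphic_intros) auto
    thus "(\<lambda>z. \<psi> (v i z) $ j) holomorphic_on (U \<inter> V)"
    proof (rule holomorphic_transform)
      fix z assume z: "z \<in> U \<inter> V"
      have "\<psi> (v i z) = g z *v axis i 1" using v[of z i] g(2)[of "v i z" z] z by simp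
      thus "(g z $ j $ 1) * axis i 1 $ 1 + (g z $ j $ 2) * axis i 1 $ 2 = \<psi> (v i z) $ j"
        by (simp only: matrix_vector_2)
    qed
  qed
  moreover have "indep z (v 1 z) (v 2 z)" if "z \<in> U" for z
    by (rule indepI[OF _ _ U that]) (use v[OF that] in \<open>auto simp: det2_def axis_def\<close>)
  ultimately have "frame U (v 1) (v 2)" using chart_open[OF U] by (simp add: frame_def)
  thus thesis using v by (intro that) blast+
qed

lemma ex_frame:
  obtains U v1 v2 where "frame U v1 v2" "z \<in> U"
proof -
  obtain U \<phi> where U: "(U, \<phi>) \<in> atlas H" "z \<in> U" using ex_chart by blast
  obtain v1 v2 where "frame U v1 v2" by (rule chart_frame[OF U(1)], rule that)
  thus thesis using U(2) by (rule that)
qed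

lemma frame_change:
  assumes fr: "frame W v1 v2" and W': "open W'" "W' \<subseteq> W"
    and hol: "a holomorphic_on W'" "b holomorphic_on W'" "c holomorphic_on W'" "d holomorphic_on W'"
    and det: "\<And>z. z \<in> W' \<Longrightarrow> a z * d z - b z * c z \<noteq> 0"
  shows "frame W' (\<lambda>z. comb2 H (a z) (v1 z) (b z) (v2 z)) (\<lambda>z. comb2 H (c z) (v1 z) (d z) (v2 z))"
  unfolding frame_def
  using frameD[OF frame_subset[OF fr W']] hol det by (auto intro!: hol_section_comb simp: indep_comb_iff W')

end

section \<open>Flat sections and monodromy\<close>

locale te2 = bundle2 +
  assumes holomorphic_connection: "holomorphic_connection H"
    and ex_z2nabla: "\<And>W s. open W \<Longrightarrow> hol_section H W s \<Longrightarrow> \<exists>t. z2nabla H W s t"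

lemma te2_iff: "te2 H \<longleftrightarrow> te_structure H"
  unfolding te2_def te2_axioms_def bundle2_def te_structure_def by blast

context te2
begin

lemma nabla_section:
  assumes "open W" "W \<subseteq> - {0}" "hol_section H W s"
  shows "hol_section H W (nabla H W s)"
  using holomorphic_connection[unfolded holomorphic_connection_def, THEN conjunct1] assms by simp

lemma nabla_restrict:
  assumes "open W" "W \<subseteq> - {0}" "hol_section H W s" "open W'" "W' \<subseteq> W" "\<And>z. z \<in> W' \<Longrightarrow> s' z = s z" "z \<in> W'"
  shows "nabla H W' s' z = nabla H W s z"
proof -
  have "open W \<and> W \<subseteq> - {0} \<and> open W' \<and> W' \<subseteq> W \<and> hol_section H W s \<and> (\<forall>z \<in> W'. s' z = s z)"
    using assms by simp
  with holomorphic_connection[unfolded holomorphic_connection_def, THEN conjunct2, THEN conjunct1]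
  show ?thesis using assms(7) by simp
qed

lemma nabla_add:
  assumes "open W" "W \<subseteq> - {0}" "hol_section H W s" "hol_section H W t" "z \<in> W"
  shows "nabla H W (\<lambda>w. fibre_add H (s w) (t w)) z = fibre_add H (nabla H W s z) (nabla H W t z)"
  using holomorphic_connection[unfolded holomorphic_connection_def, THEN conjunct2, THEN conjunct2, THEN conjunct1]
    assms by simp

lemma nabla_scale:
  assumes "open W" "W \<subseteq> - {0}" "f holomorphic_on W" "hol_section H W s" "z \<in> W"
  shows "nabla H W (\<lambda>w. fibre_scale H (f w) (s w)) z =
          fibre_add H (fibre_scale H (deriv f z) (s z)) (fibre_scale H (f z) (nabla H W s z))"
  using holomorphic_connection[unfolded holomorphic_connection_def, THEN conjunct2, THEN conjunct2, THEN conjunct2]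
    assms by simp

lemma scale_eq_comb: "x \<in> fibre H z \<Longrightarrow> fibre_scale H c x = comb2 H c x 0 x"
  by (rule fibre_eqI[of _ z]; simp add: chart_simps)

lemma hol_section_scale:
  assumes "hol_section H W s" "f holomorphic_on W"
  shows "hol_section H W (\<lambda>z. fibre_scale H (f z) (s z))"
proof (rule hol_section_cong)
  show "hol_section H W (\<lambda>z. comb2 H (f z) (s z) ((\<lambda>_. 0) z) (s z))"
    by (intro hol_section_comb assms holomorphic_on_const)
qed (simp add: scale_eq_comb[OF hol_section_fibre[OF assms(1)]])

lemma nabla_comb:
  assumes "open W" "W \<subseteq> - {0}" "hol_section H W s" "hol_section H W t" "f holomorphic_on W" "g holomorphic_on W" "z \<in> W"
  shows "nabla H W (\<lambda>w. comb2 H (f w) (s w) (g w) (t w)) z =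
     fibre_add H (comb2 H (deriv f z) (s z) (f z) (nabla H W s z)) (comb2 H (deriv g z) (t z) (g z) (nabla H W t z))"
  unfolding comb2_def
  using assms by (simp add: nabla_add nabla_scale hol_section_scale)

lemma nabla_frame_comb:
  assumes fr: "frame W v1 v2" and W: "W \<subseteq> - {0}"
    and hol: "f holomorphic_on W" "g holomorphic_on W" and z: "z \<in> W"
    and n1: "nabla H W v1 z = comb2 H a (v1 z) c (v2 z)" and n2: "nabla H W v2 z = comb2 H b (v1 z) d (v2 z)"
  shows "nabla H W (\<lambda>w. comb2 H (f w) (v1 w) (g w) (v2 w)) z =
     comb2 H (deriv f z + a * f z + b * g z) (v1 z) (deriv g z + c * f z + d * g z) (v2 z)"
proof -
  note fr = frameD[OF fr]
  show ?thesis
    unfolding nabla_comb[OF fr(1) W fr(2,3) hol z] n1 n2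
    by (rule fibre_eqI[of _ z]; simp add: chart_simps fr(5,6) z; (intro vec2_eqI; simp add: algebra_simps))
qed

definition flat_frame :: "complex set \<Rightarrow> (complex \<Rightarrow> 'a) \<Rightarrow> (complex \<Rightarrow> 'a) \<Rightarrow> bool" where
  "flat_frame W t1 t2 \<longleftrightarrow> frame W t1 t2 \<and> W \<subseteq> - {0} \<and> flat_section H W t1 \<and> flat_section H W t2"

lemma flat_sectionD:
  assumes "flat_section H W s"
  shows "hol_section H W s" "z \<in> W \<Longrightarrow> nabla H W s z = fibre_zero H z"
  using assms by (simp_all add: flat_section_def)

lemma flat_section_restrict:
  assumes "flat_section H W s" "open W" "W \<subseteq> - {0}" "open W'" "W' \<subseteq> W" "\<And>z. z \<in> W' \<Longrightarrow> s' z = s z"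
  shows "flat_section H W' s'"
  unfolding flat_section_def
proof
  note s = flat_sectionD[OF assms(1)]
  show "hol_section H W' s'"
    by (rule hol_section_cong[OF hol_section_subset[OF s(1) assms(5)]]) (rule assms(6)[symmetric])
  show "\<forall>z\<in>W'. nabla H W' s' z = fibre_zero H z"
  proof
    fix z assume z: "z \<in> W'"
    hence "z \<in> W" using assms(5) by (rule rev_subsetD)
    from s(2)[OF this] show "nabla H W' s' z = fibre_zero H z"
      using nabla_restrict[OF assms(2,3) s(1) assms(4,5,6) z] by (rule trans[rotated])
  qed
qed

lemma flat_section_comb:
  assumes "open W" "W \<subseteq> - {0}" "flat_section H W s" "flat_section H W t"
  shows "flat_section H W (\<lambda>z. comb2 H a (s z) b (t z))"
  unfolding flat_section_def
proof
  note s = flat_sectionD[OF assms(3)] and t = flat_sectionD[OF assms(4)]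
  have c: "(\<lambda>_. a) holomorphic_on W" "(\<lambda>_. b) holomorphic_on W" by (rule holomorphic_on_const)+
  show "hol_section H W (\<lambda>z. comb2 H a (s z) b (t z))" by (rule hol_section_comb[OF s(1) t(1) c])
  show "\<forall>z\<in>W. nabla H W (\<lambda>z. comb2 H a (s z) b (t z)) z = fibre_zero H z"
  proof
    fix z assume z: "z \<in> W"
    note f = hol_section_fibre[OF s(1) z] hol_section_fibre[OF t(1) z]
    show "nabla H W (\<lambda>z. comb2 H a (s z) b (t z)) z = fibre_zero H z"
      unfolding nabla_comb[OF assms(1,2) s(1) t(1) c z] s(2)[OF z] t(2)[OF z]
      by (rule fibre_eqI[of _ z]; simp add: chart_simps f)
  qed
qed

lemma frame_nabla_coeffs:
  assumes fr: "frame W v1 v2" and W: "W \<subseteq> - {0}"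
  obtains a b c d where "a holomorphic_on W" "b holomorphic_on W" "c holomorphic_on W" "d holomorphic_on W"
    "\<And>z. z \<in> W \<Longrightarrow> nabla H W v1 z = comb2 H (a z) (v1 z) (c z) (v2 z)"
    "\<And>z. z \<in> W \<Longrightarrow> nabla H W v2 z = comb2 H (b z) (v1 z) (d z) (v2 z)"
proof -
  note f = frameD[OF fr]
  note n = nabla_section[OF f(1) W f(2)] nabla_section[OF f(1) W f(3)]
  show thesis
    by (rule that[OF coord_holomorphic(1)[OF fr n(1)] coord_holomorphic(1)[OF fr n(2)]
          coord_holomorphic(2)[OF fr n(1)] coord_holomorphic(2)[OF fr n(2)]])
      (simp_all add: comb_coord[OF f(4)] hol_section_fibre[OF n(1)] hol_section_fibre[OF n(2)])
qed

text \<open>The coordinates of flat sections solve a linear system. The solutions starting at the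
  two unit vectors have determinant 1 at \<open>z0\<close>, hence a nonzero one in a smaller
  disc.\<close>

lemma ex_flat_frame:
  assumes "z0 \<noteq> 0"
  obtains \<epsilon> t1 t2 where "\<epsilon> > 0" "flat_frame (ball z0 \<epsilon>) t1 t2"
proof -
  obtain U v1 v2 where U: "frame U v1 v2" "z0 \<in> U" by (rule ex_frame[of z0], rule that)
  have "open (U - {0})" using frameD(1)[OF U(1)] by (intro open_Diff) auto
  then obtain R where R: "R > 0" "ball z0 R \<subseteq> U - {0}" using U(2) assms open_contains_ball by blast
  have fr: "frame (ball z0 R) v1 v2" by (rule frame_subset[OF U(1)]) (use R in auto)
  have W: "ball z0 R \<subseteq> - {0}" using R(2) by blast
  obtain a b c d where hol: "a holomorphic_on ball z0 R" "b holomorphic_on ball z0 R" "c holomorphic_on ball z0 R" "d holomorphic_on ball z0 R"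
    and n: "\<And>z. z \<in> ball z0 R \<Longrightarrow> nabla H (ball z0 R) v1 z = comb2 H (a z) (v1 z) (c z) (v2 z)"
    "\<And>z. z \<in> ball z0 R \<Longrightarrow> nabla H (ball z0 R) v2 z = comb2 H (b z) (v1 z) (d z) (v2 z)"
    by (rule frame_nabla_coeffs[OF fr W], rule that)
  have hol': "(\<lambda>z. - a z) holomorphic_on eball z0 (ereal R)" "(\<lambda>z. - b z) holomorphic_on eball z0 (ereal R)"
    "(\<lambda>z. - c z) holomorphic_on eball z0 (ereal R)" "(\<lambda>z. - d z) holomorphic_on eball z0 (ereal R)"
    using hol by (auto intro: holomorphic_intros)
  have ex: "\<exists>f g. f z0 = x \<and> g z0 = y \<and> f holomorphic_on ball z0 R \<and> g holomorphic_on ball z0 R \<and>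
      (\<forall>z\<in>ball z0 R. deriv f z + a z * f z + b z * g z = 0 \<and> deriv g z + c z * f z + d z * g z = 0)" for x y
  proof -
    obtain f g where fg: "f z0 = x" "g z0 = y"
      "\<And>z. z \<in> eball z0 (ereal R) \<Longrightarrow> (f has_field_derivative - a z * f z + - b z * g z) (at z)"
      "\<And>z. z \<in> eball z0 (ereal R) \<Longrightarrow> (g has_field_derivative - c z * f z + - d z * g z) (at z)"
      by (rule linear_system_solution[OF hol', of x y], rule that)
    have "f holomorphic_on ball z0 R" "g holomorphic_on ball z0 R"
      unfolding holomorphic_on_open[OF open_ball]
      by (intro allI ballI exI, rule fg(3), simp, intro allI ballI exI, rule fg(4), simp)
    moreover have "deriv f z + a z * f z + b z * g z = 0" "deriv g z + c z * f z + d z * g z = 0" if "z \<in> ball z0 R" for z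
      using DERIV_imp_deriv[OF fg(3)[of z]] DERIV_imp_deriv[OF fg(4)[of z]] that by simp_all
    ultimately show ?thesis using fg(1,2) by blast
  qed
  obtain f1 g1 where 1: "f1 z0 = 1" "g1 z0 = 0" "f1 holomorphic_on ball z0 R" "g1 holomorphic_on ball z0 R"
    "\<And>z. z \<in> ball z0 R \<Longrightarrow> deriv f1 z + a z * f1 z + b z * g1 z = 0 \<and> deriv g1 z + c z * f1 z + d z * g1 z = 0"
    using ex[of 1 0] by blast
  obtain f2 g2 where 2: "f2 z0 = 0" "g2 z0 = 1" "f2 holomorphic_on ball z0 R" "g2 holomorphic_on ball z0 R"
    "\<And>z. z \<in> ball z0 R \<Longrightarrow> deriv f2 z + a z * f2 z + b z * g2 z = 0 \<and> deriv g2 z + c z * f2 z + d z * g2 z = 0"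
    using ex[of 0 1] by blast
  define \<Delta> where "\<Delta> z = f1 z * g2 z - g1 z * f2 z" for z
  have "\<Delta> holomorphic_on ball z0 R" unfolding \<Delta>_def[abs_def] by (intro holomorphic_intros 1 2)
  hence "isCont \<Delta> z0"
    using R(1) by (intro continuous_on_interior[OF holomorphic_on_imp_continuous_on]) (auto simp: interior_open)
  moreover have "\<Delta> z0 \<noteq> 0" using 1 2 by (simp add: \<Delta>_def)
  ultimately obtain \<delta> where \<delta>: "\<delta> > 0" "\<And>z. dist z0 z < \<delta> \<Longrightarrow> \<Delta> z \<noteq> 0"
    using continuous_at_avoid[of z0 \<Delta> 0] by blast
  define \<epsilon> where "\<epsilon> = min \<delta> R"
  have \<epsilon>: "\<epsilon> > 0" "ball z0 \<epsilon> \<subseteq> ball z0 R" using \<delta> R by (auto simp: \<epsilon>_def)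
  define t1 where "t1 z = comb2 H (f1 z) (v1 z) (g1 z) (v2 z)" for z
  define t2 where "t2 z = comb2 H (f2 z) (v1 z) (g2 z) (v2 z)" for z
  have "frame (ball z0 \<epsilon>) t1 t2"
    unfolding t1_def[abs_def] t2_def[abs_def]
    by (rule frame_change[OF fr open_ball \<epsilon>(2)])
      (use \<delta> \<epsilon> 1 2 in \<open>auto simp: \<Delta>_def \<epsilon>_def elim: holomorphic_on_subset\<close>)
  moreover have flat: "flat_section H (ball z0 R) (\<lambda>z. comb2 H (f z) (v1 z) (g z) (v2 z))"
    if h: "f holomorphic_on ball z0 R" "g holomorphic_on ball z0 R"
      and e: "\<And>z. z \<in> ball z0 R \<Longrightarrow> deriv f z + a z * f z + b z * g z = 0 \<and> deriv g z + c z * f z + d z * g z = 0" for f g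
    unfolding flat_section_def
  proof
    note v = frameD[OF fr]
    show "hol_section H (ball z0 R) (\<lambda>z. comb2 H (f z) (v1 z) (g z) (v2 z))" by (rule hol_section_comb[OF v(2,3) h])
    show "\<forall>z\<in>ball z0 R. nabla H (ball z0 R) (\<lambda>z. comb2 H (f z) (v1 z) (g z) (v2 z)) z = fibre_zero H z"
    proof
      fix z assume z: "z \<in> ball z0 R"
      show "nabla H (ball z0 R) (\<lambda>z. comb2 H (f z) (v1 z) (g z) (v2 z)) z = fibre_zero H z"
        unfolding nabla_frame_comb[OF fr W h z n[OF z]] using e[OF z] comb_zero[OF v(5,6)[OF z]] by simp
    qed
  qed
  have "flat_section H (ball z0 \<epsilon>) t1" "flat_section H (ball z0 \<epsilon>) t2"
    by (rule flat_section_restrict[OF flat[OF 1(3,4,5)] open_ball W open_ball \<epsilon>(2)]; simp add: t1_def)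
      (rule flat_section_restrict[OF flat[OF 2(3,4,5)] open_ball W open_ball \<epsilon>(2)]; simp add: t2_def)
  ultimately show thesis using that[OF \<epsilon>(1)] W \<epsilon>(2) unfolding flat_frame_def by blast
qed

text \<open>By the Leibniz rule the coordinates of a flat section with respect to a flat frame have
  derivative 0.\<close>

lemma flat_coords_const:
  assumes t: "flat_frame V t1 t2" and s: "flat_section H W s" "open W" "W \<subseteq> - {0}"
    and N: "convex N" "N \<subseteq> V" "N \<subseteq> W" "open N"
  obtains a b where "\<And>z. z \<in> N \<Longrightarrow> s z = comb2 H a (t1 z) b (t2 z)"
proof -
  have t': "frame V t1 t2" "V \<subseteq> - {0}" "flat_section H V t1" "flat_section H V t2"
    using t by (simp_all add: flat_frame_def)
  have N0: "N \<subseteq> - {0}" using N(2) t'(2) by blast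
  have fr: "frame N t1 t2" by (rule frame_subset[OF t'(1) N(4,2)])
  note f = frameD[OF fr]
  have flat: "flat_section H N t1" "flat_section H N t2" "flat_section H N s"
    using flat_section_restrict[OF t'(3) frameD(1)[OF t'(1)] t'(2) N(4,2)]
      flat_section_restrict[OF t'(4) frameD(1)[OF t'(1)] t'(2) N(4,2)] flat_section_restrict[OF s N(4,3)] by blast+
  note sN = flat_sectionD[OF flat(3)]
  define a where "a z = coord1 (t1 z) (t2 z) (s z)" for z
  define b where "b z = coord2 (t1 z) (t2 z) (s z)" for z
  have hol: "a holomorphic_on N" "b holomorphic_on N"
    unfolding a_def[abs_def] b_def[abs_def] using coord_holomorphic[OF fr sN(1)] .
  have eq: "comb2 H (a z) (t1 z) (b z) (t2 z) = s z" if "z \<in> N" for z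
    unfolding a_def b_def by (rule comb_coord[OF f(4)[OF that] hol_section_fibre[OF sN(1) that]])
  have d0: "deriv a z = 0 \<and> deriv b z = 0" if z: "z \<in> N" for z
  proof -
    have n: "nabla H N t1 z = comb2 H 0 (t1 z) 0 (t2 z)" "nabla H N t2 z = comb2 H 0 (t1 z) 0 (t2 z)"
      using flat_sectionD(2)[OF flat(1) z] flat_sectionD(2)[OF flat(2) z] comb_zero[OF f(5,6)[OF z]] by simp_all
    have "nabla H N (\<lambda>z. comb2 H (a z) (t1 z) (b z) (t2 z)) z = nabla H N s z"
      by (rule nabla_restrict[OF f(1) N0 sN(1) f(1) order_refl eq z])
    also have "\<dots> = comb2 H 0 (t1 z) 0 (t2 z)" using sN(2)[OF z] comb_zero[OF f(5,6)[OF z]] by simp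
    finally have "comb2 H (deriv a z + 0 * a z + 0 * b z) (t1 z) (deriv b z + 0 * a z + 0 * b z) (t2 z) = comb2 H 0 (t1 z) 0 (t2 z)"
      unfolding nabla_frame_comb[OF fr N0 hol z n] .
    from indep_comb_eq[OF f(4)[OF z] this] show ?thesis by simp
  qed
  have const: "\<exists>k. \<forall>z\<in>N. h z = k" if "h holomorphic_on N" "\<And>z. z \<in> N \<Longrightarrow> deriv h z = 0" for h :: "complex \<Rightarrow> complex"
  proof (rule has_field_derivative_zero_constant[OF N(1)])
    fix z assume z: "z \<in> N"
    have "(h has_field_derivative 0) (at z)" using holomorphic_derivI[OF that(1) N(4) z] that(2)[OF z] by simp
    thus "(h has_field_derivative 0) (at z within N)" by (rule has_field_derivative_at_within)
  qed
  obtain k where k: "\<forall>z\<in>N. a z = k" using const[OF hol(1)] d0 by blast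
  obtain l where l: "\<forall>z\<in>N. b z = l" using const[OF hol(2)] d0 by blast
  show thesis
  proof (rule that[of k l])
    fix z assume "z \<in> N"
    thus "s z = comb2 H k (t1 z) l (t2 z)" using eq[of z] k l by simp
  qed
qed

text \<open>The condition of \<open>flat_multivalued\<close>, relativised to a set so that sections
  can be continued piece by piece; \<open>N = UNIV\<close> gives back the original.\<close>

definition mvflat :: "complex set \<Rightarrow> (complex \<Rightarrow> 'a) \<Rightarrow> bool" where
  "mvflat N \<sigma> \<longleftrightarrow> (\<forall>\<zeta>\<in>N. \<exists>N' W s. open N' \<and> \<zeta> \<in> N' \<and> open W \<and> W \<subseteq> - {0} \<and> exp ` N' \<subseteq> W \<and>
     flat_section H W s \<and> (\<forall>\<xi> \<in> N'. \<sigma> \<xi> = s (exp \<xi>)))"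

lemma flat_multivalued_iff: "\<sigma> \<in> flat_multivalued H \<longleftrightarrow> mvflat UNIV \<sigma>"
  by (simp add: flat_multivalued_def mvflat_def)

lemma mvflatE:
  assumes "mvflat N \<sigma>" "\<zeta> \<in> N"
  obtains N' W s where "open N'" "\<zeta> \<in> N'" "open W" "W \<subseteq> - {0}" "exp ` N' \<subseteq> W" "flat_section H W s"
    "\<And>\<xi>. \<xi> \<in> N' \<Longrightarrow> \<sigma> \<xi> = s (exp \<xi>)"
proof -
  from assms obtain N' W s where "open N' \<and> \<zeta> \<in> N' \<and> open W \<and> W \<subseteq> - {0} \<and> exp ` N' \<subseteq> W \<and>
     flat_section H W s \<and> (\<forall>\<xi> \<in> N'. \<sigma> \<xi> = s (exp \<xi>))" unfolding mvflat_def by meson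
  thus thesis by (intro that[of N' W s]) simp_all
qed

lemma mvflatI:
  assumes "\<And>\<zeta>. \<zeta> \<in> N \<Longrightarrow> \<exists>N' W s. open N' \<and> \<zeta> \<in> N' \<and> open W \<and> W \<subseteq> - {0} \<and> exp ` N' \<subseteq> W \<and>
     flat_section H W s \<and> (\<forall>\<xi> \<in> N'. \<sigma> \<xi> = s (exp \<xi>))"
  shows "mvflat N \<sigma>"
  unfolding mvflat_def by (intro ballI assms)

lemma mvflat_subset: "mvflat N \<sigma> \<Longrightarrow> N' \<subseteq> N \<Longrightarrow> mvflat N' \<sigma>"
  unfolding mvflat_def by (meson subsetD)

lemma mvflat_fibre:
  assumes "mvflat N \<sigma>" "\<zeta> \<in> N" shows "\<sigma> \<zeta> \<in> fibre H (exp \<zeta>)"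
proof -
  obtain N' W s where "open N'" "\<zeta> \<in> N'" "open W" "W \<subseteq> - {0}" "exp ` N' \<subseteq> W" "flat_section H W s"
    "\<And>\<xi>. \<xi> \<in> N' \<Longrightarrow> \<sigma> \<xi> = s (exp \<xi>)" by (rule mvflatE[OF assms], rule that)
  thus ?thesis using hol_section_fibre[OF flat_sectionD(1), of W s "exp \<zeta>"] by auto
qed

lemma mvflat_cong_near:
  assumes "\<And>\<zeta>. \<zeta> \<in> N \<Longrightarrow> \<exists>B \<tau>. open B \<and> \<zeta> \<in> B \<and> mvflat B \<tau> \<and> (\<forall>\<xi>\<in>B. \<sigma> \<xi> = \<tau> \<xi>)"
  shows "mvflat N \<sigma>"
proof (rule mvflatI)
  fix \<zeta> assume "\<zeta> \<in> N"
  then obtain B \<tau> where B: "open B" "\<zeta> \<in> B" "mvflat B \<tau>" "\<forall>\<xi>\<in>B. \<sigma> \<xi> = \<tau> \<xi>" using assms by blast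
  obtain N' W s where *: "open N'" "\<zeta> \<in> N'" "open W" "W \<subseteq> - {0}" "exp ` N' \<subseteq> W" "flat_section H W s"
    "\<And>\<xi>. \<xi> \<in> N' \<Longrightarrow> \<tau> \<xi> = s (exp \<xi>)" by (rule mvflatE[OF B(3,2)], rule that)
  show "\<exists>N' W s. open N' \<and> \<zeta> \<in> N' \<and> open W \<and> W \<subseteq> - {0} \<and> exp ` N' \<subseteq> W \<and>
     flat_section H W s \<and> (\<forall>\<xi> \<in> N'. \<sigma> \<xi> = s (exp \<xi>))"
    by (rule exI[of _ "N' \<inter> B"], rule exI[of _ W], rule exI[of _ s]) (use * B in auto)
qed

text \<open>\<open>flat_coords_const\<close> applies near a single \<open>z\<close>. Constancy then
  spreads over the convex set in the logarithmic variable, where different branches do not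
  interfere.\<close>

lemma mvflat_const_comb:
  assumes t: "flat_frame V t1 t2" and \<sigma>: "mvflat N \<sigma>" and N: "convex N" "exp ` N \<subseteq> V"
  obtains a b where "\<And>\<zeta>. \<zeta> \<in> N \<Longrightarrow> \<sigma> \<zeta> = comb2 H a (t1 (exp \<zeta>)) b (t2 (exp \<zeta>))"
proof -
  have fr: "frame V t1 t2" using t by (simp add: flat_frame_def)
  define a where "a \<zeta> = coord1 (t1 (exp \<zeta>)) (t2 (exp \<zeta>)) (\<sigma> \<zeta>)" for \<zeta>
  define b where "b \<zeta> = coord2 (t1 (exp \<zeta>)) (t2 (exp \<zeta>)) (\<sigma> \<zeta>)" for \<zeta>
  have V: "exp \<zeta> \<in> V" if "\<zeta> \<in> N" for \<zeta> using that N(2) by blast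
  have eq: "comb2 H (a \<zeta>) (t1 (exp \<zeta>)) (b \<zeta>) (t2 (exp \<zeta>)) = \<sigma> \<zeta>" if "\<zeta> \<in> N" for \<zeta>
    unfolding a_def b_def by (rule comb_coord[OF frameD(4)[OF fr V[OF that]] mvflat_fibre[OF \<sigma> that]])
  have d0: "(a has_field_derivative 0) (at \<zeta> within N) \<and> (b has_field_derivative 0) (at \<zeta> within N)" if \<zeta>: "\<zeta> \<in> N" for \<zeta>
  proof -
    obtain N' W s where *: "open N'" "\<zeta> \<in> N'" "open W" "W \<subseteq> - {0}" "exp ` N' \<subseteq> W" "flat_section H W s"
      "\<And>\<xi>. \<xi> \<in> N' \<Longrightarrow> \<sigma> \<xi> = s (exp \<xi>)" by (rule mvflatE[OF \<sigma> \<zeta>], rule that)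
    have "open (V \<inter> W)" "exp \<zeta> \<in> V \<inter> W" using * V[OF \<zeta>] frameD(1)[OF fr] by auto
    then obtain r where r: "r > 0" "ball (exp \<zeta>) r \<subseteq> V \<inter> W" using open_contains_ball by blast
    obtain k l where kl: "\<And>z. z \<in> ball (exp \<zeta>) r \<Longrightarrow> s z = comb2 H k (t1 z) l (t2 z)"
      by (rule flat_coords_const[OF t *(6,3,4) convex_ball[of "exp \<zeta>" r]]) (use r that in auto)
    define B where "B = N' \<inter> exp -` ball (exp \<zeta>) r"
    have B: "open B" "\<zeta> \<in> B" unfolding B_def using * r
      by (auto intro!: open_Int continuous_open_vimage continuous_intros)
    have ab: "a \<xi> = k \<and> b \<xi> = l" if "\<xi> \<in> B" for \<xi>
    proof -
      have \<xi>: "exp \<xi> \<in> ball (exp \<zeta>) r" "\<xi> \<in> N'" "exp \<xi> \<in> V" using that r by (auto simp: B_def)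
      have "\<sigma> \<xi> = comb2 H k (t1 (exp \<xi>)) l (t2 (exp \<xi>))" using *(7)[OF \<xi>(2)] kl[OF \<xi>(1)] by simp
      thus ?thesis unfolding a_def b_def using coord_comb[OF frameD(4)[OF fr \<xi>(3)]] by simp
    qed
    have "(a has_field_derivative 0) (at \<zeta>)"
      by (rule has_field_derivative_transform_within_open[OF DERIV_const[of k] B]) (simp add: ab)
    moreover have "(b has_field_derivative 0) (at \<zeta>)"
      by (rule has_field_derivative_transform_within_open[OF DERIV_const[of l] B]) (simp add: ab)
    ultimately show ?thesis using has_field_derivative_at_within by blast
  qed
  obtain k where k: "\<forall>\<zeta>\<in>N. a \<zeta> = k"
    using has_field_derivative_zero_constant[OF N(1), of a] d0 by blast
  obtain l where l: "\<forall>\<zeta>\<in>N. b \<zeta> = l"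
    using has_field_derivative_zero_constant[OF N(1), of b] d0 by blast
  show thesis
  proof (rule that[of k l])
    fix \<zeta> assume "\<zeta> \<in> N"
    thus "\<sigma> \<zeta> = comb2 H k (t1 (exp \<zeta>)) l (t2 (exp \<zeta>))" using eq[of \<zeta>] k l by simp
  qed
qed

lemma mvflat_of_flat_frame:
  assumes "flat_frame V t1 t2" "open N" "exp ` N \<subseteq> V"
  shows "mvflat N (\<lambda>\<zeta>. comb2 H a (t1 (exp \<zeta>)) b (t2 (exp \<zeta>)))"
proof (rule mvflatI)
  fix \<zeta> assume "\<zeta> \<in> N"
  have t: "open V" "V \<subseteq> - {0}" "flat_section H V t1" "flat_section H V t2"
    using assms(1) by (auto simp: flat_frame_def dest: frameD)
  show "\<exists>N' W s. open N' \<and> \<zeta> \<in> N' \<and> open W \<and> W \<subseteq> - {0} \<and> exp ` N' \<subseteq> W \<and>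
     flat_section H W s \<and> (\<forall>\<xi> \<in> N'. comb2 H a (t1 (exp \<xi>)) b (t2 (exp \<xi>)) = s (exp \<xi>))"
    by (rule exI[of _ N], rule exI[of _ V], rule exI[of _ "\<lambda>z. comb2 H a (t1 z) b (t2 z)"])
      (use assms t flat_section_comb[OF t] \<open>\<zeta> \<in> N\<close> in auto)
qed

lemma mvflat_comb:
  assumes "mvflat N \<sigma>" "mvflat N \<tau>"
  shows "mvflat N (\<lambda>\<zeta>. comb2 H a (\<sigma> \<zeta>) b (\<tau> \<zeta>))"
proof (rule mvflatI)
  fix \<zeta> assume \<zeta>: "\<zeta> \<in> N"
  obtain N1 W1 s1 where 1: "open N1" "\<zeta> \<in> N1" "open W1" "W1 \<subseteq> - {0}" "exp ` N1 \<subseteq> W1" "flat_section H W1 s1"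
    "\<And>\<xi>. \<xi> \<in> N1 \<Longrightarrow> \<sigma> \<xi> = s1 (exp \<xi>)" by (rule mvflatE[OF assms(1) \<zeta>], rule that)
  obtain N2 W2 s2 where 2: "open N2" "\<zeta> \<in> N2" "open W2" "W2 \<subseteq> - {0}" "exp ` N2 \<subseteq> W2" "flat_section H W2 s2"
    "\<And>\<xi>. \<xi> \<in> N2 \<Longrightarrow> \<tau> \<xi> = s2 (exp \<xi>)" by (rule mvflatE[OF assms(2) \<zeta>], rule that)
  have W: "open (W1 \<inter> W2)" "W1 \<inter> W2 \<subseteq> - {0}" using 1 2 by auto
  have "flat_section H (W1 \<inter> W2) s1" "flat_section H (W1 \<inter> W2) s2"
    using flat_section_restrict[OF 1(6,3,4) W(1)] flat_section_restrict[OF 2(6,3,4) W(1)] by auto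
  from flat_section_comb[OF W this, of a b]
  show "\<exists>N' W s. open N' \<and> \<zeta> \<in> N' \<and> open W \<and> W \<subseteq> - {0} \<and> exp ` N' \<subseteq> W \<and>
     flat_section H W s \<and> (\<forall>\<xi> \<in> N'. comb2 H a (\<sigma> \<xi>) b (\<tau> \<xi>) = s (exp \<xi>))"
    by (intro exI[of _ "N1 \<inter> N2"] exI[of _ "W1 \<inter> W2"] exI[of _ "\<lambda>z. comb2 H a (s1 z) b (s2 z)"])
      (use 1 2 W in auto)
qed

lemma mvflat_turn:
  assumes "mvflat N \<sigma>" "\<And>\<zeta>. \<zeta> \<in> N \<Longrightarrow> \<zeta> + 2 * of_real pi * \<i> \<in> N"
  shows "mvflat N (\<lambda>\<zeta>. \<sigma> (\<zeta> + 2 * of_real pi * \<i>))"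
proof (rule mvflatI)
  fix \<zeta> assume "\<zeta> \<in> N"
  hence \<zeta>: "\<zeta> + 2 * of_real pi * \<i> \<in> N" by (rule assms(2))
  obtain N1 W1 s1 where 1: "open N1" "\<zeta> + 2 * of_real pi * \<i> \<in> N1" "open W1" "W1 \<subseteq> - {0}" "exp ` N1 \<subseteq> W1" "flat_section H W1 s1"
    "\<And>\<xi>. \<xi> \<in> N1 \<Longrightarrow> \<sigma> \<xi> = s1 (exp \<xi>)" by (rule mvflatE[OF assms(1) \<zeta>], rule that)
  define B where "B = (\<lambda>\<xi>. \<xi> + 2 * of_real pi * \<i>) -` N1"
  have e: "exp (\<xi> + 2 * of_real pi * \<i>) = exp \<xi>" for \<xi> by (simp only: exp_add exp_two_pi_i mult_1_right)
  have "open B" unfolding B_def using 1(1) by (intro continuous_open_vimage continuous_intros)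
  moreover
  have "exp ` B \<subseteq> W1"
  proof (rule image_subsetI)
    fix \<xi> assume "\<xi> \<in> B"
    hence "exp (\<xi> + 2 * of_real pi * \<i>) \<in> W1" using 1(5) by (auto simp: B_def)
    thus "exp \<xi> \<in> W1" by (simp only: e)
  qed
  moreover have "\<sigma> (\<xi> + 2 * of_real pi * \<i>) = s1 (exp \<xi>)" if "\<xi> \<in> B" for \<xi>
    using 1(7)[of "\<xi> + 2 * of_real pi * \<i>"] that unfolding e by (simp add: B_def)
  ultimately show "\<exists>N' W s. open N' \<and> \<zeta> \<in> N' \<and> open W \<and> W \<subseteq> - {0} \<and> exp ` N' \<subseteq> W \<and>
     flat_section H W s \<and> (\<forall>\<xi> \<in> N'. \<sigma> (\<xi> + 2 * of_real pi * \<i>) = s (exp \<xi>))"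
    by (intro exI[of _ B] exI[of _ W1] exI[of _ s1]) (use 1 in \<open>auto simp: B_def\<close>)
qed

lemma local_flat_frame:
  fixes \<zeta> :: complex
  obtains \<epsilon> V t1 t2 where "\<epsilon> > 0" "flat_frame V t1 t2" "exp ` ball \<zeta> \<epsilon> \<subseteq> V"
proof -
  obtain \<delta> t1 t2 where t: "\<delta> > 0" "flat_frame (ball (exp \<zeta>) \<delta>) t1 t2" by (rule ex_flat_frame[of "exp \<zeta>"]) auto
  have "open (exp -` ball (exp \<zeta>) \<delta> :: complex set)" by (intro continuous_open_vimage continuous_intros open_ball)
  moreover have "\<zeta> \<in> exp -` ball (exp \<zeta>) \<delta>" using t(1) by simp
  ultimately obtain \<epsilon> where "\<epsilon> > 0" "ball \<zeta> \<epsilon> \<subseteq> exp -` ball (exp \<zeta>) \<delta>" by (rule openE)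
  thus thesis using that[of \<epsilon> "ball (exp \<zeta>) \<delta>" t1 t2] t by auto
qed

text \<open>Near every point both sections are constant combinations of one flat frame, so agreement
  at one point of a small ball gives agreement on the ball; connectedness does the rest.\<close>

lemma mvflat_unique:
  assumes "mvflat N \<sigma>" "mvflat N \<tau>" "open N" "connected N" "\<zeta>0 \<in> N" "\<sigma> \<zeta>0 = \<tau> \<zeta>0" "\<zeta> \<in> N"
  shows "\<sigma> \<zeta> = \<tau> \<zeta>"
proof (rule connected_induction_simple[where P = "\<lambda>\<zeta>. \<sigma> \<zeta> = \<tau> \<zeta>" and a = \<zeta>0, OF assms(4,5,7,6)])
  fix \<xi> assume \<xi>: "\<xi> \<in> N"
  obtain \<epsilon> V t1 t2 where t: "\<epsilon> > 0" "flat_frame V t1 t2" "exp ` ball \<xi> \<epsilon> \<subseteq> V" by (rule local_flat_frame, rule that)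
  obtain r where r: "r > 0" "ball \<xi> r \<subseteq> N" using assms(3) \<xi> open_contains_ball by blast
  define B where "B = ball \<xi> (min \<epsilon> r)"
  have B: "open B" "\<xi> \<in> B" "B \<subseteq> N" "convex B" "exp ` B \<subseteq> V" using t r by (auto simp: B_def image_subset_iff)
  obtain a b where ab: "\<And>\<zeta>. \<zeta> \<in> B \<Longrightarrow> \<sigma> \<zeta> = comb2 H a (t1 (exp \<zeta>)) b (t2 (exp \<zeta>))"
    by (rule mvflat_const_comb[OF t(2) mvflat_subset[OF assms(1) B(3)] B(4,5)], rule that)
  obtain c d where cd: "\<And>\<zeta>. \<zeta> \<in> B \<Longrightarrow> \<tau> \<zeta> = comb2 H c (t1 (exp \<zeta>)) d (t2 (exp \<zeta>))"
    by (rule mvflat_const_comb[OF t(2) mvflat_subset[OF assms(2) B(3)] B(4,5)], rule that)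
  have step: "\<sigma> y = \<tau> y" if "x \<in> B" "y \<in> B" "\<sigma> x = \<tau> x" for x y
  proof -
    have "indep (exp x) (t1 (exp x)) (t2 (exp x))"
      using t(2) B(5) that(1) by (intro frameD(4)[of V]) (auto simp: flat_frame_def)
    from indep_comb_eq[OF this, of a b c d] have "a = c" "b = d" using ab[OF that(1)] cd[OF that(1)] that(3) by simp_all
    thus ?thesis using ab[OF that(2)] cd[OF that(2)] by simp
  qed
  show "\<exists>T. openin (top_of_set N) T \<and> \<xi> \<in> T \<and> (\<forall>x\<in>T. \<forall>y\<in>T. \<sigma> x = \<tau> x \<longrightarrow> \<sigma> y = \<tau> y)"
    by (rule exI[of _ B], intro conjI ballI impI open_subset[OF B(3,1)] B(2), rule step)
qed

end

section \<open>Continuation of flat sections along segments\<close>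

lemma open_neighbourhood_segment: "open (\<Union>x\<in>closed_segment 0 \<zeta>. ball (x::complex) \<delta>)"
  by (intro open_UN ballI open_ball)

text \<open>The tube is the Minkowski sum of a segment and a ball. Its convexity makes the overlaps
  of tubes and balls connected, so that continuations agree there.\<close>

lemma convex_neighbourhood_segment: "convex (\<Union>x\<in>closed_segment 0 \<zeta>. ball (x::complex) \<delta>)"
proof -
  have "(\<Union>x\<in>closed_segment 0 \<zeta>. ball x \<delta>) = (\<Union>x\<in>closed_segment 0 \<zeta>. \<Union>y\<in>ball 0 \<delta>. {x + y})"
  proof (intro SUP_cong refl equalityI subsetI)
    fix x u :: complex assume "u \<in> ball x \<delta>"
    thus "u \<in> (\<Union>y\<in>ball 0 \<delta>. {x + y})"
      by (intro UN_I[of "u - x"]) (simp_all add: dist_norm norm_minus_commute)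
  qed (auto simp: dist_norm)
  thus ?thesis using convex_sums[OF convex_closed_segment convex_ball] by simp
qed

lemma in_neighbourhood_segment:
  assumes "\<delta> > 0"
  shows "0 \<in> (\<Union>x\<in>closed_segment 0 \<zeta>. ball (x::complex) \<delta>)" "\<zeta> \<in> (\<Union>x\<in>closed_segment 0 \<zeta>. ball x \<delta>)"
  using assms by (auto intro: bexI[of _ "0::complex"] bexI[of _ \<zeta>])

lemma closed_segment_0: "closed_segment 0 \<zeta> = {of_real t * \<zeta> |t. 0 \<le> t \<and> t \<le> (1::real)}"
  by (auto simp: closed_segment_def scaleR_conv_of_real)

lemma closed_segment_subset_neighbourhood:
  assumes "\<xi> \<in> ball \<zeta> (\<delta>::real)"
  shows "closed_segment 0 \<xi> \<subseteq> (\<Union>x\<in>closed_segment 0 \<zeta>. ball (x::complex) \<delta>)"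
proof
  fix u assume "u \<in> closed_segment 0 \<xi>"
  then obtain t :: real where t: "u = of_real t * \<xi>" "0 \<le> t" "t \<le> 1" by (auto simp: closed_segment_0)
  have "dist (of_real t * \<zeta>) u = t * dist \<zeta> \<xi>"
    using t(2) by (simp add: t(1) dist_norm norm_mult flip: right_diff_distrib)
  also have "\<dots> \<le> dist \<zeta> \<xi>" using t by (simp add: mult_left_le_one_le)
  also have "\<dots> < \<delta>" using assms by simp
  finally show "u \<in> (\<Union>x\<in>closed_segment 0 \<zeta>. ball x \<delta>)"
    using t by (auto simp: closed_segment_0)
qed

context te2
begin

lemma mvflat_Un:
  assumes "mvflat A \<sigma>" "mvflat B \<tau>" "open A" "open B" "\<And>x. x \<in> A \<Longrightarrow> x \<in> B \<Longrightarrow> \<sigma> x = \<tau> x"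
  shows "mvflat (A \<union> B) (\<lambda>x. if x \<in> A then \<sigma> x else \<tau> x)"
proof (rule mvflat_cong_near)
  fix \<zeta> assume "\<zeta> \<in> A \<union> B"
  thus "\<exists>C \<rho>. open C \<and> \<zeta> \<in> C \<and> mvflat C \<rho> \<and> (\<forall>\<xi>\<in>C. (if \<xi> \<in> A then \<sigma> \<xi> else \<tau> \<xi>) = \<rho> \<xi>)"
  proof
    assume "\<zeta> \<in> A" thus ?thesis using assms by (intro exI[of _ A] exI[of _ \<sigma>]) auto
  next
    assume "\<zeta> \<in> B" thus ?thesis using assms by (intro exI[of _ B] exI[of _ \<tau>]) auto
  qed
qed

text \<open>Continuation along the segment \<open>[0, \<zeta>]\<close>, by connectedness of \<open>[0, 1]\<close>.\<close>

lemma mvflat_along_segment: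
  assumes e: "e \<in> fibre H (exp 0)"
  shows "\<exists>\<delta> \<sigma>. \<delta> > 0 \<and> mvflat (\<Union>x\<in>closed_segment 0 \<zeta>. ball x \<delta>) \<sigma> \<and> \<sigma> 0 = e"
proof -
  define T where "T \<delta> t = (\<Union>x\<in>closed_segment 0 (of_real t * \<zeta>). ball x \<delta>)" for \<delta> t
  define P where "P t \<longleftrightarrow> (\<exists>\<delta> \<sigma>. \<delta> > 0 \<and> mvflat (T \<delta> t) \<sigma> \<and> \<sigma> 0 = e)" for t
  have T: "open (T \<delta> t)" "convex (T \<delta> t)" for \<delta> t
    unfolding T_def by (rule open_neighbourhood_segment, rule convex_neighbourhood_segment)
  have T_in: "0 \<in> T \<delta> t" "of_real t * \<zeta> \<in> T \<delta> t" if "\<delta> > 0" for \<delta> t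
    unfolding T_def by (rule in_neighbourhood_segment[OF that])+
  have ext: "\<exists>\<tau>. mvflat (ball c \<epsilon>) \<tau> \<and> \<tau> x = d"
    if t: "flat_frame V t1 t2" "exp ` ball c \<epsilon> \<subseteq> V" and x: "x \<in> ball c \<epsilon>" "d \<in> fibre H (exp x)" for c \<epsilon> V t1 t2 x d
  proof -
    have "indep (exp x) (t1 (exp x)) (t2 (exp x))"
      using t x(1) by (intro frameD(4)[of V]) (auto simp: flat_frame_def)
    from comb_coord[OF this x(2)] mvflat_of_flat_frame[OF t(1) open_ball t(2)] show ?thesis by metis
  qed
  have "P 1"
  proof (rule connected_induction_simple[where S = "{0..1::real}" and P = P and a = 0 and b = 1])
    show "connected {0..1::real}" by simp
    show "P 0"
    proof -
      obtain \<epsilon> V t1 t2 where t: "\<epsilon> > 0" "flat_frame V t1 t2" "exp ` ball (0::complex) \<epsilon> \<subseteq> V"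
        by (rule local_flat_frame[of 0], rule that)
      obtain \<tau> where "mvflat (ball 0 \<epsilon>) \<tau>" "\<tau> 0 = e" using ext[OF t(2,3), of 0 e] e t(1) by auto
      moreover have "T \<epsilon> 0 = ball 0 \<epsilon>" by (simp add: T_def)
      ultimately show ?thesis unfolding P_def using t(1) by metis
    qed
    fix t0 :: real assume t0: "t0 \<in> {0..1}"
    obtain \<epsilon> V s1 s2 where fr: "\<epsilon> > 0" "flat_frame V s1 s2" "exp ` ball (of_real t0 * \<zeta>) \<epsilon> \<subseteq> V"
      by (rule local_flat_frame[of "of_real t0 * \<zeta>"], rule that)
    \<comment> \<open>Parameters closer than \<open>r\<close> to \<open>t0\<close> move the point on
      the segment by less than \<epsilon> / 2; the other half of \<epsilon> is left for the
      thickness of the new tube.\<close>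
    define r where "r = \<epsilon> / (2 * (cmod \<zeta> + 1))"
    have r: "r > 0" using fr(1) by (simp add: r_def add_nonneg_pos)
    have near: "dist (of_real t0 * \<zeta>) (of_real t * \<zeta>) < \<epsilon> / 2" if "\<bar>t - t0\<bar> < r" for t :: real
    proof -
      have "dist (of_real t0 * \<zeta>) (of_real t * \<zeta>) = \<bar>t0 - t\<bar> * cmod \<zeta>"
        by (simp add: dist_norm norm_mult flip: left_diff_distrib of_real_diff)
      also have "\<dots> \<le> \<bar>t - t0\<bar> * (cmod \<zeta> + 1)" by (intro mult_mono) auto
      also have "\<dots> < r * (cmod \<zeta> + 1)" using that by (intro mult_strict_right_mono) (auto simp: add_nonneg_pos)
      also have "\<dots> = \<epsilon> / 2"
      proof -
        have "cmod \<zeta> + 1 \<noteq> 0" using norm_ge_zero[of \<zeta>] by linarith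
        moreover have "\<epsilon> / (2 * m) * m = \<epsilon> / 2" if "m \<noteq> 0" for m using that by simp
        ultimately show ?thesis unfolding r_def by blast
      qed
      finally show ?thesis .
    qed
    have step: "P t2" if t1: "\<bar>t1 - t0\<bar> < r" "P t1" "0 \<le> t1" and t2: "\<bar>t2 - t0\<bar> < r" "0 \<le> t2" for t1 t2
    proof -
      obtain \<delta> \<sigma> where \<sigma>: "\<delta> > 0" "mvflat (T \<delta> t1) \<sigma>" "\<sigma> 0 = e" using t1(2) unfolding P_def by blast
      define c where "c = of_real t0 * \<zeta>"
      define x1 where "x1 = of_real t1 * \<zeta>"
      have x1: "x1 \<in> ball c \<epsilon>" using near[OF t1(1)] fr(1) by (simp add: c_def x1_def)
      have x1T: "x1 \<in> T \<delta> t1" unfolding x1_def by (rule T_in(2)[OF \<sigma>(1)])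
      obtain \<tau> where \<tau>: "mvflat (ball c \<epsilon>) \<tau>" "\<tau> x1 = \<sigma> x1"
        using ext[OF fr(2,3)[folded c_def] x1 mvflat_fibre[OF \<sigma>(2) x1T]] by blast
      have I: "open (T \<delta> t1 \<inter> ball c \<epsilon>)" "connected (T \<delta> t1 \<inter> ball c \<epsilon>)" "x1 \<in> T \<delta> t1 \<inter> ball c \<epsilon>"
        using T x1 T_in(2)[OF \<sigma>(1)] by (auto intro!: convex_connected convex_Int simp: x1_def)
      have agree: "\<sigma> x = \<tau> x" if "x \<in> T \<delta> t1" "x \<in> ball c \<epsilon>" for x
        by (rule mvflat_unique[OF mvflat_subset[OF \<sigma>(2) Int_lower1] mvflat_subset[OF \<tau>(1) Int_lower2] I \<tau>(2)[symmetric]]) (use that in auto)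
      note glue = mvflat_Un[OF \<sigma>(2) \<tau>(1) T(1) open_ball agree]
      define \<delta>' where "\<delta>' = min \<delta> (\<epsilon> / 2)"
      have \<delta>': "\<delta>' > 0" using \<sigma>(1) fr(1) by (simp add: \<delta>'_def)
      \<comment> \<open>The points with parameter up to \<open>t1\<close> lie on the old segment;
        the later ones are within \<epsilon> / 2 of the centre \<open>c\<close>, hence their
        \<delta>'-balls are in \<open>ball c \<epsilon>\<close>.\<close>
      have sub: "T \<delta>' t2 \<subseteq> T \<delta> t1 \<union> ball c \<epsilon>"
      proof
        fix u assume "u \<in> T \<delta>' t2"
        then obtain x where x: "x \<in> closed_segment 0 (of_real t2 * \<zeta>)" "dist x u < \<delta>'" by (auto simp: T_def)
        then obtain q :: real where q: "x = of_real q * (of_real t2 * \<zeta>)" "0 \<le> q" "q \<le> 1" by (auto simp: closed_segment_0)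
        define t where "t = q * t2"
        have t: "x = of_real t * \<zeta>" "0 \<le> t" "t \<le> t2" using q t2(2) by (auto simp: t_def mult_left_le_one_le)
        show "u \<in> T \<delta> t1 \<union> ball c \<epsilon>"
        proof (cases "t \<le> t1")
          case True
          have "x \<in> closed_segment 0 (of_real t1 * \<zeta>)"
          proof (cases "t1 = 0")
            case True thus ?thesis using \<open>t \<le> t1\<close> t by simp
          next
            case False
            hence "x = of_real (t / t1) * (of_real t1 * \<zeta>)" "0 \<le> t / t1" "t / t1 \<le> 1"
              using t \<open>t \<le> t1\<close> t1(3) by simp_all
            thus ?thesis unfolding closed_segment_0 by blast
          qed
          thus ?thesis using x(2) by (auto simp: T_def \<delta>'_def)
        next
          case False
          hence "\<bar>t - t0\<bar> < r" using t t1(1) t2(1) by linarith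
          from near[OF this] have "dist c x < \<epsilon> / 2" by (simp add: c_def t(1))
          moreover have "dist x u < \<epsilon> / 2" using x(2) by (simp add: \<delta>'_def)
          ultimately have "dist c u < \<epsilon>" using dist_triangle[of c u x] by linarith
          thus ?thesis by simp
        qed
      qed
      have "mvflat (T \<delta>' t2) (\<lambda>x. if x \<in> T \<delta> t1 then \<sigma> x else \<tau> x)" by (rule mvflat_subset[OF glue sub])
      thus "P t2" unfolding P_def using \<delta>' \<sigma>(3) T_in(1)[OF \<sigma>(1)] 
        by (intro exI[of _ \<delta>'] exI[of _ "\<lambda>x. if x \<in> T \<delta> t1 then \<sigma> x else \<tau> x"] conjI) auto
    qed
    show "\<exists>S. openin (top_of_set {0..1}) S \<and> t0 \<in> S \<and> (\<forall>x\<in>S. \<forall>y\<in>S. P x \<longrightarrow> P y)"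
    proof (intro exI[of _ "{0..1} \<inter> ball t0 r"] conjI ballI impI)
      show "openin (top_of_set {0..1}) ({0..1} \<inter> ball t0 r)" by (simp add: openin_open_Int)
      show "t0 \<in> {0..1} \<inter> ball t0 r" using t0 r by simp
      fix x y assume "x \<in> {0..1} \<inter> ball t0 r" "y \<in> {0..1} \<inter> ball t0 r" "P x"
      thus "P y" by (intro step[of x y]) (auto simp: dist_real_def)
    qed
  qed auto
  thus ?thesis unfolding P_def T_def by simp
qed

text \<open>The global section is the diagonal: at \<zeta> it is the value of the continuation along
  the segment to \<zeta>. Two tubes meet in a convex set containing 0, where all continuations have
  the value \<open>e\<close>, so neighbouring values fit together.\<close>

lemma ex_mvflat_global:
  assumes e: "e \<in> fibre H (exp 0)"
  obtains \<sigma> where "mvflat UNIV \<sigma>" "\<sigma> 0 = e"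
proof -
  define T where "T \<delta> \<zeta> = (\<Union>x\<in>closed_segment 0 \<zeta>. ball (x::complex) \<delta>)" for \<delta> \<zeta>
  have "\<forall>\<zeta>. \<exists>\<delta> \<sigma>. \<delta> > 0 \<and> mvflat (T \<delta> \<zeta>) \<sigma> \<and> \<sigma> 0 = e"
    unfolding T_def using mvflat_along_segment[OF e] by blast
  then obtain \<delta> \<sigma> where \<sigma>: "\<And>\<zeta>. \<delta> \<zeta> > 0" "\<And>\<zeta>. mvflat (T (\<delta> \<zeta>) \<zeta>) (\<sigma> \<zeta>)" "\<And>\<zeta>. \<sigma> \<zeta> 0 = e"
    by metis
  have T: "open (T d \<zeta>)" "convex (T d \<zeta>)" for d \<zeta>
    unfolding T_def by (rule open_neighbourhood_segment, rule convex_neighbourhood_segment)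
  have T_in: "0 \<in> T d \<zeta>" "\<zeta> \<in> T d \<zeta>" if "d > 0" for d \<zeta>
    unfolding T_def by (rule in_neighbourhood_segment[OF that])+
  have agree: "\<sigma> \<xi> \<xi> = \<sigma> \<zeta> \<xi>" if \<xi>: "\<xi> \<in> ball \<zeta> (\<delta> \<zeta>)" for \<xi> \<zeta>
  proof -
    let ?I = "T (\<delta> \<xi>) \<xi> \<inter> T (\<delta> \<zeta>) \<zeta>"
    have "\<xi> \<in> T (\<delta> \<zeta>) \<zeta>"
      using subsetD[OF closed_segment_subset_neighbourhood[OF \<xi>] ends_in_segment(2)] unfolding T_def .
    hence I: "open ?I" "connected ?I" "0 \<in> ?I" "\<xi> \<in> ?I"
      using T T_in \<sigma>(1) by (auto intro!: convex_connected convex_Int)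
    show ?thesis
      by (rule mvflat_unique[OF mvflat_subset[OF \<sigma>(2) Int_lower1] mvflat_subset[OF \<sigma>(2) Int_lower2] I(1,2,3) _ I(4)])
        (simp add: \<sigma>(3))
  qed
  have "mvflat UNIV (\<lambda>\<zeta>. \<sigma> \<zeta> \<zeta>)"
  proof (rule mvflat_cong_near)
    fix \<zeta> :: complex
    have "ball \<zeta> (\<delta> \<zeta>) \<subseteq> T (\<delta> \<zeta>) \<zeta>" unfolding T_def by auto
    thus "\<exists>B \<tau>. open B \<and> \<zeta> \<in> B \<and> mvflat B \<tau> \<and> (\<forall>\<xi>\<in>B. \<sigma> \<xi> \<xi> = \<tau> \<xi>)"
      using mvflat_subset[OF \<sigma>(2)] agree \<sigma>(1) by (intro exI[of _ "ball \<zeta> (\<delta> \<zeta>)"] exI[of _ "\<sigma> \<zeta>"]) auto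
  qed
  thus thesis using that \<sigma>(3) by blast
qed

section \<open>Global flat frames and the monodromy matrix\<close>

definition mvframe :: "(complex \<Rightarrow> 'a) \<Rightarrow> (complex \<Rightarrow> 'a) \<Rightarrow> bool" where
  "mvframe \<sigma>1 \<sigma>2 \<longleftrightarrow> mvflat UNIV \<sigma>1 \<and> mvflat UNIV \<sigma>2 \<and> (\<forall>\<zeta>. indep (exp \<zeta>) (\<sigma>1 \<zeta>) (\<sigma>2 \<zeta>))"

text \<open>Near any point both sections are constant combinations of one flat frame, so their
  independence there is decided by a single constant determinant and spreads by
  connectedness.\<close>

lemma mvframe_if_indep:
  assumes \<sigma>: "mvflat UNIV \<sigma>1" "mvflat UNIV \<sigma>2" and i: "indep (exp \<zeta>0) (\<sigma>1 \<zeta>0) (\<sigma>2 \<zeta>0)"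
  shows "mvframe \<sigma>1 \<sigma>2"
  unfolding mvframe_def
proof (intro conjI allI \<sigma>)
  fix \<zeta>
  show "indep (exp \<zeta>) (\<sigma>1 \<zeta>) (\<sigma>2 \<zeta>)"
  proof (rule connected_induction_simple[where S = UNIV and P = "\<lambda>\<zeta>. indep (exp \<zeta>) (\<sigma>1 \<zeta>) (\<sigma>2 \<zeta>)" and a = \<zeta>0, OF _ _ _ i])
    fix \<xi> :: complex
    obtain \<epsilon> V t1 t2 where t: "\<epsilon> > 0" "flat_frame V t1 t2" "exp ` ball \<xi> \<epsilon> \<subseteq> V" by (rule local_flat_frame, rule that)
    obtain a b where ab: "\<And>\<zeta>. \<zeta> \<in> ball \<xi> \<epsilon> \<Longrightarrow> \<sigma>1 \<zeta> = comb2 H a (t1 (exp \<zeta>)) b (t2 (exp \<zeta>))"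
      by (rule mvflat_const_comb[OF t(2) mvflat_subset[OF \<sigma>(1) subset_UNIV] convex_ball t(3)], rule that)
    obtain c d where cd: "\<And>\<zeta>. \<zeta> \<in> ball \<xi> \<epsilon> \<Longrightarrow> \<sigma>2 \<zeta> = comb2 H c (t1 (exp \<zeta>)) d (t2 (exp \<zeta>))"
      by (rule mvflat_const_comb[OF t(2) mvflat_subset[OF \<sigma>(2) subset_UNIV] convex_ball t(3)], rule that)
    have "indep (exp x) (\<sigma>1 x) (\<sigma>2 x) \<longleftrightarrow> a * d - b * c \<noteq> 0" if "x \<in> ball \<xi> \<epsilon>" for x
    proof -
      have "indep (exp x) (t1 (exp x)) (t2 (exp x))"
        using t that by (intro frameD(4)[of V]) (auto simp: flat_frame_def)
      from indep_comb_iff[OF this] show ?thesis unfolding ab[OF that] cd[OF that] .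
    qed
    thus "\<exists>T. openin (top_of_set UNIV) T \<and> \<xi> \<in> T \<and>
        (\<forall>x\<in>T. \<forall>y\<in>T. indep (exp x) (\<sigma>1 x) (\<sigma>2 x) \<longrightarrow> indep (exp y) (\<sigma>1 y) (\<sigma>2 y))"
      using t(1) by (intro exI[of _ "ball \<xi> \<epsilon>"]) auto
  qed auto
qed

lemma ex_mvframe: obtains \<sigma>1 \<sigma>2 where "mvframe \<sigma>1 \<sigma>2"
proof -
  obtain U v1 v2 where U: "frame U v1 v2" "exp 0 \<in> U" by (rule ex_frame[of "exp 0"], rule that)
  note i = frameD(4)[OF U]
  obtain \<sigma>1 where 1: "mvflat UNIV \<sigma>1" "\<sigma>1 0 = v1 (exp 0)" by (rule ex_mvflat_global[OF indep_fibre(1)[OF i]], rule that)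
  obtain \<sigma>2 where 2: "mvflat UNIV \<sigma>2" "\<sigma>2 0 = v2 (exp 0)" by (rule ex_mvflat_global[OF indep_fibre(2)[OF i]], rule that)
  have "mvframe \<sigma>1 \<sigma>2" by (rule mvframe_if_indep[OF 1(1) 2(1), of 0]) (simp only: 1(2) 2(2) i)
  thus thesis by (rule that)
qed

lemma mvframe_comb:
  assumes fr: "mvframe \<sigma>1 \<sigma>2" and \<tau>: "mvflat N \<tau>" and N: "open N" "connected N"
  obtains a b where "\<And>\<zeta>. \<zeta> \<in> N \<Longrightarrow> \<tau> \<zeta> = comb2 H a (\<sigma>1 \<zeta>) b (\<sigma>2 \<zeta>)"
proof (cases "N = {}")
  case False
  then obtain \<zeta>0 where \<zeta>0: "\<zeta>0 \<in> N" by blast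
  have \<sigma>: "mvflat UNIV \<sigma>1" "mvflat UNIV \<sigma>2" "indep (exp \<zeta>0) (\<sigma>1 \<zeta>0) (\<sigma>2 \<zeta>0)" using fr by (simp_all add: mvframe_def)
  obtain a b where ab: "\<tau> \<zeta>0 = comb2 H a (\<sigma>1 \<zeta>0) b (\<sigma>2 \<zeta>0)" by (rule indep_span[OF \<sigma>(3) mvflat_fibre[OF \<tau> \<zeta>0]], rule that)
  have "\<tau> \<zeta> = comb2 H a (\<sigma>1 \<zeta>) b (\<sigma>2 \<zeta>)" if "\<zeta> \<in> N" for \<zeta>
    by (rule mvflat_unique[OF \<tau> mvflat_subset[OF mvflat_comb[OF \<sigma>(1,2)] subset_UNIV] N \<zeta>0 ab that])
  thus thesis by (rule that)
qed (use that in auto)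

lemma mvframe_turn:
  assumes fr: "mvframe \<sigma>1 \<sigma>2"
  obtains a b c d where "a * d - b * c \<noteq> 0"
    "\<And>\<zeta>. \<sigma>1 (\<zeta> + 2 * of_real pi * \<i>) = comb2 H a (\<sigma>1 \<zeta>) c (\<sigma>2 \<zeta>)"
    "\<And>\<zeta>. \<sigma>2 (\<zeta> + 2 * of_real pi * \<i>) = comb2 H b (\<sigma>1 \<zeta>) d (\<sigma>2 \<zeta>)"
proof -
  have \<sigma>: "mvflat UNIV \<sigma>1" "mvflat UNIV \<sigma>2" "\<And>\<zeta>. indep (exp \<zeta>) (\<sigma>1 \<zeta>) (\<sigma>2 \<zeta>)" using fr by (simp_all add: mvframe_def)
  obtain a c where 1: "\<And>\<zeta>. \<zeta> \<in> UNIV \<Longrightarrow> \<sigma>1 (\<zeta> + 2 * of_real pi * \<i>) = comb2 H a (\<sigma>1 \<zeta>) c (\<sigma>2 \<zeta>)"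
    by (rule mvframe_comb[OF fr mvflat_turn[OF \<sigma>(1)] open_UNIV connected_UNIV]) (simp, rule that)
  obtain b d where 2: "\<And>\<zeta>. \<zeta> \<in> UNIV \<Longrightarrow> \<sigma>2 (\<zeta> + 2 * of_real pi * \<i>) = comb2 H b (\<sigma>1 \<zeta>) d (\<sigma>2 \<zeta>)"
    by (rule mvframe_comb[OF fr mvflat_turn[OF \<sigma>(2)] open_UNIV connected_UNIV]) (simp, rule that)
  have "exp (0 + 2 * of_real pi * \<i>) = exp (0::complex)" by (simp only: exp_add exp_two_pi_i mult_1_right)
  hence "indep (exp 0) (comb2 H a (\<sigma>1 0) c (\<sigma>2 0)) (comb2 H b (\<sigma>1 0) d (\<sigma>2 0))"
    using \<sigma>(3)[of "0 + 2 * of_real pi * \<i>"] 1[of 0] 2[of 0] by simp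
  hence "a * d - c * b \<noteq> 0" using indep_comb_iff[OF \<sigma>(3)] by blast
  thus thesis using that[of a d b c] 1 2 by (simp add: mult.commute)
qed

text \<open>Every flat multivalued section is a constant combination of the flat frame, so its
  monodromy acts on the pair of coefficients by a constant matrix and comparison at one point
  suffices.\<close>

lemma Eig_mon_iff:
  assumes fr: "mvframe \<sigma>1 \<sigma>2"
    and M: "\<And>\<zeta>. \<sigma>1 (\<zeta> + 2 * of_real pi * \<i>) = comb2 H a (\<sigma>1 \<zeta>) c (\<sigma>2 \<zeta>)"
      "\<And>\<zeta>. \<sigma>2 (\<zeta> + 2 * of_real pi * \<i>) = comb2 H b (\<sigma>1 \<zeta>) d (\<sigma>2 \<zeta>)"
  shows "k \<in> Eig_mon H \<longleftrightarrow> (\<exists>x y. (x \<noteq> 0 \<or> y \<noteq> 0) \<and> a * x + b * y = k * x \<and> c * x + d * y = k * y)"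
proof -
  have \<sigma>: "mvflat UNIV \<sigma>1" "mvflat UNIV \<sigma>2" "\<And>\<zeta>. indep (exp \<zeta>) (\<sigma>1 \<zeta>) (\<sigma>2 \<zeta>)" using fr by (simp_all add: mvframe_def)
  note f = indep_fibre[OF \<sigma>(3)]
  have e: "exp (\<zeta> + 2 * of_real pi * \<i>) = exp \<zeta>" for \<zeta> :: complex by (simp only: exp_add exp_two_pi_i mult_1_right)
  have turn: "comb2 H x (\<sigma>1 (\<zeta> + 2 * of_real pi * \<i>)) y (\<sigma>2 (\<zeta> + 2 * of_real pi * \<i>)) =
      comb2 H (a * x + b * y) (\<sigma>1 \<zeta>) (c * x + d * y) (\<sigma>2 \<zeta>)" for x y \<zeta>
    unfolding M comb_comb[OF f] by (simp add: mult.commute)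
  have scale: "fibre_scale H k (comb2 H x (\<sigma>1 \<zeta>) y (\<sigma>2 \<zeta>)) = comb2 H (k * x) (\<sigma>1 \<zeta>) (k * y) (\<sigma>2 \<zeta>)" for x y \<zeta>
    by (rule scale_comb[OF f])
  have zero: "comb2 H x (\<sigma>1 \<zeta>) y (\<sigma>2 \<zeta>) = fibre_zero H (exp \<zeta>) \<longleftrightarrow> x = 0 \<and> y = 0" for x y \<zeta>
    using indep_comb_eq[OF \<sigma>(3), of x \<zeta> y 0 0] comb_zero[OF f] by metis
  show ?thesis
  proof
    assume "k \<in> Eig_mon H"
    then obtain \<sigma> \<zeta>0 where s: "mvflat UNIV \<sigma>" "\<sigma> \<zeta>0 \<noteq> fibre_zero H (exp \<zeta>0)" "monodromy \<sigma> = (\<lambda>\<zeta>. fibre_scale H k (\<sigma> \<zeta>))"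
      unfolding Eig_mon_def mem_Collect_eq using flat_multivalued_iff by (elim bexE conjE exE) blast
    obtain x y where xy: "\<And>\<zeta>. \<zeta> \<in> UNIV \<Longrightarrow> \<sigma> \<zeta> = comb2 H x (\<sigma>1 \<zeta>) y (\<sigma>2 \<zeta>)"
      by (rule mvframe_comb[OF fr s(1) open_UNIV connected_UNIV], rule that)
    have "x \<noteq> 0 \<or> y \<noteq> 0" using s(2) xy[of \<zeta>0] zero by auto
    moreover have "\<sigma> (0 + 2 * of_real pi * \<i>) = fibre_scale H k (\<sigma> 0)" using fun_cong[OF s(3), of 0] by (simp add: monodromy_def)
    hence "comb2 H (a * x + b * y) (\<sigma>1 0) (c * x + d * y) (\<sigma>2 0) = comb2 H (k * x) (\<sigma>1 0) (k * y) (\<sigma>2 0)"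
      unfolding xy[OF UNIV_I] turn scale .
    from indep_comb_eq[OF \<sigma>(3) this] have "a * x + b * y = k * x" "c * x + d * y = k * y" .
    ultimately show "\<exists>x y. (x \<noteq> 0 \<or> y \<noteq> 0) \<and> a * x + b * y = k * x \<and> c * x + d * y = k * y" by blast
  next
    assume "\<exists>x y. (x \<noteq> 0 \<or> y \<noteq> 0) \<and> a * x + b * y = k * x \<and> c * x + d * y = k * y"
    then obtain x y where xy: "x \<noteq> 0 \<or> y \<noteq> 0" "a * x + b * y = k * x" "c * x + d * y = k * y" by blast
    define \<sigma> where "\<sigma> = (\<lambda>\<zeta>. comb2 H x (\<sigma>1 \<zeta>) y (\<sigma>2 \<zeta>))"
    have "mvflat UNIV \<sigma>" unfolding \<sigma>_def by (rule mvflat_comb[OF \<sigma>(1,2)])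
    moreover have "\<sigma> 0 \<noteq> fibre_zero H (exp 0)" unfolding \<sigma>_def zero using xy(1) by blast
    moreover have "monodromy \<sigma> = (\<lambda>\<zeta>. fibre_scale H k (\<sigma> \<zeta>))"
      unfolding monodromy_def \<sigma>_def turn scale xy(2,3) ..
    ultimately show "k \<in> Eig_mon H"
      unfolding Eig_mon_def mem_Collect_eq using flat_multivalued_iff[of \<sigma>] by (intro bexI[of _ \<sigma>] conjI exI[of _ 0]) simp_all
  qed
qed

end

section \<open>Connection matrices at 0 and the formal invariants\<close>

lemma ex_ball_in_Int:
  fixes A B :: "complex set"
  assumes "open A" "open B" "0 \<in> A" "0 \<in> B"
  obtains r where "r > 0" "ball 0 r \<subseteq> A" "ball 0 r \<subseteq> B"
proof -
  have "open (A \<inter> B)" "0 \<in> A \<inter> B" using assms by auto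
  then obtain r where "r > 0" "ball 0 r \<subseteq> A \<inter> B" by (rule openE)
  thus thesis using that[of r] by simp
qed

text \<open>Tailored to gauge transformations, which change the trace and the determinant of a
  connection matrix only by z^2 times a holomorphic function.\<close>

lemma first_order_agree:
  fixes f g k :: "complex \<Rightarrow> complex"
  assumes hol: "f holomorphic_on ball 0 r" "g holomorphic_on ball 0 r" "k holomorphic_on ball 0 r" and r: "r > 0"
    and eq0: "\<And>z. z \<in> ball 0 r - {0} \<Longrightarrow> f z = g z + z\<^sup>2 * k z"
  shows "f 0 = g 0" "deriv f 0 = deriv g 0"
proof -
  have eq: "f z = g z + z\<^sup>2 * k z" if "z \<in> ball 0 r" for z
    by (rule continuous_eq_at_zero[OF hol(1) _ r eq0 that]) (intro holomorphic_intros hol)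
  show "f 0 = g 0" using eq[of 0] r by simp
  have 0: "0 \<in> ball (0::complex) r" using r by simp
  note d = holomorphic_derivI[OF hol(2) open_ball 0] holomorphic_derivI[OF hol(3) open_ball 0]
  have "((\<lambda>z. z\<^sup>2 * k z) has_field_derivative 0) (at 0)"
    using d(2) by (auto intro!: derivative_eq_intros)
  from DERIV_add[OF d(1) this] have "((\<lambda>z. g z + z\<^sup>2 * k z) has_field_derivative deriv g 0) (at 0)" by simp
  hence "(f has_field_derivative deriv g 0) (at 0)"
    by (rule has_field_derivative_transform_within_open[OF _ open_ball 0]) (simp add: eq)
  thus "deriv f 0 = deriv g 0" by (rule DERIV_imp_deriv)
qed

lemma matrix_coeff_nth:
  "matrix_coeff B 0 $ i $ j = B 0 $ i $ j" "matrix_coeff B 1 $ i $ j = deriv (\<lambda>z. B z $ i $ j) 0"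
  by (simp_all add: matrix_coeff_def fps_expansion_def)

context te2
begin

text \<open>That is, \<open>z\<^sup>2 \<nabla> (v1, v2) = (v1, v2) B\<close> with the rows \<open>(a, b)\<close> and \<open>(c, d)\<close> of \<open>B\<close>.\<close>

definition cframe :: "complex set \<Rightarrow> (complex \<Rightarrow> 'a) \<Rightarrow> (complex \<Rightarrow> 'a) \<Rightarrow> (complex \<Rightarrow> complex) \<Rightarrow> (complex \<Rightarrow> complex) \<Rightarrow>
    (complex \<Rightarrow> complex) \<Rightarrow> (complex \<Rightarrow> complex) \<Rightarrow> bool" where
  "cframe W v1 v2 a b c d \<longleftrightarrow> frame W v1 v2 \<and> 0 \<in> W \<and>
     a holomorphic_on W \<and> b holomorphic_on W \<and> c holomorphic_on W \<and> d holomorphic_on W \<and>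
     (\<forall>z\<in>W - {0}. nabla H (W - {0}) v1 z = comb2 H (a z / z\<^sup>2) (v1 z) (c z / z\<^sup>2) (v2 z) \<and>
        nabla H (W - {0}) v2 z = comb2 H (b z / z\<^sup>2) (v1 z) (d z / z\<^sup>2) (v2 z))"

lemma cframeD:
  assumes "cframe W v1 v2 a b c d"
  shows "frame W v1 v2" "0 \<in> W" "open W" "a holomorphic_on W" "b holomorphic_on W" "c holomorphic_on W" "d holomorphic_on W"
    "z \<in> W - {0} \<Longrightarrow> nabla H (W - {0}) v1 z = comb2 H (a z / z\<^sup>2) (v1 z) (c z / z\<^sup>2) (v2 z)"
    "z \<in> W - {0} \<Longrightarrow> nabla H (W - {0}) v2 z = comb2 H (b z / z\<^sup>2) (v1 z) (d z / z\<^sup>2) (v2 z)"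
    "open (W - {0})" "W - {0} \<subseteq> - {0}" "frame (W - {0}) v1 v2"
proof -
  show fr: "frame W v1 v2" using assms by (simp add: cframe_def)
  show o: "open W" by (rule frameD(1)[OF fr])
  thus o': "open (W - {0})" by (rule open_delete)
  show "W - {0} \<subseteq> - {0}" by blast
  show "frame (W - {0}) v1 v2" by (rule frame_subset[OF fr o']) blast
qed (use assms in \<open>simp_all add: cframe_def\<close>)

lemma cframe_subset:
  assumes "cframe W v1 v2 a b c d" "open W'" "0 \<in> W'" "W' \<subseteq> W"
  shows "cframe W' v1 v2 a b c d"
proof -
  note D = cframeD[OF assms(1)]
  have o: "open (W' - {0})" "W' - {0} \<subseteq> W - {0}" using assms(2,4) open_delete by auto
  have n: "nabla H (W' - {0}) s z = nabla H (W - {0}) s z" if "hol_section H W s" "z \<in> W' - {0}" for s z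
    by (rule nabla_restrict[OF D(10,11) hol_section_subset[OF that(1)] o refl that(2)]) blast
  show ?thesis
    unfolding cframe_def
    using frame_subset[OF D(1) assms(2,4)] assms(3,4) D(4-9) n frameD(2,3)[OF D(1)] o(2)
    by (auto elim: holomorphic_on_subset)
qed

lemma ex_cframe_of_frame:
  assumes fr: "frame W v1 v2" and 0: "0 \<in> W"
  obtains a b c d where "cframe W v1 v2 a b c d"
proof -
  note F = frameD[OF fr]
  obtain t1 where t1: "z2nabla H W v1 t1" using ex_z2nabla[OF F(1,2)] by blast
  obtain t2 where t2: "z2nabla H W v2 t2" using ex_z2nabla[OF F(1,3)] by blast
  have t: "hol_section H W t1" "hol_section H W t2" using t1 t2 by (simp_all add: z2nabla_def)
  have o: "open (W - {0})" "W - {0} \<subseteq> - {0}" using F(1) open_delete by auto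
  have key: "nabla H (W - {0}) v z = comb2 H (coord1 (v1 z) (v2 z) (t z) / z\<^sup>2) (v1 z) (coord2 (v1 z) (v2 z) (t z) / z\<^sup>2) (v2 z)"
    if z: "z \<in> W - {0}" and v: "hol_section H W v" and vt: "z2nabla H W v t" for z v t
  proof -
    have zW: "z \<in> W" using z by blast
    have n: "nabla H (W - {0}) v z \<in> fibre H z"
      by (rule hol_section_fibre[OF nabla_section[OF o hol_section_subset[OF v]] z]) blast
    obtain p q where pq: "nabla H (W - {0}) v z = comb2 H p (v1 z) q (v2 z)" by (rule indep_span[OF F(4)[OF zW] n], rule that)
    have "t z = fibre_scale H (z\<^sup>2) (comb2 H p (v1 z) q (v2 z))" using vt z pq by (simp add: z2nabla_def)
    also have "\<dots> = comb2 H (z\<^sup>2 * p) (v1 z) (z\<^sup>2 * q) (v2 z)" by (rule scale_comb[OF F(5,6)[OF zW]])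
    finally show ?thesis unfolding pq using z by (simp add: coord_comb[OF F(4)[OF zW]])
  qed
  have "cframe W v1 v2 (\<lambda>z. coord1 (v1 z) (v2 z) (t1 z)) (\<lambda>z. coord1 (v1 z) (v2 z) (t2 z))
      (\<lambda>z. coord2 (v1 z) (v2 z) (t1 z)) (\<lambda>z. coord2 (v1 z) (v2 z) (t2 z))"
    unfolding cframe_def
    using fr 0 coord_holomorphic[OF fr t(1)] coord_holomorphic[OF fr t(2)] key[OF _ F(2) t1] key[OF _ F(3) t2] by blast
  thus thesis by (rule that)
qed

lemma ex_cframe: obtains W v1 v2 a b c d where "cframe W v1 v2 a b c d"
proof -
  obtain U v1 v2 where U: "frame U v1 v2" "0 \<in> U" by (rule ex_frame[of 0], rule that)
  obtain a b c d where "cframe U v1 v2 a b c d" by (rule ex_cframe_of_frame[OF U], rule that)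
  thus thesis by (rule that)
qed

lemma cframe_nabla_comb:
  assumes cf: "cframe W v1 v2 a b c d" and hol: "f holomorphic_on W" "g holomorphic_on W" and z: "z \<in> W - {0}"
  shows "nabla H (W - {0}) (\<lambda>w. comb2 H (f w) (v1 w) (g w) (v2 w)) z =
     comb2 H ((z\<^sup>2 * deriv f z + a z * f z + b z * g z) / z\<^sup>2) (v1 z) ((z\<^sup>2 * deriv g z + c z * f z + d z * g z) / z\<^sup>2) (v2 z)"
proof -
  note D = cframeD[OF cf]
  have hol': "f holomorphic_on W - {0}" "g holomorphic_on W - {0}" using hol by (auto elim: holomorphic_on_subset)
  have z0: "z \<noteq> 0" using z by blast
  show ?thesis
    unfolding nabla_frame_comb[OF D(12,11) hol' z D(8,9)[OF z]]
    by (rule arg_cong2[where f = "\<lambda>x y. comb2 H x (v1 z) y (v2 z)"]) (use z0 in \<open>simp_all add: field_simps\<close>)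
qed

text \<open>Let G have the rows (p, q) and (r, s). The four equations say G B' = z^2 G' + B G, where
  G' is the derivative and B' the new connection matrix; the new frame is the old one times
  G.\<close>

lemma cframe_gauge:
  assumes cf: "cframe W v1 v2 a b c d" and W': "open W'" "0 \<in> W'" "W' \<subseteq> W"
    and hol: "p holomorphic_on W'" "q holomorphic_on W'" "r holomorphic_on W'" "s holomorphic_on W'"
    and hol': "a' holomorphic_on W'" "b' holomorphic_on W'" "c' holomorphic_on W'" "d' holomorphic_on W'"
    and det: "\<And>z. z \<in> W' \<Longrightarrow> p z * s z - r z * q z \<noteq> 0"
    and eq: "\<And>z. z \<in> W' - {0} \<Longrightarrow>
      p z * a' z + q z * c' z = z\<^sup>2 * deriv p z + a z * p z + b z * r z \<and>
      r z * a' z + s z * c' z = z\<^sup>2 * deriv r z + c z * p z + d z * r z \<and>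
      p z * b' z + q z * d' z = z\<^sup>2 * deriv q z + a z * q z + b z * s z \<and>
      r z * b' z + s z * d' z = z\<^sup>2 * deriv s z + c z * q z + d z * s z"
  shows "cframe W' (\<lambda>z. comb2 H (p z) (v1 z) (r z) (v2 z)) (\<lambda>z. comb2 H (q z) (v1 z) (s z) (v2 z)) a' b' c' d'"
proof -
  have cf': "cframe W' v1 v2 a b c d" by (rule cframe_subset[OF cf W'])
  note D = cframeD[OF cf']
  have fr: "frame W' (\<lambda>z. comb2 H (p z) (v1 z) (r z) (v2 z)) (\<lambda>z. comb2 H (q z) (v1 z) (s z) (v2 z))"
    by (rule frame_change[OF D(1) W'(1) order_refl hol(1,3,2,4) det])
  have "nabla H (W' - {0}) (\<lambda>z. comb2 H (p z) (v1 z) (r z) (v2 z)) z =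
      comb2 H (a' z / z\<^sup>2) (comb2 H (p z) (v1 z) (r z) (v2 z)) (c' z / z\<^sup>2) (comb2 H (q z) (v1 z) (s z) (v2 z)) \<and>
     nabla H (W' - {0}) (\<lambda>z. comb2 H (q z) (v1 z) (s z) (v2 z)) z =
      comb2 H (b' z / z\<^sup>2) (comb2 H (p z) (v1 z) (r z) (v2 z)) (d' z / z\<^sup>2) (comb2 H (q z) (v1 z) (s z) (v2 z))"
    if z: "z \<in> W' - {0}" for z
  proof -
    have f: "v1 z \<in> fibre H z" "v2 z \<in> fibre H z" using frameD(5,6)[OF D(1)] z by blast+
    note e = eq[OF z, THEN conjunct1] eq[OF z, THEN conjunct2, THEN conjunct1]
      eq[OF z, THEN conjunct2, THEN conjunct2, THEN conjunct1] eq[OF z, THEN conjunct2, THEN conjunct2, THEN conjunct2]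
    show ?thesis
      unfolding cframe_nabla_comb[OF cf' hol(1,3) z] cframe_nabla_comb[OF cf' hol(2,4) z] comb_comb[OF f] e[symmetric]
      by (simp add: add_divide_distrib mult.commute)
  qed
  thus ?thesis unfolding cframe_def using fr W'(2) hol' by blast
qed

section \<open>Germ bases, frames near 0 and their connection matrices\<close>

lemma indep_of_span:
  assumes "indep z e1 e2" and f: "x \<in> fibre H z" "y \<in> fibre H z"
    and e: "e1 = comb2 H a x b y" "e2 = comb2 H c x d y"
  shows "indep z x y"
proof -
  obtain U \<phi> where U: "(U, \<phi>) \<in> atlas H" "z \<in> U" using ex_chart by blast
  have "det2 (\<phi> e1) (\<phi> e2) = (a * d - b * c) * det2 (\<phi> x) (\<phi> y)"
    unfolding e comb_chart[OF U f] by (simp add: det2_def algebra_simps)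
  hence "det2 (\<phi> x) (\<phi> y) \<noteq> 0" using indep_chart[OF assms(1) U] by auto
  thus ?thesis by (rule indepI[OF f U])
qed

lemma frame_germ_section:
  assumes "frame W v1 v2" "0 \<in> W" "germ_section H s"
  obtains W' f g where "open W'" "0 \<in> W'" "W' \<subseteq> W" "f holomorphic_on W'" "g holomorphic_on W'" "hol_section H W' s"
    "\<And>z. z \<in> W' \<Longrightarrow> s z = comb2 H (f z) (v1 z) (g z) (v2 z)"
proof -
  obtain V where V: "open V" "0 \<in> V" "hol_section H V s" using assms(3) unfolding germ_section_def by blast
  note F = frameD[OF assms(1)]
  have o: "open (W \<inter> V)" using F(1) V(1) by (rule open_Int)
  have fr: "frame (W \<inter> V) v1 v2" by (rule frame_subset[OF assms(1) o Int_lower1])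
  have s: "hol_section H (W \<inter> V) s" by (rule hol_section_subset[OF V(3) Int_lower2])
  show thesis
    by (rule that[OF o _ Int_lower1 coord_holomorphic[OF fr s] s])
      (use assms(2) V(2) comb_coord[OF frameD(4)[OF fr] hol_section_fibre[OF s]] in auto)
qed

lemma germ_basis_of_frame:
  assumes fr: "frame W v1 v2" and 0: "0 \<in> W"
  shows "germ_basis H v1 v2"
  unfolding germ_basis_def
proof (intro conjI allI impI)
  note F = frameD[OF fr]
  show "germ_section H v1" "germ_section H v2" unfolding germ_section_def using F(1-3) 0 by blast+
  show "\<exists>f g. f analytic_on {0} \<and> g analytic_on {0} \<and> (\<forall>\<^sub>F z in nhds 0. s z = comb2 H (f z) (v1 z) (g z) (v2 z))"
    if s: "germ_section H s" for s
  proof -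
    obtain W' f g where *: "open W'" "0 \<in> W'" "W' \<subseteq> W" "f holomorphic_on W'" "g holomorphic_on W'" "hol_section H W' s"
      "\<And>z. z \<in> W' \<Longrightarrow> s z = comb2 H (f z) (v1 z) (g z) (v2 z)" by (rule frame_germ_section[OF fr 0 s], rule that)
    have "f analytic_on {0}" "g analytic_on {0}" using * by (auto simp: analytic_at)
    moreover have "\<forall>\<^sub>F z in nhds 0. s z = comb2 H (f z) (v1 z) (g z) (v2 z)"
      using eventually_nhds_in_open[OF *(1,2)] by eventually_elim (rule *(7))
    ultimately show ?thesis by blast
  qed
  fix f g assume fg: "f analytic_on {0} \<and> g analytic_on {0} \<and> (\<forall>\<^sub>F z in nhds 0. comb2 H (f z) (v1 z) (g z) (v2 z) = fibre_zero H z)"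
  hence "\<forall>\<^sub>F z in nhds 0. comb2 H (f z) (v1 z) (g z) (v2 z) = fibre_zero H z" by blast
  moreover have "\<forall>\<^sub>F z in nhds 0. z \<in> W" by (rule eventually_nhds_in_open[OF F(1) 0])
  ultimately show "\<forall>\<^sub>F z in nhds 0. f z = 0 \<and> g z = 0"
  proof eventually_elim
    case (elim z)
    hence "comb2 H (f z) (v1 z) (g z) (v2 z) = comb2 H 0 (v1 z) 0 (v2 z)" using comb_zero[OF F(5,6)[OF elim(2)]] by simp
    from indep_comb_eq[OF F(4)[OF elim(2)] this] show ?case by blast
  qed
qed

text \<open>A germ basis generates the sections of a frame \<open>e1\<close>, \<open>e2\<close>, so
  its values at 0 span the fibre and are independent. The determinant with respect to the frame then
  stays nonzero near 0.\<close>

lemma frame_of_germ_basis: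
  assumes gb: "germ_basis H v1 v2"
  obtains W where "frame W v1 v2" "0 \<in> W"
proof -
  obtain U e1 e2 where U: "frame U e1 e2" "0 \<in> U" by (rule ex_frame[of 0], rule that)
  have gs: "germ_section H v1" "germ_section H v2" "germ_section H e1" "germ_section H e2"
    using gb frameD(1-3)[OF U(1)] U(2) unfolding germ_basis_def germ_section_def by blast+
  obtain W1 p r where 1: "open W1" "0 \<in> W1" "W1 \<subseteq> U" "p holomorphic_on W1" "r holomorphic_on W1" "hol_section H W1 v1"
    "\<And>z. z \<in> W1 \<Longrightarrow> v1 z = comb2 H (p z) (e1 z) (r z) (e2 z)" by (rule frame_germ_section[OF U gs(1)], rule that)
  obtain W2 q s where 2: "open W2" "0 \<in> W2" "W2 \<subseteq> U" "q holomorphic_on W2" "s holomorphic_on W2" "hol_section H W2 v2"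
    "\<And>z. z \<in> W2 \<Longrightarrow> v2 z = comb2 H (q z) (e1 z) (s z) (e2 z)" by (rule frame_germ_section[OF U gs(2)], rule that)
  note i0 = frameD(4)[OF U]
  have ex: "\<exists>x y. e = comb2 H x (v1 0) y (v2 0)" if s: "germ_section H s" "e = s 0" for s e
  proof -
    obtain f g where "\<forall>\<^sub>F z in nhds 0. s z = comb2 H (f z) (v1 z) (g z) (v2 z)"
      using gb s(1) unfolding germ_basis_def by blast
    from eventually_nhds_x_imp_x[OF this] show ?thesis using s(2) by blast
  qed
  obtain x1 y1 where e1: "e1 0 = comb2 H x1 (v1 0) y1 (v2 0)" using ex[OF gs(3) refl] by blast
  obtain x2 y2 where e2: "e2 0 = comb2 H x2 (v1 0) y2 (v2 0)" using ex[OF gs(4) refl] by blast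
  note f0 = indep_fibre[OF i0]
  have fv: "v1 0 \<in> fibre H 0" "v2 0 \<in> fibre H 0"
    using hol_section_fibre[OF 1(6,2)] hol_section_fibre[OF 2(6,2)] .
  have "p 0 * s 0 - r 0 * q 0 \<noteq> 0"
    using indep_of_span[OF i0 fv e1 e2] unfolding 1(7)[OF 1(2)] 2(7)[OF 2(2)] indep_comb_iff[OF i0] .
  hence d0: "p 0 * s 0 - r 0 * q 0 \<noteq> 0" .
  define \<Delta> where "\<Delta> z = p z * s z - r z * q z" for z
  have o: "open (W1 \<inter> W2)" using 1(1) 2(1) by (rule open_Int)
  have "\<Delta> holomorphic_on W1 \<inter> W2" unfolding \<Delta>_def[abs_def]
    by (intro holomorphic_intros) (use 1(4,5) 2(4,5) in \<open>auto elim: holomorphic_on_subset\<close>)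
  hence "continuous_on (W1 \<inter> W2) \<Delta>" by (rule holomorphic_on_imp_continuous_on)
  hence "isCont \<Delta> 0" using 1(2) 2(2) by (simp only: continuous_on_eq_continuous_at[OF o] IntI Ball_def)
  then obtain \<delta> where \<delta>: "\<delta> > 0" "\<And>z. dist 0 z < \<delta> \<Longrightarrow> \<Delta> z \<noteq> 0"
    using continuous_at_avoid[of 0 \<Delta> 0] d0 unfolding \<Delta>_def by blast
  define W where "W = W1 \<inter> W2 \<inter> ball 0 \<delta>"
  have W: "open W" "0 \<in> W" "W \<subseteq> U" using o 1(2,3) 2(2) \<delta>(1) by (auto simp: W_def)
  have "frame W (\<lambda>z. comb2 H (p z) (e1 z) (r z) (e2 z)) (\<lambda>z. comb2 H (q z) (e1 z) (s z) (e2 z))"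
    by (rule frame_change[OF U(1) W(1,3)]) (use 1(4,5) 2(4,5) \<delta>(2) in \<open>auto simp: W_def \<Delta>_def elim: holomorphic_on_subset\<close>)
  moreover have "hol_section H W v1" "hol_section H W v2"
    by (rule hol_section_subset[OF 1(6)], force simp: W_def, rule hol_section_subset[OF 2(6)], force simp: W_def)
  ultimately have "frame W v1 v2"
    unfolding frame_def using 1(7) 2(7) by (auto simp: W_def)
  thus thesis using W(2) that by blast
qed

text \<open>Off 0 this is the Leibniz rule; at 0 it follows because both sides have holomorphic
  coordinates.\<close>

lemma z2nabla_coords:
  assumes cf: "cframe W v1 v2 a b c d" and W': "open W'" "0 \<in> W'" "W' \<subseteq> W"
    and st: "z2nabla H W' s t" and hol: "f holomorphic_on W'" "g holomorphic_on W'"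
    and s: "\<And>z. z \<in> W' \<Longrightarrow> s z = comb2 H (f z) (v1 z) (g z) (v2 z)" and z: "z \<in> W'"
  shows "t z = comb2 H (z\<^sup>2 * deriv f z + a z * f z + b z * g z) (v1 z) (z\<^sup>2 * deriv g z + c z * f z + d z * g z) (v2 z)"
proof -
  have cf': "cframe W' v1 v2 a b c d" by (rule cframe_subset[OF cf W'])
  note D = cframeD[OF cf'] and F = frameD[OF cframeD(1)[OF cf']]
  have ss: "hol_section H W' s" and tt: "hol_section H W' t" using st by (simp_all add: z2nabla_def)
  have off0: "t z = comb2 H (z\<^sup>2 * deriv f z + a z * f z + b z * g z) (v1 z) (z\<^sup>2 * deriv g z + c z * f z + d z * g z) (v2 z)"
    if z: "z \<in> W' - {0}" for z
  proof -
    have zW: "z \<in> W'" "z \<noteq> 0" using z by blast+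
    have "nabla H (W' - {0}) s z = nabla H (W' - {0}) (\<lambda>z. comb2 H (f z) (v1 z) (g z) (v2 z)) z"
      by (rule nabla_restrict[OF D(10,11) _ D(10) order_refl _ z])
        (use hol_section_subset[OF hol_section_comb[OF F(2,3) hol]] s in auto)
    moreover have "t z = fibre_scale H (z\<^sup>2) (nabla H (W' - {0}) s z)" using st z by (simp add: z2nabla_def)
    ultimately show ?thesis
      using zW(2) by (simp add: cframe_nabla_comb[OF cf' hol z] scale_comb[OF F(5,6)[OF zW(1)]])
  qed
  have "\<exists>r>0. ball 0 r \<subseteq> W'" using W' open_contains_ball by blast
  then obtain r where r: "r > 0" "ball 0 r \<subseteq> W'" by blast
  note ct = coord_holomorphic[OF D(1) tt]
  have 0: "0 \<in> ball (0::complex) r" using r(1) by simp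
  have "coord1 (v1 0) (v2 0) (t 0) = 0\<^sup>2 * deriv f 0 + a 0 * f 0 + b 0 * g 0"
    by (rule continuous_eq_at_zero[OF holomorphic_on_subset[OF ct(1) r(2)] _ r(1) _ 0, of "\<lambda>z. z\<^sup>2 * deriv f z + a z * f z + b z * g z"])
      (use r(2) off0 coord_comb[OF F(4)] in \<open>auto intro!: holomorphic_intros holomorphic_on_subset[OF hol(1)]
        holomorphic_on_subset[OF hol(2)] holomorphic_on_subset[OF D(4)] holomorphic_on_subset[OF D(5)]\<close>)
  moreover have "coord2 (v1 0) (v2 0) (t 0) = 0\<^sup>2 * deriv g 0 + c 0 * f 0 + d 0 * g 0"
    by (rule continuous_eq_at_zero[OF holomorphic_on_subset[OF ct(2) r(2)] _ r(1) _ 0, of "\<lambda>z. z\<^sup>2 * deriv g z + c z * f z + d z * g z"])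
      (use r(2) off0 coord_comb[OF F(4)] in \<open>auto intro!: holomorphic_intros holomorphic_on_subset[OF hol(1)]
        holomorphic_on_subset[OF hol(2)] holomorphic_on_subset[OF D(6)] holomorphic_on_subset[OF D(7)]\<close>)
  ultimately have "t 0 = comb2 H (0\<^sup>2 * deriv f 0 + a 0 * f 0 + b 0 * g 0) (v1 0) (0\<^sup>2 * deriv g 0 + c 0 * f 0 + d 0 * g 0) (v2 0)"
    using comb_coord[OF F(4)[OF W'(2)] hol_section_fibre[OF tt W'(2)]] by simp
  thus ?thesis using off0 z by (cases "z = 0") auto
qed

lemma cframe_z2nabla:
  assumes cf: "cframe W v1 v2 a b c d" and hol: "f holomorphic_on W" "g holomorphic_on W"
  shows "z2nabla H W (\<lambda>z. comb2 H (f z) (v1 z) (g z) (v2 z))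
     (\<lambda>z. comb2 H (z\<^sup>2 * deriv f z + a z * f z + b z * g z) (v1 z) (z\<^sup>2 * deriv g z + c z * f z + d z * g z) (v2 z))"
  unfolding z2nabla_def
proof (intro conjI ballI)
  note D = cframeD[OF cf] and F = frameD[OF cframeD(1)[OF cf]]
  show "hol_section H W (\<lambda>z. comb2 H (f z) (v1 z) (g z) (v2 z))" by (rule hol_section_comb[OF F(2,3) hol])
  show "hol_section H W (\<lambda>z. comb2 H (z\<^sup>2 * deriv f z + a z * f z + b z * g z) (v1 z) (z\<^sup>2 * deriv g z + c z * f z + d z * g z) (v2 z))"
    by (rule hol_section_comb[OF F(2,3)]; intro holomorphic_intros hol D(3-7))
  fix z assume z: "z \<in> W - {0}"
  hence zW: "z \<in> W" "z \<noteq> 0" by blast+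
  show "comb2 H (z\<^sup>2 * deriv f z + a z * f z + b z * g z) (v1 z) (z\<^sup>2 * deriv g z + c z * f z + d z * g z) (v2 z) =
     fibre_scale H (z\<^sup>2) (nabla H (W - {0}) (\<lambda>z. comb2 H (f z) (v1 z) (g z) (v2 z)) z)"
    unfolding cframe_nabla_comb[OF cf hol z] scale_comb[OF F(5,6)[OF zW(1)]] using zW(2) by simp
qed

lemma z2nabla_cong:
  assumes "z2nabla H W s t" "open W" "\<And>z. z \<in> W \<Longrightarrow> s' z = s z" "\<And>z. z \<in> W \<Longrightarrow> t' z = t z"
  shows "z2nabla H W s' t'"
  unfolding z2nabla_def
proof (intro conjI ballI)
  have st: "hol_section H W s" "hol_section H W t" "\<forall>z\<in>W - {0}. t z = fibre_scale H (z\<^sup>2) (nabla H (W - {0}) s z)"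
    using assms(1) by (simp_all add: z2nabla_def)
  show "hol_section H W s'" "hol_section H W t'" using hol_section_cong st assms(3,4) by metis+
  fix z assume z: "z \<in> W - {0}"
  have "nabla H (W - {0}) s' z = nabla H (W - {0}) s z"
    by (rule nabla_restrict[OF open_delete[OF assms(2)] _ hol_section_subset[OF st(1)] open_delete[OF assms(2)] order_refl _ z])
      (use assms(3) in auto)
  thus "t' z = fibre_scale H (z\<^sup>2) (nabla H (W - {0}) s' z)" using st(3) z assms(4) by simp
qed

lemma connection_matrix_of_cframe:
  assumes cf: "cframe W v1 v2 a b c d"
    and B: "\<And>z. B z $ 1 $ 1 = a z" "\<And>z. B z $ 1 $ 2 = b z" "\<And>z. B z $ 2 $ 1 = c z" "\<And>z. B z $ 2 $ 2 = d z"
  shows "connection_matrix H v1 v2 B"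
proof -
  note D = cframeD[OF cf] and F = frameD[OF cframeD(1)[OF cf]]
  have c: "(\<lambda>_. 1) holomorphic_on W" "(\<lambda>_. 0) holomorphic_on W" by (rule holomorphic_on_const)+
  have "z2nabla H W v1 (\<lambda>z. comb2 H (B z $ 1 $ 1) (v1 z) (B z $ 2 $ 1) (v2 z))"
    by (rule z2nabla_cong[OF cframe_z2nabla[OF cf c] D(3)]) (simp_all add: B comb_1[OF F(5,6)])
  moreover have "z2nabla H W v2 (\<lambda>z. comb2 H (B z $ 1 $ 2) (v1 z) (B z $ 2 $ 2) (v2 z))"
    by (rule z2nabla_cong[OF cframe_z2nabla[OF cf c(2,1)] D(3)]) (simp_all add: B comb_1[OF F(5,6)])
  moreover have "holomorphic_matrix_on B W"
    unfolding holomorphic_matrix_on_def forall_2 B using D(4-7) by simp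
  ultimately show ?thesis unfolding connection_matrix_def using D(2,3) by blast
qed

lemma cframe_of_connection_matrix:
  assumes gb: "germ_basis H v1 v2" and cm: "connection_matrix H v1 v2 B"
  obtains W where "cframe W v1 v2 (\<lambda>z. B z $ 1 $ 1) (\<lambda>z. B z $ 1 $ 2) (\<lambda>z. B z $ 2 $ 1) (\<lambda>z. B z $ 2 $ 2)"
proof -
  obtain U where U: "frame U v1 v2" "0 \<in> U" by (rule frame_of_germ_basis[OF gb], rule that)
  obtain V where V: "open V" "0 \<in> V" "holomorphic_matrix_on B V"
     "z2nabla H V v1 (\<lambda>z. comb2 H (B z $ 1 $ 1) (v1 z) (B z $ 2 $ 1) (v2 z))"
     "z2nabla H V v2 (\<lambda>z. comb2 H (B z $ 1 $ 2) (v1 z) (B z $ 2 $ 2) (v2 z))"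
    using cm unfolding connection_matrix_def by blast
  obtain a b c d where cf: "cframe U v1 v2 a b c d" by (rule ex_cframe_of_frame[OF U], rule that)
  note D = cframeD[OF cf]
  define W where "W = U \<inter> V"
  have W: "open W" "0 \<in> W" "W \<subseteq> U" "W \<subseteq> V" using D(3) V U by (auto simp: W_def)
  have cf': "cframe W v1 v2 a b c d" by (rule cframe_subset[OF cf W(1-3)])
  note F = frameD[OF cframeD(1)[OF cf']]
  have z2: "z2nabla H W s t" if "z2nabla H V s t" for s t
  proof -
    have st: "hol_section H V s" "hol_section H V t" "\<forall>z\<in>V - {0}. t z = fibre_scale H (z\<^sup>2) (nabla H (V - {0}) s z)"
      using that by (simp_all add: z2nabla_def)
    have "nabla H (W - {0}) s z = nabla H (V - {0}) s z" if "z \<in> W - {0}" for z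
      by (rule nabla_restrict[OF open_delete[OF V(1)] _ hol_section_subset[OF st(1)] open_delete[OF W(1)] _ refl that]) (use W(4) in auto)
    thus ?thesis unfolding z2nabla_def using st hol_section_subset W(4) by auto
  qed
  have c: "(\<lambda>_. 1) holomorphic_on W" "(\<lambda>_. 0) holomorphic_on W" by (rule holomorphic_on_const)+
  have eq: "B z $ 1 $ 1 = a z \<and> B z $ 2 $ 1 = c z \<and> B z $ 1 $ 2 = b z \<and> B z $ 2 $ 2 = d z" if z: "z \<in> W" for z
  proof -
    have 1: "comb2 H (B z $ 1 $ 1) (v1 z) (B z $ 2 $ 1) (v2 z) =
       comb2 H (z\<^sup>2 * deriv (\<lambda>_. 1) z + a z * 1 + b z * 0) (v1 z) (z\<^sup>2 * deriv (\<lambda>_. 0) z + c z * 1 + d z * 0) (v2 z)"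
      by (rule z2nabla_coords[OF cf W(1-3) z2[OF V(4)] c _ z]) (simp add: comb_1[OF F(5,6)])
    have 2: "comb2 H (B z $ 1 $ 2) (v1 z) (B z $ 2 $ 2) (v2 z) =
       comb2 H (z\<^sup>2 * deriv (\<lambda>_. 0) z + a z * 0 + b z * 1) (v1 z) (z\<^sup>2 * deriv (\<lambda>_. 1) z + c z * 0 + d z * 1) (v2 z)"
      by (rule z2nabla_coords[OF cf W(1-3) z2[OF V(5)] c(2,1) _ z]) (simp add: comb_1[OF F(5,6)])
    show ?thesis using indep_comb_eq[OF F(4)[OF z] 1] indep_comb_eq[OF F(4)[OF z] 2] by simp
  qed
  have hol: "(\<lambda>z. B z $ i $ j) holomorphic_on W" for i j
    by (rule holomorphic_on_subset[OF _ W(4)]) (use V(3) in \<open>simp add: holomorphic_matrix_on_def\<close>)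
  have "cframe W v1 v2 (\<lambda>z. B z $ 1 $ 1) (\<lambda>z. B z $ 1 $ 2) (\<lambda>z. B z $ 2 $ 1) (\<lambda>z. B z $ 2 $ 2)"
    using cframeD[OF cf'] hol eq unfolding cframe_def by simp
  thus thesis by (rule that)
qed

end

section \<open>Gauge transformations and the invariance of the formal data\<close>

context te2
begin

text \<open>The converse of \<open>cframe_gauge\<close>: the coordinates of one frame in the other
  form a gauge matrix, and comparing coefficients of both covariant derivatives gives its
  equations.\<close>

lemma cframe_compare:
  assumes cf: "cframe W v1 v2 a b c d" and cf': "cframe W' w1 w2 a' b' c' d'"
  obtains \<rho> p q r s where "\<rho> > 0" "ball 0 \<rho> \<subseteq> W" "ball 0 \<rho> \<subseteq> W'" "p holomorphic_on ball 0 \<rho>" "q holomorphic_on ball 0 \<rho>"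
    "r holomorphic_on ball 0 \<rho>" "s holomorphic_on ball 0 \<rho>" "\<And>z. z \<in> ball 0 \<rho> \<Longrightarrow> p z * s z - r z * q z \<noteq> 0"
    "\<And>z. z \<in> ball 0 \<rho> - {0} \<Longrightarrow>
      p z * a' z + q z * c' z = z\<^sup>2 * deriv p z + a z * p z + b z * r z \<and>
      r z * a' z + s z * c' z = z\<^sup>2 * deriv r z + c z * p z + d z * r z \<and>
      p z * b' z + q z * d' z = z\<^sup>2 * deriv q z + a z * q z + b z * s z \<and>
      r z * b' z + s z * d' z = z\<^sup>2 * deriv s z + c z * q z + d z * s z"
proof -
  obtain \<rho> where \<rho>: "\<rho> > 0" "ball 0 \<rho> \<subseteq> W" "ball 0 \<rho> \<subseteq> W'"
    by (rule ex_ball_in_Int[OF cframeD(3)[OF cf] cframeD(3)[OF cf'] cframeD(2)[OF cf] cframeD(2)[OF cf']], rule that)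
  have 0: "0 \<in> ball (0::complex) \<rho>" using \<rho>(1) by simp
  have c1: "cframe (ball 0 \<rho>) v1 v2 a b c d" by (rule cframe_subset[OF cf open_ball 0 \<rho>(2)])
  have c2: "cframe (ball 0 \<rho>) w1 w2 a' b' c' d'" by (rule cframe_subset[OF cf' open_ball 0 \<rho>(3)])
  note D1 = cframeD[OF c1] and D2 = cframeD[OF c2]
  note F1 = frameD[OF D1(1)] and F2 = frameD[OF D2(1)]
  define p where "p z = coord1 (v1 z) (v2 z) (w1 z)" for z
  define r where "r z = coord2 (v1 z) (v2 z) (w1 z)" for z
  define q where "q z = coord1 (v1 z) (v2 z) (w2 z)" for z
  define s where "s z = coord2 (v1 z) (v2 z) (w2 z)" for z
  have hol: "p holomorphic_on ball 0 \<rho>" "q holomorphic_on ball 0 \<rho>" "r holomorphic_on ball 0 \<rho>" "s holomorphic_on ball 0 \<rho>"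
    unfolding p_def[abs_def] q_def[abs_def] r_def[abs_def] s_def[abs_def]
    using coord_holomorphic[OF D1(1) F2(2)] coord_holomorphic[OF D1(1) F2(3)] by simp_all
  have w: "w1 z = comb2 H (p z) (v1 z) (r z) (v2 z)" "w2 z = comb2 H (q z) (v1 z) (s z) (v2 z)" if "z \<in> ball 0 \<rho>" for z
    unfolding p_def q_def r_def s_def
    using comb_coord[OF F1(4)[OF that] F2(5)[OF that]] comb_coord[OF F1(4)[OF that] F2(6)[OF that]] by simp_all
  show thesis
  proof (rule that[OF \<rho> hol])
    show "p z * s z - r z * q z \<noteq> 0" if "z \<in> ball 0 \<rho>" for z
      using F2(4)[OF that] unfolding w[OF that] indep_comb_iff[OF F1(4)[OF that]] .
    fix z :: complex assume z: "z \<in> ball 0 \<rho> - {0}"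
    hence zb: "z \<in> ball 0 \<rho>" "z \<noteq> 0" by blast+
    note f = F1(5)[OF zb(1)] F1(6)[OF zb(1)]
    have n: "nabla H (ball 0 \<rho> - {0}) w z = nabla H (ball 0 \<rho> - {0}) (\<lambda>z. comb2 H (g z) (v1 z) (h z) (v2 z)) z"
      if "hol_section H (ball 0 \<rho>) w" "\<And>z. z \<in> ball 0 \<rho> \<Longrightarrow> w z = comb2 H (g z) (v1 z) (h z) (v2 z)" for w g h
      by (rule nabla_restrict[OF D1(10,11) _ D1(10) order_refl _ z, symmetric])
        (use hol_section_subset[OF that(1)] that(2) in auto)
    have "comb2 H ((z\<^sup>2 * deriv p z + a z * p z + b z * r z) / z\<^sup>2) (v1 z) ((z\<^sup>2 * deriv r z + c z * p z + d z * r z) / z\<^sup>2) (v2 z)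
      = nabla H (ball 0 \<rho> - {0}) w1 z"
      using cframe_nabla_comb[OF c1 hol(1,3) z] by (rule trans[OF sym]) (rule n[OF F2(2) w(1), symmetric])
    also have "\<dots> = comb2 H (a' z / z\<^sup>2 * p z + c' z / z\<^sup>2 * q z) (v1 z) (a' z / z\<^sup>2 * r z + c' z / z\<^sup>2 * s z) (v2 z)"
      unfolding D2(8)[OF z] w[OF zb(1)] comb_comb[OF f] ..
    finally have e1: "(z\<^sup>2 * deriv p z + a z * p z + b z * r z) / z\<^sup>2 = a' z / z\<^sup>2 * p z + c' z / z\<^sup>2 * q z \<and>
       (z\<^sup>2 * deriv r z + c z * p z + d z * r z) / z\<^sup>2 = a' z / z\<^sup>2 * r z + c' z / z\<^sup>2 * s z"
      using indep_comb_eq[OF F1(4)[OF zb(1)]] by blast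
    have "comb2 H ((z\<^sup>2 * deriv q z + a z * q z + b z * s z) / z\<^sup>2) (v1 z) ((z\<^sup>2 * deriv s z + c z * q z + d z * s z) / z\<^sup>2) (v2 z)
      = nabla H (ball 0 \<rho> - {0}) w2 z"
      using cframe_nabla_comb[OF c1 hol(2,4) z] by (rule trans[OF sym]) (rule n[OF F2(3) w(2), symmetric])
    also have "\<dots> = comb2 H (b' z / z\<^sup>2 * p z + d' z / z\<^sup>2 * q z) (v1 z) (b' z / z\<^sup>2 * r z + d' z / z\<^sup>2 * s z) (v2 z)"
      unfolding D2(9)[OF z] w[OF zb(1)] comb_comb[OF f] ..
    finally have e2: "(z\<^sup>2 * deriv q z + a z * q z + b z * s z) / z\<^sup>2 = b' z / z\<^sup>2 * p z + d' z / z\<^sup>2 * q z \<and>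
       (z\<^sup>2 * deriv s z + c z * q z + d z * s z) / z\<^sup>2 = b' z / z\<^sup>2 * r z + d' z / z\<^sup>2 * s z"
      using indep_comb_eq[OF F1(4)[OF zb(1)]] by blast
    have e3: "x / z\<^sup>2 = u / z\<^sup>2 * g + v / z\<^sup>2 * h \<longleftrightarrow> g * u + h * v = x" for x u v g h
    proof -
      have "u / z\<^sup>2 * g + v / z\<^sup>2 * h = (g * u + h * v) / z\<^sup>2" by (simp add: add_divide_distrib mult.commute)
      moreover have "x / z\<^sup>2 = y / z\<^sup>2 \<longleftrightarrow> y = x" for y using zb(2) by auto
      ultimately show ?thesis by simp
    qed
    show "p z * a' z + q z * c' z = z\<^sup>2 * deriv p z + a z * p z + b z * r z \<and>
      r z * a' z + s z * c' z = z\<^sup>2 * deriv r z + c z * p z + d z * r z \<and>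
      p z * b' z + q z * d' z = z\<^sup>2 * deriv q z + a z * q z + b z * s z \<and>
      r z * b' z + s z * d' z = z\<^sup>2 * deriv s z + c z * q z + d z * s z"
      using e1 e2 unfolding e3 by blast
  qed
qed

text \<open>Multiplied by det G, the trace and the determinant of the new matrix can be read off
  from the gauge equation and agree with the old ones modulo z^2. As det G has no zeros, the
  coefficients of order 0 and 1 are invariant.\<close>

lemma cframe_invariants:
  assumes cf: "cframe W v1 v2 a b c d" and cf': "cframe W' w1 w2 a' b' c' d'"
  shows "a' 0 + d' 0 = a 0 + d 0" "deriv (\<lambda>z. a' z + d' z) 0 = deriv (\<lambda>z. a z + d z) 0"
    "a' 0 * d' 0 - b' 0 * c' 0 = a 0 * d 0 - b 0 * c 0"
    "deriv (\<lambda>z. a' z * d' z - b' z * c' z) 0 = deriv (\<lambda>z. a z * d z - b z * c z) 0"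
proof -
  obtain \<rho> p q r s where \<rho>: "\<rho> > 0" "ball 0 \<rho> \<subseteq> W" "ball 0 \<rho> \<subseteq> W'"
    and hol: "p holomorphic_on ball 0 \<rho>" "q holomorphic_on ball 0 \<rho>" "r holomorphic_on ball 0 \<rho>" "s holomorphic_on ball 0 \<rho>"
    and det: "\<And>z. z \<in> ball 0 \<rho> \<Longrightarrow> p z * s z - r z * q z \<noteq> 0"
    and eq: "\<And>z. z \<in> ball 0 \<rho> - {0} \<Longrightarrow>
      p z * a' z + q z * c' z = z\<^sup>2 * deriv p z + a z * p z + b z * r z \<and>
      r z * a' z + s z * c' z = z\<^sup>2 * deriv r z + c z * p z + d z * r z \<and>
      p z * b' z + q z * d' z = z\<^sup>2 * deriv q z + a z * q z + b z * s z \<and>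
      r z * b' z + s z * d' z = z\<^sup>2 * deriv s z + c z * q z + d z * s z"
    by (rule cframe_compare[OF cf cf'], rule that)
  have h: "a holomorphic_on ball 0 \<rho>" "b holomorphic_on ball 0 \<rho>" "c holomorphic_on ball 0 \<rho>" "d holomorphic_on ball 0 \<rho>"
    using cframeD(4-7)[OF cf] \<rho>(2) by (auto elim: holomorphic_on_subset)
  have h': "a' holomorphic_on ball 0 \<rho>" "b' holomorphic_on ball 0 \<rho>" "c' holomorphic_on ball 0 \<rho>" "d' holomorphic_on ball 0 \<rho>"
    using cframeD(4-7)[OF cf'] \<rho>(3) by (auto elim: holomorphic_on_subset)
  \<comment> \<open>\<open>k\<close> is the logarithmic derivative of det G. \<open>l\<close>
    collects what det (B G + z^2 G') contains beyond det (B G), divided by z^2 det G.\<close>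
  define k where "k z = (s z * deriv p z - q z * deriv r z - r z * deriv q z + p z * deriv s z) / (p z * s z - r z * q z)" for z
  define l where "l z = ((a z * p z + b z * r z) * deriv s z + deriv p z * (c z * q z + d z * s z) -
      (a z * q z + b z * s z) * deriv r z - deriv q z * (c z * p z + d z * r z) +
      z\<^sup>2 * (deriv p z * deriv s z - deriv q z * deriv r z)) / (p z * s z - r z * q z)" for z
  have kl: "k holomorphic_on ball 0 \<rho>" "l holomorphic_on ball 0 \<rho>"
  proof -
    note dh = holomorphic_deriv[OF hol(1) open_ball] holomorphic_deriv[OF hol(2) open_ball]
      holomorphic_deriv[OF hol(3) open_ball] holomorphic_deriv[OF hol(4) open_ball]
    show "k holomorphic_on ball 0 \<rho>" unfolding k_def[abs_def]
      by (intro holomorphic_on_divide holomorphic_on_add holomorphic_on_diff holomorphic_on_mult hol dh det)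
    show "l holomorphic_on ball 0 \<rho>" unfolding l_def[abs_def]
      by (intro holomorphic_on_divide holomorphic_on_add holomorphic_on_diff holomorphic_on_mult holomorphic_on_power
        holomorphic_on_ident hol dh h det)
  qed
  have aux: "\<Delta> * (x + y * (n / \<Delta>)) = \<Delta> * x + y * n" if "\<Delta> \<noteq> 0" for \<Delta> x y n :: complex
    using that by (simp add: distrib_left)
  have tr: "a' z + d' z = a z + d z + z\<^sup>2 * k z" if z: "z \<in> ball 0 \<rho> - {0}" for z
  proof -
    have "(p z * s z - r z * q z) * (a' z + d' z) =
       s z * (p z * a' z + q z * c' z) - q z * (r z * a' z + s z * c' z) - r z * (p z * b' z + q z * d' z) + p z * (r z * b' z + s z * d' z)"
      by (simp add: algebra_simps)
    also have "\<dots> = (p z * s z - r z * q z) * (a z + d z) +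
       z\<^sup>2 * (s z * deriv p z - q z * deriv r z - r z * deriv q z + p z * deriv s z)"
      using eq[OF z] by (simp add: algebra_simps)
    also have "\<dots> = (p z * s z - r z * q z) * (a z + d z + z\<^sup>2 * k z)"
      unfolding k_def by (rule aux[symmetric]) (use det[of z] z in blast)
    finally show ?thesis using det[of z] z by simp
  qed
  have dt: "a' z * d' z - b' z * c' z = a z * d z - b z * c z + z\<^sup>2 * l z" if z: "z \<in> ball 0 \<rho> - {0}" for z
  proof -
    have "(p z * s z - r z * q z) * (a' z * d' z - b' z * c' z) =
       (p z * a' z + q z * c' z) * (r z * b' z + s z * d' z) - (p z * b' z + q z * d' z) * (r z * a' z + s z * c' z)"
      by (simp add: algebra_simps)
    also have "\<dots> = (z\<^sup>2 * deriv p z + a z * p z + b z * r z) * (z\<^sup>2 * deriv s z + c z * q z + d z * s z) -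
       (z\<^sup>2 * deriv q z + a z * q z + b z * s z) * (z\<^sup>2 * deriv r z + c z * p z + d z * r z)"
      using eq[OF z] by simp
    also have "\<dots> = (p z * s z - r z * q z) * (a z * d z - b z * c z) + z\<^sup>2 *
      ((a z * p z + b z * r z) * deriv s z + deriv p z * (c z * q z + d z * s z) -
      (a z * q z + b z * s z) * deriv r z - deriv q z * (c z * p z + d z * r z) +
      z\<^sup>2 * (deriv p z * deriv s z - deriv q z * deriv r z))"
      by (simp add: algebra_simps power2_eq_square)
    also have "\<dots> = (p z * s z - r z * q z) * (a z * d z - b z * c z + z\<^sup>2 * l z)"
      unfolding l_def by (rule aux[symmetric]) (use det[of z] z in blast)
    finally show ?thesis using det[of z] z by simp
  qed
  have hs: "(\<lambda>z. a' z + d' z) holomorphic_on ball 0 \<rho>" "(\<lambda>z. a z + d z) holomorphic_on ball 0 \<rho>"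
    "(\<lambda>z. a' z * d' z - b' z * c' z) holomorphic_on ball 0 \<rho>" "(\<lambda>z. a z * d z - b z * c z) holomorphic_on ball 0 \<rho>"
    by (intro holomorphic_intros h h')+
  show "a' 0 + d' 0 = a 0 + d 0" by (rule first_order_agree(1)[OF hs(1,2) kl(1) \<rho>(1) tr])
  show "deriv (\<lambda>z. a' z + d' z) 0 = deriv (\<lambda>z. a z + d z) 0" by (rule first_order_agree(2)[OF hs(1,2) kl(1) \<rho>(1) tr])
  show "a' 0 * d' 0 - b' 0 * c' 0 = a 0 * d 0 - b 0 * c 0" by (rule first_order_agree(1)[OF hs(3,4) kl(2) \<rho>(1) dt])
  show "deriv (\<lambda>z. a' z * d' z - b' z * c' z) 0 = deriv (\<lambda>z. a z * d z - b z * c z) 0"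
    by (rule first_order_agree(2)[OF hs(3,4) kl(2) \<rho>(1) dt])
qed

lemma germ_matrix_of_cframe:
  assumes cf: "cframe W v1 v2 a b c d"
  defines "B \<equiv> \<lambda>z. vector [vector [a z, b z], vector [c z, d z]] :: complex ^ 2 ^ 2"
  shows "germ_basis H v1 v2" "connection_matrix H v1 v2 B"
proof -
  show "germ_basis H v1 v2" by (rule germ_basis_of_frame[OF cframeD(1,2)[OF cf]])
  show "connection_matrix H v1 v2 B" by (rule connection_matrix_of_cframe[OF cf]) (simp_all add: B_def)
qed

text \<open>The definite descriptions of \<open>rho\<close> and \<open>delta\<close> are meaningful
  because every germ basis with a connection matrix gives a \<open>cframe\<close>, all of these have
  the same invariants, and one exists.\<close>

lemma formal_invariants:
  assumes cf: "cframe W v1 v2 a b c d"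
  shows "rho H 0 = (a 0 + d 0) / 2" "rho H 1 = deriv (\<lambda>z. a z + d z) 0 / 2"
    "delta H 0 = a 0 * d 0 - b 0 * c 0" "delta H 1 = deriv (\<lambda>z. a z * d z - b z * c z) 0"
proof -
  have sum: "deriv (\<lambda>z. f z + g z) 0 = deriv f 0 + deriv g 0" if "f holomorphic_on V" "g holomorphic_on V" "open V" "0 \<in> V"
    for f g :: "complex \<Rightarrow> complex" and V
    using that by (intro deriv_add holomorphic_on_imp_differentiable_at)
  note gm = germ_matrix_of_cframe[OF cf]
  have all: "B 0 $ 1 $ 1 + B 0 $ 2 $ 2 = a 0 + d 0 \<and> deriv (\<lambda>z. B z $ 1 $ 1) 0 + deriv (\<lambda>z. B z $ 2 $ 2) 0 = deriv (\<lambda>z. a z + d z) 0 \<and>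
      det (B 0) = a 0 * d 0 - b 0 * c 0 \<and> deriv (\<lambda>z. det (B z)) 0 = deriv (\<lambda>z. a z * d z - b z * c z) 0"
    if B: "germ_basis H w1 w2" "connection_matrix H w1 w2 B" for w1 w2 B
  proof -
    obtain V where V: "cframe V w1 w2 (\<lambda>z. B z $ 1 $ 1) (\<lambda>z. B z $ 1 $ 2) (\<lambda>z. B z $ 2 $ 1) (\<lambda>z. B z $ 2 $ 2)"
      by (rule cframe_of_connection_matrix[OF B], rule that)
    note D = cframeD[OF V]
    show ?thesis
      using cframe_invariants[OF cf V] sum[OF D(4,7,3,2)] by (simp add: det_2)
  qed
  have the: "(THE r. \<forall>v1 v2 B. germ_basis H v1 v2 \<and> connection_matrix H v1 v2 B \<longrightarrow> r = F B) = x"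
    if "\<And>w1 w2 B. germ_basis H w1 w2 \<Longrightarrow> connection_matrix H w1 w2 B \<Longrightarrow> F B = x" for F :: "_ \<Rightarrow> complex" and x
  proof (rule the_equality)
    show "\<forall>v1 v2 B. germ_basis H v1 v2 \<and> connection_matrix H v1 v2 B \<longrightarrow> x = F B"
      by (intro allI impI, elim conjE, rule that[symmetric]) assumption+
    fix y assume y: "\<forall>v1 v2 B. germ_basis H v1 v2 \<and> connection_matrix H v1 v2 B \<longrightarrow> y = F B"
    show "y = x" unfolding y[rule_format, OF conjI[OF gm]] by (rule that[OF gm])
  qed
  show "rho H 0 = (a 0 + d 0) / 2"
    unfolding rho_def by (rule the) (use all in \<open>simp add: trace_def sum_2 matrix_coeff_nth\<close>)
  show "rho H 1 = deriv (\<lambda>z. a z + d z) 0 / 2"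
    unfolding rho_def by (rule the) (use all in \<open>simp add: trace_def sum_2 matrix_coeff_nth del: One_nat_def\<close>)
  show "delta H 0 = a 0 * d 0 - b 0 * c 0"
    unfolding delta_def by (rule the) (use all in \<open>simp add: fps_expansion_def\<close>)
  show "delta H 1 = deriv (\<lambda>z. a z * d z - b z * c z) 0"
    unfolding delta_def by (rule the) (use all in \<open>simp add: fps_expansion_def\<close>)
qed

text \<open>The derivative terms carry the factor z^2 and vanish at 0, so the result depends only on
  the value of a section at 0 and not on its extension.\<close>

lemma pole_part_cframe:
  assumes cf: "cframe W v1 v2 a b c d"
  shows "pole_part H (comb2 H p (v1 0) q (v2 0)) = comb2 H (a 0 * p + b 0 * q) (v1 0) (c 0 * p + d 0 * q) (v2 0)"
  unfolding pole_part_def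
proof (rule the_equality)
  note D = cframeD[OF cf] and F = frameD[OF cframeD(1)[OF cf]]
  have "z2nabla H W (\<lambda>z. comb2 H p (v1 z) q (v2 z))
     (\<lambda>z. comb2 H (z\<^sup>2 * deriv (\<lambda>_. p) z + a z * p + b z * q) (v1 z) (z\<^sup>2 * deriv (\<lambda>_. q) z + c z * p + d z * q) (v2 z))"
    by (rule cframe_z2nabla[OF cf holomorphic_on_const holomorphic_on_const])
  thus "\<exists>V s t. open V \<and> 0 \<in> V \<and> z2nabla H V s t \<and> s 0 = comb2 H p (v1 0) q (v2 0) \<and>
      t 0 = comb2 H (a 0 * p + b 0 * q) (v1 0) (c 0 * p + d 0 * q) (v2 0)"
    by (intro exI[of _ W] exI[of _ "\<lambda>z. comb2 H p (v1 z) q (v2 z)"]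
        exI[of _ "\<lambda>z. comb2 H (z\<^sup>2 * deriv (\<lambda>_. p) z + a z * p + b z * q) (v1 z) (z\<^sup>2 * deriv (\<lambda>_. q) z + c z * p + d z * q) (v2 z)"]
        conjI D(2,3)) (assumption, rule refl, simp)
  fix y assume "\<exists>V s t. open V \<and> 0 \<in> V \<and> z2nabla H V s t \<and> s 0 = comb2 H p (v1 0) q (v2 0) \<and> t 0 = y"
  then obtain V s t where V: "open V" "0 \<in> V" "z2nabla H V s t" "s 0 = comb2 H p (v1 0) q (v2 0)" "t 0 = y" by blast
  have st: "hol_section H V s" "hol_section H V t" "\<forall>z\<in>V - {0}. t z = fibre_scale H (z\<^sup>2) (nabla H (V - {0}) s z)"
    using V(3) by (simp_all add: z2nabla_def)
  define U where "U = W \<inter> V"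
  have U: "open U" "0 \<in> U" "U \<subseteq> W" "U \<subseteq> V" using D(2,3) V(1,2) by (auto simp: U_def)
  have sU: "hol_section H U s" by (rule hol_section_subset[OF st(1) U(4)])
  have fr: "frame U v1 v2" by (rule frame_subset[OF D(1) U(1,3)])
  have "nabla H (U - {0}) s z = nabla H (V - {0}) s z" if "z \<in> U - {0}" for z
    by (rule nabla_restrict[OF open_delete[OF V(1)] _ hol_section_subset[OF st(1)] open_delete[OF U(1)] _ refl that]) (use U(4) in auto)
  hence z2: "z2nabla H U s t" unfolding z2nabla_def using st hol_section_subset U(4) by auto
  note i0 = F(4)[OF D(2)]
  have "y = comb2 H (0\<^sup>2 * deriv (\<lambda>z. coord1 (v1 z) (v2 z) (s z)) 0 + a 0 * coord1 (v1 0) (v2 0) (s 0) + b 0 * coord2 (v1 0) (v2 0) (s 0)) (v1 0)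
     (0\<^sup>2 * deriv (\<lambda>z. coord2 (v1 z) (v2 z) (s z)) 0 + c 0 * coord1 (v1 0) (v2 0) (s 0) + d 0 * coord2 (v1 0) (v2 0) (s 0)) (v2 0)"
    unfolding V(5)[symmetric]
    by (rule z2nabla_coords[OF cf U(1-3) z2 coord_holomorphic[OF fr sU] _ U(2)])
      (rule comb_coord[OF frameD(4)[OF fr] hol_section_fibre[OF sU], symmetric])
  thus "y = comb2 H (a 0 * p + b 0 * q) (v1 0) (c 0 * p + d 0 * q) (v2 0)"
    unfolding V(4) coord_comb[OF i0] by simp
qed

text \<open>The frame passes through the Jordan basis in the order \<open>y\<close>,
  \<open>x\<close>, the eigenvector last. This puts the entry 1 of the block into the lower left
  corner, as the companion form requires.\<close>

lemma cframe_of_jordan_block: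
  assumes "single_jordan_block H"
  obtains W v1 v2 a b c d where "cframe W v1 v2 a b c d" "b 0 = 0" "c 0 = 1" "d 0 = a 0"
proof -
  obtain k x y where xy: "fibre_basis H 0 x y" "pole_part H x = fibre_scale H k x" "pole_part H y = fibre_add H x (fibre_scale H k y)"
    using assms unfolding single_jordan_block_def by blast
  have f: "x \<in> fibre H 0" "y \<in> fibre H 0" using xy(1) by (simp_all add: fibre_basis_def)
  obtain W e1 e2 a b c d where cf: "cframe W e1 e2 a b c d" by (rule ex_cframe, rule that)
  note D = cframeD[OF cf] and F = frameD[OF cframeD(1)[OF cf]]
  note i0 = F(4)[OF D(2)]
  have span: "\<exists>a b. e = comb2 H a x b y" if "e \<in> fibre H 0" for e
    using xy(1) that unfolding fibre_basis_def by (blast dest: ex1_implies_ex)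
  obtain x1 y1 where e1: "e1 0 = comb2 H x1 x y1 y" using span[OF F(5)[OF D(2)]] by blast
  obtain x2 y2 where e2: "e2 0 = comb2 H x2 x y2 y" using span[OF F(6)[OF D(2)]] by blast
  have ixy: "indep 0 x y" by (rule indep_of_span[OF i0 f e1 e2])
  obtain p r where y: "y = comb2 H p (e1 0) r (e2 0)" by (rule indep_span[OF i0 f(2)], rule that)
  obtain q s where x: "x = comb2 H q (e1 0) s (e2 0)" by (rule indep_span[OF i0 f(1)], rule that)
  have "q * r - s * p \<noteq> 0" using ixy unfolding x y indep_comb_iff[OF i0] .
  hence det: "p * s - r * q \<noteq> 0" by (simp add: mult.commute)
  have con: "(\<lambda>_. k) holomorphic_on W" for k :: complex by (rule holomorphic_on_const)
  \<comment> \<open>Only values at 0 are prescribed, so a change of frame with constant coefficients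
    is enough.\<close>
  have "frame W (\<lambda>z. comb2 H p (e1 z) r (e2 z)) (\<lambda>z. comb2 H q (e1 z) s (e2 z))"
    by (rule frame_change[OF D(1,3) order_refl con con con con det])
  then obtain a' b' c' d' where cf': "cframe W (\<lambda>z. comb2 H p (e1 z) r (e2 z)) (\<lambda>z. comb2 H q (e1 z) s (e2 z)) a' b' c' d'"
    using D(2) by (rule ex_cframe_of_frame)
  note P = pole_part_cframe[OF cf', folded x y]
  have iyx: "indep 0 y x" using frameD(4)[OF cframeD(1)[OF cf'] D(2)] by (simp only: x[symmetric] y[symmetric])
  have "comb2 H (a' 0) y (c' 0) x = comb2 H k y 1 x"
  proof -
    have "comb2 H (a' 0) y (c' 0) x = pole_part H (comb2 H 1 y 0 x)" unfolding P by simp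
    also have "\<dots> = fibre_add H x (fibre_scale H k y)" by (simp only: comb_1[OF f(2,1)] xy(3))
    also have "\<dots> = comb2 H k y 1 x"
      by (rule fibre_eqI[of _ 0]; simp add: chart_simps f; (intro vec2_eqI; simp))
    finally show ?thesis .
  qed
  from indep_comb_eq[OF iyx this] have 1: "a' 0 = k" "c' 0 = 1" .
  have "comb2 H (b' 0) y (d' 0) x = comb2 H 0 y k x"
  proof -
    have "comb2 H (b' 0) y (d' 0) x = pole_part H (comb2 H 0 y 1 x)" unfolding P by simp
    also have "\<dots> = fibre_scale H k x" by (simp only: comb_1[OF f(2,1)] xy(2))
    also have "\<dots> = comb2 H 0 y k x"
      by (rule fibre_eqI[of _ 0]; simp add: chart_simps f; (intro vec2_eqI; simp))
    finally show ?thesis .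
  qed
  from indep_comb_eq[OF iyx this] have 2: "b' 0 = 0" "d' 0 = k" .
  show thesis by (rule that[OF cf']) (simp_all add: 1 2)
qed

end

section \<open>Companion form of a TE-structure of type (Bra)\<close>

lemma holomorphic_divide_by_square:
  fixes f :: "complex \<Rightarrow> complex"
  assumes "f holomorphic_on S" "open S" "f 0 = 0" "deriv f 0 = 0"
  obtains g where "g holomorphic_on S" "\<And>z. f z = z\<^sup>2 * g z"
proof -
  obtain g where g: "g holomorphic_on S" "\<And>z. f z = z * g z" "g 0 = deriv f 0"
    by (rule holomorphic_divide_by_variable[OF assms(1-3)], rule that)
  obtain h where h: "h holomorphic_on S" "\<And>z. g z = z * h z"
    by (rule holomorphic_divide_by_variable[OF g(1) assms(2)]) (use g(3) assms(4) in simp, rule that)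
  show thesis by (rule that[OF h(1)]) (simp add: g(2) h(2) power2_eq_square)
qed

lemma quadratic_roots:
  fixes s n :: complex
  obtains k l where "k + l = s" "k * l = n" "\<And>x. x\<^sup>2 - s * x + n = 0 \<longleftrightarrow> x = k \<or> x = l"
proof -
  define w where "w = csqrt (s\<^sup>2 - 4 * n)"
  define k l where "k = (s + w) / 2" and "l = (s - w) / 2"
  have w: "w\<^sup>2 = s\<^sup>2 - 4 * n" by (simp add: w_def)
  have kl: "k + l = s" by (simp add: k_def l_def field_simps)
  have "4 * (k * l) = s\<^sup>2 - w\<^sup>2" by (simp add: k_def l_def field_simps power2_eq_square)
  hence n: "k * l = n" unfolding w by simp
  have "x\<^sup>2 - s * x + n = (x - k) * (x - l)" for x
    unfolding kl[symmetric] n[symmetric] by (simp add: algebra_simps power2_eq_square)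
  thus thesis using that[OF kl n] by simp
qed

lemma kernel_2x2:
  fixes a b c d :: complex
  shows "(\<exists>x y. (x \<noteq> 0 \<or> y \<noteq> 0) \<and> a * x + b * y = 0 \<and> c * x + d * y = 0) \<longleftrightarrow> a * d - b * c = 0"
proof
  assume "\<exists>x y. (x \<noteq> 0 \<or> y \<noteq> 0) \<and> a * x + b * y = 0 \<and> c * x + d * y = 0"
  then obtain x y where xy: "x \<noteq> 0 \<or> y \<noteq> 0" "a * x + b * y = 0" "c * x + d * y = 0" by blast
  have "(a * d - b * c) * x = d * (a * x + b * y) - b * (c * x + d * y)"
    "(a * d - b * c) * y = a * (c * x + d * y) - c * (a * x + b * y)" by (simp_all add: algebra_simps)
  thus "a * d - b * c = 0" using xy by auto
next
  assume 0: "a * d - b * c = 0"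
  show "\<exists>x y. (x \<noteq> 0 \<or> y \<noteq> 0) \<and> a * x + b * y = 0 \<and> c * x + d * y = 0"
  proof (cases "a = 0 \<and> b = 0")
    case True
    thus ?thesis
      by (cases "c = 0 \<and> d = 0")
        (simp add: exI[of _ 1], intro exI[of _ d] exI[of _ "- c"], auto)
  next
    case False
    thus ?thesis using 0 by (intro exI[of _ b] exI[of _ "- a"]) (auto simp: algebra_simps)
  qed
qed

text \<open>The solution exp (- \<rho>0 / z) z^\<rho>1 of the scalar equation z^2 T' = (\<rho>0 +
  \<rho>1 z) T, pulled back along z = exp \<zeta>. Multiplication by it removes the scalar part of
  the connection.\<close>

definition twist :: "complex \<Rightarrow> complex \<Rightarrow> complex \<Rightarrow> complex" where
  "twist \<rho>0 \<rho>1 \<zeta> = exp (\<rho>1 * \<zeta> - \<rho>0 * exp (- \<zeta>))"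

lemma twist_nonzero: "twist \<rho>0 \<rho>1 \<zeta> \<noteq> 0" by (simp add: twist_def)

lemma twist_deriv:
  "(twist \<rho>0 \<rho>1 has_field_derivative exp (- \<zeta>) * (\<rho>0 + \<rho>1 * exp \<zeta>) * twist \<rho>0 \<rho>1 \<zeta>) (at \<zeta>)"
proof -
  have "((\<lambda>\<zeta>. exp (\<rho>1 * \<zeta> - \<rho>0 * exp (- \<zeta>))) has_field_derivative
      exp (\<rho>1 * \<zeta> - \<rho>0 * exp (- \<zeta>)) * (\<rho>1 + \<rho>0 * exp (- \<zeta>))) (at \<zeta>)"
    by (auto intro!: derivative_eq_intros)
  moreover have "exp (- \<zeta>) * (\<rho>0 + \<rho>1 * exp \<zeta>) = \<rho>1 + \<rho>0 * exp (- \<zeta>)"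
    by (simp add: distrib_left exp_minus_inverse mult.left_commute mult.commute[of "exp (- \<zeta>)"] flip: mult.assoc)
  ultimately show ?thesis unfolding twist_def[abs_def] by (simp only: mult.commute)
qed

lemma twist_turn: "twist \<rho>0 \<rho>1 (\<zeta> + 2 * of_real pi * \<i>) = exp (2 * of_real pi * \<i> * \<rho>1) * twist \<rho>0 \<rho>1 \<zeta>"
proof -
  have "exp (- (\<zeta> + 2 * of_real pi * \<i>)) = exp (- \<zeta>)" by (simp only: exp_minus exp_add exp_two_pi_i mult_1_right)
  hence "twist \<rho>0 \<rho>1 (\<zeta> + 2 * of_real pi * \<i>) = exp (2 * of_real pi * \<i> * \<rho>1 + (\<rho>1 * \<zeta> - \<rho>0 * exp (- \<zeta>)))"
    unfolding twist_def by (simp add: algebra_simps)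
  thus ?thesis unfolding twist_def exp_add .
qed

context te2
begin

abbreviation companion_cframe :: "real \<Rightarrow> (complex \<Rightarrow> 'a) \<Rightarrow> (complex \<Rightarrow> 'a) \<Rightarrow> complex \<Rightarrow> complex \<Rightarrow> (complex \<Rightarrow> complex) \<Rightarrow> bool" where
  "companion_cframe L v1 v2 \<rho>0 \<rho>1 p \<equiv>
     cframe (ball 0 (exp L)) v1 v2 (\<lambda>z. \<rho>0 + \<rho>1 * z) p (\<lambda>_. 1) (\<lambda>z. \<rho>0 + \<rho>1 * z)"

text \<open>The first basis section is rescaled so that the trace becomes \<open>2 (\<rho>0 + \<rho>1 z)\<close> exactly; the
  second one is then forced by the first column of the companion matrix.\<close>

lemma ex_companion_cframe:
  assumes Bra: "type_Bra H"
  obtains L v1 v2 p where "companion_cframe L v1 v2 (rho H 0) (rho H 1) p" "p 0 = 0"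
    "deriv p 0 = - (delta H 1 - 2 * rho H 0 * rho H 1)"
proof -
  have "single_jordan_block H" using Bra by (simp add: type_Bra_def)
  then obtain W v1 v2 a b c d where cf: "cframe W v1 v2 a b c d" and 0: "b 0 = 0" "c 0 = 1" "d 0 = a 0"
    by (rule cframe_of_jordan_block)
  note D = cframeD[OF cf] and I = formal_invariants[OF cf]
  define t where "t z = rho H 0 + rho H 1 * z" for z
  have t': "(t has_field_derivative rho H 1) (at z)" for z
    unfolding t_def[abs_def] by (auto intro!: derivative_eq_intros)
  have t_hol: "t holomorphic_on S" for S unfolding t_def[abs_def] by (intro holomorphic_intros)
  have a0: "a 0 = rho H 0" using I(1) 0(3) by simp
  have "continuous_on W c" by (rule holomorphic_on_imp_continuous_on[OF D(6)])
  hence "isCont c 0" using D(2) by (simp only: continuous_on_eq_continuous_at[OF D(3)])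
  then obtain \<delta> where \<delta>: "\<delta> > 0" "\<And>z. dist 0 z < \<delta> \<Longrightarrow> c z \<noteq> 0"
    using continuous_at_avoid[of 0 c 0] 0(2) by auto
  obtain \<epsilon> where \<epsilon>: "\<epsilon> > 0" "ball 0 \<epsilon> \<subseteq> W" using openE[OF D(3,2)] by blast
  define L where "L = ln (min \<delta> \<epsilon>)"
  define U where "U = ball (0::complex) (exp L)"
  have L: "exp L = min \<delta> \<epsilon>" using \<delta>(1) \<epsilon>(1) by (simp add: L_def)
  have U: "open U" "0 \<in> U" "U \<subseteq> W" "convex U" using L \<delta>(1) \<epsilon> by (auto simp: U_def)
  have c0: "c z \<noteq> 0" if "z \<in> U" for z using \<delta>(2)[of z] that L by (simp add: U_def)
  have h: "a holomorphic_on U" "b holomorphic_on U" "c holomorphic_on U" "d holomorphic_on U"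
    using D(4-7) U(3) by (auto elim: holomorphic_on_subset)
  have tr: "(\<lambda>z. a z + d z - 2 * t z) holomorphic_on U" by (intro holomorphic_intros h t_hol)
  have tr': "deriv (\<lambda>z. a z + d z - 2 * t z) 0 = 0"
  proof -
    have "(\<lambda>z. a z + d z) holomorphic_on U" by (intro holomorphic_intros h)
    moreover have "deriv (\<lambda>z. a z + d z) 0 = 2 * rho H 1" using I(2) by (simp add: mult.commute)
    ultimately have "((\<lambda>z. a z + d z) has_field_derivative 2 * rho H 1) (at 0)"
      using holomorphic_derivI[OF _ U(1,2)] by metis
    from DERIV_diff[OF this DERIV_cmult[OF t', of 2]] show ?thesis by (intro DERIV_imp_deriv) simp
  qed
  have tr0: "a 0 + d 0 - 2 * t 0 = 0" using 0(3) a0 by (simp add: t_def)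
  \<comment> \<open>The invariants \<rho>0 and \<rho>1 match the trace in orders 0 and 1, so what is
    left is divisible by z^2.\<close>
  obtain k where k: "k holomorphic_on U" "\<And>z. a z + d z - 2 * t z = z\<^sup>2 * k z"
    by (rule holomorphic_divide_by_square[OF tr U(1) tr0 tr'], rule that)
  \<comment> \<open>The logarithmic derivative of the rescaling \<open>P\<close>. The last gauge
    equation reduces to 2 g c + c' + k c = 0, which is solved for \<open>g\<close>.\<close>
  define g where "g z = - (k z + deriv c z / c z) / 2" for z
  have dc: "deriv c holomorphic_on U" by (rule holomorphic_deriv[OF h(3) U(1)])
  have g: "g holomorphic_on U" unfolding g_def[abs_def] by (intro holomorphic_intros k(1) dc h(3) c0) auto
  obtain \<eta> where \<eta>: "\<And>z. z \<in> U \<Longrightarrow> (\<eta> has_field_derivative g z) (at z)"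
  proof -
    obtain \<eta> where "\<And>z. z \<in> U \<Longrightarrow> (\<eta> has_field_derivative g z) (at z within U)"
      by (rule holomorphic_convex_primitive'[OF U(4,1) g], rule that)
    thus thesis using that at_within_open[OF _ U(1)] by auto
  qed
  define P where "P z = exp (\<eta> z)" for z
  have P': "(P has_field_derivative P z * g z) (at z)" if "z \<in> U" for z
    unfolding P_def[abs_def] by (rule DERIV_fun_exp[OF \<eta>[OF that]])
  have P: "P holomorphic_on U" unfolding holomorphic_on_open[OF U(1)] using P' by blast
  define S where "S z = P z * c z" for z
  \<comment> \<open>\<open>S\<close> and \<open>Q\<close> are forced by the first column of the
    gauge equation, in which the new matrix has the entries \<open>t\<close> and 1.\<close>
  define Q where "Q z = P z * (z\<^sup>2 * g z + a z - t z)" for z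
  have QS: "Q holomorphic_on U" "S holomorphic_on U" unfolding Q_def[abs_def] S_def[abs_def]
    by (intro holomorphic_intros P g h t_hol)+
  define p where "p z = (z\<^sup>2 * deriv Q z + a z * Q z + b z * S z - Q z * t z) / P z" for z
  have P0: "P z \<noteq> 0" for z by (simp add: P_def)
  have p: "p holomorphic_on U" unfolding p_def[abs_def]
    by (intro holomorphic_intros holomorphic_deriv[OF QS(1) U(1)] QS P h t_hol P0)
  have "cframe U (\<lambda>z. comb2 H (P z) (v1 z) 0 (v2 z)) (\<lambda>z. comb2 H (Q z) (v1 z) (S z) (v2 z)) t p (\<lambda>_. 1) t"
  proof (rule cframe_gauge[OF cf U(1-3) P QS(1) holomorphic_on_const QS(2) t_hol p holomorphic_on_const t_hol])
    show "P z * S z - 0 * Q z \<noteq> 0" if "z \<in> U" for z using c0[OF that] P0[of z] by (simp add: S_def)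
    fix z assume "z \<in> U - {0}"
    hence z: "z \<in> U" by blast
    have dP: "deriv P z = P z * g z" by (rule DERIV_imp_deriv[OF P'[OF z]])
    have dS: "deriv S z = P z * g z * c z + P z * deriv c z"
      unfolding S_def[abs_def] using DERIV_mult'[OF P'[OF z] holomorphic_derivI[OF h(3) U(1) z]]
      by (intro DERIV_imp_deriv) (simp add: algebra_simps)
    have "P z * t z + Q z * 1 = z\<^sup>2 * deriv P z + a z * P z + b z * 0"
      unfolding dP Q_def by (simp add: algebra_simps)
    moreover have "0 * t z + S z * 1 = z\<^sup>2 * deriv (\<lambda>_. 0) z + c z * P z + d z * 0"
      by (simp add: S_def)
    moreover have "P z * p z + Q z * t z = z\<^sup>2 * deriv Q z + a z * Q z + b z * S z"
      using P0[of z] by (simp add: p_def)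
    moreover have "0 * p z + S z * t z = z\<^sup>2 * deriv S z + c z * Q z + d z * S z"
    proof -
      have *: "2 * (g z * c z) = - (k z * c z + deriv c z)" using c0[OF z] by (simp add: g_def field_simps)
      have "z\<^sup>2 * deriv S z + c z * Q z + d z * S z - S z * t z =
          P z * (z\<^sup>2 * (2 * (g z * c z) + deriv c z) + c z * (a z + d z - 2 * t z))"
        unfolding dS S_def Q_def by (simp add: algebra_simps)
      also have "\<dots> = 0" unfolding * k(2) by (simp add: algebra_simps)
      finally show ?thesis by simp
    qed
    ultimately show "P z * t z + Q z * 1 = z\<^sup>2 * deriv P z + a z * P z + b z * 0 \<and>
       0 * t z + S z * 1 = z\<^sup>2 * deriv (\<lambda>_. 0) z + c z * P z + d z * 0 \<and>
       P z * p z + Q z * t z = z\<^sup>2 * deriv Q z + a z * Q z + b z * S z \<and>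
       0 * p z + S z * t z = z\<^sup>2 * deriv S z + c z * Q z + d z * S z" by blast
  qed
  note cf' = this
  note I' = formal_invariants[OF cf']
  \<comment> \<open>The determinant t^2 - p of the new matrix has the invariant coefficients of
    order 0 and 1; these give first \<open>p 0\<close> and then \<open>deriv p 0\<close>.\<close>
  have p0: "p 0 = 0" using I'(3) I(3) 0 a0 by (simp add: t_def)
  have "((\<lambda>z. t z * t z - p z * 1) has_field_derivative rho H 1 * t 0 + t 0 * rho H 1 - deriv p 0 * 1) (at 0)"
    by (rule derivative_eq_intros t' holomorphic_derivI[OF p U(1,2)] refl)+ simp
  from DERIV_imp_deriv[OF this] have "delta H 1 = 2 * rho H 0 * rho H 1 - deriv p 0"
    unfolding I'(4) by (simp add: t_def)
  hence p1: "deriv p 0 = - (delta H 1 - 2 * rho H 0 * rho H 1)" by simp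
  show thesis by (rule that[OF cf'[unfolded U_def t_def[abs_def]] p0 p1])
qed

text \<open>Flatness reads z^2 Y' = - B Y; in the variable \<zeta> the chain rule supplies one
  factor z, so that - B / z remains.\<close>

lemma mvflat_coords_deriv:
  assumes cf: "cframe (ball 0 (exp L)) v1 v2 a b c d" and \<sigma>: "mvflat {\<zeta>. Re \<zeta> < L} \<sigma>"
  defines "Y1 \<equiv> \<lambda>\<zeta>. coord1 (v1 (exp \<zeta>)) (v2 (exp \<zeta>)) (\<sigma> \<zeta>)"
    and "Y2 \<equiv> \<lambda>\<zeta>. coord2 (v1 (exp \<zeta>)) (v2 (exp \<zeta>)) (\<sigma> \<zeta>)"
  assumes \<zeta>: "Re \<zeta> < L"
  shows "(Y1 has_field_derivative - exp (- \<zeta>) * (a (exp \<zeta>) * Y1 \<zeta> + b (exp \<zeta>) * Y2 \<zeta>)) (at \<zeta>)"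
    "(Y2 has_field_derivative - exp (- \<zeta>) * (c (exp \<zeta>) * Y1 \<zeta> + d (exp \<zeta>) * Y2 \<zeta>)) (at \<zeta>)"
proof -
  let ?U = "ball (0::complex) (exp L)"
  note D = cframeD[OF cf]
  have \<zeta>': "\<zeta> \<in> {\<zeta>. Re \<zeta> < L}" using \<zeta> by simp
  obtain N W s where *: "open N" "\<zeta> \<in> N" "open W" "W \<subseteq> - {0}" "exp ` N \<subseteq> W" "flat_section H W s"
    "\<And>\<xi>. \<xi> \<in> N \<Longrightarrow> \<sigma> \<xi> = s (exp \<xi>)" by (rule mvflatE[OF \<sigma> \<zeta>'], rule that)
  define W0 where "W0 = W \<inter> (?U - {0})"
  have W0: "open W0" "W0 \<subseteq> W" "W0 \<subseteq> ?U - {0}" "W0 \<subseteq> - {0}" using *(3,4) D(10) by (auto simp: W0_def)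
  have fr: "frame W0 v1 v2" by (rule frame_subset[OF D(12) W0(1,3)])
  have "flat_section H W0 s" by (rule flat_section_restrict[OF *(6,3,4) W0(1,2) refl])
  note s = flat_sectionD[OF this]
  define f where "f z = coord1 (v1 z) (v2 z) (s z)" for z
  define g where "g z = coord2 (v1 z) (v2 z) (s z)" for z
  have hol: "f holomorphic_on W0" "g holomorphic_on W0" unfolding f_def[abs_def] g_def[abs_def]
    by (rule coord_holomorphic[OF fr s(1)])+
  define z where "z = exp \<zeta>"
  have z: "z \<in> W0" "z \<noteq> 0" using *(2,5) \<zeta> by (auto simp: W0_def z_def)
  note f1 = frameD(5,6)[OF fr z(1)]
  have zU: "z \<in> ?U - {0}" using z(1) W0(3) by blast
  have n: "nabla H W0 v z = nabla H (?U - {0}) v z" if "hol_section H (?U - {0}) v" for v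
    by (rule nabla_restrict[OF D(10,11) that W0(1,3) refl z(1)])
  note n' = n[OF frameD(2)[OF D(12)], unfolded D(8)[OF zU]] n[OF frameD(3)[OF D(12)], unfolded D(9)[OF zU]]
  have "comb2 H (deriv f z + a z / z\<^sup>2 * f z + b z / z\<^sup>2 * g z) (v1 z) (deriv g z + c z / z\<^sup>2 * f z + d z / z\<^sup>2 * g z) (v2 z)
    = nabla H W0 (\<lambda>z. comb2 H (f z) (v1 z) (g z) (v2 z)) z"
    by (rule nabla_frame_comb[OF fr W0(4) hol z(1) n', symmetric])
  also have "\<dots> = nabla H W0 s z"
    by (rule nabla_restrict[OF W0(1,4) s(1) W0(1) order_refl _ z(1)])
      (simp add: f_def g_def comb_coord[OF frameD(4)[OF fr] hol_section_fibre[OF s(1)]])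
  also have "\<dots> = comb2 H 0 (v1 z) 0 (v2 z)" unfolding s(2)[OF z(1)] comb_zero[OF f1] ..
  finally have "deriv f z + a z / z\<^sup>2 * f z + b z / z\<^sup>2 * g z = 0" "deriv g z + c z / z\<^sup>2 * f z + d z / z\<^sup>2 * g z = 0"
    by (rule indep_comb_eq[OF frameD(4)[OF fr z(1)]])+
  hence df: "deriv f z = - (a z * f z + b z * g z) / z\<^sup>2" "deriv g z = - (c z * f z + d z * g z) / z\<^sup>2"
    by (simp_all add: add_eq_0_iff2 add.assoc add_divide_distrib diff_divide_distrib)
  have sq: "- x / z\<^sup>2 * z = - exp (- \<zeta>) * x" for x
    using z(2) by (simp add: power2_eq_square exp_minus divide_inverse flip: z_def)
  have Y: "Y1 \<xi> = f (exp \<xi>)" "Y2 \<xi> = g (exp \<xi>)" if "\<xi> \<in> N" for \<xi>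
    unfolding Y1_def Y2_def f_def g_def *(7)[OF that] by simp_all
  have ex: "(exp has_field_derivative z) (at \<zeta>)" unfolding z_def by (rule DERIV_exp)
  have f': "((\<lambda>\<xi>. f (exp \<xi>)) has_field_derivative - exp (- \<zeta>) * (a z * f z + b z * g z)) (at \<zeta>)"
    using DERIV_chain2[OF holomorphic_derivI[OF hol(1) W0(1) z(1), unfolded z_def] DERIV_exp] unfolding z_def[symmetric] df sq .
  have g': "((\<lambda>\<xi>. g (exp \<xi>)) has_field_derivative - exp (- \<zeta>) * (c z * f z + d z * g z)) (at \<zeta>)"
    using DERIV_chain2[OF holomorphic_derivI[OF hol(2) W0(1) z(1), unfolded z_def] DERIV_exp] unfolding z_def[symmetric] df sq .
  show "(Y1 has_field_derivative - exp (- \<zeta>) * (a (exp \<zeta>) * Y1 \<zeta> + b (exp \<zeta>) * Y2 \<zeta>)) (at \<zeta>)"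
    unfolding Y[OF *(2)] z_def[symmetric]
    by (rule has_field_derivative_transform_within_open[OF f' *(1,2)]) (simp add: Y)
  show "(Y2 has_field_derivative - exp (- \<zeta>) * (c (exp \<zeta>) * Y1 \<zeta> + d (exp \<zeta>) * Y2 \<zeta>)) (at \<zeta>)"
    unfolding Y[OF *(2)] z_def[symmetric]
    by (rule has_field_derivative_transform_within_open[OF g' *(1,2)]) (simp add: Y)
qed

text \<open>The derivative of the twist cancels the diagonal of the connection matrix. The second
  coordinate takes the role of \<open>y\<close> and the first that of \<open>v\<close>.\<close>

lemma companion_sol_of_mvflat:
  assumes cf: "companion_cframe L v1 v2 \<rho>0 \<rho>1 p" and \<sigma>: "mvflat {\<zeta>. Re \<zeta> < L} \<sigma>"
  shows "companion_sol p L (\<lambda>\<zeta>. twist \<rho>0 \<rho>1 \<zeta> * coord2 (v1 (exp \<zeta>)) (v2 (exp \<zeta>)) (\<sigma> \<zeta>))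
     (\<lambda>\<zeta>. twist \<rho>0 \<rho>1 \<zeta> * coord1 (v1 (exp \<zeta>)) (v2 (exp \<zeta>)) (\<sigma> \<zeta>))"
  unfolding companion_sol_def
proof (intro allI impI conjI)
  fix \<zeta> :: complex assume "Re \<zeta> < L"
  note d = mvflat_coords_deriv[OF cf \<sigma> this]
  show "((\<lambda>\<zeta>. twist \<rho>0 \<rho>1 \<zeta> * coord2 (v1 (exp \<zeta>)) (v2 (exp \<zeta>)) (\<sigma> \<zeta>)) has_field_derivative
      - exp (- \<zeta>) * (twist \<rho>0 \<rho>1 \<zeta> * coord1 (v1 (exp \<zeta>)) (v2 (exp \<zeta>)) (\<sigma> \<zeta>))) (at \<zeta>)"
    by (rule DERIV_cong[OF DERIV_mult'[OF twist_deriv d(2)]]) (simp add: algebra_simps)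
  show "((\<lambda>\<zeta>. twist \<rho>0 \<rho>1 \<zeta> * coord1 (v1 (exp \<zeta>)) (v2 (exp \<zeta>)) (\<sigma> \<zeta>)) has_field_derivative
      - exp (- \<zeta>) * p (exp \<zeta>) * (twist \<rho>0 \<rho>1 \<zeta> * coord2 (v1 (exp \<zeta>)) (v2 (exp \<zeta>)) (\<sigma> \<zeta>))) (at \<zeta>)"
    by (rule DERIV_cong[OF DERIV_mult'[OF twist_deriv d(1)]]) (simp add: algebra_simps)
qed

end

section \<open>Monodromy eigenvalues and reduction to the model\<close>

context te2
begin

lemma mvframe_twisted_wronskian:
  assumes cf: "companion_cframe L v1 v2 \<rho>0 \<rho>1 p" and fr: "mvframe \<sigma>1 \<sigma>2"
  defines "y \<equiv> \<lambda>\<sigma> \<zeta>. twist \<rho>0 \<rho>1 \<zeta> * coord2 (v1 (exp \<zeta>)) (v2 (exp \<zeta>)) (\<sigma> \<zeta>)"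
    and "v \<equiv> \<lambda>\<sigma> \<zeta>. twist \<rho>0 \<rho>1 \<zeta> * coord1 (v1 (exp \<zeta>)) (v2 (exp \<zeta>)) (\<sigma> \<zeta>)"
  shows "companion_sol p L (y \<sigma>1) (v \<sigma>1)" "companion_sol p L (y \<sigma>2) (v \<sigma>2)"
    "Re \<zeta> < L \<Longrightarrow> wronskian (y \<sigma>1) (v \<sigma>1) (y \<sigma>2) (v \<sigma>2) \<zeta> \<noteq> 0"
proof -
  have \<sigma>: "mvflat UNIV \<sigma>1" "mvflat UNIV \<sigma>2" "\<And>\<zeta>. indep (exp \<zeta>) (\<sigma>1 \<zeta>) (\<sigma>2 \<zeta>)" using fr by (simp_all add: mvframe_def)
  show "companion_sol p L (y \<sigma>1) (v \<sigma>1)" "companion_sol p L (y \<sigma>2) (v \<sigma>2)"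
    unfolding y_def v_def
    by (rule companion_sol_of_mvflat[OF cf mvflat_subset[OF \<sigma>(1) subset_UNIV]],
        rule companion_sol_of_mvflat[OF cf mvflat_subset[OF \<sigma>(2) subset_UNIV]])
  assume "Re \<zeta> < L"
  hence "exp \<zeta> \<in> ball 0 (exp L)" by simp
  note i = frameD(4)[OF cframeD(1)[OF cf] this]
  let ?x = "v1 (exp \<zeta>)" and ?y = "v2 (exp \<zeta>)"
  have "indep (exp \<zeta>) (comb2 H (coord1 ?x ?y (\<sigma>1 \<zeta>)) ?x (coord2 ?x ?y (\<sigma>1 \<zeta>)) ?y)
     (comb2 H (coord1 ?x ?y (\<sigma>2 \<zeta>)) ?x (coord2 ?x ?y (\<sigma>2 \<zeta>)) ?y)"
    unfolding comb_coord[OF i indep_fibre(1)[OF \<sigma>(3)]] comb_coord[OF i indep_fibre(2)[OF \<sigma>(3)]] by (rule \<sigma>(3))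
  hence "coord1 ?x ?y (\<sigma>1 \<zeta>) * coord2 ?x ?y (\<sigma>2 \<zeta>) - coord2 ?x ?y (\<sigma>1 \<zeta>) * coord1 ?x ?y (\<sigma>2 \<zeta>) \<noteq> 0"
    unfolding indep_comb_iff[OF i] .
  moreover have "wronskian (y \<sigma>1) (v \<sigma>1) (y \<sigma>2) (v \<sigma>2) \<zeta> = - (twist \<rho>0 \<rho>1 \<zeta>)\<^sup>2 *
     (coord1 ?x ?y (\<sigma>1 \<zeta>) * coord2 ?x ?y (\<sigma>2 \<zeta>) - coord2 ?x ?y (\<sigma>1 \<zeta>) * coord1 ?x ?y (\<sigma>2 \<zeta>))"
    by (simp add: wronskian_def y_def v_def power2_eq_square algebra_simps)
  ultimately show "wronskian (y \<sigma>1) (v \<sigma>1) (y \<sigma>2) (v \<sigma>2) \<zeta> \<noteq> 0" using twist_nonzero by simp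
qed

lemma coords_of_comb:
  assumes cf: "cframe (ball 0 (exp L)) v1 v2 a b c d" and f: "x \<in> fibre H (exp \<zeta>)" "y \<in> fibre H (exp \<zeta>)" and \<zeta>: "Re \<zeta> < L"
  shows "coord1 (v1 (exp \<zeta>)) (v2 (exp \<zeta>)) (comb2 H k x l y) =
      k * coord1 (v1 (exp \<zeta>)) (v2 (exp \<zeta>)) x + l * coord1 (v1 (exp \<zeta>)) (v2 (exp \<zeta>)) y"
    "coord2 (v1 (exp \<zeta>)) (v2 (exp \<zeta>)) (comb2 H k x l y) =
      k * coord2 (v1 (exp \<zeta>)) (v2 (exp \<zeta>)) x + l * coord2 (v1 (exp \<zeta>)) (v2 (exp \<zeta>)) y"
proof -
  let ?x = "v1 (exp \<zeta>)" and ?y = "v2 (exp \<zeta>)"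
  have z: "exp \<zeta> \<in> ball 0 (exp L)" using \<zeta> by simp
  note i = frameD(4)[OF cframeD(1)[OF cf] z]
  have "comb2 H k x l y = comb2 H k (comb2 H (coord1 ?x ?y x) ?x (coord2 ?x ?y x) ?y) l (comb2 H (coord1 ?x ?y y) ?x (coord2 ?x ?y y) ?y)"
    unfolding comb_coord[OF i f(1)] comb_coord[OF i f(2)] ..
  also have "\<dots> = comb2 H (k * coord1 ?x ?y x + l * coord1 ?x ?y y) ?x (k * coord2 ?x ?y x + l * coord2 ?x ?y y) ?y"
    by (rule comb_comb[OF indep_fibre[OF i]])
  finally show "coord1 ?x ?y (comb2 H k x l y) = k * coord1 ?x ?y x + l * coord1 ?x ?y y"
    "coord2 ?x ?y (comb2 H k x l y) = k * coord2 ?x ?y x + l * coord2 ?x ?y y"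
    by (simp_all only: coord_comb[OF i])
qed

text \<open>The twisted solutions have constant Wronskian, which fixes the determinant of the monodromy.\<close>

lemma Eig_mon_pair:
  assumes cf: "companion_cframe L v1 v2 \<rho>0 \<rho>1 p"
  obtains k l where "Eig_mon H = {k, l}" "k * l = exp (- 4 * of_real pi * \<i> * \<rho>1)"
proof -
  obtain \<sigma>1 \<sigma>2 where fr: "mvframe \<sigma>1 \<sigma>2" by (rule ex_mvframe, rule that)
  obtain a b c d where M: "a * d - b * c \<noteq> 0"
    "\<And>\<zeta>. \<sigma>1 (\<zeta> + 2 * of_real pi * \<i>) = comb2 H a (\<sigma>1 \<zeta>) c (\<sigma>2 \<zeta>)"
    "\<And>\<zeta>. \<sigma>2 (\<zeta> + 2 * of_real pi * \<i>) = comb2 H b (\<sigma>1 \<zeta>) d (\<sigma>2 \<zeta>)" by (rule mvframe_turn[OF fr], rule that)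
  have i: "indep (exp \<zeta>) (\<sigma>1 \<zeta>) (\<sigma>2 \<zeta>)" for \<zeta> using fr by (simp add: mvframe_def)
  define y where "y \<sigma> \<zeta> = twist \<rho>0 \<rho>1 \<zeta> * coord2 (v1 (exp \<zeta>)) (v2 (exp \<zeta>)) (\<sigma> \<zeta>)" for \<sigma> \<zeta>
  define v where "v \<sigma> \<zeta> = twist \<rho>0 \<rho>1 \<zeta> * coord1 (v1 (exp \<zeta>)) (v2 (exp \<zeta>)) (\<sigma> \<zeta>)" for \<sigma> \<zeta>
  have yv_eq: "y \<sigma> = (\<lambda>\<zeta>. twist \<rho>0 \<rho>1 \<zeta> * coord2 (v1 (exp \<zeta>)) (v2 (exp \<zeta>)) (\<sigma> \<zeta>))"
    "v \<sigma> = (\<lambda>\<zeta>. twist \<rho>0 \<rho>1 \<zeta> * coord1 (v1 (exp \<zeta>)) (v2 (exp \<zeta>)) (\<sigma> \<zeta>))" for \<sigma>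
    by (simp_all add: y_def v_def fun_eq_iff)
  note w = mvframe_twisted_wronskian[OF cf fr, folded yv_eq]
  obtain W where W: "\<And>\<zeta>. Re \<zeta> < L \<Longrightarrow> wronskian (y \<sigma>1) (v \<sigma>1) (y \<sigma>2) (v \<sigma>2) \<zeta> = W"
    using wronskian_const[OF w(1,2)] by blast
  define q where "q = exp (2 * of_real pi * \<i> * \<rho>1)"
  define \<zeta> where "\<zeta> = complex_of_real (L - 1)"
  define \<zeta>' where "\<zeta>' = \<zeta> + 2 * of_real pi * \<i>"
  have \<zeta>: "Re \<zeta> < L" "Re \<zeta>' < L" by (simp_all add: \<zeta>_def \<zeta>'_def)
  have e: "exp \<zeta>' = exp \<zeta>" unfolding \<zeta>'_def by (simp only: exp_add exp_two_pi_i mult_1_right)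
  note ct = coords_of_comb[OF cf indep_fibre[OF i] \<zeta>(1)]
  have tw: "twist \<rho>0 \<rho>1 \<zeta>' = q * twist \<rho>0 \<rho>1 \<zeta>" unfolding \<zeta>'_def q_def by (rule twist_turn)
  have yv: "y \<sigma>1 \<zeta>' = q * (a * y \<sigma>1 \<zeta> + c * y \<sigma>2 \<zeta>)" "v \<sigma>1 \<zeta>' = q * (a * v \<sigma>1 \<zeta> + c * v \<sigma>2 \<zeta>)"
    "y \<sigma>2 \<zeta>' = q * (b * y \<sigma>1 \<zeta> + d * y \<sigma>2 \<zeta>)" "v \<sigma>2 \<zeta>' = q * (b * v \<sigma>1 \<zeta> + d * v \<sigma>2 \<zeta>)"
    unfolding y_def v_def e tw M(2,3)[of \<zeta>, folded \<zeta>'_def] ct by (simp_all add: algebra_simps)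
  have "W = wronskian (y \<sigma>1) (v \<sigma>1) (y \<sigma>2) (v \<sigma>2) \<zeta>'" by (rule W[OF \<zeta>(2), symmetric])
  also have "\<dots> = q\<^sup>2 * (a * d - b * c) * wronskian (y \<sigma>1) (v \<sigma>1) (y \<sigma>2) (v \<sigma>2) \<zeta>"
    unfolding wronskian_def yv by (simp add: power2_eq_square algebra_simps)
  also have "wronskian (y \<sigma>1) (v \<sigma>1) (y \<sigma>2) (v \<sigma>2) \<zeta> = W" by (rule W[OF \<zeta>(1)])
  finally have "W = q\<^sup>2 * (a * d - b * c) * W" .
  hence "q\<^sup>2 * (a * d - b * c) = 1" using w(3)[OF \<zeta>(1)] W[OF \<zeta>(1)] by simp
  moreover have "q\<^sup>2 = exp (4 * of_real pi * \<i> * \<rho>1)"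
    by (simp add: q_def power2_eq_square mult_ac flip: exp_add)
  ultimately have det: "a * d - b * c = exp (- 4 * of_real pi * \<i> * \<rho>1)"
    by (simp add: exp_minus field_simps)
  obtain k l where kl: "k + l = a + d" "k * l = a * d - b * c"
    "\<And>x. x\<^sup>2 - (a + d) * x + (a * d - b * c) = 0 \<longleftrightarrow> x = k \<or> x = l" by (rule quadratic_roots, rule that)
  have "x \<in> Eig_mon H \<longleftrightarrow> x = k \<or> x = l" for x
  proof -
    have "x \<in> Eig_mon H \<longleftrightarrow> (\<exists>u w. (u \<noteq> 0 \<or> w \<noteq> 0) \<and> a * u + b * w = x * u \<and> c * u + d * w = x * w)"
      by (rule Eig_mon_iff[OF fr M(2,3)])
    also have "\<dots> \<longleftrightarrow> (\<exists>u w. (u \<noteq> 0 \<or> w \<noteq> 0) \<and> (a - x) * u + b * w = 0 \<and> c * u + (d - x) * w = 0)"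
      by (simp add: algebra_simps)
    also have "\<dots> \<longleftrightarrow> (a - x) * (d - x) - b * c = 0" by (rule kernel_2x2)
    also have "(a - x) * (d - x) - b * c = x\<^sup>2 - (a + d) * x + (a * d - b * c)" by (simp add: power2_eq_square algebra_simps)
    finally show ?thesis unfolding kl(3) .
  qed
  hence "Eig_mon H = {k, l}" by blast
  thus thesis using that kl(2) det by simp
qed

text \<open>An eigenvector of the monodromy gives the eigensolution; the additional factor in its
  eigenvalue is what the twist acquires under a turn.\<close>

lemma companion_system_of_eigenvalue:
  assumes cf: "companion_cframe L v1 v2 \<rho>0 \<rho>1 p" and p: "p 0 = 0" "deriv p 0 \<noteq> 0" and k: "k \<in> Eig_mon H"
  obtains y1 w1 y2 w2 f g where "companion_system p L y1 w1 y2 w2 f g (k * exp (2 * of_real pi * \<i> * \<rho>1))"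
proof -
  obtain \<sigma>1 \<sigma>2 where fr: "mvframe \<sigma>1 \<sigma>2" by (rule ex_mvframe, rule that)
  define y where "y \<sigma> \<zeta> = twist \<rho>0 \<rho>1 \<zeta> * coord2 (v1 (exp \<zeta>)) (v2 (exp \<zeta>)) (\<sigma> \<zeta>)" for \<sigma> \<zeta>
  define v where "v \<sigma> \<zeta> = twist \<rho>0 \<rho>1 \<zeta> * coord1 (v1 (exp \<zeta>)) (v2 (exp \<zeta>)) (\<sigma> \<zeta>)" for \<sigma> \<zeta>
  have yv_eq: "y \<sigma> = (\<lambda>\<zeta>. twist \<rho>0 \<rho>1 \<zeta> * coord2 (v1 (exp \<zeta>)) (v2 (exp \<zeta>)) (\<sigma> \<zeta>))"
    "v \<sigma> = (\<lambda>\<zeta>. twist \<rho>0 \<rho>1 \<zeta> * coord1 (v1 (exp \<zeta>)) (v2 (exp \<zeta>)) (\<sigma> \<zeta>))" for \<sigma>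
    by (simp_all add: y_def v_def fun_eq_iff)
  note w = mvframe_twisted_wronskian[OF cf fr, folded yv_eq]
  obtain \<sigma> \<zeta>0 where s: "mvflat UNIV \<sigma>" "\<sigma> \<zeta>0 \<noteq> fibre_zero H (exp \<zeta>0)" "monodromy \<sigma> = (\<lambda>\<zeta>. fibre_scale H k (\<sigma> \<zeta>))"
    using k unfolding Eig_mon_def mem_Collect_eq using flat_multivalued_iff by (elim bexE conjE exE) blast
  have sol: "companion_sol p L (y \<sigma>) (v \<sigma>)"
    unfolding yv_eq by (rule companion_sol_of_mvflat[OF cf mvflat_subset[OF s(1) subset_UNIV]])
  note fib = mvflat_fibre[OF s(1) UNIV_I]
  have turn: "\<sigma> (\<zeta> + 2 * of_real pi * \<i>) = comb2 H k (\<sigma> \<zeta>) 0 (\<sigma> \<zeta>)" for \<zeta>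
    using fun_cong[OF s(3), of \<zeta>] by (simp add: monodromy_def scale_eq_comb[OF fib])
  have e: "exp (\<zeta> + 2 * of_real pi * \<i>) = exp \<zeta>" for \<zeta> :: complex by (simp only: exp_add exp_two_pi_i mult_1_right)
  have eig: "y \<sigma> (\<zeta> + 2 * of_real pi * \<i>) = k * exp (2 * of_real pi * \<i> * \<rho>1) * y \<sigma> \<zeta>"
    "v \<sigma> (\<zeta> + 2 * of_real pi * \<i>) = k * exp (2 * of_real pi * \<i> * \<rho>1) * v \<sigma> \<zeta>" if "Re \<zeta> < L" for \<zeta>
    unfolding y_def v_def e turn twist_turn coords_of_comb[OF cf fib fib that] by simp_all
  have zero: "mvflat UNIV (\<lambda>\<zeta>. fibre_zero H (exp \<zeta>))"
  proof -
    have "(\<lambda>\<zeta>. fibre_zero H (exp \<zeta>)) = (\<lambda>\<zeta>. comb2 H 0 (\<sigma> \<zeta>) 0 (\<sigma> \<zeta>))" using comb_zero[OF fib fib] by simp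
    thus ?thesis using mvflat_comb[OF s(1) s(1), of 0 0] by simp
  qed
  \<comment> \<open>If both coordinates vanished at one point of the half-plane, the flat section
    would be zero there and hence everywhere.\<close>
  have nz: "\<exists>\<zeta>. Re \<zeta> < L \<and> (y \<sigma> \<zeta> \<noteq> 0 \<or> v \<sigma> \<zeta> \<noteq> 0)"
  proof (rule ccontr)
    assume contra: "\<not> (\<exists>\<zeta>. Re \<zeta> < L \<and> (y \<sigma> \<zeta> \<noteq> 0 \<or> v \<sigma> \<zeta> \<noteq> 0))"
    define \<zeta> where "\<zeta> = complex_of_real (L - 1)"
    have \<zeta>: "Re \<zeta> < L" by (simp add: \<zeta>_def)
    hence "y \<sigma> \<zeta> = 0" "v \<sigma> \<zeta> = 0" using contra by blast+
    hence c0: "coord2 (v1 (exp \<zeta>)) (v2 (exp \<zeta>)) (\<sigma> \<zeta>) = 0" "coord1 (v1 (exp \<zeta>)) (v2 (exp \<zeta>)) (\<sigma> \<zeta>) = 0"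
      unfolding y_def v_def by (simp_all add: twist_nonzero)
    have z: "exp \<zeta> \<in> ball 0 (exp L)" using \<zeta> by simp
    note i = frameD(4)[OF cframeD(1)[OF cf] z]
    have "\<sigma> \<zeta> = fibre_zero H (exp \<zeta>)"
      using comb_coord[OF i fib] unfolding c0 comb_zero[OF indep_fibre[OF i]] by simp
    from mvflat_unique[OF s(1) zero open_UNIV connected_UNIV UNIV_I this UNIV_I] show False using s(2) by blast
  qed
  have "companion_system p L (y \<sigma>1) (v \<sigma>1) (y \<sigma>2) (v \<sigma>2) (y \<sigma>) (v \<sigma>) (k * exp (2 * of_real pi * \<i> * \<rho>1))"
    by (rule companion_system.intro[OF cframeD(5)[OF cf] p w(1,2,3) sol eig nz])
  thus thesis by (rule that)
qed

text \<open>\<open>companion_equivalence\<close> compares the system of a companion frame with the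
  quadratic one: the derivatives at 0 agree, and the choice of the eigenvalue makes the twisted
  eigenvalues agree. What remains is to pass from solutions to frames.\<close>

lemma ex_model_cframe:
  assumes Bra: "type_Bra H" and b: "Re b < 0" and k: "exp (- 2 * of_real pi * \<i> * (rho H 1 - b)) \<in> Eig_mon H"
  obtains L v1 v2 where
    "companion_cframe L v1 v2 (rho H 0) (rho H 1) (\<lambda>z. - (delta H 1 - 2 * rho H 0 * rho H 1) * z + (b\<^sup>2 + b) * z\<^sup>2)"
proof -
  define \<rho>0 \<rho>1 c where "\<rho>0 = rho H 0" and "\<rho>1 = rho H 1" and "c = - (delta H 1 - 2 * rho H 0 * rho H 1)"
  obtain L v1 v2 p where cf0: "companion_cframe L v1 v2 (rho H 0) (rho H 1) p" and p0: "p 0 = 0"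
    "deriv p 0 = - (delta H 1 - 2 * rho H 0 * rho H 1)" by (rule ex_companion_cframe[OF Bra], rule that)
  note cf = cf0[folded \<rho>0_def \<rho>1_def] and p = p0(1) p0(2)[folded c_def]
  have c: "c \<noteq> 0" using Bra unfolding type_Bra_def c_def by simp argo
  hence p1: "deriv p 0 \<noteq> 0" using p by simp
  define q where "q z = c * z + (b\<^sup>2 + b) * z\<^sup>2" for z
  have q_eq: "q = (\<lambda>z. c * z + (b\<^sup>2 + b) * z\<^sup>2)" by (simp add: q_def fun_eq_iff)
  have q': "deriv q 0 = c" unfolding q_def[abs_def] by (rule DERIV_imp_deriv) (auto intro!: derivative_eq_intros)
  have lam: "exp (- 2 * of_real pi * \<i> * (rho H 1 - b)) * exp (2 * of_real pi * \<i> * \<rho>1) = exp (2 * of_real pi * \<i> * b)"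
    unfolding \<rho>1_def exp_add[symmetric] by (simp add: algebra_simps)
  obtain y1 w1 y2 w2 f g where S1: "companion_system p L y1 w1 y2 w2 f g (exp (2 * of_real pi * \<i> * b))"
    by (rule companion_system_of_eigenvalue[OF cf p(1) p1 k, unfolded lam], rule that)
  obtain y1' w1' y2' w2' f' g' where S2: "companion_system q L y1' w1' y2' w2' f' g' (exp (2 * of_real pi * \<i> * b))"
    by (rule companion_system_model[where L = L, OF b c, folded q_eq], rule that)
  obtain A B W where AB: "A holomorphic_on ball 0 (exp L)" "B holomorphic_on ball 0 (exp L)" "W \<noteq> 0"
    "\<And>C D z. C = (\<lambda>z. B z * p z - z\<^sup>2 * deriv A z) \<Longrightarrow> D = (\<lambda>z. A z - z\<^sup>2 * deriv B z) \<Longrightarrow> z \<in> ball 0 (exp L) \<Longrightarrow>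
       A z * D z - B z * C z = W \<and> A z * q z = D z * p z - z\<^sup>2 * deriv C z \<and> B z * q z = C z - z\<^sup>2 * deriv D z"
    by (rule companion_equivalence[OF S1 S2 p(2)[folded q']], rule that)
  define C where "C = (\<lambda>z. B z * p z - z\<^sup>2 * deriv A z)"
  define D where "D = (\<lambda>z. A z - z\<^sup>2 * deriv B z)"
  note eqs = AB(4)[OF C_def D_def]
  let ?U = "ball (0::complex) (exp L)" and ?t = "\<lambda>z. \<rho>0 + \<rho>1 * z"
  note cD = cframeD[OF cf]
  have CD: "C holomorphic_on ?U" "D holomorphic_on ?U" unfolding C_def D_def
    by (intro holomorphic_on_diff holomorphic_on_mult holomorphic_on_power holomorphic_on_ident AB(1,2) cD(5)
        holomorphic_deriv[OF AB(1) open_ball] holomorphic_deriv[OF AB(2) open_ball])+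
  have hol: "(\<lambda>z. - C z) holomorphic_on ?U" "(\<lambda>z. - B z) holomorphic_on ?U" "q holomorphic_on ?U"
    unfolding q_def[abs_def] by (intro holomorphic_intros CD AB)+
  \<comment> \<open>The pair (y, v) is mapped by the matrix with rows (A, B) and (C, D), and
    coordinates are ordered as (v, y). Frames change by the inverse of the coordinate
    transformation; its columns are (A, - B) and (- C, D) up to the constant W, which is
    dropped.\<close>
  have "cframe ?U (\<lambda>z. comb2 H (A z) (v1 z) (- B z) (v2 z)) (\<lambda>z. comb2 H (- C z) (v1 z) (D z) (v2 z)) ?t q (\<lambda>_. 1) ?t"
  proof (rule cframe_gauge[OF cf open_ball cD(2) order_refl AB(1) hol(1,2) CD(2) cD(4) hol(3) cD(6,7)])
    show "A z * D z - - B z * - C z \<noteq> 0" if "z \<in> ?U" for z using eqs[OF that] AB(3) by simp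
    fix z assume "z \<in> ?U - {0}"
    hence z: "z \<in> ?U" by blast
    have dB: "deriv (\<lambda>z. - B z) z = - deriv B z" "deriv (\<lambda>z. - C z) z = - deriv C z"
      using holomorphic_on_imp_differentiable_at[OF AB(2) open_ball z] holomorphic_on_imp_differentiable_at[OF CD(1) open_ball z]
      by simp_all
    have C: "C z = B z * p z - z\<^sup>2 * deriv A z" and D: "D z = A z - z\<^sup>2 * deriv B z" by (simp_all add: C_def D_def)
    have "A z * ?t z + - C z * 1 = z\<^sup>2 * deriv A z + ?t z * A z + p z * - B z" unfolding C by (simp add: algebra_simps)
    moreover have "- B z * ?t z + D z * 1 = z\<^sup>2 * deriv (\<lambda>z. - B z) z + 1 * A z + ?t z * - B z" unfolding D dB by (simp add: algebra_simps)
    moreover have "A z * q z + - C z * ?t z = z\<^sup>2 * deriv (\<lambda>z. - C z) z + ?t z * - C z + p z * D z"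
      using eqs[OF z] unfolding dB by (simp add: algebra_simps)
    moreover have "- B z * q z + D z * ?t z = z\<^sup>2 * deriv D z + 1 * - C z + ?t z * D z"
      using eqs[OF z] by (simp add: algebra_simps)
    ultimately show "A z * ?t z + - C z * 1 = z\<^sup>2 * deriv A z + ?t z * A z + p z * - B z \<and>
       - B z * ?t z + D z * 1 = z\<^sup>2 * deriv (\<lambda>z. - B z) z + 1 * A z + ?t z * - B z \<and>
       A z * q z + - C z * ?t z = z\<^sup>2 * deriv (\<lambda>z. - C z) z + ?t z * - C z + p z * D z \<and>
       - B z * q z + D z * ?t z = z\<^sup>2 * deriv D z + 1 * - C z + ?t z * D z" by blast
  qed
  thus thesis using that unfolding q_def[abs_def] \<rho>0_def \<rho>1_def c_def by blast
qed

text \<open>A logarithm of one eigenvalue yields b, and the known product of the eigenvalues yields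
  the other exponential. Subtracting a large integer from b changes neither of them.\<close>

lemma ex_exponent:
  assumes Bra: "type_Bra H"
  obtains b where "Re b < 0"
    "Eig_mon H = {exp (- 2 * of_real pi * \<i> * (rho H 1 + b)), exp (- 2 * of_real pi * \<i> * (rho H 1 - b))}"
proof -
  obtain L v1 v2 p where cf: "companion_cframe L v1 v2 (rho H 0) (rho H 1) p" by (rule ex_companion_cframe[OF Bra], rule that)
  obtain k l where kl: "Eig_mon H = {k, l}" "k * l = exp (- 4 * of_real pi * \<i> * rho H 1)" by (rule Eig_mon_pair[OF cf], rule that)
  hence k0: "k \<noteq> 0" by auto
  define b0 where "b0 = rho H 1 + Ln k / (2 * of_real pi * \<i>)"
  obtain n :: nat where n: "Re b0 < real n" using reals_Archimedean2 by blast
  define b where "b = b0 - of_nat n"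
  have "- 2 * of_real pi * \<i> * (rho H 1 - b) = Ln k + of_int (- int n) * (2 * of_real pi * \<i>)"
    by (simp add: b_def b0_def field_simps)
  moreover have "exp (of_int m * (2 * of_real pi * \<i>)) = 1" for m :: int unfolding exp_eq_1 by auto
  ultimately have k: "exp (- 2 * of_real pi * \<i> * (rho H 1 - b)) = k" using k0 by (simp only: exp_add exp_Ln[OF k0] mult_1_right)
  have "exp (- 2 * of_real pi * \<i> * (rho H 1 + b)) * k = k * l"
    unfolding kl(2) unfolding k[symmetric] exp_add[symmetric] by (simp add: algebra_simps)
  hence l: "exp (- 2 * of_real pi * \<i> * (rho H 1 + b)) = l" using k0 by simp
  have "Re b < 0" using n by (simp add: b_def)
  thus thesis by (rule that) (simp only: k l kl(1) insert_commute)
qed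

end

lemma fps_expansion_affine:
  assumes "k \<ge> 2"
  shows "fps_nth (fps_expansion (\<lambda>z. x + y * z) 0) k = 0"
proof -
  have d0: "(deriv ^^ n) (\<lambda>_. 0 :: complex) = (\<lambda>_. 0)" for n by (induction n) auto
  have "deriv (\<lambda>z. x + y * z) = (\<lambda>_. y)"
  proof
    show "deriv (\<lambda>z. x + y * z) z = y" for z by (rule DERIV_imp_deriv) (auto intro!: derivative_eq_intros)
  qed
  moreover obtain n where "k = Suc (Suc n)" using assms by (metis Suc_le_D numeral_2_eq_2 Suc_le_mono)
  ultimately have "(deriv ^^ k) (\<lambda>z. x + y * z) = (\<lambda>_. 0)"
    by (simp add: funpow_Suc_right d0 del: funpow.simps)
  thus ?thesis by (simp add: fps_expansion_def)
qed

lemma birkhoff_normal_form_affine: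
  assumes "\<And>z i j. B z $ i $ j = M $ i $ j + N $ i $ j * z"
  shows "birkhoff_normal_form B"
  unfolding birkhoff_normal_form_def matrix_coeff_def vec_eq_iff
  by (simp add: assms fps_expansion_affine)

context te2
begin

text \<open>The shear that adds - b z times the first section to the second explains the coefficient
  of the model: b^2 comes from the new diagonal entries, and b from z^2 times the derivative of - b
  z.\<close>

lemma birkhoff_of_model_cframe:
  assumes cf: "companion_cframe L v1 v2 \<rho>0 \<rho>1 (\<lambda>z. c * z + (b\<^sup>2 + b) * z\<^sup>2)"
  defines "B \<equiv> \<lambda>z. (\<rho>0 + z * \<rho>1) *\<^sub>m matC1 + 1 *\<^sub>m matC2 + (z * b) *\<^sub>m matD + (z * c) *\<^sub>m matE"
  obtains w1 w2 where "germ_basis H w1 w2" "connection_matrix H w1 w2 B" "birkhoff_normal_form B"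
proof -
  have entry: "B z $ 1 $ 1 = \<rho>0 + z * \<rho>1 + z * b" "B z $ 1 $ 2 = z * c" "B z $ 2 $ 1 = 1" "B z $ 2 $ 2 = \<rho>0 + z * \<rho>1 - z * b" for z
    by (simp_all add: B_def mat_scale_def matC1_def matC2_def matD_def matE_def)
  let ?U = "ball (0::complex) (exp L)"
  note D = cframeD[OF cf]
  have hol: "(\<lambda>_. k) holomorphic_on ?U" "(\<lambda>z. - b * z) holomorphic_on ?U" "(\<lambda>z. B z $ i $ j) holomorphic_on ?U" for k :: complex and i j
    by (intro holomorphic_intros)+ (use exhaust_2[of i] exhaust_2[of j] in \<open>auto simp: entry intro!: holomorphic_intros\<close>)
  have "cframe ?U (\<lambda>z. comb2 H 1 (v1 z) 0 (v2 z)) (\<lambda>z. comb2 H (- b * z) (v1 z) 1 (v2 z))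
     (\<lambda>z. B z $ 1 $ 1) (\<lambda>z. B z $ 1 $ 2) (\<lambda>z. B z $ 2 $ 1) (\<lambda>z. B z $ 2 $ 2)"
  proof (rule cframe_gauge[OF cf open_ball D(2) order_refl hol(1,2,1,1) hol(3,3,3,3)])
    show "1 * 1 - 0 * (- b * z) \<noteq> 0" for z by simp
    fix z
    have "((\<lambda>z. - b * z) has_field_derivative - b) (at z)" by (auto intro!: derivative_eq_intros)
    hence d: "deriv (\<lambda>z. - b * z) z = - b" by (rule DERIV_imp_deriv)
    show "1 * B z $ 1 $ 1 + - b * z * B z $ 2 $ 1 = z\<^sup>2 * deriv (\<lambda>_. 1) z + (\<rho>0 + \<rho>1 * z) * 1 + (c * z + (b\<^sup>2 + b) * z\<^sup>2) * 0 \<and>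
       0 * B z $ 1 $ 1 + 1 * B z $ 2 $ 1 = z\<^sup>2 * deriv (\<lambda>_. 0) z + 1 * 1 + (\<rho>0 + \<rho>1 * z) * 0 \<and>
       1 * B z $ 1 $ 2 + - b * z * B z $ 2 $ 2 = z\<^sup>2 * deriv (\<lambda>z. - b * z) z + (\<rho>0 + \<rho>1 * z) * (- b * z) + (c * z + (b\<^sup>2 + b) * z\<^sup>2) * 1 \<and>
       0 * B z $ 1 $ 2 + 1 * B z $ 2 $ 2 = z\<^sup>2 * deriv (\<lambda>_. 1) z + 1 * (- b * z) + (\<rho>0 + \<rho>1 * z) * 1"
      unfolding entry d by (simp add: algebra_simps power2_eq_square)
  qed
  note cf' = this
  have "birkhoff_normal_form B"
  proof (rule birkhoff_normal_form_affine)
    show "B z $ i $ j = B 0 $ i $ j + (B 1 - B 0) $ i $ j * z" for z i j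
      using exhaust_2[of i] exhaust_2[of j] by (auto simp: entry algebra_simps)
  qed
  thus thesis
    by (rule that[OF germ_basis_of_frame[OF cframeD(1,2)[OF cf']] connection_matrix_of_cframe[OF cf' refl refl refl refl]])
qed

end

section \<open>Isomorphisms of TE-structures\<close>

locale te2_pair = H: te2 H + H': te2 H' for H :: "('h, 2) te" and H' :: "('k, 2) te"
begin

definition matches :: "('h \<Rightarrow> 'k) \<Rightarrow> complex set \<Rightarrow> (complex \<Rightarrow> 'h) \<Rightarrow> (complex \<Rightarrow> 'h) \<Rightarrow> (complex \<Rightarrow> 'k) \<Rightarrow> (complex \<Rightarrow> 'k) \<Rightarrow> bool" where
  "matches F N w1 w2 w1' w2' \<longleftrightarrow> H.frame N w1 w2 \<and> H'.frame N w1' w2' \<and>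
     (\<forall>u\<in>N. \<forall>x y. F (comb2 H x (w1 u) y (w2 u)) = comb2 H' x (w1' u) y (w2' u))"

lemma matchesD:
  assumes "matches F N w1 w2 w1' w2'"
  shows "H.frame N w1 w2" "H'.frame N w1' w2'" "u \<in> N \<Longrightarrow> F (comb2 H x (w1 u) y (w2 u)) = comb2 H' x (w1' u) y (w2' u)"
  using assms unfolding matches_def by blast+

text \<open>Linearity, bijectivity and holomorphy of F are local and can be checked in matching
  frames. For the connection flat frames are used: both covariant derivatives then differentiate
  only the coefficients, and F keeps these. Since the connection lives on the punctured plane, the
  frames at 0 need not be flat.\<close>

lemma te_isomorphism_of_matching_frames:
  assumes loc0: "\<exists>N w1 w2 w1' w2'. 0 \<in> N \<and> matches F N w1 w2 w1' w2'"
    and flat: "\<And>z. z \<noteq> 0 \<Longrightarrow> \<exists>N w1 w2 w1' w2'. z \<in> N \<and> matches F N w1 w2 w1' w2' \<and>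
      H.flat_frame N w1 w2 \<and> H'.flat_frame N w1' w2'"
  shows "te_isomorphism H H' F"
proof -
  \<comment> \<open>An elimination rule, so that each fibrewise property can be checked in one pair
    of frames, with 0 treated like the other points.\<close>
  have loc: thesis
    if "\<And>N w1 w2 w1' w2'. z \<in> N \<Longrightarrow> matches F N w1 w2 w1' w2' \<Longrightarrow> thesis" for z thesis
    using loc0 flat[of z] that by (cases "z = 0") blast+
  have fib: "F e \<in> fibre H' z" if e: "e \<in> fibre H z" for e z
  proof (rule loc[of z])
    fix N w1 w2 w1' w2' assume N: "z \<in> N" and m: "matches F N w1 w2 w1' w2'"
    note M = matchesD[OF m]
    obtain x y where "e = comb2 H x (w1 z) y (w2 z)" by (rule H.indep_span[OF H.frameD(4)[OF M(1) N] e], rule that)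
    thus "F e \<in> fibre H' z" using M(3)[OF N] H'.comb_fibre[OF H'.frameD(5,6)[OF M(2)], OF N N] by simp
  qed
  have lin: "F (comb2 H p e q f) = comb2 H' p (F e) q (F f)" if e: "e \<in> fibre H z" "f \<in> fibre H z" for e f z p q
  proof (rule loc[of z])
    fix N w1 w2 w1' w2' assume N: "z \<in> N" and m: "matches F N w1 w2 w1' w2'"
    note M = matchesD[OF m]
    note i = H.frameD(4)[OF M(1) N] and i' = H'.frameD(4)[OF M(2) N]
    obtain x y where xy: "e = comb2 H x (w1 z) y (w2 z)" by (rule H.indep_span[OF i e(1)], rule that)
    obtain r s where rs: "f = comb2 H r (w1 z) s (w2 z)" by (rule H.indep_span[OF i e(2)], rule that)
    show "F (comb2 H p e q f) = comb2 H' p (F e) q (F f)"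
      unfolding xy rs H.comb_comb[OF H.indep_fibre[OF i]] M(3)[OF N] H'.comb_comb[OF H'.indep_fibre[OF i']] ..
  qed
  have sec: "hol_section H' W (\<lambda>z. F (s z))" if s: "hol_section H W s" and W: "open W" for W s
  proof (rule H'.hol_section_local)
    fix z assume z: "z \<in> W"
    show "\<exists>N. open N \<and> z \<in> N \<and> hol_section H' (N \<inter> W) (\<lambda>z. F (s z))"
    proof (rule loc[of z])
      fix N w1 w2 w1' w2' assume N: "z \<in> N" and m: "matches F N w1 w2 w1' w2'"
      note M = matchesD[OF m]
      have o: "open N" "open (N \<inter> W)" using H.frameD(1)[OF M(1)] W by auto
      have fr: "H.frame (N \<inter> W) w1 w2" by (rule H.frame_subset[OF M(1) o(2) Int_lower1])
      have fr': "H'.frame (N \<inter> W) w1' w2'" by (rule H'.frame_subset[OF M(2) o(2) Int_lower1])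
      have sN: "hol_section H (N \<inter> W) s" by (rule H.hol_section_subset[OF s Int_lower2])
      have "hol_section H' (N \<inter> W) (\<lambda>z. comb2 H' (H.coord1 (w1 z) (w2 z) (s z)) (w1' z) (H.coord2 (w1 z) (w2 z) (s z)) (w2' z))"
        by (rule H'.hol_section_comb[OF H'.frameD(2,3)[OF fr'] H.coord_holomorphic[OF fr sN]])
      moreover have "comb2 H' (H.coord1 (w1 z) (w2 z) (s z)) (w1' z) (H.coord2 (w1 z) (w2 z) (s z)) (w2' z) = F (s z)"
        if "z \<in> N \<inter> W" for z
        using M(3)[symmetric, of z] H.comb_coord[OF H.frameD(4)[OF fr that] H.hol_section_fibre[OF sN that]] that by simp
      ultimately have "hol_section H' (N \<inter> W) (\<lambda>z. F (s z))" by (rule H'.hol_section_cong)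
      thus ?thesis using o(1) N by blast
    qed
  qed
  have inj: "e = f" if e: "e \<in> fibre H z" "f \<in> fibre H z" "F e = F f" for e f z
  proof (rule loc[of z])
    fix N w1 w2 w1' w2' assume N: "z \<in> N" and m: "matches F N w1 w2 w1' w2'"
    note M = matchesD[OF m]
    note i = H.frameD(4)[OF M(1) N] and i' = H'.frameD(4)[OF M(2) N]
    obtain x y where xy: "e = comb2 H x (w1 z) y (w2 z)" by (rule H.indep_span[OF i e(1)], rule that)
    obtain r s where rs: "f = comb2 H r (w1 z) s (w2 z)" by (rule H.indep_span[OF i e(2)], rule that)
    have "x = r" "y = s" using e(3) unfolding xy rs M(3)[OF N] by (rule H'.indep_comb_eq[OF i'])+
    thus "e = f" by (simp add: xy rs)
  qed
  have surj: "\<exists>e. e \<in> fibre H z \<and> F e = f" if f: "f \<in> fibre H' z" for f z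
  proof (rule loc[of z])
    fix N w1 w2 w1' w2' assume N: "z \<in> N" and m: "matches F N w1 w2 w1' w2'"
    note M = matchesD[OF m]
    note i = H.frameD(4)[OF M(1) N] and i' = H'.frameD(4)[OF M(2) N]
    obtain x y where xy: "f = comb2 H' x (w1' z) y (w2' z)" by (rule H'.indep_span[OF i' f], rule that)
    show "\<exists>e. e \<in> fibre H z \<and> F e = f"
      using H.comb_fibre[OF H.indep_fibre[OF i], of x y] M(3)[OF N, of x y] xy by auto
  qed
  have tot: "e \<in> fibre H (base H e)" if "e \<in> total H" for e unfolding fibre_def using that by blast
  have tot': "f \<in> fibre H' (base H' f)" if "f \<in> total H'" for f unfolding fibre_def using that by blast
  have base: "base H' (F e) = base H e" if "e \<in> total H" for e
    by (rule H'.base_fibre[OF fib[OF tot[OF that]]])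
  have "bij_betw F (total H) (total H')"
  proof (rule bij_betwI')
    fix e f assume ef: "e \<in> total H" "f \<in> total H"
    show "(F e = F f) = (e = f)"
    proof
      assume eq: "F e = F f"
      have "base H f = base H e" using base[OF ef(1)] base[OF ef(2)] eq by simp
      hence "f \<in> fibre H (base H e)" using tot[OF ef(2)] by (simp only:)
      thus "e = f" by (rule inj[OF tot[OF ef(1)] _ eq])
    qed simp
  next
    fix e assume "e \<in> total H"
    from fib[OF tot[OF this]] show "F e \<in> total H'" unfolding fibre_def by blast
  next
    fix f assume "f \<in> total H'"
    from surj[OF tot'[OF this]] obtain e where "e \<in> fibre H (base H' f)" "F e = f" by blast
    thus "\<exists>e\<in>total H. f = F e" unfolding fibre_def by blast
  qed
  moreover have "\<forall>e \<in> total H. base H' (F e) = base H e" using base by blast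
  moreover have "\<exists>g :: complex \<Rightarrow> complex ^ 2 ^ 2. holomorphic_matrix_on g (U \<inter> V) \<and>
      (\<forall>e \<in> total H. base H e \<in> U \<inter> V \<longrightarrow> \<psi> (F e) = g (base H e) *v \<phi> e)"
    if U: "(U, \<phi>) \<in> atlas H" and V: "(V, \<psi>) \<in> atlas H'" for U \<phi> V \<psi>
  proof -
    obtain v1 v2 where v: "H.frame U v1 v2" "\<And>z. z \<in> U \<Longrightarrow> \<phi> (v1 z) = axis 1 1" "\<And>z. z \<in> U \<Longrightarrow> \<phi> (v2 z) = axis 2 1"
      by (rule H.chart_frame[OF U], rule that)
    note f = H.frameD[OF v(1)]
    have s: "hol_section H' U (\<lambda>z. F (v1 z))" "hol_section H' U (\<lambda>z. F (v2 z))" using sec f(1-3) by blast+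
    define g :: "complex \<Rightarrow> complex ^ 2 ^ 2" where "g z = (\<chi> i j. if j = 1 then \<psi> (F (v1 z)) $ i else \<psi> (F (v2 z)) $ i)" for z
    have "(\<lambda>z. g z $ i $ j) holomorphic_on (U \<inter> V)" for i j
      using H'.hol_section_chart[OF s(1) V] H'.hol_section_chart[OF s(2) V] by (cases "j = 1") (simp_all add: g_def)
    hence "holomorphic_matrix_on g (U \<inter> V)" by (simp add: holomorphic_matrix_on_def)
    moreover have "\<psi> (F e) = g (base H e) *v \<phi> e" if e: "e \<in> total H" "base H e \<in> U \<inter> V" for e
    proof -
      define z where "z = base H e"
      have z: "e \<in> fibre H z" "z \<in> U" "z \<in> V" using tot[OF e(1)] e(2) unfolding z_def by blast+
      have vf: "v1 z \<in> fibre H z" "v2 z \<in> fibre H z" using f(5,6) z(2) by blast+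
      have "\<phi> e = \<phi> (comb2 H (\<phi> e $ 1) (v1 z) (\<phi> e $ 2) (v2 z))"
        unfolding H.comb_chart[OF U z(2) vf] v(2,3)[OF z(2)] by (rule vec2_eqI) (simp_all add: axis_def)
      hence "e = comb2 H (\<phi> e $ 1) (v1 z) (\<phi> e $ 2) (v2 z)"
        by (rule H.chart_inj[OF U z(2,1) H.comb_fibre[OF vf]])
      hence "F e = comb2 H' (\<phi> e $ 1) (F (v1 z)) (\<phi> e $ 2) (F (v2 z))" using lin[OF vf, of "\<phi> e $ 1" "\<phi> e $ 2"] by simp
      hence "\<psi> (F e) = \<phi> e $ 1 *s \<psi> (F (v1 z)) + \<phi> e $ 2 *s \<psi> (F (v2 z))"
        using H'.comb_chart[OF V z(3) fib[OF vf(1)] fib[OF vf(2)]] by simp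
      thus ?thesis unfolding z_def[symmetric]
        by (intro vec2_eqI) (simp_all add: matrix_vector_2 g_def mult.commute)
    qed
    ultimately show ?thesis by blast
  qed
  moreover have "F (nabla H W s z) = nabla H' W (\<lambda>w. F (s w)) z"
    if W: "open W" "W \<subseteq> - {0}" and s: "hol_section H W s" and z: "z \<in> W" for W s z
  proof -
    have "z \<noteq> 0" using W(2) z by blast
    then obtain N w1 w2 w1' w2' where N: "z \<in> N" "matches F N w1 w2 w1' w2'" "H.flat_frame N w1 w2" "H'.flat_frame N w1' w2'"
      using flat by blast
    note M = matchesD[OF N(2)]
    have t: "N \<subseteq> - {0}" "flat_section H N w1" "flat_section H N w2" using N(3) by (simp_all add: H.flat_frame_def)
    have t': "flat_section H' N w1'" "flat_section H' N w2'" using N(4) by (simp_all add: H'.flat_frame_def)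
    have oN: "open N" by (rule H.frameD(1)[OF M(1)])
    define V where "V = N \<inter> W"
    have V: "open V" "V \<subseteq> N" "V \<subseteq> W" "z \<in> V" "V \<subseteq> - {0}" using oN W z N(1) by (auto simp: V_def)
    have fr: "H.frame V w1 w2" by (rule H.frame_subset[OF M(1) V(1,2)])
    have fr': "H'.frame V w1' w2'" by (rule H'.frame_subset[OF M(2) V(1,2)])
    have sV: "hol_section H V s" by (rule H.hol_section_subset[OF s V(3)])
    define f where "f z = H.coord1 (w1 z) (w2 z) (s z)" for z
    define g where "g z = H.coord2 (w1 z) (w2 z) (s z)" for z
    have hol: "f holomorphic_on V" "g holomorphic_on V" unfolding f_def[abs_def] g_def[abs_def]
      by (rule H.coord_holomorphic[OF fr sV])+
    have eq: "s u = comb2 H (f u) (w1 u) (g u) (w2 u)" if "u \<in> V" for u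
      unfolding f_def g_def by (rule H.comb_coord[OF H.frameD(4)[OF fr that] H.hol_section_fibre[OF sV that], symmetric])
    have zf: "w1 z \<in> fibre H z" "w2 z \<in> fibre H z" "w1' z \<in> fibre H' z" "w2' z \<in> fibre H' z"
      using H.frameD(5,6)[OF fr V(4)] H'.frameD(5,6)[OF fr' V(4)] by blast+
    have n: "nabla H V w z = comb2 H 0 (w1 z) 0 (w2 z)" if "flat_section H N w" for w
      using H.flat_sectionD(2)[OF H.flat_section_restrict[OF that oN t(1) V(1,2) refl] V(4)] H.comb_zero[OF zf(1,2)] by simp
    have n': "nabla H' V w z = comb2 H' 0 (w1' z) 0 (w2' z)" if "flat_section H' N w" for w
      using H'.flat_sectionD(2)[OF H'.flat_section_restrict[OF that oN t(1) V(1,2) refl] V(4)] H'.comb_zero[OF zf(3,4)] by simp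
    have "nabla H W s z = nabla H V (\<lambda>u. comb2 H (f u) (w1 u) (g u) (w2 u)) z"
      by (rule H.nabla_restrict[OF W s V(1,3) _ V(4), symmetric]) (rule eq[symmetric])
    also have "\<dots> = comb2 H (deriv f z) (w1 z) (deriv g z) (w2 z)"
      unfolding H.nabla_frame_comb[OF fr V(5) hol V(4) n[OF t(2)] n[OF t(3)]] by simp
    finally have 1: "F (nabla H W s z) = comb2 H' (deriv f z) (w1' z) (deriv g z) (w2' z)"
      using M(3)[OF N(1)] by simp
    have "nabla H' W (\<lambda>w. F (s w)) z = nabla H' V (\<lambda>u. comb2 H' (f u) (w1' u) (g u) (w2' u)) z"
    proof (rule H'.nabla_restrict[OF W sec[OF s W(1)] V(1,3) _ V(4), symmetric])
      fix u assume u: "u \<in> V"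
      show "comb2 H' (f u) (w1' u) (g u) (w2' u) = F (s u)" unfolding eq[OF u] by (rule M(3)[symmetric]) (use u V(2) in blast)
    qed
    also have "\<dots> = comb2 H' (deriv f z) (w1' z) (deriv g z) (w2' z)"
      unfolding H'.nabla_frame_comb[OF fr' V(5) hol V(4) n'[OF t'(1)] n'[OF t'(2)]] by simp
    finally show ?thesis using 1 by simp
  qed
  ultimately show ?thesis unfolding te_isomorphism_def by blast
qed

end

context te2
begin

lemma flat_frame_subset:
  assumes "flat_frame V t1 t2" "open V'" "V' \<subseteq> V"
  shows "flat_frame V' t1 t2"
proof -
  have t: "frame V t1 t2" "V \<subseteq> - {0}" "flat_section H V t1" "flat_section H V t2"
    using assms(1) by (simp_all add: flat_frame_def)
  note r = flat_section_restrict[OF _ frameD(1)[OF t(1)] t(2) assms(2,3) refl]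
  show ?thesis unfolding flat_frame_def
    using frame_subset[OF t(1) assms(2,3)] t(2) assms(3) r[OF t(3)] r[OF t(4)] by blast
qed

text \<open>Composition with the branch of the logarithm that takes the value \<zeta> at exp
  \<zeta>; dividing by exp \<zeta> first moves the argument of \<open>Ln\<close> near 1, away from
  the cut.\<close>

lemma flat_frame_of_mvframe:
  assumes fr: "mvframe \<sigma>1 \<sigma>2"
  obtains \<delta> where "\<delta> > 0" "flat_frame (ball (exp \<zeta>) \<delta>) (\<lambda>u. \<sigma>1 (Ln (u / exp \<zeta>) + \<zeta>)) (\<lambda>u. \<sigma>2 (Ln (u / exp \<zeta>) + \<zeta>))"
    "\<And>u. u \<in> ball (exp \<zeta>) \<delta> \<Longrightarrow> exp (Ln (u / exp \<zeta>) + \<zeta>) = u"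
proof -
  have \<sigma>: "mvflat UNIV \<sigma>1" "mvflat UNIV \<sigma>2" "\<And>\<zeta>. indep (exp \<zeta>) (\<sigma>1 \<zeta>) (\<sigma>2 \<zeta>)" using fr by (simp_all add: mvframe_def)
  obtain N1 W1 s1 where 1: "open N1" "\<zeta> \<in> N1" "open W1" "W1 \<subseteq> - {0}" "exp ` N1 \<subseteq> W1" "flat_section H W1 s1"
    "\<And>\<xi>. \<xi> \<in> N1 \<Longrightarrow> \<sigma>1 \<xi> = s1 (exp \<xi>)" by (rule mvflatE[OF \<sigma>(1) UNIV_I], rule that)
  obtain N2 W2 s2 where 2: "open N2" "\<zeta> \<in> N2" "open W2" "W2 \<subseteq> - {0}" "exp ` N2 \<subseteq> W2" "flat_section H W2 s2"
    "\<And>\<xi>. \<xi> \<in> N2 \<Longrightarrow> \<sigma>2 \<xi> = s2 (exp \<xi>)" by (rule mvflatE[OF \<sigma>(2) UNIV_I], rule that)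
  define z where "z = exp \<zeta>"
  have z0: "z \<noteq> 0" by (simp add: z_def)
  define lg where "lg u = Ln (u / z) + \<zeta>" for u
  have "isCont lg z" unfolding lg_def[abs_def] using z0 by (intro continuous_intros) simp_all
  moreover have "lg z = \<zeta>" using z0 by (simp add: lg_def)
  ultimately have "(lg \<longlongrightarrow> \<zeta>) (at z)" by (simp add: isCont_def)
  hence "\<forall>\<^sub>F u in at z. lg u \<in> N1 \<inter> N2" by (rule topological_tendstoD) (use 1 2 in auto)
  then obtain \<delta>0 where \<delta>0: "\<delta>0 > 0" "\<And>u. u \<noteq> z \<Longrightarrow> dist u z < \<delta>0 \<Longrightarrow> lg u \<in> N1 \<inter> N2"
    unfolding eventually_at by blast
  define \<delta> where "\<delta> = min \<delta>0 (cmod z)"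
  have lgN: "lg u \<in> N1" "lg u \<in> N2" if "u \<in> ball z \<delta>" for u
    using \<delta>0(2)[of u] that \<open>lg z = \<zeta>\<close> 1(2) 2(2) by (cases "u = z"; auto simp: \<delta>_def dist_commute)+
  have ex: "exp (lg u) = u" if "u \<in> ball z \<delta>" for u
  proof -
    have "u \<noteq> 0" using that by (auto simp: \<delta>_def)
    thus ?thesis using z0 by (simp add: lg_def exp_add flip: z_def)
  qed
  have sub: "ball z \<delta> \<subseteq> W1" "ball z \<delta> \<subseteq> W2" using lgN ex 1(5) 2(5) by force+
  have f1: "flat_section H (ball z \<delta>) (\<lambda>u. \<sigma>1 (lg u))"
    by (rule flat_section_restrict[OF 1(6,3,4) open_ball sub(1)]) (simp only: 1(7) lgN ex)
  have f2: "flat_section H (ball z \<delta>) (\<lambda>u. \<sigma>2 (lg u))"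
    by (rule flat_section_restrict[OF 2(6,3,4) open_ball sub(2)]) (simp only: 2(7) lgN ex)
  have i: "indep u (\<sigma>1 (lg u)) (\<sigma>2 (lg u))" if "u \<in> ball z \<delta>" for u using \<sigma>(3)[of "lg u"] ex[OF that] by simp
  have "ball z \<delta> \<subseteq> - {0}" using sub(1) 1(4) by (rule order_trans)
  hence "flat_frame (ball z \<delta>) (\<lambda>u. \<sigma>1 (lg u)) (\<lambda>u. \<sigma>2 (lg u))"
    unfolding flat_frame_def frame_def
    by (intro conjI f1 f2 i flat_sectionD(1)[OF f1] flat_sectionD(1)[OF f2] open_ball ballI)
  moreover have "\<delta> > 0" using \<delta>0(1) z0 by (simp add: \<delta>_def)
  ultimately show thesis using that[of \<delta>] ex unfolding lg_def z_def by blast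
qed

lemma fibre_eq_if_coords_eq:
  assumes "indep z x y" "e \<in> fibre H z" "f \<in> fibre H z" "coord1 x y e = coord1 x y f" "coord2 x y e = coord2 x y f"
  shows "e = f"
proof -
  have "e = comb2 H (coord1 x y e) x (coord2 x y e) y" by (rule comb_coord[OF assms(1,2), symmetric])
  also have "\<dots> = f" unfolding assms(4,5) by (rule comb_coord[OF assms(1,3)])
  finally show ?thesis .
qed

end

context te2_pair
begin

text \<open>The flat isomorphism matching the two companion frames near 0 continues to the punctured plane
  along the flat frames, consistently because the latter have equal monodromy.\<close>

lemma te_isomorphic_of_companion_cframes:
  assumes cf0: "H.companion_cframe L v1 v2 \<rho>0 \<rho>1 p" and cf0': "H'.companion_cframe L' v1' v2' \<rho>0 \<rho>1 p"
  shows "te_isomorphic H H'"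
proof -
  define M where "M = min L L'"
  let ?U = "ball (0::complex) (exp M)"
  have sub: "?U \<subseteq> ball 0 (exp L)" "?U \<subseteq> ball 0 (exp L')" "0 \<in> ?U" by (simp_all add: M_def subset_ball)
  have cf: "H.companion_cframe M v1 v2 \<rho>0 \<rho>1 p" by (rule H.cframe_subset[OF cf0 open_ball sub(3,1)])
  have cf': "H'.companion_cframe M v1' v2' \<rho>0 \<rho>1 p" by (rule H'.cframe_subset[OF cf0' open_ball sub(3,2)])
  have fr_v: "H.frame ?U v1 v2" and fr_v': "H'.frame ?U v1' v2'" using H.cframeD(1)[OF cf] H'.cframeD(1)[OF cf'] .
  have in_U: "exp \<zeta> \<in> ?U" if "Re \<zeta> < M" for \<zeta> using that by simp
  have e2: "exp (\<zeta> + 2 * of_real pi * \<i>) = exp \<zeta>" for \<zeta> :: complex by (simp only: exp_add exp_two_pi_i mult_1_right)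

  obtain \<sigma>1 \<sigma>2 where fr: "H.mvframe \<sigma>1 \<sigma>2" by (rule H.ex_mvframe, rule that)
  have \<sigma>: "H.mvflat UNIV \<sigma>1" "H.mvflat UNIV \<sigma>2" "\<And>\<zeta>. H.indep (exp \<zeta>) (\<sigma>1 \<zeta>) (\<sigma>2 \<zeta>)" using fr by (simp_all add: H.mvframe_def)
  obtain \<tau>1 \<tau>2 where fr\<tau>: "H'.mvframe \<tau>1 \<tau>2" by (rule H'.ex_mvframe, rule that)
  have \<tau>: "H'.mvflat UNIV \<tau>1" "H'.mvflat UNIV \<tau>2" using fr\<tau> by (simp_all add: H'.mvframe_def)
  define c1 where "c1 \<sigma> \<zeta> = H.coord1 (v1 (exp \<zeta>)) (v2 (exp \<zeta>)) (\<sigma> \<zeta>)" for \<sigma> \<zeta>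
  define c2 where "c2 \<sigma> \<zeta> = H.coord2 (v1 (exp \<zeta>)) (v2 (exp \<zeta>)) (\<sigma> \<zeta>)" for \<sigma> \<zeta>
  define c1' where "c1' \<sigma> \<zeta> = H'.coord1 (v1' (exp \<zeta>)) (v2' (exp \<zeta>)) (\<sigma> \<zeta>)" for \<sigma> \<zeta>
  define c2' where "c2' \<sigma> \<zeta> = H'.coord2 (v1' (exp \<zeta>)) (v2' (exp \<zeta>)) (\<sigma> \<zeta>)" for \<sigma> \<zeta>
  \<comment> \<open>Both structures have the same \<rho>0, \<rho>1 and p, so their flat sections
    have coordinates in the same twisted solution space; every section of one has a partner in the
    other.\<close>
  have transport: "\<exists>\<sigma>'. H'.mvflat UNIV \<sigma>' \<and> (\<forall>\<zeta>. Re \<zeta> < M \<longrightarrow> c1' \<sigma>' \<zeta> = c1 \<sigma> \<zeta> \<and> c2' \<sigma>' \<zeta> = c2 \<sigma> \<zeta>)"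
    if s: "H.mvflat UNIV \<sigma>" for \<sigma>
  proof -
    note w = H'.mvframe_twisted_wronskian[OF cf' fr\<tau>, folded c1'_def c2'_def]
    note sol = H.companion_sol_of_mvflat[OF cf H.mvflat_subset[OF s subset_UNIV], folded c1_def c2_def]
    obtain a b where ab: "\<And>\<zeta>. Re \<zeta> < M \<Longrightarrow>
        twist \<rho>0 \<rho>1 \<zeta> * c2 \<sigma> \<zeta> = a * (twist \<rho>0 \<rho>1 \<zeta> * c2' \<tau>1 \<zeta>) + b * (twist \<rho>0 \<rho>1 \<zeta> * c2' \<tau>2 \<zeta>) \<and>
        twist \<rho>0 \<rho>1 \<zeta> * c1 \<sigma> \<zeta> = a * (twist \<rho>0 \<rho>1 \<zeta> * c1' \<tau>1 \<zeta>) + b * (twist \<rho>0 \<rho>1 \<zeta> * c1' \<tau>2 \<zeta>)"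
      by (rule companion_sol_combination[OF w(1,2) sol w(3)], assumption, rule that)
    have "c1' (\<lambda>\<zeta>. comb2 H' a (\<tau>1 \<zeta>) b (\<tau>2 \<zeta>)) \<zeta> = c1 \<sigma> \<zeta> \<and> c2' (\<lambda>\<zeta>. comb2 H' a (\<tau>1 \<zeta>) b (\<tau>2 \<zeta>)) \<zeta> = c2 \<sigma> \<zeta>"
      if \<zeta>: "Re \<zeta> < M" for \<zeta>
    proof -
      note ct = H'.coords_of_comb[OF cf' H'.mvflat_fibre[OF \<tau>(1) UNIV_I] H'.mvflat_fibre[OF \<tau>(2) UNIV_I] \<zeta>]
      have "twist \<rho>0 \<rho>1 \<zeta> * c2 \<sigma> \<zeta> = twist \<rho>0 \<rho>1 \<zeta> * (a * c2' \<tau>1 \<zeta> + b * c2' \<tau>2 \<zeta>)"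
        "twist \<rho>0 \<rho>1 \<zeta> * c1 \<sigma> \<zeta> = twist \<rho>0 \<rho>1 \<zeta> * (a * c1' \<tau>1 \<zeta> + b * c1' \<tau>2 \<zeta>)"
        using ab[OF \<zeta>] by (simp_all add: algebra_simps)
      hence "c2 \<sigma> \<zeta> = a * c2' \<tau>1 \<zeta> + b * c2' \<tau>2 \<zeta>" "c1 \<sigma> \<zeta> = a * c1' \<tau>1 \<zeta> + b * c1' \<tau>2 \<zeta>"
        by (simp_all add: twist_nonzero)
      thus ?thesis unfolding c1'_def c2'_def ct by simp
    qed
    thus ?thesis using H'.mvflat_comb[OF \<tau>] by blast
  qed
  obtain \<sigma>1' where 1: "H'.mvflat UNIV \<sigma>1'" "\<And>\<zeta>. Re \<zeta> < M \<Longrightarrow> c1' \<sigma>1' \<zeta> = c1 \<sigma>1 \<zeta> \<and> c2' \<sigma>1' \<zeta> = c2 \<sigma>1 \<zeta>"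
    using transport[OF \<sigma>(1)] by blast
  obtain \<sigma>2' where 2: "H'.mvflat UNIV \<sigma>2'" "\<And>\<zeta>. Re \<zeta> < M \<Longrightarrow> c1' \<sigma>2' \<zeta> = c1 \<sigma>2 \<zeta> \<and> c2' \<sigma>2' \<zeta> = c2 \<sigma>2 \<zeta>"
    using transport[OF \<sigma>(2)] by blast
  note fib = H.mvflat_fibre[OF \<sigma>(1) UNIV_I] H.mvflat_fibre[OF \<sigma>(2) UNIV_I]
  note fib' = H'.mvflat_fibre[OF 1(1) UNIV_I] H'.mvflat_fibre[OF 2(1) UNIV_I]
  define \<zeta>0 where "\<zeta>0 = complex_of_real (M - 1)"
  have \<zeta>0: "Re \<zeta>0 < M" "Re (\<zeta>0 + 2 * of_real pi * \<i>) < M" by (simp_all add: \<zeta>0_def)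
  note i0 = H.frameD(4)[OF fr_v in_U] and i0' = H'.frameD(4)[OF fr_v' in_U]

  have fr': "H'.mvframe \<sigma>1' \<sigma>2'"
  proof (rule H'.mvframe_if_indep[OF 1(1) 2(1), of \<zeta>0])
    have "H.indep (exp \<zeta>0) (comb2 H (c1 \<sigma>1 \<zeta>0) (v1 (exp \<zeta>0)) (c2 \<sigma>1 \<zeta>0) (v2 (exp \<zeta>0)))
        (comb2 H (c1 \<sigma>2 \<zeta>0) (v1 (exp \<zeta>0)) (c2 \<sigma>2 \<zeta>0) (v2 (exp \<zeta>0)))"
      unfolding c1_def c2_def H.comb_coord[OF i0[OF \<zeta>0(1)] fib(1)] H.comb_coord[OF i0[OF \<zeta>0(1)] fib(2)] by (rule \<sigma>(3))
    hence "H'.indep (exp \<zeta>0) (comb2 H' (c1' \<sigma>1' \<zeta>0) (v1' (exp \<zeta>0)) (c2' \<sigma>1' \<zeta>0) (v2' (exp \<zeta>0)))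
        (comb2 H' (c1' \<sigma>2' \<zeta>0) (v1' (exp \<zeta>0)) (c2' \<sigma>2' \<zeta>0) (v2' (exp \<zeta>0)))"
      unfolding H.indep_comb_iff[OF i0[OF \<zeta>0(1)]] H'.indep_comb_iff[OF i0'[OF \<zeta>0(1)]]
      using 1(2)[OF \<zeta>0(1)] 2(2)[OF \<zeta>0(1)] by simp
    thus "H'.indep (exp \<zeta>0) (\<sigma>1' \<zeta>0) (\<sigma>2' \<zeta>0)"
      unfolding c1'_def c2'_def H'.comb_coord[OF i0'[OF \<zeta>0(1)] fib'(1)] H'.comb_coord[OF i0'[OF \<zeta>0(1)] fib'(2)] .
  qed
  hence i': "\<And>\<zeta>. H'.indep (exp \<zeta>) (\<sigma>1' \<zeta>) (\<sigma>2' \<zeta>)" by (simp add: H'.mvframe_def)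

  obtain a b c d where T: "a * d - b * c \<noteq> 0"
    "\<And>\<zeta>. \<sigma>1 (\<zeta> + 2 * of_real pi * \<i>) = comb2 H a (\<sigma>1 \<zeta>) c (\<sigma>2 \<zeta>)"
    "\<And>\<zeta>. \<sigma>2 (\<zeta> + 2 * of_real pi * \<i>) = comb2 H b (\<sigma>1 \<zeta>) d (\<sigma>2 \<zeta>)" by (rule H.mvframe_turn[OF fr], rule that)
  \<comment> \<open>Coordinates can be compared only over the half-plane
    \<open>Re \<zeta> < M\<close>, so the identity is checked at \<zeta>0 and extended by uniqueness
    of flat sections.\<close>
  have turn': "\<sigma>' (\<zeta> + 2 * of_real pi * \<i>) = comb2 H' x (\<sigma>1' \<zeta>) y (\<sigma>2' \<zeta>)"
    if s: "H'.mvflat UNIV \<sigma>'" "\<And>\<zeta>. Re \<zeta> < M \<Longrightarrow> c1' \<sigma>' \<zeta> = c1 \<sigma> \<zeta> \<and> c2' \<sigma>' \<zeta> = c2 \<sigma> \<zeta>"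
      and t: "\<And>\<zeta>. \<sigma> (\<zeta> + 2 * of_real pi * \<i>) = comb2 H x (\<sigma>1 \<zeta>) y (\<sigma>2 \<zeta>)" for \<sigma> \<sigma>' x y \<zeta>
  proof (rule H'.mvflat_unique[OF H'.mvflat_turn[OF s(1)] H'.mvflat_comb[OF 1(1) 2(1)] open_UNIV connected_UNIV UNIV_I _ UNIV_I])
    note ct = H.coords_of_comb[OF cf fib \<zeta>0(1)] and ct' = H'.coords_of_comb[OF cf' fib' \<zeta>0(1)]
    have f: "\<sigma>' (\<zeta>0 + 2 * of_real pi * \<i>) \<in> fibre H' (exp \<zeta>0)"
      using H'.mvflat_fibre[OF s(1) UNIV_I, of "\<zeta>0 + 2 * of_real pi * \<i>"] unfolding e2 .
    note eq = s(2)[OF \<zeta>0(2), unfolded c1_def c2_def c1'_def c2'_def e2 t ct]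
    note eq1 = 1(2)[OF \<zeta>0(1), unfolded c1_def c2_def c1'_def c2'_def]
    note eq2 = 2(2)[OF \<zeta>0(1), unfolded c1_def c2_def c1'_def c2'_def]
    show "\<sigma>' (\<zeta>0 + 2 * of_real pi * \<i>) = comb2 H' x (\<sigma>1' \<zeta>0) y (\<sigma>2' \<zeta>0)"
      by (rule H'.fibre_eq_if_coords_eq[OF i0'[OF \<zeta>0(1)] f H'.comb_fibre[OF fib']])
        (simp_all only: ct' eq eq1 eq2)
  qed simp_all
  have T': "\<sigma>1' (\<zeta> + 2 * of_real pi * \<i>) = comb2 H' a (\<sigma>1' \<zeta>) c (\<sigma>2' \<zeta>)"
    "\<sigma>2' (\<zeta> + 2 * of_real pi * \<i>) = comb2 H' b (\<sigma>1' \<zeta>) d (\<sigma>2' \<zeta>)" for \<zeta>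
    by (rule turn'[OF 1(1) _ T(2)], rule 1(2), assumption, rule turn'[OF 2(1) _ T(3)], rule 2(2))

  \<comment> \<open>The fixed default outside the fibre makes the maps for \<zeta> and its shift
    equal as functions, and thus accessible to \<open>periodic_eq_if_exp_eq\<close>.\<close>
  define \<Phi> where "\<Phi> \<zeta> e = (if e \<in> fibre H (exp \<zeta>) then
      comb2 H' (H.coord1 (\<sigma>1 \<zeta>) (\<sigma>2 \<zeta>) e) (\<sigma>1' \<zeta>) (H.coord2 (\<sigma>1 \<zeta>) (\<sigma>2 \<zeta>) e) (\<sigma>2' \<zeta>) else undefined)" for \<zeta> e
  have \<Phi>: "\<Phi> \<zeta> (comb2 H x (\<sigma>1 \<zeta>) y (\<sigma>2 \<zeta>)) = comb2 H' x (\<sigma>1' \<zeta>) y (\<sigma>2' \<zeta>)" for \<zeta> x y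
    unfolding \<Phi>_def H.coord_comb[OF \<sigma>(3)] using H.comb_fibre[OF fib] by simp
  have \<Phi>_turn: "\<Phi> (\<zeta> + 2 * of_real pi * \<i>) = \<Phi> \<zeta>" for \<zeta>
  proof
    fix e
    show "\<Phi> (\<zeta> + 2 * of_real pi * \<i>) e = \<Phi> \<zeta> e"
    proof (cases "e \<in> fibre H (exp \<zeta>)")
      case False
      thus ?thesis unfolding \<Phi>_def e2 by simp
    next
      case True
      obtain x y where e: "e = comb2 H x (\<sigma>1 (\<zeta> + 2 * of_real pi * \<i>)) y (\<sigma>2 (\<zeta> + 2 * of_real pi * \<i>))"
        by (rule H.indep_span[OF \<sigma>(3)[of "\<zeta> + 2 * of_real pi * \<i>"]]) (use True in \<open>simp only: e2\<close>, rule that)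
      have e': "e = comb2 H (x * a + y * b) (\<sigma>1 \<zeta>) (x * c + y * d) (\<sigma>2 \<zeta>)"
        unfolding e T(2,3) by (rule H.comb_comb[OF fib])
      have "\<Phi> (\<zeta> + 2 * of_real pi * \<i>) e = comb2 H' (x * a + y * b) (\<sigma>1' \<zeta>) (x * c + y * d) (\<sigma>2' \<zeta>)"
        unfolding e \<Phi> T' by (rule H'.comb_comb[OF fib'])
      thus ?thesis unfolding e' \<Phi> .
    qed
  qed
  \<comment> \<open>The fibre over 0 has no logarithm, so there F is defined by the companion
    frames. Elsewhere the branch is irrelevant because \<Phi> is periodic.\<close>
  define F where "F e = (if base H e = 0 then
      comb2 H' (H.coord1 (v1 0) (v2 0) e) (v1' 0) (H.coord2 (v1 0) (v2 0) e) (v2' 0) else \<Phi> (Ln (base H e)) e)" for e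
  have F\<sigma>: "F (comb2 H x (\<sigma>1 \<zeta>) y (\<sigma>2 \<zeta>)) = comb2 H' x (\<sigma>1' \<zeta>) y (\<sigma>2' \<zeta>)" for x y \<zeta>
  proof -
    have "base H (comb2 H x (\<sigma>1 \<zeta>) y (\<sigma>2 \<zeta>)) = exp \<zeta>" by (rule H.base_fibre[OF H.comb_fibre[OF fib]])
    moreover have "\<Phi> (Ln (exp \<zeta>)) = \<Phi> \<zeta>"
      by (rule periodic_eq_if_exp_eq[where F = \<Phi> and L = "Re \<zeta> + 1"]) (simp_all add: \<Phi>_turn)
    ultimately show ?thesis by (simp add: F_def \<Phi>)
  qed
  \<comment> \<open>The two pieces of the definition of F fit together near 0: the partners
    \<sigma>1', \<sigma>2' have the same companion coordinates as \<sigma>1, \<sigma>2.\<close>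
  have Fv: "F (comb2 H x (v1 z) y (v2 z)) = comb2 H' x (v1' z) y (v2' z)" if z: "z \<in> ?U" for x y z
  proof (cases "z = 0")
    case True
    have i: "H.indep 0 (v1 0) (v2 0)" by (rule H.frameD(4)[OF fr_v sub(3)])
    show ?thesis unfolding True F_def H.base_fibre[OF H.comb_fibre[OF H.indep_fibre[OF i]]] H.coord_comb[OF i] by simp
  next
    case False
    define \<zeta> where "\<zeta> = Ln z"
    have ez: "exp \<zeta> = z" using False by (simp add: \<zeta>_def)
    have \<zeta>: "Re \<zeta> < M" using z by (intro Re_less_of_exp_in_ball) (simp only: ez)
    note iv = i0[OF \<zeta>] and iv' = i0'[OF \<zeta>]
    have ef: "comb2 H x (v1 (exp \<zeta>)) y (v2 (exp \<zeta>)) \<in> fibre H (exp \<zeta>)" by (rule H.comb_fibre[OF H.indep_fibre[OF iv]])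
    obtain k l where kl: "comb2 H x (v1 (exp \<zeta>)) y (v2 (exp \<zeta>)) = comb2 H k (\<sigma>1 \<zeta>) l (\<sigma>2 \<zeta>)"
      by (rule H.indep_span[OF \<sigma>(3) ef], rule that)
    note ct = H.coords_of_comb[OF cf fib \<zeta>] and ct' = H'.coords_of_comb[OF cf' fib' \<zeta>]
    note eq1 = 1(2)[OF \<zeta>, unfolded c1_def c2_def c1'_def c2'_def]
    note eq2 = 2(2)[OF \<zeta>, unfolded c1_def c2_def c1'_def c2'_def]
    have "comb2 H' k (\<sigma>1' \<zeta>) l (\<sigma>2' \<zeta>) = comb2 H' x (v1' (exp \<zeta>)) y (v2' (exp \<zeta>))"
    proof (rule H'.fibre_eq_if_coords_eq[OF iv' H'.comb_fibre[OF fib'] H'.comb_fibre[OF H'.indep_fibre[OF iv']]])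
      show "H'.coord1 (v1' (exp \<zeta>)) (v2' (exp \<zeta>)) (comb2 H' k (\<sigma>1' \<zeta>) l (\<sigma>2' \<zeta>)) =
         H'.coord1 (v1' (exp \<zeta>)) (v2' (exp \<zeta>)) (comb2 H' x (v1' (exp \<zeta>)) y (v2' (exp \<zeta>)))"
        unfolding H'.coord_comb[OF iv'] ct' using eq1 eq2 ct(1)[of k l] H.coord_comb(1)[OF iv, of x y] unfolding kl by simp
      show "H'.coord2 (v1' (exp \<zeta>)) (v2' (exp \<zeta>)) (comb2 H' k (\<sigma>1' \<zeta>) l (\<sigma>2' \<zeta>)) =
         H'.coord2 (v1' (exp \<zeta>)) (v2' (exp \<zeta>)) (comb2 H' x (v1' (exp \<zeta>)) y (v2' (exp \<zeta>)))"
        unfolding H'.coord_comb[OF iv'] ct' using eq1 eq2 ct(2)[of k l] H.coord_comb(2)[OF iv, of x y] unfolding kl by simp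
    qed
    thus ?thesis using F\<sigma>[of k \<zeta> l] unfolding kl[symmetric] unfolding ez by simp
  qed
  have "te_isomorphism H H' F"
  proof (rule te_isomorphism_of_matching_frames)
    show "\<exists>N w1 w2 w1' w2'. 0 \<in> N \<and> matches F N w1 w2 w1' w2'"
      unfolding matches_def using sub(3) fr_v fr_v' Fv by blast
    fix z :: complex assume "z \<noteq> 0"
    define \<zeta> where "\<zeta> = Ln z"
    have ez: "exp \<zeta> = z" using \<open>z \<noteq> 0\<close> by (simp add: \<zeta>_def)
    define lg where "lg u = Ln (u / exp \<zeta>) + \<zeta>" for u
    obtain \<delta> where \<delta>: "\<delta> > 0" "H.flat_frame (ball (exp \<zeta>) \<delta>) (\<lambda>u. \<sigma>1 (lg u)) (\<lambda>u. \<sigma>2 (lg u))"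
      by (rule H.flat_frame_of_mvframe[where \<zeta> = \<zeta>, OF fr, folded lg_def], rule that)
    obtain \<delta>' where \<delta>': "\<delta>' > 0" "H'.flat_frame (ball (exp \<zeta>) \<delta>') (\<lambda>u. \<sigma>1' (lg u)) (\<lambda>u. \<sigma>2' (lg u))"
      by (rule H'.flat_frame_of_mvframe[where \<zeta> = \<zeta>, OF fr', folded lg_def], rule that)
    define N where "N = ball (exp \<zeta>) (min \<delta> \<delta>')"
    have N: "open N" "N \<subseteq> ball (exp \<zeta>) \<delta>" "N \<subseteq> ball (exp \<zeta>) \<delta>'" "z \<in> N" using \<delta>(1) \<delta>'(1) by (auto simp: N_def ez)
    have ff: "H.flat_frame N (\<lambda>u. \<sigma>1 (lg u)) (\<lambda>u. \<sigma>2 (lg u))" by (rule H.flat_frame_subset[OF \<delta>(2) N(1,2)])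
    have ff': "H'.flat_frame N (\<lambda>u. \<sigma>1' (lg u)) (\<lambda>u. \<sigma>2' (lg u))" by (rule H'.flat_frame_subset[OF \<delta>'(2) N(1,3)])
    have "matches F N (\<lambda>u. \<sigma>1 (lg u)) (\<lambda>u. \<sigma>2 (lg u)) (\<lambda>u. \<sigma>1' (lg u)) (\<lambda>u. \<sigma>2' (lg u))"
      unfolding matches_def using ff ff' F\<sigma> by (simp add: H.flat_frame_def H'.flat_frame_def)
    thus "\<exists>N w1 w2 w1' w2'. z \<in> N \<and> matches F N w1 w2 w1' w2' \<and> H.flat_frame N w1 w2 \<and> H'.flat_frame N w1' w2'"
      using N(4) ff ff' by blast
  qed
  thus ?thesis unfolding te_isomorphic_def by blast
qed

end

section \<open>Invariance under isomorphisms\<close>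

locale te2_iso = te2_pair H H' for H :: "('h, 2) te" and H' :: "('k, 2) te" +
  fixes F :: "'h \<Rightarrow> 'k"
  assumes iso: "te_isomorphism H H' F"
begin

lemma iso_bij: "bij_betw F (total H) (total H')"
  using iso unfolding te_isomorphism_def by blast

lemma iso_fibre: "e \<in> fibre H z \<Longrightarrow> F e \<in> fibre H' z"
  using iso bij_betwE[OF iso_bij] unfolding te_isomorphism_def fibre_def by blast

lemma iso_inj: "e \<in> fibre H z \<Longrightarrow> f \<in> fibre H z \<Longrightarrow> F e = F f \<Longrightarrow> e = f"
  using bij_betw_imp_inj_on[OF iso_bij] unfolding inj_on_def fibre_def by blast

lemma iso_nabla:
  assumes "open W" "W \<subseteq> - {0}" "hol_section H W s" "z \<in> W"
  shows "F (nabla H W s z) = nabla H' W (\<lambda>w. F (s w)) z"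
  using iso[unfolded te_isomorphism_def, THEN conjunct2, THEN conjunct2, THEN conjunct2] assms by simp

lemma ex_iso_matrix:
  assumes "(U, \<phi>) \<in> atlas H" "(V, \<psi>) \<in> atlas H'"
  obtains g :: "complex \<Rightarrow> complex ^ 2 ^ 2" where "holomorphic_matrix_on g (U \<inter> V)"
    "\<And>e z. e \<in> fibre H z \<Longrightarrow> z \<in> U \<Longrightarrow> z \<in> V \<Longrightarrow> \<psi> (F e) = g z *v \<phi> e"
proof -
  note * = iso[unfolded te_isomorphism_def, THEN conjunct2, THEN conjunct2, THEN conjunct1]
  from bspec[OF * assms(1), unfolded prod.case, THEN bspec, OF assms(2), unfolded prod.case]
  obtain g :: "complex \<Rightarrow> complex ^ 2 ^ 2" where g: "holomorphic_matrix_on g (U \<inter> V)"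
    "\<forall>e \<in> total H. base H e \<in> U \<inter> V \<longrightarrow> \<psi> (F e) = g (base H e) *v \<phi> e" by (elim exE conjE)
  show thesis
  proof (rule that[OF g(1)])
    fix e z assume e: "e \<in> fibre H z" and z: "z \<in> U" "z \<in> V"
    have "e \<in> total H" "base H e = z" using e unfolding fibre_def by blast+
    thus "\<psi> (F e) = g z *v \<phi> e" using g(2) z by (metis IntI)
  qed
qed

lemma iso_comb:
  assumes e: "e \<in> fibre H z" "f \<in> fibre H z"
  shows "F (comb2 H x e y f) = comb2 H' x (F e) y (F f)"
proof -
  obtain U \<phi> where U: "(U, \<phi>) \<in> atlas H" "z \<in> U" by (rule H.ex_chart, rule that)
  obtain V \<psi> where V: "(V, \<psi>) \<in> atlas H'" "z \<in> V" by (rule H'.ex_chart, rule that)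
  obtain g :: "complex \<Rightarrow> complex ^ 2 ^ 2" where g: "\<And>e z. e \<in> fibre H z \<Longrightarrow> z \<in> U \<Longrightarrow> z \<in> V \<Longrightarrow> \<psi> (F e) = g z *v \<phi> e"
    by (rule ex_iso_matrix[OF U(1) V(1)], rule that)
  have g': "\<psi> (F e) = g z *v \<phi> e" if "e \<in> fibre H z" for e by (rule g[OF that U(2) V(2)])
  show ?thesis
  proof (rule H'.chart_inj[OF V iso_fibre[OF H.comb_fibre[OF e]] H'.comb_fibre[OF iso_fibre[OF e(1)] iso_fibre[OF e(2)]]])
    show "\<psi> (F (comb2 H x e y f)) = \<psi> (comb2 H' x (F e) y (F f))"
      unfolding H'.comb_chart[OF V iso_fibre[OF e(1)] iso_fibre[OF e(2)]] g'[OF e(1)] g'[OF e(2)] g'[OF H.comb_fibre[OF e]]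
        H.comb_chart[OF U e]
      by (rule vec2_eqI) (simp_all add: matrix_vector_2 algebra_simps)
  qed
qed

lemma iso_zero: "F (fibre_zero H z) = fibre_zero H' z"
proof -
  note f = H.zero_fibre[of z]
  have "F (fibre_zero H z) = F (comb2 H 0 (fibre_zero H z) 0 (fibre_zero H z))" unfolding H.comb_zero[OF f f] ..
  also have "\<dots> = fibre_zero H' z" unfolding iso_comb[OF f f] by (rule H'.comb_zero[OF iso_fibre[OF f] iso_fibre[OF f]])
  finally show ?thesis .
qed

text \<open>A linear relation between the images is the image of a linear relation, which is trivial
  because F is injective on fibres.\<close>

lemma iso_indep:
  assumes i: "H.indep z x y"
  shows "H'.indep z (F x) (F y)"
proof -
  note f = H.indep_fibre[OF i]
  note f' = iso_fibre[OF f(1)] iso_fibre[OF f(2)]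
  obtain V \<psi> where V: "(V, \<psi>) \<in> atlas H'" "z \<in> V" by (rule H'.ex_chart, rule that)
  show ?thesis
  proof (rule H'.indepI[OF f' V], rule notI)
    assume "det2 (\<psi> (F x)) (\<psi> (F y)) = 0"
    hence "\<psi> (F x) $ 1 * \<psi> (F y) $ 2 - \<psi> (F y) $ 1 * \<psi> (F x) $ 2 = 0" by (simp add: det2_def mult.commute)
    then obtain a b where ab: "a \<noteq> 0 \<or> b \<noteq> 0"
      "\<psi> (F x) $ 1 * a + \<psi> (F y) $ 1 * b = 0" "\<psi> (F x) $ 2 * a + \<psi> (F y) $ 2 * b = 0"
      unfolding kernel_2x2[symmetric] by blast
    have "\<psi> (F (comb2 H a x b y)) = 0"
      unfolding iso_comb[OF f] H'.comb_chart[OF V f'] by (rule vec2_eqI) (use ab in \<open>simp_all add: mult.commute\<close>)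
    hence "\<psi> (F (comb2 H a x b y)) = \<psi> (F (comb2 H 0 x 0 y))"
      unfolding H.comb_zero[OF f] iso_zero H'.zero_chart[OF V] .
    hence "F (comb2 H a x b y) = F (comb2 H 0 x 0 y)"
      by (rule H'.chart_inj[OF V iso_fibre[OF H.comb_fibre[OF f]] iso_fibre[OF H.comb_fibre[OF f]]])
    hence "comb2 H a x b y = comb2 H 0 x 0 y" by (rule iso_inj[OF H.comb_fibre[OF f] H.comb_fibre[OF f]])
    from H.indep_comb_eq[OF i this] ab(1) show False by simp
  qed
qed

lemma iso_hol_section:
  assumes s: "hol_section H W s"
  shows "hol_section H' W (\<lambda>z. F (s z))"
proof (rule H'.hol_sectionI)
  show "F (s z) \<in> fibre H' z" if "z \<in> W" for z by (rule iso_fibre[OF H.hol_section_fibre[OF s that]])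
  fix V \<psi> i assume V: "(V, \<psi>) \<in> atlas H'"
  show "(\<lambda>z. \<psi> (F (s z)) $ i) holomorphic_on (W \<inter> V)"
  proof (rule H.holomorphic_on_local)
    fix z assume z: "z \<in> W \<inter> V"
    obtain U \<phi> where U: "(U, \<phi>) \<in> atlas H" "z \<in> U" by (rule H.ex_chart, rule that)
    obtain g :: "complex \<Rightarrow> complex ^ 2 ^ 2" where g: "holomorphic_matrix_on g (U \<inter> V)"
      "\<And>e z. e \<in> fibre H z \<Longrightarrow> z \<in> U \<Longrightarrow> z \<in> V \<Longrightarrow> \<psi> (F e) = g z *v \<phi> e"
      by (rule ex_iso_matrix[OF U(1) V], rule that)
    have h: "(\<lambda>z. \<phi> (s z) $ j) holomorphic_on U \<inter> (W \<inter> V)" for j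
      by (rule holomorphic_on_subset[OF H.hol_section_chart[OF s U(1)]]) blast
    have g': "(\<lambda>z. g z $ i $ j) holomorphic_on U \<inter> (W \<inter> V)" for j
      by (rule holomorphic_on_subset[of _ "U \<inter> V"]) (use g(1) in \<open>auto simp: holomorphic_matrix_on_def\<close>)
    have "(\<lambda>z. g z $ i $ 1 * \<phi> (s z) $ 1 + g z $ i $ 2 * \<phi> (s z) $ 2) holomorphic_on U \<inter> (W \<inter> V)"
      by (intro holomorphic_intros h g')
    hence "(\<lambda>z. \<psi> (F (s z)) $ i) holomorphic_on U \<inter> (W \<inter> V)"
    proof (rule holomorphic_transform)
      fix u assume "u \<in> U \<inter> (W \<inter> V)"
      hence u: "u \<in> U" "u \<in> W" "u \<in> V" by blast+
      show "g u $ i $ 1 * \<phi> (s u) $ 1 + g u $ i $ 2 * \<phi> (s u) $ 2 = \<psi> (F (s u)) $ i"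
        unfolding g(2)[OF H.hol_section_fibre[OF s u(2)] u(1,3)] matrix_vector_2 ..
    qed
    thus "\<exists>N. open N \<and> z \<in> N \<and> (\<lambda>z. \<psi> (F (s z)) $ i) holomorphic_on N \<inter> (W \<inter> V)"
      using H.chart_open[OF U(1)] U(2) by blast
  qed
qed

lemma iso_frame:
  assumes "H.frame W v1 v2"
  shows "H'.frame W (\<lambda>z. F (v1 z)) (\<lambda>z. F (v2 z))"
  using H.frameD[OF assms] iso_hol_section iso_indep unfolding H'.frame_def by blast

text \<open>The image frame has literally the same connection matrix, so all invariants that are
  computed from a \<open>cframe\<close> agree.\<close>

lemma iso_cframe:
  assumes cf: "H.cframe W v1 v2 a b c d"
  shows "H'.cframe W (\<lambda>z. F (v1 z)) (\<lambda>z. F (v2 z)) a b c d"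
proof -
  note D = H.cframeD[OF cf]
  note f = H.frameD[OF D(12)]
  have "nabla H' (W - {0}) (\<lambda>z. F (v1 z)) z = comb2 H' (a z / z\<^sup>2) (F (v1 z)) (c z / z\<^sup>2) (F (v2 z)) \<and>
      nabla H' (W - {0}) (\<lambda>z. F (v2 z)) z = comb2 H' (b z / z\<^sup>2) (F (v1 z)) (d z / z\<^sup>2) (F (v2 z))"
    if z: "z \<in> W - {0}" for z
    unfolding iso_nabla[OF D(10,11) f(2) z, symmetric] iso_nabla[OF D(10,11) f(3) z, symmetric] D(8)[OF z] D(9)[OF z]
      iso_comb[OF f(5)[OF z] f(6)[OF z]] by (intro conjI refl)
  thus ?thesis unfolding H'.cframe_def using iso_frame[OF D(1)] D(2,4-7) by blast
qed

lemma iso_flat_section: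
  assumes "open W" "W \<subseteq> - {0}" and s: "flat_section H W s"
  shows "flat_section H' W (\<lambda>z. F (s z))"
  unfolding flat_section_def
proof (intro conjI ballI)
  note S = H.flat_sectionD[OF s]
  show "hol_section H' W (\<lambda>z. F (s z))" by (rule iso_hol_section[OF S(1)])
  show "nabla H' W (\<lambda>z. F (s z)) z = fibre_zero H' z" if "z \<in> W" for z
    unfolding iso_nabla[OF assms(1,2) S(1) that, symmetric] S(2)[OF that] by (rule iso_zero)
qed

lemma iso_mvflat:
  assumes "H.mvflat N \<sigma>"
  shows "H'.mvflat N (\<lambda>\<zeta>. F (\<sigma> \<zeta>))"
proof (rule H'.mvflatI)
  fix \<zeta> assume \<zeta>: "\<zeta> \<in> N"
  obtain N' W s where *: "open N'" "\<zeta> \<in> N'" "open W" "W \<subseteq> - {0}" "exp ` N' \<subseteq> W" "flat_section H W s"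
    "\<And>\<xi>. \<xi> \<in> N' \<Longrightarrow> \<sigma> \<xi> = s (exp \<xi>)" by (rule H.mvflatE[OF assms \<zeta>], rule that)
  have "\<forall>\<xi>\<in>N'. F (\<sigma> \<xi>) = F (s (exp \<xi>))" using *(7) by simp
  thus "\<exists>N' W s. open N' \<and> \<zeta> \<in> N' \<and> open W \<and> W \<subseteq> - {0} \<and> exp ` N' \<subseteq> W \<and>
     flat_section H' W s \<and> (\<forall>\<xi> \<in> N'. F (\<sigma> \<xi>) = s (exp \<xi>))"
    using *(1-5) iso_flat_section[OF *(3,4,6)] by blast
qed

lemma iso_mvframe:
  assumes "H.mvframe \<sigma>1 \<sigma>2"
  shows "H'.mvframe (\<lambda>\<zeta>. F (\<sigma>1 \<zeta>)) (\<lambda>\<zeta>. F (\<sigma>2 \<zeta>))"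
  using assms iso_mvflat iso_indep unfolding H.mvframe_def H'.mvframe_def by blast

text \<open>The image of a global flat frame is one again, and its monodromy matrix is the
  same.\<close>

lemma iso_Eig_mon: "Eig_mon H = Eig_mon H'"
proof -
  obtain \<sigma>1 \<sigma>2 where fr: "H.mvframe \<sigma>1 \<sigma>2" by (rule H.ex_mvframe, rule that)
  have i: "H.indep (exp \<zeta>) (\<sigma>1 \<zeta>) (\<sigma>2 \<zeta>)" for \<zeta> using fr by (simp add: H.mvframe_def)
  obtain a b c d where T: "\<And>\<zeta>. \<sigma>1 (\<zeta> + 2 * of_real pi * \<i>) = comb2 H a (\<sigma>1 \<zeta>) c (\<sigma>2 \<zeta>)"
    "\<And>\<zeta>. \<sigma>2 (\<zeta> + 2 * of_real pi * \<i>) = comb2 H b (\<sigma>1 \<zeta>) d (\<sigma>2 \<zeta>)" by (rule H.mvframe_turn[OF fr], rule that)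
  have T': "F (\<sigma>1 (\<zeta> + 2 * of_real pi * \<i>)) = comb2 H' a (F (\<sigma>1 \<zeta>)) c (F (\<sigma>2 \<zeta>))"
    "F (\<sigma>2 (\<zeta> + 2 * of_real pi * \<i>)) = comb2 H' b (F (\<sigma>1 \<zeta>)) d (F (\<sigma>2 \<zeta>))" for \<zeta>
    unfolding T by (rule iso_comb[OF H.indep_fibre[OF i]])+
  have "k \<in> Eig_mon H \<longleftrightarrow> k \<in> Eig_mon H'" for k
    unfolding H.Eig_mon_iff[OF fr T] H'.Eig_mon_iff[OF iso_mvframe[OF fr] T'] ..
  thus ?thesis by blast
qed

lemma iso_formal_invariants:
  "rho H 0 = rho H' 0" "rho H 1 = rho H' 1" "delta H 1 = delta H' 1"
proof -
  obtain W v1 v2 a b c d where cf: "H.cframe W v1 v2 a b c d" by (rule H.ex_cframe, rule that)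
  note I = H.formal_invariants[OF cf] and I' = H'.formal_invariants[OF iso_cframe[OF cf]]
  show "rho H 0 = rho H' 0" "rho H 1 = rho H' 1" "delta H 1 = delta H' 1"
    by (simp_all only: I I')
qed

end

section \<open>The classification\<close>

theorem theorem4p11:
  fixes H :: "('h, 2) te"
  assumes "te_structure H" and "type_Bra H"
  shows
    "(\<forall>H' :: ('k, 2) te. te_structure H' \<longrightarrow> te_isomorphic H H' \<longrightarrow>
        rho H 0 = rho H' 0 \<and> rho H 1 = rho H' 1 \<and> delta H 1 = delta H' 1 \<and>
        Eig_mon H = Eig_mon H') \<and>
     (\<forall>H' :: ('k, 2) te. te_structure H' \<longrightarrow> type_Bra H' \<longrightarrow>
        rho H 0 = rho H' 0 \<longrightarrow> rho H 1 = rho H' 1 \<longrightarrow> delta H 1 = delta H' 1 \<longrightarrow>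
        Eig_mon H = Eig_mon H' \<longrightarrow> te_isomorphic H H') \<and>
     (\<exists>v1 v2 B b2 b3 b4. germ_basis H v1 v2 \<and> connection_matrix H v1 v2 B \<and>
        birkhoff_normal_form B \<and>
        B = (\<lambda>z. (rho H 0 + z * rho H 1) *\<^sub>m matC1 + b2 *\<^sub>m matC2 + (z * b3) *\<^sub>m matD
               + (z * b4) *\<^sub>m matE) \<and>
        b2 \<noteq> 0 \<and> b4 \<noteq> 0 \<and>
        - b2 * b4 = delta H 1 - 2 * rho H 0 * rho H 1 \<and>
        Eig_mon H = {exp (- 2 * of_real pi * \<i> * (rho H 1 + b3)),
                     exp (- 2 * of_real pi * \<i> * (rho H 1 - b3))})"
proof (intro conjI allI impI)
  interpret H: te2 H using assms(1) by (simp only: te2_iff)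
  obtain b where b: "Re b < 0"
    "Eig_mon H = {exp (- 2 * of_real pi * \<i> * (rho H 1 + b)), exp (- 2 * of_real pi * \<i> * (rho H 1 - b))}"
    by (rule H.ex_exponent[OF assms(2)], rule that)
  have k: "exp (- 2 * of_real pi * \<i> * (rho H 1 - b)) \<in> Eig_mon H" unfolding b(2) by blast
  obtain L v1 v2 where cf: "H.companion_cframe L v1 v2 (rho H 0) (rho H 1)
      (\<lambda>z. - (delta H 1 - 2 * rho H 0 * rho H 1) * z + (b\<^sup>2 + b) * z\<^sup>2)"
    by (rule H.ex_model_cframe[OF assms(2) b(1) k], rule that)
  {
    fix H' :: "('k, 2) te"
    assume H': "te_structure H'" "te_isomorphic H H'"
    interpret H': te2 H' using H'(1) by (simp only: te2_iff)
    obtain F where "te_isomorphism H H' F" using H'(2) unfolding te_isomorphic_def by blast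
    then interpret te2_iso H H' F by unfold_locales
    show "rho H 0 = rho H' 0" "rho H 1 = rho H' 1" "delta H 1 = delta H' 1" "Eig_mon H = Eig_mon H'"
      by (rule iso_formal_invariants iso_Eig_mon)+
  next
    fix H' :: "('k, 2) te"
    assume H': "te_structure H'" "type_Bra H'"
      and eq: "rho H 0 = rho H' 0" "rho H 1 = rho H' 1" "delta H 1 = delta H' 1" "Eig_mon H = Eig_mon H'"
    interpret H': te2 H' using H'(1) by (simp only: te2_iff)
    interpret te2_pair H H' by unfold_locales
    \<comment> \<open>The exponent \<open>b\<close> chosen for H also serves H', because the
      eigenvalues are the same; this leads both structures to one and the same model instead of
      merely to models with equal monodromy.\<close>
    obtain L' v1' v2' where "H'.companion_cframe L' v1' v2' (rho H 0) (rho H 1)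
        (\<lambda>z. - (delta H 1 - 2 * rho H 0 * rho H 1) * z + (b\<^sup>2 + b) * z\<^sup>2)"
      by (rule H'.ex_model_cframe[OF H'(2) b(1) k[unfolded eq], folded eq], rule that)
    from te_isomorphic_of_companion_cframes[OF cf this] show "te_isomorphic H H'" .
  }
  define c where "c = - (delta H 1 - 2 * rho H 0 * rho H 1)"
  have c: "c \<noteq> 0" using assms(2) unfolding type_Bra_def c_def by simp argo
  have c': "- 1 * c = delta H 1 - 2 * rho H 0 * rho H 1" by (simp add: c_def)
  \<comment> \<open>The lower left entry 1 of the companion frame survives the shear, so the normal
    form is reached with b2 = 1, b3 = b and b4 = c.\<close>
  obtain w1 w2 where "germ_basis H w1 w2" "connection_matrix H w1 w2
      (\<lambda>z. (rho H 0 + z * rho H 1) *\<^sub>m matC1 + 1 *\<^sub>m matC2 + (z * b) *\<^sub>m matD + (z * c) *\<^sub>m matE)"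
    "birkhoff_normal_form (\<lambda>z. (rho H 0 + z * rho H 1) *\<^sub>m matC1 + 1 *\<^sub>m matC2 + (z * b) *\<^sub>m matD + (z * c) *\<^sub>m matE)"
    by (rule H.birkhoff_of_model_cframe[OF cf[folded c_def]], rule that)
  with c c' b(2) show "\<exists>v1 v2 B b2 b3 b4. germ_basis H v1 v2 \<and> connection_matrix H v1 v2 B \<and>
      birkhoff_normal_form B \<and>
      B = (\<lambda>z. (rho H 0 + z * rho H 1) *\<^sub>m matC1 + b2 *\<^sub>m matC2 + (z * b3) *\<^sub>m matD + (z * b4) *\<^sub>m matE) \<and>
      b2 \<noteq> 0 \<and> b4 \<noteq> 0 \<and> - b2 * b4 = delta H 1 - 2 * rho H 0 * rho H 1 \<and>
      Eig_mon H = {exp (- 2 * of_real pi * \<i> * (rho H 1 + b3)), exp (- 2 * of_real pi * \<i> * (rho H 1 - b3))}"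
    by (intro exI[of _ w1] exI[of _ w2] exI[of _ "\<lambda>z. (rho H 0 + z * rho H 1) *\<^sub>m matC1 + 1 *\<^sub>m matC2 + (z * b) *\<^sub>m matD + (z * c) *\<^sub>m matE"]
        exI[of _ 1] exI[of _ b] exI[of _ c] conjI) (assumption | rule refl one_neq_zero)+
qed

end
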